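(* Let $n\ge2$. The strong representation-spectral converse is valid for $(\mathrm{SU}(n+1),\mathrm S(\mathrm U(n)\times\mathrm U(1)),\tau_p)$ for $p=0,1$.
   Context: $G=\mathrm{SU}(n+1)$, $K=\mathrm S(\mathrm U(n)\times\mathrm U(1))=\{\mathrm{diag}(g,z):g\in\mathrm U(n),z\in\mathrm U(1),\det(g)z=1\}$, $G/K=P^n(\mathbb C)$ with metric induced by $\langle X,Y\rangle=-\mathrm{tr}(XY)$ on $\mathfrak g$. $\tau_p$ is the representation of $K$ on $\bigwedge^p(\mathfrak p_{\mathbb C}^* )$, where $\mathfrak g=\mathfrak k\oplus\mathfrak p$ orthogonally and $K$ acts on $\mathfrak p_{\mathbb C}^*$ by the contragredient of the complexified adjoint action. For a finite subgroup $\Gamma\subset G$ and a finite dimensional representation $(\tau,W_\tau)$ of $K$: $n_\Gamma(\pi)=\dim\mathrm{Hom}_G(V_\pi,L^2(\Gamma\backslash G))=\dim V_\pi^\Gamma$ for $\pi\in\widehat G$; $\Delta_{\tau,\Gamma}$ is the operator defined by the Casimir element $C$ (non-negative sign) on $\Gamma$-invariant smooth sections of $G\times_\tau W_\tau$, and $\mathrm{mult}_{\Delta_{\tau,\Gamma}}(\lambda)=\sum_{\pi\in\widehat G:\lambda(C,\pi)=\lambda}n_\Gamma(\pi)\dim\mathrm{Hom}_K(W_\tau,V_\pi)$ is the multiplicity of $\lambda$ in its spectrum, with $\lambda(C,\pi)$ the scalar by which $C$ acts on $V_\pi$, i.e. $\langle\Lambda_\pi,\Lambda_\pi+2\rho_G\rangle$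 for $\Lambda_\pi$ the highest weight of $\pi$ and $\rho_G$ half the sum of positive roots. The strong representation-spectral converse is valid for $(G,K,\tau)$ if for all finite subgroups $\Gamma,\Gamma'$ of $G$: whenever $\mathrm{mult}_{\Delta_{\tau,\Gamma}}(\lambda)=\mathrm{mult}_{\Delta_{\tau,\Gamma'}}(\lambda)$ for all but finitely many $\lambda$, then $n_\Gamma(\pi)=n_{\Gamma'}(\pi)$ for all $\pi\in\widehat G$ with $\mathrm{Hom}_K(W_\tau,V_\pi)\ne0$. *)

theory Defs
  imports
    "HOL-Analysis.Derivative"
    "Jordan_Normal_Form.VS_Connect"
    "Jordan_Normal_Form.Schur_Decomposition"
begin

section \<open>The groups\<close>

definition U_group :: "nat \<Rightarrow> complex mat monoid" where
  "U_group d = \<lparr>carrier = {A \<in> carrier_mat d d. mat_adjoint A * A = 1\<^sub>m d},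
                mult = (*), one = 1\<^sub>m d\<rparr>"

definition SU_group :: "nat \<Rightarrow> complex mat monoid" where
  "SU_group N = (U_group N)\<lparr>carrier := {A \<in> carrier (U_group N). det A = 1}\<rparr>"

definition S_U_U1 :: "nat \<Rightarrow> complex mat set" where
  "S_U_U1 n = {four_block_mat g (0\<^sub>m n 1) (0\<^sub>m 1 n) h | g h.
                 g \<in> carrier (U_group n) \<and> h \<in> carrier (U_group 1) \<and> det g * det h = 1}"

lemma mat_adjoint_index:
  fixes A :: "complex mat"
  assumes "A \<in> carrier_mat d d" "i < d" "j < d"
  shows "mat_adjoint A $$ (i, j) = cnj (A $$ (j, i))"
  using assms by (simp add: mat_adjoint_def mat_of_rows_index conjugate_complex_def cols_nth)

lemma mat_adjoint_carrier:
  fixes A :: "complex mat"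
  assumes "A \<in> carrier_mat d d"
  shows "mat_adjoint A \<in> carrier_mat d d"
  using assms unfolding mat_adjoint_def mat_of_rows_def carrier_mat_def by auto

lemma mat_adjoint_mult:
  fixes A B :: "complex mat"
  assumes "A \<in> carrier_mat d d" "B \<in> carrier_mat d d"
  shows "mat_adjoint (A * B) = mat_adjoint B * mat_adjoint A"
proof (rule eq_matI)
  have [simp]: "mat_adjoint A \<in> carrier_mat d d" "mat_adjoint B \<in> carrier_mat d d"
    "mat_adjoint (A * B) \<in> carrier_mat d d" "A * B \<in> carrier_mat d d"
    using assms mat_adjoint_carrier by auto
  fix i j
  assume "i < dim_row (mat_adjoint B * mat_adjoint A)" "j < dim_col (mat_adjoint B * mat_adjoint A)"
  hence ij: "i < d" "j < d" by (auto simp: carrier_matD[OF \<open>mat_adjoint A \<in> carrier_mat d d\<close>]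
        carrier_matD[OF \<open>mat_adjoint B \<in> carrier_mat d d\<close>])
  have "mat_adjoint (A * B) $$ (i, j) = cnj (\<Sum>k<d. A $$ (j, k) * B $$ (k, i))"
    using assms ij by (simp add: mat_adjoint_index[of _ d] scalar_prod_def atLeast0LessThan)
  also have "\<dots> = (\<Sum>k<d. mat_adjoint B $$ (i, k) * mat_adjoint A $$ (k, j))"
    using assms ij by (simp add: mat_adjoint_index[of _ d] mult.commute)
  also have "\<dots> = (mat_adjoint B * mat_adjoint A) $$ (i, j)"
    using ij carrier_matD[OF \<open>mat_adjoint A \<in> carrier_mat d d\<close>]
      carrier_matD[OF \<open>mat_adjoint B \<in> carrier_mat d d\<close>]
    by (simp add: scalar_prod_def atLeast0LessThan)
  finally show "mat_adjoint (A * B) $$ (i, j) = (mat_adjoint B * mat_adjoint A) $$ (i, j)" .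
qed (use assms mat_adjoint_carrier[of "A * B" d] mat_adjoint_carrier[of A d]
       mat_adjoint_carrier[of B d] in auto)

lemma mat_adjoint_adjoint:
  fixes A :: "complex mat"
  assumes "A \<in> carrier_mat d d"
  shows "mat_adjoint (mat_adjoint A) = A"
  by (rule eq_matI)
    (use assms mat_adjoint_carrier[OF assms] mat_adjoint_carrier[OF mat_adjoint_carrier[OF assms]]
     in \<open>auto simp: mat_adjoint_index[of _ d]\<close>)

lemma mat_adjoint_one: "mat_adjoint (1\<^sub>m d :: complex mat) = 1\<^sub>m d"
  by (rule eq_matI)
    (use mat_adjoint_carrier[of "1\<^sub>m d" d] in \<open>auto simp: mat_adjoint_index[of _ d]\<close>)

lemma det_mat_adjoint:
  fixes A :: "complex mat"
  assumes "A \<in> carrier_mat d d"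
  shows "det (mat_adjoint A) = cnj (det A)"
proof -
  have "mat_adjoint A = transpose_mat (map_mat cnj A)"
    by (rule eq_matI)
      (use assms mat_adjoint_carrier[OF assms] in \<open>auto simp: mat_adjoint_index[of _ d]\<close>)
  moreover have "det (map_mat cnj A) = cnj (det A)"
  proof -
    interpret comm_ring_hom cnj by unfold_locales auto
    show ?thesis by (rule hom_det)
  qed
  ultimately show ?thesis using det_transpose[of "map_mat cnj A" d] assms by simp
qed

lemma U_group_adjoint:
  assumes "A \<in> carrier (U_group d)"
  shows "mat_adjoint A \<in> carrier (U_group d)" "mat_adjoint A * A = 1\<^sub>m d" "A * mat_adjoint A = 1\<^sub>m d"
proof -
  have A: "A \<in> carrier_mat d d" and 1: "mat_adjoint A * A = 1\<^sub>m d"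
    using assms by (auto simp: U_group_def)
  have 2: "A * mat_adjoint A = 1\<^sub>m d"
    using mat_mult_left_right_inverse[OF mat_adjoint_carrier[OF A] A 1] .
  show "mat_adjoint A \<in> carrier (U_group d)" "mat_adjoint A * A = 1\<^sub>m d" "A * mat_adjoint A = 1\<^sub>m d"
    using 1 2 A mat_adjoint_carrier[OF A] by (auto simp: U_group_def mat_adjoint_adjoint)
qed

lemma group_U: "group (U_group d)"
proof (rule groupI)
  fix x y
  assume x: "x \<in> carrier (U_group d)" and y: "y \<in> carrier (U_group d)"
  have c: "x \<in> carrier_mat d d" "y \<in> carrier_mat d d"
    "mat_adjoint x \<in> carrier_mat d d" "mat_adjoint y \<in> carrier_mat d d"
    using x y mat_adjoint_carrier by (auto simp: U_group_def)
  have "mat_adjoint (x * y) * (x * y) = mat_adjoint y * (mat_adjoint x * (x * y))"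
    using c by (simp add: mat_adjoint_mult assoc_mult_mat[of _ d d _ d _ d])
  also have "mat_adjoint x * (x * y) = (mat_adjoint x * x) * y"
    using c by (simp add: assoc_mult_mat[of _ d d _ d _ d])
  finally show "x \<otimes>\<^bsub>U_group d\<^esub> y \<in> carrier (U_group d)"
    using c U_group_adjoint(2)[OF x] U_group_adjoint(2)[OF y] by (simp add: U_group_def)
next
  fix x assume "x \<in> carrier (U_group d)"
  thus "\<exists>y\<in>carrier (U_group d). y \<otimes>\<^bsub>U_group d\<^esub> x = \<one>\<^bsub>U_group d\<^esub>"
    using U_group_adjoint[of x d] by (auto simp: U_group_def)
qed (auto simp: U_group_def mat_adjoint_one assoc_mult_mat[of _ d d _ d _ d])

lemma group_SU: "group (SU_group N)"
proof -
  interpret group "U_group N" by (rule group_U)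
  have "subgroup (carrier (SU_group N)) (U_group N)"
  proof
    fix x assume x: "x \<in> carrier (SU_group N)"
    hence xU: "x \<in> carrier (U_group N)" by (simp add: SU_group_def)
    have "inv\<^bsub>U_group N\<^esub> x = mat_adjoint x"
      by (rule inv_equality) (use U_group_adjoint[OF xU] xU in \<open>auto simp: U_group_def\<close>)
    thus "inv\<^bsub>U_group N\<^esub> x \<in> carrier (SU_group N)"
      using x U_group_adjoint[OF xU] by (auto simp: SU_group_def U_group_def det_mat_adjoint)
  next
    fix x y assume xy: "x \<in> carrier (SU_group N)" "y \<in> carrier (SU_group N)"
    hence "x \<otimes>\<^bsub>U_group N\<^esub> y \<in> carrier (U_group N)" by (simp add: SU_group_def)
    thus "x \<otimes>\<^bsub>U_group N\<^esub> y \<in> carrier (SU_group N)"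
      using xy by (auto simp: SU_group_def U_group_def det_mult[of _ N])
  qed (auto simp: SU_group_def U_group_def mat_adjoint_one)
  from subgroup.subgroup_is_group[OF this group_U] show ?thesis
    by (simp add: SU_group_def U_group_def)
qed

lemma SU_inv:
  assumes "k \<in> carrier (SU_group N)"
  shows "inv\<^bsub>SU_group N\<^esub> k = mat_adjoint k"
proof -
  interpret group "SU_group N" by (rule group_SU)
  have kU: "k \<in> carrier (U_group N)" using assms by (simp add: SU_group_def)
  show ?thesis
    by (rule inv_equality)
      (use U_group_adjoint[OF kU] assms in \<open>auto simp: U_group_def SU_group_def det_mat_adjoint\<close>)
qed

lemma mat_adjoint_block_diag:
  fixes g h :: "complex mat"
  assumes g: "g \<in> carrier_mat n n" and h: "h \<in> carrier_mat 1 1"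
  shows "mat_adjoint (four_block_mat g (0\<^sub>m n 1) (0\<^sub>m 1 n) h) =
    four_block_mat (mat_adjoint g) (0\<^sub>m n 1) (0\<^sub>m 1 n) (mat_adjoint h)" (is "mat_adjoint ?k = ?r")
proof (rule eq_matI)
  have k: "?k \<in> carrier_mat (n + 1) (n + 1)" using four_block_carrier_mat[OF g h] .
  have r: "?r \<in> carrier_mat (n + 1) (n + 1)"
    using four_block_carrier_mat[OF mat_adjoint_carrier[OF g] mat_adjoint_carrier[OF h]] .
  show "dim_row (mat_adjoint ?k) = dim_row ?r" "dim_col (mat_adjoint ?k) = dim_col ?r"
    using mat_adjoint_carrier[OF k] r unfolding carrier_mat_def by auto
  fix i j assume "i < dim_row ?r" "j < dim_col ?r"
  hence ij: "i < n + 1" "j < n + 1" using r unfolding carrier_mat_def by auto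
  have "mat_adjoint ?k $$ (i, j) = cnj (?k $$ (j, i))" by (rule mat_adjoint_index[OF k ij])
  also have "\<dots> = ?r $$ (i, j)"
    using ij g h mat_adjoint_carrier[OF g] mat_adjoint_carrier[OF h]
    by (auto simp: mat_adjoint_index[OF g] mat_adjoint_index[OF h])
  finally show "mat_adjoint ?k $$ (i, j) = ?r $$ (i, j)" .
qed

lemma S_U_U1_iff:
  "k \<in> S_U_U1 n \<longleftrightarrow> k \<in> carrier (SU_group (n + 1)) \<and> (\<forall>i<n. k $$ (i, n) = 0 \<and> k $$ (n, i) = 0)"
proof
  assume "k \<in> S_U_U1 n"
  then obtain g h where k: "k = four_block_mat g (0\<^sub>m n 1) (0\<^sub>m 1 n) h"
    and g: "g \<in> carrier (U_group n)" and h: "h \<in> carrier (U_group 1)" and d: "det g * det h = 1"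
    by (auto simp: S_U_U1_def)
  have gc: "g \<in> carrier_mat n n" and hc: "h \<in> carrier_mat 1 1"
    using g h by (auto simp: U_group_def)
  have kc: "k \<in> carrier_mat (n + 1) (n + 1)" using gc hc by (auto simp: k)
  have adj: "mat_adjoint k = four_block_mat (mat_adjoint g) (0\<^sub>m n 1) (0\<^sub>m 1 n) (mat_adjoint h)"
    unfolding k by (rule mat_adjoint_block_diag[OF gc hc])
  have "mat_adjoint k * k = 1\<^sub>m (n + 1)"
    unfolding adj unfolding k
    by (subst mult_four_block_mat[of _ n n _ 1 _ 1 _ _ n _ 1])
      (use gc hc mat_adjoint_carrier[OF gc] mat_adjoint_carrier[OF hc] U_group_adjoint(2)[OF g]
        U_group_adjoint(2)[OF h] in auto)
  moreover have "det k = 1"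
    unfolding k using d by (subst det_four_block_mat_upper_right_zero[of _ n _ 1]) (use gc hc in auto)
  ultimately show "k \<in> carrier (SU_group (n + 1)) \<and> (\<forall>i<n. k $$ (i, n) = 0 \<and> k $$ (n, i) = 0)"
    using kc gc hc by (auto simp: SU_group_def U_group_def k)
next
  assume k: "k \<in> carrier (SU_group (n + 1)) \<and> (\<forall>i<n. k $$ (i, n) = 0 \<and> k $$ (n, i) = 0)"
  define g where "g = mat n n (\<lambda>ij. k $$ ij)"
  define h where "h = mat 1 1 (\<lambda>_. k $$ (n, n))"
  have gc: "g \<in> carrier_mat n n" and hc: "h \<in> carrier_mat 1 1" by (auto simp: g_def h_def)
  have kc: "k \<in> carrier_mat (n + 1) (n + 1)" and kk: "mat_adjoint k * k = 1\<^sub>m (n + 1)"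
    and dk: "det k = 1" using k by (auto simp: SU_group_def U_group_def)
  have keq: "k = four_block_mat g (0\<^sub>m n 1) (0\<^sub>m 1 n) h"
  proof (rule eq_matI)
    fix i j
    assume "i < dim_row (four_block_mat g (0\<^sub>m n 1) (0\<^sub>m 1 n) h)"
      "j < dim_col (four_block_mat g (0\<^sub>m n 1) (0\<^sub>m 1 n) h)"
    hence "i < n \<or> i = n" "j < n \<or> j = n" by (auto simp: g_def h_def)
    thus "k $$ (i, j) = four_block_mat g (0\<^sub>m n 1) (0\<^sub>m 1 n) h $$ (i, j)"
      using k by (auto simp: g_def h_def)
  qed (use kc in \<open>auto simp: g_def h_def\<close>)
  have adj: "mat_adjoint k = four_block_mat (mat_adjoint g) (0\<^sub>m n 1) (0\<^sub>m 1 n) (mat_adjoint h)"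
    unfolding keq by (rule mat_adjoint_block_diag[OF gc hc])
  have kk': "four_block_mat (mat_adjoint g * g) (0\<^sub>m n 1) (0\<^sub>m 1 n) (mat_adjoint h * h) = 1\<^sub>m (n + 1)"
    unfolding kk[symmetric] adj unfolding keq
    by (subst mult_four_block_mat[of _ n n _ 1 _ 1 _ _ n _ 1])
      (use gc hc mat_adjoint_carrier[OF gc] mat_adjoint_carrier[OF hc] in auto)
  have c: "mat_adjoint g * g \<in> carrier_mat n n" "mat_adjoint h * h \<in> carrier_mat 1 1"
    using gc hc mat_adjoint_carrier[OF gc] mat_adjoint_carrier[OF hc] by auto
  have "mat_adjoint g * g = 1\<^sub>m n"
  proof (rule eq_matI)
    fix i j assume "i < dim_row (1\<^sub>m n :: complex mat)" "j < dim_col (1\<^sub>m n :: complex mat)"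
    thus "(mat_adjoint g * g) $$ (i, j) = 1\<^sub>m n $$ (i, j)"
      using arg_cong[OF kk', of "\<lambda>M. M $$ (i, j)"] c[THEN carrier_matD(1)] c[THEN carrier_matD(2)] by simp
  qed (use c in auto)
  moreover have "mat_adjoint h * h = 1\<^sub>m 1"
  proof (rule eq_matI)
    fix i j assume "i < dim_row (1\<^sub>m 1 :: complex mat)" "j < dim_col (1\<^sub>m 1 :: complex mat)"
    thus "(mat_adjoint h * h) $$ (i, j) = 1\<^sub>m 1 $$ (i, j)"
      using arg_cong[OF kk', of "\<lambda>M. M $$ (n + i, n + j)"] c[THEN carrier_matD(1)] c[THEN carrier_matD(2)] by simp
  qed (use c in auto)
  moreover have "det g * det h = 1"
    using dk unfolding keq
    by (subst (asm) det_four_block_mat_upper_right_zero[of _ n _ 1]) (use gc hc in auto)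
  ultimately show "k \<in> S_U_U1 n"
    unfolding S_U_U1_def keq using gc hc by (auto simp: U_group_def)
qed

lemma mult_index_sum:
  assumes "A \<in> carrier_mat m m" "B \<in> carrier_mat m m" "i < m" "j < m"
  shows "(A * B) $$ (i, j) = (\<Sum>k<m. A $$ (i, k) * B $$ (k, j))"
  using assms by (simp add: scalar_prod_def atLeast0LessThan)

lemma subgroup_S_U_U1: "subgroup (S_U_U1 n) (SU_group (n + 1))"
proof -
  interpret group "SU_group (n + 1)" by (rule group_SU)
  note S_U_U1_iff [simp]
  show ?thesis
  proof
    fix x y assume x: "x \<in> S_U_U1 n" and y: "y \<in> S_U_U1 n"
    have xy: "x \<otimes>\<^bsub>SU_group (n + 1)\<^esub> y \<in> carrier (SU_group (n + 1))" using x y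
      by (intro m_closed) (simp_all only: S_U_U1_iff)
    have eq: "x \<otimes>\<^bsub>SU_group (n + 1)\<^esub> y = x * y" by (simp add: SU_group_def U_group_def)
    have c: "x \<in> carrier_mat (n + 1) (n + 1)" "y \<in> carrier_mat (n + 1) (n + 1)"
      using x y by (auto simp: SU_group_def U_group_def)
    have "(x * y) $$ (i, n) = 0 \<and> (x * y) $$ (n, i) = 0" if "i < n" for i
      using x y that by (simp add: mult_index_sum[OF c])
    thus "x \<otimes>\<^bsub>SU_group (n + 1)\<^esub> y \<in> S_U_U1 n" using xy unfolding eq by simp
  next
    fix x assume x: "x \<in> S_U_U1 n"
    hence c: "x \<in> carrier_mat (n + 1) (n + 1)" by (auto simp: SU_group_def U_group_def)
    show "inv\<^bsub>SU_group (n + 1)\<^esub> x \<in> S_U_U1 n"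
      using x inv_closed[of x] by (simp add: SU_inv mat_adjoint_index[OF c])
  qed (auto simp: SU_group_def U_group_def mat_adjoint_one)
qed


section \<open>Representations and the unitary dual\<close>

text \<open>A finite dimensional complex representation is a pair \<open>(d, \<rho>)\<close> acting on
  \<open>carrier_vec d\<close>; the values of \<open>\<rho>\<close> outside the group under consideration are irrelevant.\<close>

type_synonym mat_rep = "nat \<times> (complex mat \<Rightarrow> complex mat)"

text \<open>The matrix type carries no topology; this is sequential continuity with respect to
  entrywise convergence, i.e. to the usual topology.\<close>

definition mat_continuous_on :: "nat \<Rightarrow> complex mat set \<Rightarrow> nat \<Rightarrow> (complex mat \<Rightarrow> complex mat) \<Rightarrow> bool"
  where
  "mat_continuous_on N S d f \<longleftrightarrow>
     (\<forall>X A. (\<forall>k. X k \<in> S) \<and> A \<in> S \<and>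
        (\<forall>i<N. \<forall>j<N. (\<lambda>k. X k $$ (i, j)) \<longlonglongrightarrow> A $$ (i, j)) \<longrightarrow>
        (\<forall>i<d. \<forall>j<d. (\<lambda>k. f (X k) $$ (i, j)) \<longlonglongrightarrow> f A $$ (i, j)))"

text \<open>Since the special unitary group is compact, its irreducible unitary representations are
  exactly the finite dimensional ones below.\<close>

definition unitary_irreps :: "nat \<Rightarrow> mat_rep set" where
  "unitary_irreps N = {(d, \<rho>).
     \<rho> \<in> hom (SU_group N) (U_group d) \<and>
     mat_continuous_on N (carrier (SU_group N)) d \<rho> \<and>
     d > 0 \<and>
     (\<forall>W. VectorSpace.subspace class_ring W (module_vec TYPE(complex) d) \<and>
          (\<forall>g \<in> carrier (SU_group N). \<forall>w \<in> W. \<rho> g *\<^sub>v w \<in> W) \<longrightarrow>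
          W = {0\<^sub>v d} \<or> W = carrier_vec d)}"

definition hom_K :: "complex mat set \<Rightarrow> mat_rep \<Rightarrow> mat_rep \<Rightarrow> complex mat set" where
  "hom_K K \<tau> \<rho> = {T \<in> carrier_mat (fst \<rho>) (fst \<tau>). \<forall>k \<in> K. T * snd \<tau> k = snd \<rho> k * T}"

definition rep_equiv :: "nat \<Rightarrow> mat_rep rel" where
  "rep_equiv N = {(\<rho>, \<sigma>). \<rho> \<in> unitary_irreps N \<and> \<sigma> \<in> unitary_irreps N \<and>
     (\<exists>T \<in> hom_K (carrier (SU_group N)) \<rho> \<sigma>. invertible_mat T)}"

definition unitary_dual :: "nat \<Rightarrow> mat_rep set set" where
  "unitary_dual N = unitary_irreps N // rep_equiv N"

text \<open>A representative of a class; everything below that is evaluated on it depends on the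
  class only.\<close>

definition rep_of :: "mat_rep set \<Rightarrow> mat_rep" where
  "rep_of \<pi> = (SOME \<rho>. \<rho> \<in> \<pi>)"


section \<open>Multiplicities\<close>

definition dim_Hom_K :: "complex mat set \<Rightarrow> mat_rep \<Rightarrow> mat_rep \<Rightarrow> nat" where
  "dim_Hom_K K \<tau> \<rho> = vectorspace.dim class_ring
     ((module_mat TYPE(complex) (fst \<rho>) (fst \<tau>))\<lparr>carrier := hom_K K \<tau> \<rho>\<rparr>)"

definition n_inv :: "complex mat set \<Rightarrow> mat_rep \<Rightarrow> nat" where
  "n_inv \<Gamma> \<rho> = vectorspace.dim class_ring
     ((module_vec TYPE(complex) (fst \<rho>))\<lparr>carrier :=
        {v \<in> carrier_vec (fst \<rho>). \<forall>\<gamma> \<in> \<Gamma>. snd \<rho> \<gamma> *\<^sub>v v = v}\<rparr>)"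


section \<open>The Casimir eigenvalue\<close>

definition su_alg :: "nat \<Rightarrow> complex mat set" where
  "su_alg N = {X \<in> carrier_mat N N. mat_adjoint X = - X \<and> sum_list (diag_mat X) = 0}"

text \<open>On \<open>su_alg N\<close> the trace of a product is real.\<close>

definition su_inner :: "complex mat \<Rightarrow> complex mat \<Rightarrow> real" where
  "su_inner X Y = Re (- sum_list (diag_mat (X * Y)))"

definition su_orthonormal_basis :: "nat \<Rightarrow> complex mat set \<Rightarrow> bool" where
  "su_orthonormal_basis N B \<longleftrightarrow> finite B \<and> B \<subseteq> su_alg N \<and>
     (\<forall>X \<in> B. \<forall>Y \<in> B. su_inner X Y = (if X = Y then 1 else 0)) \<and>
     (\<forall>X \<in> su_alg N. \<exists>c :: complex mat \<Rightarrow> real. \<forall>i<N. \<forall>j<N.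
        X $$ (i, j) = (\<Sum>Y\<in>B. of_real (c Y) * Y $$ (i, j)))"

definition mat_exp :: "nat \<Rightarrow> complex mat \<Rightarrow> complex mat" where
  "mat_exp N X = mat N N (\<lambda>(i, j). \<Sum>k. (X ^\<^sub>m k) $$ (i, j) / fact k)"

definition rep_deriv :: "nat \<Rightarrow> mat_rep \<Rightarrow> complex mat \<Rightarrow> complex mat" where
  "rep_deriv N \<rho> X = mat (fst \<rho>) (fst \<rho>) (\<lambda>(i, j).
     vector_derivative (\<lambda>t::real. snd \<rho> (mat_exp N (of_real t \<cdot>\<^sub>m X)) $$ (i, j)) (at 0))"

definition casimir_op :: "nat \<Rightarrow> complex mat set \<Rightarrow> mat_rep \<Rightarrow> complex mat" where
  "casimir_op N B \<rho> = mat (fst \<rho>) (fst \<rho>) (\<lambda>(i, j).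
     - (\<Sum>X\<in>B. (rep_deriv N \<rho> X * rep_deriv N \<rho> X) $$ (i, j)))"

text \<open>The Casimir element does not depend on the orthonormal basis; on an irreducible
  representation it acts by a non-negative real scalar.\<close>

definition casimir_eigenvalue :: "nat \<Rightarrow> mat_rep \<Rightarrow> real" where
  "casimir_eigenvalue N \<rho> = (THE c. \<forall>B. su_orthonormal_basis N B \<longrightarrow>
     casimir_op N B \<rho> = of_real c \<cdot>\<^sub>m 1\<^sub>m (fst \<rho>))"


section \<open>Spectra and the strong representation-spectral converse\<close>

text \<open>Only finitely many classes share a Casimir eigenvalue, so the sum is over a finite set.\<close>

definition mult_spec :: "nat \<Rightarrow> complex mat set \<Rightarrow> mat_rep \<Rightarrow> complex mat set \<Rightarrow> real \<Rightarrow> nat" where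
  "mult_spec N K \<tau> \<Gamma> \<mu> =
     (\<Sum>\<pi> | \<pi> \<in> unitary_dual N \<and> casimir_eigenvalue N (rep_of \<pi>) = \<mu>.
        n_inv \<Gamma> (rep_of \<pi>) * dim_Hom_K K \<tau> (rep_of \<pi>))"

definition strong_rep_spectral_converse :: "nat \<Rightarrow> complex mat set \<Rightarrow> mat_rep \<Rightarrow> bool" where
  "strong_rep_spectral_converse N K \<tau> \<longleftrightarrow>
     (\<forall>\<Gamma> \<Gamma>'. subgroup \<Gamma> (SU_group N) \<and> finite \<Gamma> \<and> subgroup \<Gamma>' (SU_group N) \<and> finite \<Gamma>' \<longrightarrow>
        finite {\<mu>. mult_spec N K \<tau> \<Gamma> \<mu> \<noteq> mult_spec N K \<tau> \<Gamma>' \<mu>} \<longrightarrow>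
        (\<forall>\<pi> \<in> unitary_dual N. hom_K K \<tau> (rep_of \<pi>) \<noteq> {0\<^sub>m (fst (rep_of \<pi>)) (fst \<tau>)} \<longrightarrow>
           n_inv \<Gamma> (rep_of \<pi>) = n_inv \<Gamma>' (rep_of \<pi>)))"


section \<open>The representations of K on the exterior powers of the dual of the isotropy space\<close>

definition k_alg :: "nat \<Rightarrow> complex mat set" where
  "k_alg n = {X \<in> su_alg (n + 1). \<forall>i<n. X $$ (i, n) = 0 \<and> X $$ (n, i) = 0}"

definition p_alg :: "nat \<Rightarrow> complex mat set" where
  "p_alg n = {X \<in> su_alg (n + 1). \<forall>Y \<in> k_alg n. su_inner X Y = 0}"

definition p_complex :: "nat \<Rightarrow> complex mat set" where
  "p_complex n = {X + \<i> \<cdot>\<^sub>m Y | X Y. X \<in> p_alg n \<and> Y \<in> p_alg n}"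

text \<open>The matrix units at the positions in the following list form a basis of
  \<open>p_complex n\<close>; see the lemmas \<open>p_complex_eq\<close> and \<open>Ad_p_matrix\<close> below.\<close>

definition p_index :: "nat \<Rightarrow> (nat \<times> nat) list" where
  "p_index n = map (\<lambda>j. (j, n)) [0..<n] @ map (\<lambda>j. (n, j)) [0..<n]"

definition mat_unit :: "nat \<Rightarrow> nat \<times> nat \<Rightarrow> complex mat" where
  "mat_unit N b = mat N N (\<lambda>a. if a = b then 1 else 0)"

definition Ad_p :: "nat \<Rightarrow> complex mat \<Rightarrow> complex mat" where
  "Ad_p n k = mat (2 * n) (2 * n) (\<lambda>(a, b).
     (k * mat_unit (n + 1) (p_index n ! b) * inv\<^bsub>SU_group (n + 1)\<^esub> k) $$ (p_index n ! a))"

lemma su_inner_sum: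
  assumes "X \<in> carrier_mat m m" "Y \<in> carrier_mat m m"
  shows "su_inner X Y = - (\<Sum>i<m. \<Sum>k<m. Re (X $$ (i, k) * Y $$ (k, i)))"
proof -
  have "sum_list (diag_mat (X * Y)) = (\<Sum>i<m. (X * Y) $$ (i, i))"
    using assms by (simp add: diag_mat_def interv_sum_list_conv_sum_set_nat atLeast0LessThan)
  also have "\<dots> = (\<Sum>i<m. \<Sum>k<m. X $$ (i, k) * Y $$ (k, i))"
    by (intro sum.cong) (auto simp: mult_index_sum[OF assms])
  finally show ?thesis by (simp add: su_inner_def)
qed

lemma su_alg_iff:
  "X \<in> su_alg m \<longleftrightarrow> X \<in> carrier_mat m m \<and> (\<forall>i<m. \<forall>j<m. X $$ (j, i) = - cnj (X $$ (i, j))) \<and>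
     (\<Sum>i<m. X $$ (i, i)) = 0"
proof (cases "X \<in> carrier_mat m m")
  case X: True
  have "mat_adjoint X = - X \<longleftrightarrow> (\<forall>i<m. \<forall>j<m. cnj (X $$ (i, j)) = - X $$ (j, i))"
    using X mat_adjoint_carrier[OF X]
    by (auto simp: mat_eq_iff mat_adjoint_index[OF X])
  moreover have "sum_list (diag_mat X) = (\<Sum>i<m. X $$ (i, i))"
    using X by (simp add: diag_mat_def interv_sum_list_conv_sum_set_nat atLeast0LessThan)
  moreover have "cnj a = - b \<longleftrightarrow> b = - cnj a" for a b :: complex
    by (metis minus_minus)
  ultimately show ?thesis using X unfolding su_alg_def by simp
qed (simp add: su_alg_def)

lemma set_p_index: "set (p_index n) = {(i, j). i = n \<and> j < n \<or> i < n \<and> j = n}"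
  by (auto simp: p_index_def)

lemma distinct_p_index: "distinct (p_index n)"
  by (auto simp: p_index_def distinct_map inj_on_def)

lemma length_p_index: "length (p_index n) = 2 * n"
  by (simp add: p_index_def)

lemma p_alg_iff:
  "X \<in> p_alg n \<longleftrightarrow> X \<in> su_alg (n + 1) \<and>
     (\<forall>i<n + 1. \<forall>j<n + 1. (i, j) \<notin> set (p_index n) \<longrightarrow> X $$ (i, j) = 0)"
proof
  assume "X \<in> p_alg n"
  hence X: "X \<in> su_alg (n + 1)" and orth: "\<And>Y. Y \<in> k_alg n \<Longrightarrow> su_inner X Y = 0"
    by (auto simp: p_alg_def)
  define Y where "Y = mat (n + 1) (n + 1) (\<lambda>ij. if ij \<in> set (p_index n) then 0 else X $$ ij)"
  have c: "X \<in> carrier_mat (n + 1) (n + 1)" "Y \<in> carrier_mat (n + 1) (n + 1)"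
    using X by (auto simp: su_alg_def Y_def)
  have tr: "(\<Sum>i<n + 1. Y $$ (i, i)) = (\<Sum>i<n + 1. X $$ (i, i))"
    by (intro sum.cong) (auto simp: Y_def set_p_index)
  have skew: "X $$ (j, i) = - cnj (X $$ (i, j))" if "i < n + 1" "j < n + 1" for i j
    using X that unfolding su_alg_iff by blast
  have "Y $$ (j, i) = - cnj (Y $$ (i, j))" if "i < n + 1" "j < n + 1" for i j
    using that skew[OF that] by (auto simp: Y_def set_p_index)
  moreover have "(\<Sum>i<n + 1. Y $$ (i, i)) = 0"
    unfolding tr using X unfolding su_alg_iff by blast
  ultimately have "Y \<in> su_alg (n + 1)" using c(2) unfolding su_alg_iff by blast
  hence "Y \<in> k_alg n" by (auto simp: k_alg_def Y_def set_p_index)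
  hence "su_inner X Y = 0" by (rule orth)
  moreover have "su_inner X Y = (\<Sum>i<n + 1. \<Sum>k<n + 1. (cmod (Y $$ (i, k)))\<^sup>2)"
    unfolding su_inner_sum[OF c] sum_negf[symmetric]
  proof (intro sum.cong refl)
    fix i k assume "i \<in> {..<n + 1}" "k \<in> {..<n + 1}"
    hence ik: "i < n + 1" "k < n + 1" by auto
    have "X $$ (k, i) = - cnj (X $$ (i, k))" by (rule skew[OF ik])
    thus "- Re (X $$ (i, k) * Y $$ (k, i)) = (cmod (Y $$ (i, k)))\<^sup>2"
      using ik unfolding cmod_power2 unfolding power2_eq_square by (auto simp: Y_def set_p_index)
  qed
  ultimately have 0: "(\<Sum>i<n + 1. \<Sum>k<n + 1. (cmod (Y $$ (i, k)))\<^sup>2) = 0" by simp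
  have "Y $$ (i, k) = 0" if "i < n + 1" "k < n + 1" for i k
  proof -
    have "(\<Sum>k<n + 1. (cmod (Y $$ (i, k)))\<^sup>2) = 0"
      using 0 that by (subst (asm) sum_nonneg_eq_0_iff) (auto intro: sum_nonneg simp del: sum.lessThan_Suc)
    thus ?thesis using that by (subst (asm) sum_nonneg_eq_0_iff) auto
  qed
  moreover have "Y $$ (i, j) = X $$ (i, j)"
    if "i < n + 1" "j < n + 1" "(i, j) \<notin> set (p_index n)" for i j
    using that by (simp add: Y_def)
  ultimately show "X \<in> su_alg (n + 1) \<and>
     (\<forall>i<n + 1. \<forall>j<n + 1. (i, j) \<notin> set (p_index n) \<longrightarrow> X $$ (i, j) = 0)"
    using X by metis
next
  assume X: "X \<in> su_alg (n + 1) \<and>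
     (\<forall>i<n + 1. \<forall>j<n + 1. (i, j) \<notin> set (p_index n) \<longrightarrow> X $$ (i, j) = 0)"
  have "su_inner X Y = 0" if Y: "Y \<in> k_alg n" for Y
  proof -
    have c: "X \<in> carrier_mat (n + 1) (n + 1)" "Y \<in> carrier_mat (n + 1) (n + 1)"
      using X Y unfolding su_alg_def k_alg_def by blast+
    have "X $$ (i, k) * Y $$ (k, i) = 0" if "i < n + 1" "k < n + 1" for i k
    proof (cases "(i, k) \<in> set (p_index n)")
      case True
      have "\<forall>j<n. Y $$ (j, n) = 0 \<and> Y $$ (n, j) = 0" using Y by (simp add: k_alg_def)
      thus ?thesis using True by (auto simp: set_p_index)
    next
      case False
      hence "X $$ (i, k) = 0" using X that by blast
      thus ?thesis by simp
    qed
    hence "(\<Sum>i<n + 1. \<Sum>k<n + 1. Re (X $$ (i, k) * Y $$ (k, i))) = 0"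
      by (intro sum.neutral ballI) (simp only: lessThan_iff zero_complex.simps)
    thus ?thesis unfolding su_inner_sum[OF c] by (simp only: neg_0_equal_iff_equal minus_zero)
  qed
  thus "X \<in> p_alg n" using X unfolding p_alg_def by blast
qed

lemma p_complex_eq:
  "p_complex n = {Z \<in> carrier_mat (n + 1) (n + 1).
     \<forall>i<n + 1. \<forall>j<n + 1. (i, j) \<notin> set (p_index n) \<longrightarrow> Z $$ (i, j) = 0}" (is "_ = ?R")
proof
  show "p_complex n \<subseteq> ?R"
    by (auto simp: p_complex_def p_alg_iff su_alg_def)
  show "?R \<subseteq> p_complex n"
  proof
    fix Z assume Z: "Z \<in> ?R"
    define X where "X = mat (n + 1) (n + 1) (\<lambda>(i, j). (Z $$ (i, j) - cnj (Z $$ (j, i))) / 2)"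
    define Y where "Y = mat (n + 1) (n + 1) (\<lambda>(i, j). - \<i> * (Z $$ (i, j) + cnj (Z $$ (j, i))) / 2)"
    have d: "Z $$ (i, i) = 0" if "i < n + 1" for i using Z that by (auto simp: set_p_index)
    have "X \<in> su_alg (n + 1)" "Y \<in> su_alg (n + 1)"
      unfolding su_alg_iff using d
      by (auto simp: X_def Y_def field_simps simp del: sum.lessThan_Suc intro!: sum.neutral)
    hence "X \<in> p_alg n" "Y \<in> p_alg n"
      unfolding p_alg_iff using Z by (auto simp: X_def Y_def set_p_index)
    moreover have "Z = X + \<i> \<cdot>\<^sub>m Y"
      by (rule eq_matI) (use Z in \<open>auto simp: X_def Y_def field_simps\<close>)
    ultimately show "Z \<in> p_complex n" by (auto simp: p_complex_def)
  qed
qed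

lemma p_index_expansion:
  assumes "Z \<in> p_complex n" "i < n + 1" "j < n + 1"
  shows "Z $$ (i, j) = (\<Sum>a<2 * n. Z $$ (p_index n ! a) * mat_unit (n + 1) (p_index n ! a) $$ (i, j))"
proof -
  have "(\<Sum>a<2 * n. Z $$ (p_index n ! a) * mat_unit (n + 1) (p_index n ! a) $$ (i, j))
      = (\<Sum>a<2 * n. if (i, j) = p_index n ! a then Z $$ (p_index n ! a) else 0)"
    using assms by (intro sum.cong) (auto simp: mat_unit_def)
  also have "\<dots> = (\<Sum>b\<in>set (p_index n). if (i, j) = b then Z $$ b else 0)"
    by (rule sum.reindex_bij_betw) (metis bij_betw_nth distinct_p_index length_p_index)
  also have "\<dots> = (if (i, j) \<in> set (p_index n) then Z $$ (i, j) else 0)"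
    by (simp add: sum.delta)
  also have "\<dots> = Z $$ (i, j)" using assms by (auto simp: p_complex_eq)
  finally show ?thesis by simp
qed

lemma Ad_p_invariant:
  assumes k: "k \<in> S_U_U1 n" and Z: "Z \<in> p_complex n"
  shows "k * Z * inv\<^bsub>SU_group (n + 1)\<^esub> k \<in> p_complex n"
proof -
  interpret group "SU_group (n + 1)" by (rule group_SU)
  define l where "l = inv\<^bsub>SU_group (n + 1)\<^esub> k"
  have l: "l \<in> S_U_U1 n" unfolding l_def
    using subgroup.m_inv_closed[OF subgroup_S_U_U1 k] .
  have c: "k \<in> carrier_mat (n + 1) (n + 1)" "l \<in> carrier_mat (n + 1) (n + 1)"
    "Z \<in> carrier_mat (n + 1) (n + 1)" "k * Z \<in> carrier_mat (n + 1) (n + 1)"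
    using k l Z by (auto simp: S_U_U1_iff SU_group_def U_group_def p_complex_eq)
  have "(k * Z * l) $$ (i, j) = 0" if ij: "i < n + 1" "j < n + 1" "(i, j) \<notin> set (p_index n)" for i j
  proof -
    have "(k * Z * l) $$ (i, j) = (\<Sum>r<n + 1. \<Sum>s<n + 1. k $$ (i, s) * Z $$ (s, r) * l $$ (r, j))"
      unfolding mult_index_sum[OF c(4,2) ij(1,2)]
      by (intro sum.cong refl) (simp only: lessThan_iff mult_index_sum[OF c(1,3) ij(1)] sum_distrib_right)
    also have "\<dots> = 0"
    proof (intro sum.neutral ballI)
      fix r s assume "r \<in> {..<n + 1}" "s \<in> {..<n + 1}"
      hence rs: "r < n \<or> r = n" "s < n \<or> s = n" by auto
      have "i < n \<or> i = n" "j < n \<or> j = n" using ij by auto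
      thus "k $$ (i, s) * Z $$ (s, r) * l $$ (r, j) = 0"
        using rs ij(3) k l Z by (auto simp: S_U_U1_iff p_complex_eq set_p_index)
    qed
    finally show ?thesis .
  qed
  moreover have "k * Z * l \<in> carrier_mat (n + 1) (n + 1)" using c(4,2) by (rule mult_carrier_mat)
  ultimately show ?thesis unfolding l_def[symmetric] p_complex_eq by blast
qed

lemma Ad_p_matrix:
  assumes "k \<in> S_U_U1 n" "b < 2 * n" "i < n + 1" "j < n + 1"
  shows "(k * mat_unit (n + 1) (p_index n ! b) * inv\<^bsub>SU_group (n + 1)\<^esub> k) $$ (i, j) =
    (\<Sum>a<2 * n. Ad_p n k $$ (a, b) * mat_unit (n + 1) (p_index n ! a) $$ (i, j))"
proof -
  have "p_index n ! b \<in> set (p_index n)" using assms(2) by (simp add: length_p_index)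
  hence "mat_unit (n + 1) (p_index n ! b) \<in> p_complex n"
    by (auto simp: p_complex_eq mat_unit_def)
  from p_index_expansion[OF Ad_p_invariant[OF assms(1) this] assms(3,4)]
  show ?thesis using assms(2) by (simp add: Ad_p_def)
qed

text \<open>The matrix of the \<open>p\<close>-th exterior power of an endomorphism with \<open>m \<times> m\<close> matrix \<open>A\<close>:
  with respect to the basis \<open>e\<^sub>I\<close> (wedge products over increasing \<open>p\<close>-tuples \<open>I\<close>) its entries
  are the \<open>p \<times> p\<close> minors of \<open>A\<close>.\<close>

definition ext_index :: "nat \<Rightarrow> nat \<Rightarrow> nat list list" where
  "ext_index p m = filter (\<lambda>I. length I = p) (subseqs [0..<m])"

definition ext_power :: "nat \<Rightarrow> nat \<Rightarrow> complex mat \<Rightarrow> complex mat" where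
  "ext_power p m A = mat (length (ext_index p m)) (length (ext_index p m)) (\<lambda>(a, b).
     det (mat p p (\<lambda>(i, j). A $$ (ext_index p m ! a ! i, ext_index p m ! b ! j))))"

text \<open>In the dual basis, the contragredient of \<open>Ad_p n\<close> has as matrix the transpose of
  \<open>Ad_p n\<close> at the inverse element.\<close>

definition tau :: "nat \<Rightarrow> nat \<Rightarrow> mat_rep" where
  "tau n p = (length (ext_index p (2 * n)),
     \<lambda>k. ext_power p (2 * n) (transpose_mat (Ad_p n (inv\<^bsub>SU_group (n + 1)\<^esub> k))))"

end

theory Submission
  imports Defs "HOL-Analysis.Henstock_Kurzweil_Integration"
    "HOL-Analysis.Complex_Transcendental" "HOL-Library.Nat_Bijection" "Jordan_Normal_Form.Spectral_Radius"
begin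

text \<open>
  The multiplicity of a Casimir eigenvalue is \<open>dim V\<^sup>\<Gamma>\<close> times a constant independent of \<open>\<Gamma>\<close>
  as soon as all irreducible representations \<open>V\<close> contributing to it agree up to complex conjugation.
  A \<open>K\<close>-equivariant map from \<open>\<tau>\<^sub>0\<close> or from half of \<open>\<tau>\<^sub>1\<close> into an irreducible representation is
  determined, by the Iwasawa decomposition, by its value at the highest weight vector. This leaves,
  up to conjugation, only the highest weights \<open>A\<^sub>j = (j, 0, \<dots>, 0, -j)\<close> for \<open>p = 0\<close>, and additionally
  \<open>B\<^sub>j = (j, 1, 0, \<dots>, 0, -j - 1)\<close> with \<open>j \<ge> 1\<close> for \<open>p = 1\<close>, whose Casimir eigenvalues \<open>2j(j + n)\<close> and
  \<open>2(j + 1)(j + n)\<close> are distinct. So the hypothesis says that the dimensions of \<open>\<Gamma>\<close>-invariants agree for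
  all but finitely many of these weights.

  To reach the remaining weights, consider the subrepresentation of a mixed tensor power of the
  standard representation that is generated by the vectors \<open>z \<otimes> cnj z \<otimes> \<dots> \<otimes> z \<otimes> cnj z\<close> (\<open>k\<close> pairs). It
  is the sum of the representations of highest weight \<open>A\<^sub>j\<close>, \<open>j \<le> k\<close>, each occurring once, and its
  character is a product of two complete homogeneous symmetric polynomials of degree \<open>k\<close> in the
  eigenvalues. An element of a finite group has roots of unity as eigenvalues, so the dimension of
  the invariants is a quasi-polynomial in \<open>k\<close>: on residue classes modulo the order it is a polynomial.
  Hence the differences of these dimensions for the two groups vanish identically if they vanish for
  large \<open>k\<close>. With a further factor \<open>v \<otimes> cnj z\<close>, where \<open>v\<close> is independent of \<open>z\<close>, the same argument
  applies to the weights \<open>B\<^sub>j\<close>.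
\<close>

section \<open>Finitely supported matrices\<close>

text \<open>Half of \<open>tau n 1\<close> suffices because complex conjugation exchanges its two
  halves and changes neither the Casimir scalar nor the number of invariants; so the representations
  behind one eigenvalue share a single unknown. The two families of eigenvalues do not collide
  because \<open>(j + 1) * (j + n)\<close> lies strictly between \<open>j * (j + n)\<close> and
  \<open>(j + 1) * (j + 1 + n)\<close>. Passing from \<open>k\<close> to \<open>k + 1\<close> pairs
  adds one unknown to a tensor model, so every unknown is a first difference of the
  quasi-polynomial. The weight with index 0 is not reached in this way, but it belongs to the
  trivial representation, which has one invariant for every group. In the model with the extra
  factor the multiplicities of the first family are left open; that family is therefore settled
  first and then cancels. The space of finitely supported matrices is neither complete nor unital.
  Hence exponentials come from diagonalisation instead of power series, projections \<open>e\<close>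
  serve as local units, and the Lie algebra action has to be extracted from continuity of the group
  action.\<close>

text \<open>Complex matrices of all sizes live in one type. Vectors are matrices supported in column 0,
 subspaces are right ideals or projections, and the \<open>d \<times> d\<close> unit matrix is \<open>un {..<d}\<close>.\<close>

typedef fmat = "{A :: nat => nat => complex. \<exists>n. \<forall>i j. A i j \<noteq> 0 --> i < n \<and> j < n}"
 morphisms ent Fmat by (rule exI[of _ "\<lambda>_ _. 0"]) simp

setup_lifting type_definition_fmat

lemmas assoc' = mult.assoc[symmetric]

lemma fmat_eqI: "(\<And>i j. ent A i j = ent B i j) ==> A = B" by (metis ent_inject ext)

lemma fmat_eq_iff: "A = B \<longleftrightarrow> (\<forall>i j. ent A i j = ent B i j)"
 by (auto intro: fmat_eqI)

lemma ent_bound: obtains n where "\<And>i j. n \<le> i \<or> n \<le> j ==> ent A i j = 0"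
 using ent[of A] by (auto simp: not_less[symmetric])

definition inn :: "nat => fmat => bool" where
 "inn n A \<longleftrightarrow> (\<forall>i j. n \<le> i \<or> n \<le> j --> ent A i j = 0)"

lemma inn_ex: "\<exists>n. inn n A" by (metis ent_bound inn_def)

lemma inn_mono: "inn n A ==> n \<le> m ==> inn m A" by (auto simp: inn_def)

lemma inn_ex2: "\<exists>n. inn n A \<and> inn n B" by (meson inn_ex inn_mono nat_le_linear)

lemma inn_ex3: "\<exists>n. inn n A \<and> inn n B \<and> inn n C" by (meson inn_ex inn_mono nat_le_linear)

lemma Fmat_finite:
 "finite S ==> (\<And>i j. f i j \<noteq> 0 ==> i \<in> S \<and> j \<in> S) ==> ent (Fmat f) = f"
proof -
 assume S: "finite S" and f: "\<And>i j. f i j \<noteq> 0 ==> i \<in> S \<and> j \<in> S"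
 obtain n where "S \<subseteq> {..<n}" using S finite_nat_iff_bounded by blast
 then have "\<forall>i j. f i j \<noteq> 0 --> i < n \<and> j < n" using f by blast
 then show ?thesis by (subst Fmat_inverse) auto
qed

instantiation fmat :: ab_group_add
begin
lift_definition zero_fmat :: fmat is "\<lambda>_ _. 0" by simp
lift_definition plus_fmat :: "fmat => fmat => fmat" is "\<lambda>A B i j. A i j + B i j"
proof -
 fix A B :: "nat => nat => complex"
 assume "\<exists>n. \<forall>i j. A i j \<noteq> 0 --> i < n \<and> j < n" "\<exists>n. \<forall>i j. B i j \<noteq> 0 --> i < n \<and> j < n"
 then obtain n m where "\<forall>i j. A i j \<noteq> 0 --> i < n \<and> j < n" "\<forall>i j. B i j \<noteq> 0 --> i < m \<and> j < m" by auto
 then have "\<forall>i j. A i j + B i j \<noteq> 0 --> i < max n m \<and> j < max n m"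
  by (metis add.right_neutral less_max_iff_disj add_0)
 then show "\<exists>n. \<forall>i j. A i j + B i j \<noteq> 0 --> i < n \<and> j < n" by blast
qed
lift_definition uminus_fmat :: "fmat => fmat" is "\<lambda>A i j. - A i j" by auto
definition minus_fmat :: "fmat => fmat => fmat" where "minus_fmat A B = A + - B"
instance by standard (transfer; auto simp: minus_fmat_def fun_eq_iff)+
end

lemma ent_zero [simp]: "ent 0 i j = 0" by transfer simp
lemma ent_add [simp]: "ent (A + B) i j = ent A i j + ent B i j" by transfer simp
lemma ent_uminus [simp]: "ent (- A) i j = - ent A i j" by transfer simp
lemma ent_diff [simp]: "ent (A - B) i j = ent A i j - ent B i j" by (metis ent_add ent_uminus minus_fmat_def diff_conv_add_uminus)
lemma ent_sum [simp]: "ent (sum f S) i j = (\<Sum>x\<in>S. ent (f x) i j)"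
 by (induction S rule: infinite_finite_induct) auto

lift_definition sc :: "complex => fmat => fmat" (infixr "*c" 75) is "\<lambda>c A i j. c * A i j" by auto
lift_definition adj :: "fmat => fmat" is "\<lambda>A i j. cnj (A j i)" by auto
lift_definition cj :: "fmat => fmat" is "\<lambda>A i j. cnj (A i j)" by auto
lemma ent_sc [simp]: "ent (c *c A) i j = c * ent A i j" by transfer simp
lemma ent_adj [simp]: "ent (adj A) i j = cnj (ent A j i)" by transfer simp
lemma ent_cj [simp]: "ent (cj A) i j = cnj (ent A i j)" by transfer simp

definition un :: "nat set => fmat" where "un S = Fmat (\<lambda>i j. if i = j \<and> i \<in> S then 1 else 0)"
definition eu :: "nat => nat => fmat" where "eu a b = Fmat (\<lambda>i j. if i = a \<and> j = b then 1 else 0)"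

lemma ent_un: "finite S ==> ent (un S) i j = (if i = j \<and> i \<in> S then 1 else 0)"
 unfolding un_def by (subst Fmat_finite[of S]) (auto split: if_splits)
lemma ent_eu [simp]: "ent (eu a b) i j = (if i = a \<and> j = b then 1 else 0)"
 unfolding eu_def by (subst Fmat_finite[of "{a,b}"]) (auto split: if_splits)

instantiation fmat :: ring
begin
lift_definition times_fmat :: "fmat => fmat => fmat" is
 "\<lambda>A B i j. \<Sum>k | A i k \<noteq> 0. A i k * B k j"
proof -
 fix A B :: "nat => nat => complex"
 assume "\<exists>n. \<forall>i j. A i j \<noteq> 0 --> i < n \<and> j < n" "\<exists>n. \<forall>i j. B i j \<noteq> 0 --> i < n \<and> j < n"
 then obtain n m where n: "\<forall>i j. A i j \<noteq> 0 --> i < n \<and> j < n" and m: "\<forall>i j. B i j \<noteq> 0 --> i < m \<and> j < m" by auto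
 have "(\<Sum>k | A i k \<noteq> 0. A i k * B k j) \<noteq> 0 --> i < max n m \<and> j < max n m" for i j
  by (smt (verit, best) less_max_iff_disj m mem_Collect_eq mult_zero_left mult_zero_right n sum.neutral)
 then show "\<exists>n. \<forall>i j. (\<Sum>k | A i k \<noteq> 0. A i k * B k j) \<noteq> 0 --> i < n \<and> j < n" by blast
qed

text \<open>The index set may be any finite set carrying the non-zero terms; many entry computations
  below take a singleton.\<close>

lemma ent_times_S:
 assumes "finite S" "\<And>k. ent A i k \<noteq> 0 ==> ent B k j \<noteq> 0 ==> k \<in> S"
 shows "ent (A * B) i j = (\<Sum>k\<in>S. ent A i k * ent B k j)"
proof -
 obtain n where n: "inn n A" using inn_ex by blast
 have fin: "finite {k. ent A i k \<noteq> 0}"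
  by (rule finite_subset[of _ "{..<n}"]) (use n in \<open>auto simp: inn_def not_le[symmetric]\<close>)
 have "ent (A * B) i j = (\<Sum>k | ent A i k \<noteq> 0. ent A i k * ent B k j)" by transfer simp
 also have "\<dots> = (\<Sum>k\<in>S. ent A i k * ent B k j)"
  by (rule sum.mono_neutral_cong) (use assms fin in auto)
 finally show ?thesis .
qed

lemma ent_times_n:
 assumes "inn n A \<or> inn n B"
 shows "ent (A * B) i j = (\<Sum>k<n. ent A i k * ent B k j)"
 by (rule ent_times_S) (use assms in \<open>auto simp: inn_def not_le[symmetric]\<close>)

instance
proof
 fix A B C :: fmat
 obtain n where n: "inn n A" "inn n B" "inn n C" using inn_ex3 by blast
 show "A * B * C = A * (B * C)"
 proof (rule fmat_eqI)
  fix i j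
  have "ent (A * B * C) i j = (\<Sum>l<n. (\<Sum>k<n. ent A i k * ent B k l) * ent C l j)"
   using n by (simp add: ent_times_n[of n])
  also have "\<dots> = (\<Sum>k<n. ent A i k * (\<Sum>l<n. ent B k l * ent C l j))"
   unfolding sum_distrib_left sum_distrib_right by (subst sum.swap) (simp add: mult.assoc)
  also have "\<dots> = ent (A * (B * C)) i j" using n by (simp add: ent_times_n[of n])
  finally show "ent (A * B * C) i j = ent (A * (B * C)) i j" .
 qed
 show "(A + B) * C = A * C + B * C"
  by (rule fmat_eqI) (use n in \<open>simp add: ent_times_n[of n] ring_distribs sum.distrib\<close>)
 show "A * (B + C) = A * B + A * C"
  by (rule fmat_eqI) (use n in \<open>simp add: ent_times_n[of n] ring_distribs sum.distrib\<close>)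
qed
end

lemma ent_un_times: "finite S ==> ent (un S * A) i j = (if i \<in> S then ent A i j else 0)"
 by (subst ent_times_S[of "{i}"]) (auto simp: ent_un split: if_splits)
lemma ent_times_un: "finite S ==> ent (A * un S) i j = (if j \<in> S then ent A i j else 0)"
 by (subst ent_times_S[of "{j}"]) (auto simp: ent_un split: if_splits)
lemma ent_eu_times: "ent (eu a b * A) i j = (if i = a then ent A b j else 0)"
 by (subst ent_times_S[of "{b}"]) (auto split: if_splits)
lemma ent_times_eu: "ent (A * eu a b) i j = (if j = b then ent A i a else 0)"
 by (subst ent_times_S[of "{a}"]) (auto split: if_splits)

text \<open>Support in a corner becomes a pair of equations, so that it can be handled by
  associativity and adjoints.\<close>

lemma inn_un: "inn n A \<longleftrightarrow> un {..<n} * A = A \<and> A * un {..<n} = A"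
 unfolding inn_def fmat_eq_iff by (auto simp: ent_un_times ent_times_un)

lemma adj_adj [simp]: "adj (adj A) = A" by (rule fmat_eqI) simp
lemma adj_add [simp]: "adj (A + B) = adj A + adj B" by (rule fmat_eqI) simp
lemma adj_diff [simp]: "adj (A - B) = adj A - adj B" by (rule fmat_eqI) simp
lemma adj_uminus [simp]: "adj (- A) = - adj A" by (rule fmat_eqI) simp
lemma adj_zero [simp]: "adj 0 = 0" by (rule fmat_eqI) simp
lemma adj_sc [simp]: "adj (c *c A) = cnj c *c adj A" by (rule fmat_eqI) simp
lemma adj_sum [simp]: "adj (sum f S) = (\<Sum>x\<in>S. adj (f x))" by (rule fmat_eqI) simp
lemma adj_eu [simp]: "adj (eu a b) = eu b a" by (rule fmat_eqI) simp
lemma adj_un [simp]: "finite S ==> adj (un S) = un S" by (rule fmat_eqI) (auto simp: ent_un)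
lemma adj_times [simp]: "adj (A * B) = adj B * adj A"
proof (rule fmat_eqI)
 fix i j
 obtain n where n: "inn n A" using inn_ex by blast
 then have "inn n (adj A)" by (auto simp: inn_def)
 with n show "ent (adj (A * B)) i j = ent (adj B * adj A) i j" by (simp add: ent_times_n[of n] mult.commute)
qed
lemma adj_eq_zero [simp]: "adj A = 0 \<longleftrightarrow> A = 0" by (metis adj_adj adj_zero)

lemma cj_cj [simp]: "cj (cj A) = A" by (rule fmat_eqI) simp
lemma cj_add [simp]: "cj (A + B) = cj A + cj B" by (rule fmat_eqI) simp
lemma cj_diff [simp]: "cj (A - B) = cj A - cj B" by (rule fmat_eqI) simp
lemma cj_uminus [simp]: "cj (- A) = - cj A" by (rule fmat_eqI) simp
lemma cj_zero [simp]: "cj 0 = 0" by (rule fmat_eqI) simp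
lemma cj_sc [simp]: "cj (c *c A) = cnj c *c cj A" by (rule fmat_eqI) simp
lemma cj_adj: "cj (adj A) = adj (cj A)" by (rule fmat_eqI) simp
lemma cj_un [simp]: "finite S ==> cj (un S) = un S" by (rule fmat_eqI) (auto simp: ent_un)
lemma cj_times [simp]: "cj (A * B) = cj A * cj B"
proof (rule fmat_eqI)
 fix i j
 obtain n where n: "inn n A" using inn_ex by blast
 then have "inn n (cj A)" by (auto simp: inn_def)
 with n show "ent (cj (A * B)) i j = ent (cj A * cj B) i j" by (simp add: ent_times_n[of n])
qed
lemma sc_times_left [simp]: "(c *c A) * B = c *c (A * B)"
proof (rule fmat_eqI)
 fix i j
 obtain n where n: "inn n B" using inn_ex by blast
 then show "ent ((c *c A) * B) i j = ent (c *c (A * B)) i j"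
  by (simp add: ent_times_n[of n] sum_distrib_left mult.assoc)
qed
lemma sc_times_right [simp]: "A * (c *c B) = c *c (A * B)"
proof (rule fmat_eqI)
 fix i j
 obtain n where n: "inn n A" using inn_ex by blast
 then show "ent (A * (c *c B)) i j = ent (c *c (A * B)) i j"
  by (simp add: ent_times_n[of n] sum_distrib_left mult_ac)
qed
lemma sc_sc [simp]: "a *c b *c A = (a * b) *c A" by (rule fmat_eqI) simp
lemma sc_one [simp]: "1 *c A = A" by (rule fmat_eqI) simp
lemma sc_0 [simp]: "0 *c A = 0" by (rule fmat_eqI) simp
lemma sc_zero [simp]: "c *c 0 = (0 :: fmat)" by (rule fmat_eqI) simp
lemma sc_add_right: "c *c (A + B) = c *c A + c *c B" by (rule fmat_eqI) (simp add: ring_distribs)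
lemma sc_diff_right: "c *c (A - B) = c *c A - c *c B" by (rule fmat_eqI) (simp add: ring_distribs)
lemma sc_add_left: "(a + b) *c A = a *c A + b *c A" by (rule fmat_eqI) (simp add: ring_distribs)
lemma sc_diff_left: "(a - b) *c A = a *c A - b *c A" by (rule fmat_eqI) (simp add: ring_distribs)
lemma sc_minus_right [simp]: "c *c (- A) = - (c *c A)" by (rule fmat_eqI) simp
lemma sc_minus_left [simp]: "(- c) *c A = - (c *c A)" by (rule fmat_eqI) simp
lemma sc_sum_right: "c *c sum f S = (\<Sum>x\<in>S. c *c f x)" by (rule fmat_eqI) (simp add: sum_distrib_left)
lemma sc_eq_0 [simp]: "c *c A = 0 \<longleftrightarrow> c = 0 \<or> A = 0" by (auto simp: fmat_eq_iff)
lemma sc_eq_iff: "a *c A = b *c A \<longleftrightarrow> a = b \<or> A = 0" by (auto simp: fmat_eq_iff)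

lemma un_mult: "finite S ==> finite T ==> un S * un T = un (S \<inter> T)"
 by (rule fmat_eqI) (auto simp: ent_un_times ent_un)
lemma un_idem [simp]: "finite S ==> un S * un S = un S" by (simp add: un_mult)
lemma eu_mult: "eu a b * eu c d = (if b = c then eu a d else 0)" by (rule fmat_eqI) (auto simp: ent_eu_times)
lemma eu_nz [simp]: "eu a b \<noteq> 0" by (auto simp: fmat_eq_iff)
lemma un_sum: "finite S ==> un S = (\<Sum>i\<in>S. eu i i)"
 by (rule fmat_eqI) (auto simp: ent_un sum.If_cases if_distrib[where f="\<lambda>x. x = _"] intro!: sum.neutral cong: if_cong)
text \<open>A substitute for the missing unit element of the ring.\<close>

lemma ex_unit: "\<exists>n. A * un {..<n} = A" using inn_ex inn_un by blast

lemma eq_zero_cols: "(\<And>j. A * eu j 0 = 0) ==> A = 0"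
proof (rule fmat_eqI)
 fix i j assume "\<And>j. A * eu j 0 = 0"
 then have "ent (A * eu j 0) i 0 = 0" by simp
 then show "ent A i j = ent 0 i j" by (simp add: ent_times_eu)
qed

section \<open>Trace and Hilbert-Schmidt norm\<close>

definition tr :: "fmat => complex" where "tr A = (\<Sum>i | ent A i i \<noteq> 0. ent A i i)"

lemma tr_S: "finite S ==> (\<And>i. ent A i i \<noteq> 0 ==> i \<in> S) ==> tr A = (\<Sum>i\<in>S. ent A i i)"
 unfolding tr_def by (rule sum.mono_neutral_cong_left) auto
lemma tr_n: "inn n A ==> tr A = (\<Sum>i<n. ent A i i)"
 by (rule tr_S) (auto simp: inn_def not_le[symmetric])
lemma inn_add: "inn n A ==> inn n B ==> inn n (A + B)" by (auto simp: inn_def)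
lemma inn_diff: "inn n A ==> inn n B ==> inn n (A - B)" by (auto simp: inn_def)
lemma inn_uminus: "inn n A ==> inn n (- A)" by (auto simp: inn_def)
lemma inn_sc: "inn n A ==> inn n (c *c A)" by (auto simp: inn_def)
lemma inn_adj: "inn n A ==> inn n (adj A)" by (auto simp: inn_def)
lemma inn_mult: "inn n A ==> inn n B ==> inn n (A * B)" by (auto simp: inn_def ent_times_n[of n])
lemma inn_eu: "i < n ==> j < n ==> inn n (eu i j)" by (auto simp: inn_def)
lemma inn_one: "inn n (un {..<n})" by (auto simp: inn_def ent_un)
lemma tr_zero [simp]: "tr 0 = 0" by (simp add: tr_def)
lemma tr_add [simp]: "tr (A + B) = tr A + tr B"
proof -
 obtain n where "inn n A" "inn n B" using inn_ex2 by blast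
 then show ?thesis by (simp add: tr_n[of n] inn_add sum.distrib)
qed
lemma tr_sc [simp]: "tr (c *c A) = c * tr A"
proof -
 obtain n where "inn n A" using inn_ex by blast
 then show ?thesis by (simp add: tr_n[of n] inn_sc sum_distrib_left)
qed
lemma tr_uminus [simp]: "tr (- A) = - tr A" using tr_sc[of "-1" A] by simp
lemma tr_diff [simp]: "tr (A - B) = tr A - tr B" unfolding diff_conv_add_uminus by (simp del: add_uminus_conv_diff)
lemma tr_sum [simp]: "tr (sum f S) = (\<Sum>x\<in>S. tr (f x))"
 by (induction S rule: infinite_finite_induct) auto
lemma tr_adj [simp]: "tr (adj A) = cnj (tr A)"
proof -
 obtain n where "inn n A" using inn_ex by blast
 then show ?thesis by (simp add: tr_n[of n] inn_adj)
qed
lemma tr_cj [simp]: "tr (cj A) = cnj (tr A)"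
proof -
 obtain n where n: "inn n A" using inn_ex by blast
 then have "inn n (cj A)" by (auto simp: inn_def)
 with n show ?thesis by (simp add: tr_n[of n])
qed
lemma tr_comm: "tr (A * B) = tr (B * A)"
proof -
 obtain n where n: "inn n A" "inn n B" using inn_ex2 by blast
 then have "tr (A * B) = (\<Sum>i<n. \<Sum>k<n. ent A i k * ent B k i)"
  by (simp add: tr_n[of n] inn_mult ent_times_n[of n])
 also have "\<dots> = tr (B * A)" using n
  by (subst sum.swap) (simp add: tr_n[of n] inn_mult ent_times_n[of n] mult.commute)
 finally show ?thesis .
qed
lemma tr_un: "finite S ==> tr (un S) = of_nat (card S)"
 by (subst tr_S[of S]) (auto simp: ent_un split: if_splits)
lemma tr_eu: "tr (eu a b) = (if a = b then 1 else 0)" by (subst tr_S[of "{a}"]) (auto split: if_splits)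

lemma tr_adj_self:
 assumes "inn n A" shows "tr (adj A * A) = of_real (\<Sum>i<n. \<Sum>j<n. (cmod (ent A j i))\<^sup>2)"
 using assms by (simp add: tr_n[of n] inn_mult inn_adj ent_times_n[of n] complex_norm_square mult.commute del: of_real_power)

text \<open>The real part of the Hilbert-Schmidt product; the scalars are real because
  differentiation is along real curves. For a projection the squared norm is its rank, which serves
  as induction measure later.\<close>

instantiation fmat :: real_inner
begin
definition scaleR_fmat :: "real => fmat => fmat" where "scaleR_fmat c A = of_real c *c A"
definition inner_fmat :: "fmat => fmat => real" where "inner_fmat A B = Re (tr (adj A * B))"
definition norm_fmat :: "fmat => real" where "norm_fmat A = sqrt (inner A A)"
definition sgn_fmat :: "fmat => fmat" where "sgn_fmat A = scaleR (inverse (norm A)) A"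
definition dist_fmat :: "fmat => fmat => real" where "dist_fmat A B = norm (A - B)"
definition uniformity_fmat :: "(fmat \<times> fmat) filter" where
 "uniformity_fmat = (INF e\<in>{0 <..}. principal {(x, y). dist x y < e})"
definition open_fmat :: "fmat set => bool" where
 "open_fmat U = (\<forall>x\<in>U. eventually (\<lambda>(x', y). x' = x --> y \<in> U) uniformity)"
instance
proof
 fix A B C :: fmat and a b c :: real
 show "a *\<^sub>R (A + B) = a *\<^sub>R A + a *\<^sub>R B" by (simp add: scaleR_fmat_def sc_add_right)
 show "(a + b) *\<^sub>R A = a *\<^sub>R A + b *\<^sub>R A" by (simp add: scaleR_fmat_def sc_add_left)
 show "a *\<^sub>R b *\<^sub>R A = (a * b) *\<^sub>R A" by (simp add: scaleR_fmat_def)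
 show "1 *\<^sub>R A = A" by (simp add: scaleR_fmat_def)
 show "inner A B = inner B A" unfolding inner_fmat_def by (metis adj_adj adj_times cnj.sel(1) tr_adj)
 show "inner (A + B) C = inner A C + inner B C" by (simp add: inner_fmat_def ring_distribs)
 show "inner (a *\<^sub>R A) B = a * inner A B" by (simp add: inner_fmat_def scaleR_fmat_def)
 obtain n where n: "inn n A" using inn_ex by blast
 have eq: "inner A A = (\<Sum>i<n. \<Sum>j<n. (cmod (ent A j i))\<^sup>2)"
  unfolding inner_fmat_def tr_adj_self[OF n] by simp
 show "0 \<le> inner A A" unfolding eq by (intro sum_nonneg) auto
 show "(inner A A = 0) = (A = 0)"
 proof
  assume "inner A A = 0"
  then have "\<forall>i<n. \<forall>j<n. ent A j i = 0"
   unfolding eq by (simp add: sum_nonneg_eq_0_iff sum_nonneg)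
  with n show "A = 0" by (metis ent_zero fmat_eqI inn_def not_le)
 qed (simp add: inner_fmat_def)
qed (simp_all add: norm_fmat_def sgn_fmat_def dist_fmat_def uniformity_fmat_def open_fmat_def)
end

lemma norm_fmat_sq: "inn n A ==> (norm A)\<^sup>2 = (\<Sum>i<n. \<Sum>j<n. (cmod (ent A i j))\<^sup>2)"
proof -
 assume "inn n A"
 have "(norm A)\<^sup>2 = Re (tr (adj A * A))" by (simp only: power2_norm_eq_inner inner_fmat_def)
 also have "\<dots> = (\<Sum>i<n. \<Sum>j<n. (cmod (ent A j i))\<^sup>2)"
  unfolding tr_adj_self[OF \<open>inn n A\<close>] by simp
 also have "\<dots> = (\<Sum>i<n. \<Sum>j<n. (cmod (ent A i j))\<^sup>2)" by (rule sum.swap)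
 finally show ?thesis .
qed

lemma adj_self_0: "adj A * A = 0 \<longleftrightarrow> A = 0"
proof
 assume "adj A * A = 0"
 then have "inner A A = 0" by (simp add: inner_fmat_def)
 then show "A = 0" by simp
qed auto

lemma tr_adj_self_norm: "tr (adj A * A) = of_real ((norm A)\<^sup>2)"
proof -
 obtain n where n: "inn n A" using inn_ex by blast
 show ?thesis unfolding tr_adj_self[OF n] norm_fmat_sq[OF n] by (subst sum.swap) simp
qed

instance fmat :: real_normed_algebra
proof
 fix A B :: fmat and a :: real
 show "a *\<^sub>R A * B = a *\<^sub>R (A * B)" "A * a *\<^sub>R B = a *\<^sub>R (A * B)" by (simp_all add: scaleR_fmat_def)
 obtain n where n: "inn n A" "inn n B" using inn_ex2 by blast
 have "(norm (A * B))\<^sup>2 = (\<Sum>i<n. \<Sum>j<n. (cmod (\<Sum>k<n. ent A i k * ent B k j))\<^sup>2)"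
  using n by (simp add: norm_fmat_sq[of n] inn_mult ent_times_n[of n])
 also have "\<dots> \<le> (\<Sum>i<n. \<Sum>j<n. (\<Sum>k<n. (cmod (ent A i k))\<^sup>2) * (\<Sum>k<n. (cmod (ent B k j))\<^sup>2))"
 proof (intro sum_mono)
  fix i j
  have "cmod (\<Sum>k<n. ent A i k * ent B k j) \<le> (\<Sum>k<n. cmod (ent A i k) * cmod (ent B k j))"
   by (rule order_trans[OF norm_sum]) (simp add: norm_mult)
  then have "(cmod (\<Sum>k<n. ent A i k * ent B k j))\<^sup>2 \<le> (\<Sum>k<n. cmod (ent A i k) * cmod (ent B k j))\<^sup>2"
   by (simp add: power_mono)
  also have "\<dots> \<le> (\<Sum>k<n. (cmod (ent A i k))\<^sup>2) * (\<Sum>k<n. (cmod (ent B k j))\<^sup>2)"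
   by (rule Cauchy_Schwarz_ineq_sum)
  finally show "(cmod (\<Sum>k<n. ent A i k * ent B k j))\<^sup>2 \<le> (\<Sum>k<n. (cmod (ent A i k))\<^sup>2) * (\<Sum>k<n. (cmod (ent B k j))\<^sup>2)" .
 qed
 also have "\<dots> = (\<Sum>i<n. \<Sum>k<n. (cmod (ent A i k))\<^sup>2) * (\<Sum>j<n. \<Sum>k<n. (cmod (ent B k j))\<^sup>2)"
  by (simp only: sum_product)
 also have "(\<Sum>j<n. \<Sum>k<n. (cmod (ent B k j))\<^sup>2) = (norm B)\<^sup>2"
  unfolding norm_fmat_sq[OF n(2)] by (rule sum.swap)
 also have "(\<Sum>i<n. \<Sum>k<n. (cmod (ent A i k))\<^sup>2) = (norm A)\<^sup>2"
  unfolding norm_fmat_sq[OF n(1)] ..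
 finally show "norm (A * B) \<le> norm A * norm B"
  using power2_le_imp_le[of "norm (A * B)" "norm A * norm B"] by (simp add: power_mult_distrib)
qed

section \<open>Projections and the spectral theorem\<close>

definition proj :: "fmat => bool" where "proj P \<longleftrightarrow> adj P = P \<and> P * P = P"
definition col :: "fmat => bool" where "col v \<longleftrightarrow> v * eu 0 0 = v"
definition ip :: "fmat => fmat => complex" where "ip x y = ent (adj x * y) 0 0"

lemma mac: "A * B = C ==> A * (B * X) = C * (X :: fmat)" by (metis mult.assoc)

lemma projD: "proj P ==> adj P = P" "proj P ==> P * P = P" by (auto simp: proj_def)
lemma proj_un: "finite S ==> proj (un S)" by (simp add: proj_def)
lemma proj_0: "proj 0" by (simp add: proj_def)

lemma eu_sandwich: "eu a b * A * eu c d = ent A b c *c eu a d"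
 by (rule fmat_eqI) (simp add: ent_eu_times ent_times_eu)

lemma col_mult: "col v ==> col (A * v)" by (simp add: col_def mult.assoc)
lemma col_sc: "col v ==> col (c *c v)" by (simp add: col_def)
lemma col_eu: "col (A * eu j 0)" by (simp add: col_def mult.assoc eu_mult)
lemma col_euI: "col (eu j 0)" by (simp add: col_def eu_mult)
lemma col_diff: "col v ==> col w ==> col (v - w)" by (simp add: col_def ring_distribs)

lemma adj_mult_col:
 assumes "col x" "col y" shows "adj x * y = ip x y *c eu 0 0"
proof -
 have "adj x * y = adj (x * eu 0 0) * (y * eu 0 0)" using assms by (simp add: col_def)
 also have "\<dots> = eu 0 0 * (adj x * y) * eu 0 0" by (simp add: mult.assoc)
 also have "\<dots> = ip x y *c eu 0 0" unfolding eu_sandwich ip_def ..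
 finally show ?thesis .
qed

lemma ip_adj2: "ip (A * x) y = ip x (adj A * y)" by (simp add: ip_def mult.assoc)
lemma ip_add_right: "ip x (y + z) = ip x y + ip x z" by (simp add: ip_def ring_distribs)
lemma ip_sc_left [simp]: "ip (c *c x) y = cnj c * ip x y" by (simp add: ip_def)
lemma ip_sc_right [simp]: "ip x (c *c y) = c * ip x y" by (simp add: ip_def)
lemma ip_0 [simp]: "ip 0 x = 0" "ip x 0 = 0" by (simp_all add: ip_def)
lemma ip_minus_left [simp]: "ip (- x) y = - ip x y" by (simp add: ip_def)
lemma ip_minus_right [simp]: "ip x (- y) = - ip x y" by (simp add: ip_def)
lemma ip_self: "col x ==> ip x x = of_real ((norm x)\<^sup>2)"
 using arg_cong[OF adj_mult_col[of x x], of tr] by (simp add: tr_adj_self_norm tr_eu)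
lemma ex_col: "v \<noteq> 0 ==> \<exists>j. v * eu j 0 \<noteq> 0" using eq_zero_cols by blast

lemma normalise:
 assumes "col v" "v \<noteq> 0"
 obtains c where "c \<noteq> 0" "ip (c *c v) (c *c v) = 1"
proof (rule that[of "of_real (1 / norm v)"])
 show "ip (of_real (1 / norm v) *c v) (of_real (1 / norm v) *c v) = 1"
  using assms by (simp add: ip_self power2_eq_square)
qed (use assms in auto)

lemma unit_col: "col u ==> ip u u = 1 ==> adj u * u = eu 0 0" by (simp add: adj_mult_col)

lemma proj_unit: "col u ==> ip u u = 1 ==> proj (u * adj u)"
 unfolding proj_def by (simp add: mult.assoc) (metis col_def mult.assoc unit_col)

lemma mult_unit_adj: "col u ==> ip u u = 1 ==> u * adj u * u = u"
 by (simp add: mult.assoc unit_col col_def)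

lemma tr_unit: "col u ==> ip u u = 1 ==> tr (u * adj u) = 1"
 by (subst tr_comm) (simp add: unit_col tr_eu)

lemma tr_proj: "proj P ==> tr P = of_real ((norm P)\<^sup>2)"
 using tr_adj_self_norm[of P] by (simp add: proj_def)

lemma proj_diff:
 assumes "proj P" "proj Q" "P * Q = Q" shows "proj (P - Q)" "Q * P = Q"
proof -
 show "Q * P = Q" using assms by (metis adj_times proj_def)
 then show "proj (P - Q)" using assms by (simp add: proj_def algebra_simps)
qed

section \<open>Right ideals and their projections\<close>

definition rideal :: "fmat set => bool" where
 "rideal W \<longleftrightarrow> 0 \<in> W \<and> (\<forall>A\<in>W. \<forall>B\<in>W. A + B \<in> W) \<and> (\<forall>A\<in>W. \<forall>B. A * B \<in> W)"

lemma rideal_sc: "rideal W ==> A \<in> W ==> c *c A \<in> W"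
proof -
 assume W: "rideal W" "A \<in> W"
 obtain n where "A * un {..<n} = A" using ex_unit by blast
 then have "c *c A = A * (c *c un {..<n})" by simp
 then show ?thesis using W unfolding rideal_def by metis
qed

lemma rideal_diff: "rideal W ==> A \<in> W ==> B \<in> W ==> A - B \<in> W"
 using rideal_sc[of W B "-1"] unfolding rideal_def by (metis diff_conv_add_uminus sc_minus_left sc_one)

text \<open>The squared norm of a projection in \<open>W\<close> is its rank and is at most
  \<open>n\<close>. A projection within 1 of the supremum acts as the identity on \<open>W\<close>:
  otherwise a column of \<open>Y - Q * Y\<close> yields a rank-one projection in \<open>W\<close>
  orthogonal to \<open>Q\<close>, and adding it raises the squared norm by 1, beyond the
  supremum.\<close>

theorem rideal_proj:
 assumes W: "rideal W" and e: "\<And>Y. Y \<in> W ==> e * Y = Y"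
 obtains Q where "proj Q" "Q \<in> W" "\<And>Y. Y \<in> W ==> Q * Y = Y"
proof -
 obtain n where n: "un {..<n} * e = e" using inn_ex inn_un by blast
 have bd: "(norm Q)\<^sup>2 \<le> real n" if Q: "Q \<in> W" "proj Q" for Q
 proof -
  have "un {..<n} * Q = Q" using e[OF Q(1)] n by (metis mult.assoc)
  then have "proj (un {..<n} - Q)" by (intro proj_diff) (use Q in \<open>simp_all add: proj_un\<close>)
  from tr_proj[OF this] tr_proj[OF Q(2)]
  have "of_nat n - of_real ((norm Q)\<^sup>2) = complex_of_real ((norm (un {..<n} - Q))\<^sup>2)"
   by (simp add: tr_un)
  then have "complex_of_real (real n - (norm Q)\<^sup>2) = of_real ((norm (un {..<n} - Q))\<^sup>2)" by simp
  then have "real n - (norm Q)\<^sup>2 = (norm (un {..<n} - Q))\<^sup>2" unfolding of_real_eq_iff .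
  then show ?thesis using zero_le_power2[of "norm (un {..<n} - Q)"] by linarith
 qed
 define T where "T = (\<lambda>Q. (norm Q)\<^sup>2) ` {Q \<in> W. proj Q}"
 have ne: "T \<noteq> {}" using W proj_0 by (auto simp: T_def rideal_def)
 have bdd: "bdd_above T" using bd by (auto simp: T_def intro!: bdd_aboveI)
 obtain t where t: "t \<in> T" "Sup T - 1 < t" using less_cSupE[of "Sup T - 1" T] ne by auto
 then obtain Q where Q: "Q \<in> W" "proj Q" "t = (norm Q)\<^sup>2" by (auto simp: T_def)
 have "Q * Y = Y" if Y: "Y \<in> W" for Y
 proof (rule ccontr)
  assume "Q * Y \<noteq> Y"
  define Z where "Z = Y - Q * Y"
  have Z: "Z \<noteq> 0" "Z \<in> W" "Q * Z = 0" using \<open>Q * Y \<noteq> Y\<close> Y Q W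
   by (auto simp: Z_def rideal_diff ring_distribs proj_def assoc') (metis rideal_def rideal_diff)
  obtain j where j: "Z * eu j 0 \<noteq> 0" using ex_col[OF Z(1)] by blast
  obtain c where c: "ip (c *c (Z * eu j 0)) (c *c (Z * eu j 0)) = 1" using normalise[OF col_eu j] .
  define u where "u = c *c (Z * eu j 0)"
  have u: "col u" "ip u u = 1" "u \<in> W" "Q * u = 0"
  proof -
   show "col u" by (simp add: u_def col_eu col_sc)
   show "ip u u = 1" using c by (simp add: u_def)
   show "u \<in> W" unfolding u_def by (rule rideal_sc[OF W]) (use W Z(2) in \<open>simp add: rideal_def\<close>)
   show "Q * u = 0" by (simp add: u_def mac[OF Z(3)])
  qed
  have uQ: "adj u * Q = 0" using arg_cong[OF u(4), of adj] Q by (simp add: proj_def)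
  have pu: "proj (u * adj u)" by (rule proj_unit[OF u(1,2)])
  have "Q * (u * adj u) = 0" "u * adj u * Q = 0"
   using u(4) uQ by (simp_all add: assoc') (simp add: mult.assoc uQ)
  then have P: "proj (Q + u * adj u)" using pu Q(2) by (simp add: proj_def ring_distribs)
  have "Q + u * adj u \<in> W" using W Q(1) u(3) unfolding rideal_def by blast
  then have "(norm (Q + u * adj u))\<^sup>2 \<in> T" using P by (auto simp: T_def)
  moreover have "complex_of_real ((norm (Q + u * adj u))\<^sup>2) = of_real ((norm Q)\<^sup>2 + 1)"
   using tr_proj[OF P] tr_proj[OF Q(2)] tr_unit[OF u(1,2)] by simp
  then have "(norm (Q + u * adj u))\<^sup>2 = (norm Q)\<^sup>2 + 1" unfolding of_real_eq_iff .
  ultimately have "t + 1 \<le> Sup T" using cSup_upper[OF _ bdd] Q(3) by metis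
  then show False using t by simp
 qed
 with Q that show ?thesis by blast
qed

text \<open>Invariance of the range under \<open>B\<close> gives \<open>Q * B * Q = B * Q\<close>;
  invariance under \<open>adj B\<close> gives, after taking adjoints,
  \<open>Q * B * Q = Q * B\<close>.\<close>

lemma proj_commute:
 assumes Q: "proj Q" "\<And>Y. Y \<in> W ==> Q * Y = Y" and B: "B * Q \<in> W" "adj B * Q \<in> W"
 shows "B * Q = Q * B"
proof -
 have 1: "Q * (B * Q) = B * Q" "Q * (adj B * Q) = adj B * Q" using Q(2) B by auto
 have "adj (Q * (adj B * Q)) = adj (adj B * Q)" using 1 by simp
 then have "Q * B * Q = Q * B" using Q(1) by (simp add: proj_def mult.assoc)
 then show ?thesis using 1 by (simp add: mult.assoc)
qed

text \<open>The columns of \<open>S\<close> form an orthonormal basis of the range of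
  \<open>S * adj S\<close>; conjugation by \<open>S\<close> turns operators on that range into
  \<open>m\<close> by \<open>m\<close> matrices.\<close>

definition isom :: "nat => fmat => bool" where "isom m S \<longleftrightarrow> adj S * S = un {..<m}"

lemma isom_un:
 assumes "isom m S" shows "S * un {..<m} = S" "un {..<m} * adj S = adj S"
proof -
 have s: "adj S * S = un {..<m}" using assms by (simp add: isom_def)
 then have s': "adj S * (S * X) = un {..<m} * X" for X by (metis mult.assoc)
 have "adj (S - S * un {..<m}) * (S - S * un {..<m}) = 0" by (simp add: ring_distribs mult.assoc s s')
 then have "S - S * un {..<m} = 0" by (simp only: adj_self_0)
 then show "S * un {..<m} = S" by simp
 then show "un {..<m} * adj S = adj S" by (metis adj_times adj_un finite_lessThan)
qed

lemma isom_eu: "isom m S ==> S * eu m j = 0"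
proof -
 assume S: "isom m S"
 have "un {..<m} * eu m j = 0" by (rule fmat_eqI) (simp add: ent_un_times)
 then have "S * un {..<m} * eu m j = 0" by (simp add: mult.assoc)
 then show ?thesis by (simp add: isom_un[OF S])
qed

definition dg :: "nat => (nat => complex) => fmat" where "dg m d = (\<Sum>i<m. d i *c eu i i)"

lemma ent_dg [simp]: "ent (dg m d) i j = (if i = j \<and> i < m then d i else 0)"
 unfolding dg_def by (auto simp: if_distrib cong: if_cong) (auto intro!: sum.neutral)
lemma inn_dg: "inn m (dg m d)" by (auto simp: inn_def)
lemma dg_mult: "dg m d * dg m d' = dg m (\<lambda>i. d i * d' i)"
 by (rule fmat_eqI) (auto simp: ent_times_n[of m] inn_dg if_distrib cong: if_cong)
lemma adj_dg [simp]: "adj (dg m d) = dg m (\<lambda>i. cnj (d i))" by (rule fmat_eqI) auto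
lemma dg_one: "dg m (\<lambda>_. 1) = un {..<m}" by (rule fmat_eqI) (auto simp: ent_un)
lemma dg_cong: "(\<And>i. i < m ==> d i = d' i) ==> dg m d = dg m d'" by (rule fmat_eqI) auto
lemma dg_un: "un {..<m} * dg m d = dg m d" "dg m d * un {..<m} = dg m d" using inn_dg inn_un by blast+
lemma tr_dg: "tr (dg m d) = (\<Sum>i<m. d i)" by (simp add: tr_n[OF inn_dg])
lemma dg_uminus: "- dg m d = dg m (\<lambda>i. - d i)" by (rule fmat_eqI) auto
lemma sc_dg: "c *c dg m d = dg m (\<lambda>i. c * d i)" by (rule fmat_eqI) auto
lemma dg_eq_iff: "dg m d = dg m d' \<longleftrightarrow> (\<forall>i<m. d i = d' i)"
 by (auto simp: fmat_eq_iff split: if_splits)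

lemma dg_Suc: "dg (Suc m) d = dg m d + d m *c eu m m" by (simp add: dg_def)

section \<open>Passage between \<open>complex mat\<close> and \<open>fmat\<close>\<close>

definition fm :: "complex mat => fmat" where
 "fm M = Fmat (\<lambda>i j. if i < dim_row M \<and> j < dim_col M then M $$ (i, j) else 0)"
definition mt :: "nat => nat => fmat => complex mat" where "mt r c A = mat r c (\<lambda>(i, j). ent A i j)"

lemma ent_fm: "ent (fm M) i j = (if i < dim_row M \<and> j < dim_col M then M $$ (i, j) else 0)"
 unfolding fm_def by (subst Fmat_finite[of "{..<dim_row M} \<union> {..<dim_col M}"]) (auto split: if_splits)

lemma mt_carrier [simp]: "mt r c A \<in> carrier_mat r c" "dim_row (mt r c A) = r" "dim_col (mt r c A) = c"
 by (simp_all add: mt_def)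
lemma mt_index [simp]: "i < r ==> j < c ==> mt r c A $$ (i, j) = ent A i j" by (simp add: mt_def)

lemma mt_fm: "M \<in> carrier_mat r c ==> mt r c (fm M) = M"
 by (rule eq_matI) (auto simp: ent_fm)
lemma fm_mt: "fm (mt r c A) = un {..<r} * A * un {..<c}"
 by (rule fmat_eqI) (auto simp: ent_fm ent_un_times ent_times_un)
lemma fm_mult: "M \<in> carrier_mat r k ==> M' \<in> carrier_mat k c ==> fm (M * M') = fm M * fm M'"
proof (rule fmat_eqI)
 fix i j assume c: "M \<in> carrier_mat r k" "M' \<in> carrier_mat k c"
 have "ent (fm M * fm M') i j = (\<Sum>l<k. ent (fm M) i l * ent (fm M') l j)"
  by (rule ent_times_S) (use c in \<open>auto simp: ent_fm split: if_splits\<close>)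
 also have "\<dots> = ent (fm (M * M')) i j" using c by (auto simp: ent_fm scalar_prod_def atLeast0LessThan)
 finally show "ent (fm (M * M')) i j = ent (fm M * fm M') i j" by simp
qed
lemma fm_one: "fm (1\<^sub>m d) = un {..<d}" by (rule fmat_eqI) (auto simp: ent_fm ent_un)
lemma fm_adj: "M \<in> carrier_mat d d ==> fm (mat_adjoint M) = adj (fm M)"
 by (rule fmat_eqI) (use mat_adjoint_carrier[of M d] in \<open>auto simp: ent_fm mat_adjoint_index[of M d]\<close>)
lemma fm_inj: "M \<in> carrier_mat r c ==> M' \<in> carrier_mat r c ==> fm M = fm M' \<longleftrightarrow> M = M'"
 by (metis mt_fm)
lemma fm_un: "M \<in> carrier_mat r c ==> un {..<r} * fm M = fm M" "M \<in> carrier_mat r c ==> fm M * un {..<c} = fm M"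
 by (rule fmat_eqI; auto simp: ent_un_times ent_times_un ent_fm)+
lemma inn_fm: "M \<in> carrier_mat d d ==> inn d (fm M)" by (auto simp: inn_def ent_fm)
lemma fm_uminus: "fm (- M) = - fm M" by (rule fmat_eqI) (auto simp: ent_fm)
lemma fm_smult: "fm (c \<cdot>\<^sub>m M) = c *c fm M" by (rule fmat_eqI) (auto simp: ent_fm)
lemma fm_zero: "fm (0\<^sub>m r c) = 0" by (rule fmat_eqI) (auto simp: ent_fm)
lemma mt_mult: "inn k A \<or> inn k B \<or> A * un {..<k} = A \<or> un {..<k} * B = B ==> mt r c (A * B) = mt r k A * mt k c B"
proof (rule eq_matI)
 fix i j assume a: "inn k A \<or> inn k B \<or> A * un {..<k} = A \<or> un {..<k} * B = B"
  and ij: "i < dim_row (mt r k A * mt k c B)" "j < dim_col (mt r k A * mt k c B)"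
 have "A * B = A * un {..<k} * B" using a by (metis inn_un mult.assoc)
 then have "ent (A * B) i j = ent (A * un {..<k} * B) i j" by simp
 also have "\<dots> = (\<Sum>l<k. ent A i l * ent B l j)"
  by (subst ent_times_S[of "{..<k}"]) (auto simp: ent_times_un split: if_splits)
 finally show "mt r c (A * B) $$ (i, j) = (mt r k A * mt k c B) $$ (i, j)"
  using ij by (simp add: scalar_prod_def atLeast0LessThan)
qed auto

lemma tr_proj_ge1:
 assumes "proj P" "col u" "ip u u = 1" "P * u = u"
 shows "proj (P - u * adj u)" "(norm (P - u * adj u))\<^sup>2 = (norm P)\<^sup>2 - 1" "adj u * P = adj u"
proof -
 have 1: "P * (u * adj u) = u * adj u" using assms(4) by (simp add: assoc')
 show p: "proj (P - u * adj u)" by (rule proj_diff) (use assms 1 proj_unit in auto)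
 have "complex_of_real ((norm (P - u * adj u))\<^sup>2) = of_real ((norm P)\<^sup>2 - 1)"
  using tr_proj[OF p] tr_proj[OF assms(1)] tr_unit[OF assms(2,3)] by simp
 then show "(norm (P - u * adj u))\<^sup>2 = (norm P)\<^sup>2 - 1" unfolding of_real_eq_iff .
 show "adj u * P = adj u" using arg_cong[OF assms(4), of adj] assms(1) by (simp add: proj_def)
qed

text \<open>One step in building an orthonormal basis: the new unit vector is written into column
  \<open>m\<close>, which is still empty.\<close>

lemma isom_extend:
 assumes S: "isom m S" "S * adj S = P - u * adj u" and P: "proj P" and u: "col u" "ip u u = 1" "P * u = u"
 defines "S' \<equiv> S + u * eu 0 m"
 shows "isom (Suc m) S'" "S' * adj S' = P"
proof -
 note up = tr_proj_ge1[OF P u]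
 have "adj u * (S * adj S) = 0"
  unfolding S(2) using up(3) u by (simp add: right_diff_distrib) (metis adj_times adj_adj mult.assoc mult_unit_adj)
 then have "adj u * (S * adj S) * S = 0" by simp
 then have uS: "adj u * S = 0" using S(1) isom_un[OF S(1)] by (simp add: mult.assoc isom_def)
 then have Su: "adj S * u = 0" by (metis adj_adj adj_times adj_zero)
 have uS': "adj u * (S * X) = 0" for X by (metis uS mult.assoc mult_zero_left)
 have Su': "adj S * (u * X) = 0" for X by (metis Su mult.assoc mult_zero_left)
 have uu: "adj u * (u * X) = eu 0 0 * X" for X by (metis unit_col[OF u(1,2)] mult.assoc)
 have Sm: "S * eu m 0 = 0" by (rule isom_eu[OF S(1)])
 have Sm': "S * (eu m 0 * X) = 0" for X by (metis Sm mult.assoc mult_zero_left)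
 have mS: "eu 0 m * adj S = 0" using arg_cong[OF Sm, of adj] by simp
 have "adj S' * S' = un {..<m} + eu m m" unfolding S'_def using S(1)
  by (simp add: ring_distribs mult.assoc uu eu_mult Su' uS' uS Su isom_def)
 also have "\<dots> = un {..<Suc m}" by (rule fmat_eqI) (auto simp: ent_un)
 finally show "isom (Suc m) S'" by (simp add: isom_def)
 have u0: "u * (eu 0 0 * X) = u * X" for X using u(1) by (metis col_def mult.assoc)
 have eue: "eu 0 m * (eu m 0 * X) = eu 0 0 * X" for X by (metis eu_mult mult.assoc)
 show "S' * adj S' = P" unfolding S'_def using S(2) by (simp add: ring_distribs mult.assoc Sm' mS eue u0)
qed

text \<open>Induction on an integer bound for the rank, removing one unit vector of the range at a
  time.\<close>

lemma proj_isom: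
 assumes "proj P" obtains m S where "isom m S" "S * adj S = P"
proof -
 have "\<exists>m S. isom m S \<and> S * adj S = P" if "proj P" "(norm P)\<^sup>2 < real k" for k P using that
 proof (induction k arbitrary: P)
  case 0 then show ?case by simp
 next
  case (Suc k)
  show ?case
  proof (cases "P = 0")
   case True then show ?thesis by (intro exI[of _ 0]) (simp add: isom_def un_sum)
  next
   case False
   then obtain j where j: "P * eu j 0 \<noteq> 0" using ex_col by blast
   obtain c where c: "ip (c *c (P * eu j 0)) (c *c (P * eu j 0)) = 1" using normalise[OF col_eu j] .
   define u where "u = c *c (P * eu j 0)"
   have u: "col u" "ip u u = 1" "P * u = u" using c Suc(2) by (auto simp: u_def col_eu col_sc assoc' proj_def)
   obtain m S where S: "isom m S" "S * adj S = P - u * adj u"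
    using Suc.IH[of "P - u * adj u"] tr_proj_ge1[OF Suc(2) u] Suc(3) by auto
   show ?thesis using isom_extend[OF S Suc(2) u] by blast
  qed
 qed
 moreover obtain k where "(norm P)\<^sup>2 < real k" using reals_Archimedean2 by blast
 ultimately show ?thesis using assms that by blast
qed

text \<open>The hypothesis on \<open>A\<close> says that the range of \<open>P\<close> is invariant,
  so an eigenvector of the compression of \<open>A\<close> to this range, which is an ordinary
  square matrix, is an eigenvector of \<open>A\<close>.\<close>

lemma eigen_exists:
 assumes P: "proj P" "P \<noteq> 0" and A: "P * A * P = A * P"
 obtains u l where "col u" "ip u u = 1" "P * u = u" "A * u = l *c u"
proof -
 obtain m S where S: "isom m S" "S * adj S = P" using proj_isom[OF P(1)] .
 have m: "m \<noteq> 0"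
 proof
  assume "m = 0"
  then have "S * un {} = S" using isom_un[OF S(1)] by simp
  moreover have "un {} = 0" by (rule fmat_eqI) (simp add: ent_un)
  ultimately show False using S P by simp
 qed
 define B where "B = adj S * A * S"
 define M where "M = mt m m B"
 have "spectrum M \<noteq> {}" by (rule spectrum_non_empty[of _ m]) (use m in \<open>auto simp: M_def\<close>)
 then obtain l v where v: "v \<in> carrier_vec m" "v \<noteq> 0\<^sub>v m" "M *\<^sub>v v = l \<cdot>\<^sub>v v"
  by (auto simp: spectrum_def eigenvalue_def eigenvector_def M_def)
 define w where "w = Fmat (\<lambda>i j. if j = 0 \<and> i < m then vec_index v i else 0)"
 have ew: "ent w i j = (if j = 0 \<and> i < m then vec_index v i else 0)" for i j
  unfolding w_def by (subst Fmat_finite[of "insert 0 {..<m}"]) (auto split: if_splits)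
 have cw: "col w" unfolding col_def by (rule fmat_eqI) (auto simp: ent_times_eu ew)
 have unw: "un {..<m} * w = w" by (rule fmat_eqI) (auto simp: ent_un_times ew)
 have w0: "w \<noteq> 0"
 proof
  assume "w = 0"
  then have "vec_index v i = 0" if "i < m" for i using that ew[of i 0] by simp
  with v show False by (auto intro!: eq_vecI)
 qed
 have Bw: "B * w = l *c w"
 proof (rule fmat_eqI)
  fix i j
  have "un {..<m} * B = B" unfolding B_def by (metis isom_un(2)[OF S(1)] mult.assoc)
  then have B0: "ent B i k = 0" if "\<not> i < m" for k using that by (metis ent_un_times finite_lessThan lessThan_iff)
  have "ent (B * w) i j = (\<Sum>k<m. ent B i k * ent w k j)"
   by (rule ent_times_S) (auto simp: ew split: if_splits)
  also have "\<dots> = ent (l *c w) i j"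
  proof (cases "j = 0 \<and> i < m")
   case True
   then have "vec_index (M *\<^sub>v v) i = (\<Sum>k<m. ent B i k * vec_index v k)"
    using v(1) by (simp add: M_def scalar_prod_def atLeast0LessThan)
   then show ?thesis using True v by (simp add: ew)
  qed (auto simp: ew B0)
  finally show "ent (B * w) i j = ent (l *c w) i j" .
 qed
 have "adj S * (S * w) = w" using S(1) unw by (simp add: isom_def assoc')
 then have Sw0: "S * w \<noteq> 0" using w0 by auto
 have P1: "P * (S * w) = S * w"
  unfolding S(2)[symmetric] using \<open>adj S * (S * w) = w\<close> by (simp add: mult.assoc)
 have "A * (S * w) = A * P * (S * w)" using P1 by (simp add: mult.assoc)
 also have "\<dots> = P * A * (P * (S * w))" unfolding A[symmetric] by (simp add: mult.assoc)
 also have "\<dots> = S * (B * w)" unfolding P1 by (simp add: S(2)[symmetric] B_def mult.assoc)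
 finally have ASw: "A * (S * w) = l *c (S * w)" by (simp add: Bw)
 obtain c where c: "ip (c *c (S * w)) (c *c (S * w)) = 1" using normalise[OF col_mult[OF cw] Sw0] .
 show ?thesis
  by (rule that[of "c *c (S * w)" l]) (use c P1 ASw in \<open>auto simp: col_sc col_mult cw mult.commute\<close>)
qed

text \<open>By normality the norm of \<open>adj A * u - cnj l *c u\<close> equals that of
  \<open>A * u - l *c u\<close>.\<close>

lemma normal_eigen_adj:
 assumes "A * adj A = adj A * A" "col u" "A * u = l *c u"
 shows "adj A * u = cnj l *c u"
proof -
 have 1: "adj u * adj A = cnj l *c adj u" using arg_cong[OF assms(3), of adj] by simp
 have 2: "adj A * (A * X) = A * (adj A * X)" for X using assms(1) by (metis mult.assoc)
 have 3: "A * (adj A * u) = l *c (adj A * u)" using 2[of u] assms(3) by simp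
 have "adj (adj A * u - cnj l *c u) * (adj A * u - cnj l *c u) = 0"
  by (simp add: ring_distribs mult.assoc 3 assms(3) sc_diff_right)
 then show ?thesis by (simp only: adj_self_0 right_minus_eq)
qed

text \<open>The complement of an eigenvector is again invariant by \<open>normal_eigen_adj\<close>,
  so eigenvectors split off one by one. The commuting projection \<open>P\<close> is what shrinks in
  the induction.\<close>

theorem normal_spectral:
 assumes "A * adj A = adj A * A" "proj P" "A * P = P * A"
 obtains m S d where "isom m S" "S * adj S = P" "A * S = S * dg m d"
proof -
 have "\<exists>m S d. isom m S \<and> S * adj S = P \<and> A * S = S * dg m d"
  if "proj P" "A * P = P * A" "(norm P)\<^sup>2 < real k" for k P using that
 proof (induction k arbitrary: P)
  case 0 then show ?case by simp
 next
  case (Suc k)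
  show ?case
  proof (cases "P = 0")
   case True then show ?thesis by (intro exI[of _ 0]) (simp add: isom_def un_sum)
  next
   case False
   obtain u l where u: "col u" "ip u u = 1" "P * u = u" "A * u = l *c u"
    using eigen_exists[OF Suc(2) False, of A] Suc(2,3) by (metis mult.assoc projD(2))
   have au: "adj A * u = cnj l *c u" by (rule normal_eigen_adj[OF assms(1) u(1,4)])
   have uA: "adj u * A = l *c adj u" using arg_cong[OF au, of adj] by simp
   have "A * (P - u * adj u) = (P - u * adj u) * A"
    using Suc(3) u(4) uA by (simp add: ring_distribs mult.assoc) (simp add: assoc')
   then obtain m S d where S: "isom m S" "S * adj S = P - u * adj u" "A * S = S * dg m d"
    using Suc.IH[of "P - u * adj u"] tr_proj_ge1[OF Suc(2) u(1-3)] Suc(4) by auto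
   define S' where "S' = S + u * eu 0 m"
   define d' where "d' i = (if i = m then l else d i)" for i
   have "dg (Suc m) d' = dg m d + l *c eu m m" unfolding dg_Suc by (auto simp: d'_def intro!: dg_cong)
   moreover have "S * eu m m = 0" by (rule isom_eu[OF S(1)])
   moreover have "eu 0 m * dg m d = 0" by (rule fmat_eqI) (auto simp: ent_eu_times)
   ultimately have "A * S' = S' * dg (Suc m) d'"
    using S(3) u(4) by (simp add: S'_def ring_distribs mult.assoc eu_mult) (simp add: assoc')
   then show ?thesis using isom_extend[OF S(1,2) Suc(2) u(1-3)] unfolding S'_def by blast
  qed
 qed
 moreover obtain k where "(norm P)\<^sup>2 < real k" using reals_Archimedean2 by blast
 ultimately show ?thesis using assms that by blast
qed

text \<open>Eigenspaces are intersected one operator at a time. Since the operators commute, each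
  intersection is invariant under the whole family, and its projection commutes with all of
  it.\<close>

lemma common_eigen:
 fixes H :: "fmat set"
 assumes P: "proj P" "P \<noteq> 0" and H: "\<And>h. h \<in> H ==> adj h = h" "\<And>h. h \<in> H ==> h * P = P * h"
  "\<And>h k. h \<in> H ==> k \<in> H ==> h * k = k * h" and fin: "finite H"
 obtains u where "col u" "ip u u = 1" "P * u = u" "\<And>h. h \<in> H ==> \<exists>l. h * u = l *c u"
proof -
 have "\<exists>Q. proj Q \<and> Q \<noteq> 0 \<and> P * Q = Q \<and> (\<forall>h\<in>H. h * Q = Q * h) \<and> (\<forall>h\<in>F. \<exists>l. h * Q = l *c Q)"
  if "finite F" "F \<subseteq> H" for F using that
 proof (induction F)
  case empty
  then show ?case using P H by (metis empty_iff projD(2))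
 next
  case (insert h F)
  then obtain Q where Q: "proj Q" "Q \<noteq> 0" "P * Q = Q" "\<forall>h\<in>H. h * Q = Q * h" "\<forall>h\<in>F. \<exists>l. h * Q = l *c Q"
   by auto
  have hH: "h \<in> H" using insert by auto
  obtain u l where u: "col u" "ip u u = 1" "Q * u = u" "h * u = l *c u"
   using eigen_exists[OF Q(1,2), of h] Q hH by (metis mult.assoc projD(2))
  define W where "W = {Y. Q * Y = Y \<and> h * Y = l *c Y}"
  have W: "rideal W" by (auto simp: rideal_def W_def ring_distribs sc_add_right assoc')
  obtain R where R: "proj R" "R \<in> W" "\<And>Y. Y \<in> W ==> R * Y = Y"
   using rideal_proj[OF W, of Q] by (auto simp: W_def)
  have "u \<in> W" using u by (simp add: W_def)
  then have "R * u = u" by (rule R(3))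
  then have "R \<noteq> 0" using u by auto
  moreover have "P * R = R" using Q(3) R(2) unfolding W_def by (metis (mono_tags, lifting) mem_Collect_eq mult.assoc)
  moreover have "k * R = R * k" if k: "k \<in> H" for k
  proof (rule proj_commute[OF R(1,3)])
   have "Q * (k * R) = k * R" using R(2) Q(4) k unfolding W_def by (metis (mono_tags, lifting) mem_Collect_eq mult.assoc)
   moreover have "h * (k * R) = k * (h * R)" using H(3)[OF k hH] by (metis mult.assoc)
   ultimately show "k * R \<in> W" using R(2) by (simp add: W_def)
   then show "adj k * R \<in> W" using H(1)[OF k] by simp
  qed
  moreover have "\<exists>l. k * R = l *c R" if k: "k \<in> insert h F" for k
  proof (cases "k = h")
   case True then show ?thesis using R(2) by (auto simp: W_def)
  next
   case False
   then obtain l' where "k * Q = l' *c Q" using k Q(5) by auto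
   then have "k * (Q * R) = l' *c (Q * R)" by (simp add: assoc')
   then show ?thesis using R(2) by (auto simp: W_def)
  qed
  ultimately show ?case using R(1) by blast
 qed
 from this[OF fin subset_refl] obtain Q where Q: "proj Q" "Q \<noteq> 0" "P * Q = Q" "\<forall>h\<in>H. \<exists>l. h * Q = l *c Q" by blast
 obtain j where j: "Q * eu j 0 \<noteq> 0" using ex_col[OF Q(2)] by blast
 obtain c where c: "ip (c *c (Q * eu j 0)) (c *c (Q * eu j 0)) = 1" using normalise[OF col_eu j] .
 show ?thesis
 proof (rule that[of "c *c (Q * eu j 0)"])
  show "P * (c *c (Q * eu j 0)) = c *c (Q * eu j 0)" by (simp add: mac[OF Q(3)])
  show "\<exists>l. h * (c *c (Q * eu j 0)) = l *c c *c (Q * eu j 0)" if hH: "h \<in> H" for h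
  proof -
   obtain l where l: "h * Q = l *c Q" using bspec[OF Q(4) hH] by blast
   have "h * (Q * eu j 0) = l *c (Q * eu j 0)" by (simp add: mac[OF l])
   then have "h * (c *c (Q * eu j 0)) = l *c c *c (Q * eu j 0)" by (simp add: mult.commute)
   then show ?thesis by blast
  qed
 qed (use c in \<open>auto simp: col_eu col_sc\<close>)
qed

section \<open>One-parameter groups\<close>

lemma bounded_linear_sc: "bounded_linear (\<lambda>c. c *c A)"
proof (rule bounded_linear_intro[where K = "norm A"])
 fix a b :: complex and r :: real
 show "(a + b) *c A = a *c A + b *c A" by (rule sc_add_left)
 show "(r *\<^sub>R a) *c A = r *\<^sub>R (a *c A)" by (simp add: scaleR_fmat_def scaleR_conv_of_real)
 obtain n where n: "inn n A" using inn_ex by blast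
 have "(norm (a *c A))\<^sup>2 = (cmod a * norm A)\<^sup>2"
  by (simp add: norm_fmat_sq[OF n] norm_fmat_sq[OF inn_sc[OF n]] power_mult_distrib norm_mult sum_distrib_left)
 then show "norm (a *c A) \<le> cmod a * norm A" by simp
qed

lemma norm_sc: "norm (c *c A) = cmod c * norm A"
proof -
 obtain n where n: "inn n A" using inn_ex by blast
 have "(norm (c *c A))\<^sup>2 = (cmod c * norm A)\<^sup>2"
  by (simp add: norm_fmat_sq[OF n] norm_fmat_sq[OF inn_sc[OF n]] power_mult_distrib norm_mult sum_distrib_left)
 then show ?thesis by simp
qed

lemma norm_adj [simp]: "norm (adj A) = norm A"
proof -
 have "of_real ((norm (adj A))\<^sup>2) = complex_of_real ((norm A)\<^sup>2)"
  using tr_adj_self_norm[of A] tr_adj_self_norm[of "adj A"] tr_comm[of A "adj A"] by simp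
 then show ?thesis unfolding of_real_eq_iff by simp
qed

lemma bounded_linear_adj: "bounded_linear adj"
 by (rule bounded_linear_intro[where K = 1]) (simp_all add: scaleR_fmat_def)

lemma norm_ent: "cmod (ent A i j) \<le> norm A"
proof -
 obtain n where n: "inn n A" using inn_ex by blast
 define m where "m = Suc (max n (max i j))"
 have m: "inn m A" "i < m" "j < m" using inn_mono[OF n, of m] by (auto simp: m_def)
 have "(cmod (ent A i j))\<^sup>2 \<le> (\<Sum>j<m. (cmod (ent A i j))\<^sup>2)"
  by (rule member_le_sum) (use m in auto)
 also have "\<dots> \<le> (\<Sum>i<m. \<Sum>j<m. (cmod (ent A i j))\<^sup>2)"
  by (rule member_le_sum[of i "{..<m}" "\<lambda>i. \<Sum>j<m. (cmod (ent A i j))\<^sup>2"]) (use m in \<open>auto intro: sum_nonneg\<close>)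
 finally show ?thesis unfolding norm_fmat_sq[OF m(1), symmetric] by simp
qed

lemma bounded_linear_ent: "bounded_linear (\<lambda>A. ent A i j)"
 by (rule bounded_linear_intro[where K = 1]) (simp_all add: scaleR_fmat_def scaleR_conv_of_real norm_ent)

lemma fmat_expand: "inn n A ==> A = (\<Sum>i<n. \<Sum>j<n. ent A i j *c eu i j)"
proof (rule fmat_eqI)
 fix a b assume n: "inn n A"
 have "ent (\<Sum>i<n. \<Sum>j<n. ent A i j *c eu i j) a b = (\<Sum>i<n. if i = a then (\<Sum>j<n. if j = b then ent A i j else 0) else 0)"
  by (simp add: if_distrib cong: if_cong) (intro sum.cong, auto intro!: sum.neutral sum.cong)
 also have "\<dots> = ent A a b" using n by (auto simp: inn_def)
 finally show "ent A a b = ent (\<Sum>i<n. \<Sum>j<n. ent A i j *c eu i j) a b" by simp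
qed

text \<open>The common corner is essential: without a uniform bound on the supports, entrywise
  convergence does not control the norm.\<close>

lemma tendsto_fmat:
 assumes "\<And>x. inn n (f x)" "inn n A" "\<And>i j. i < n ==> j < n ==> ((\<lambda>x. ent (f x) i j) \<longlongrightarrow> ent A i j) F"
 shows "(f \<longlongrightarrow> A) F"
proof -
 have "((\<lambda>x. \<Sum>i<n. \<Sum>j<n. ent (f x) i j *c eu i j) \<longlongrightarrow> (\<Sum>i<n. \<Sum>j<n. ent A i j *c eu i j)) F"
  by (intro tendsto_sum bounded_linear.tendsto[OF bounded_linear_sc]) (use assms in auto)
 then show ?thesis unfolding fmat_expand[OF assms(1), symmetric] fmat_expand[OF assms(2), symmetric] .
qed

lemma isom_dim:
 assumes "isom m S" "S * adj S = un {..<n}" shows "m = n"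
proof -
 have "of_nat m = (of_nat n :: complex)" using tr_comm[of S "adj S"] assms by (simp add: isom_def tr_un)
 then show ?thesis by simp
qed

lemma isom_ex_inv:
 assumes "isom m S" shows "adj S * (S * X) = un {..<m} * X" by (metis assms isom_def mult.assoc)

lemma skew_diag:
 assumes "proj e" "e * M = M" "adj M = - M"
 obtains m S d where "isom m S" "S * adj S = e" "M = S * dg m (\<lambda>i. \<i> * of_real (d i)) * adj S"
proof -
 have Me: "M * e = M" using arg_cong[OF assms(2), of adj] assms(1,3) by (simp add: proj_def)
 obtain m S c where S: "isom m S" "S * adj S = e" "M * S = S * dg m c"
  by (rule normal_spectral[of M e]) (use assms Me in auto)
 have M: "M = S * dg m c * adj S" using Me S by (metis mult.assoc)
 have "dg m c = adj S * M * S" using S(1) M by (simp add: mult.assoc isom_ex_inv isom_def dg_un)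
 then have "adj (dg m c) = - dg m c" using assms by (simp add: mult.assoc)
 then have "cnj (c i) = - c i" if "i < m" for i using that by (simp add: dg_eq_iff dg_uminus)
 then have "c i = \<i> * of_real (Im (c i))" if "i < m" for i using that by (simp add: complex_eq_iff)
 then have "dg m c = dg m (\<lambda>i. \<i> * of_real (Im (c i)))" by (intro dg_cong) auto
 then show ?thesis using that[OF S(1,2)] M by metis
qed

text \<open>Describes the curve \<open>exp (t M)\<close> on the range of \<open>e\<close> as a
  unitary one-parameter group with given derivative at 0, without a power series.\<close>

definition oneparam :: "fmat => fmat => (real => fmat) => bool" where
 "oneparam e M f \<longleftrightarrow> f 0 = e \<and> (\<forall>s t. f (s + t) = f s * f t) \<and> (\<forall>t. adj (f t) = f (- t)) \<and>
  (f has_vector_derivative M) (at 0)"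

lemma vd_sum: "(\<And>i. i \<in> S ==> (f i has_vector_derivative f' i) F) ==>
 ((\<lambda>x. \<Sum>i\<in>S. f i x) has_vector_derivative (\<Sum>i\<in>S. f' i)) F"
 by (rule has_vector_derivative_sum)

lemma vd_mult_left: "(f has_vector_derivative f') F ==> ((\<lambda>x. A * f x) has_vector_derivative A * f') F" for A :: fmat
 by (rule bounded_linear.has_vector_derivative[OF bounded_linear_mult_right])
lemma vd_mult_right: "(f has_vector_derivative f') F ==> ((\<lambda>x. f x * A) has_vector_derivative f' * A) F" for A :: fmat
 by (rule bounded_linear.has_vector_derivative[OF bounded_linear_mult_left])

lemma vd_affine:
 assumes "(f has_vector_derivative f') (at (a * t + b))"
 shows "((\<lambda>x. f (a * x + b)) has_vector_derivative a *\<^sub>R f') (at (t::real))"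
proof -
 have "((\<lambda>x. a * x + b) has_vector_derivative a) (at t)"
  unfolding has_real_derivative_iff_has_vector_derivative[symmetric] by (auto intro!: derivative_eq_intros)
 from vector_diff_chain_at[OF this assms] show ?thesis by (simp add: o_def)
qed

lemma cexp_deriv: "((\<lambda>t::real. exp (of_real t * c)) has_vector_derivative c * exp (of_real t * c)) (at t)" for c :: complex
proof -
 have "((\<lambda>z. exp (z * c)) has_field_derivative c * exp (of_real t * c)) (at (of_real t))"
  by (auto intro!: derivative_eq_intros)
 from has_vector_derivative_real_field[OF this] show ?thesis by simp
qed

lemma cnj_exp_real: "cnj (exp z) = exp (cnj z)" by (simp add: exp_eq_polar cis_cnj)

lemma oneparam_diag:
 assumes "isom m S"
 shows "oneparam (S * adj S) (S * dg m (\<lambda>i. \<i> * of_real (d i)) * adj S)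
  (\<lambda>t. S * dg m (\<lambda>i. exp (of_real t * (\<i> * of_real (d i)))) * adj S)"
 unfolding oneparam_def
proof (intro conjI allI)
 let ?f = "\<lambda>t. S * dg m (\<lambda>i. exp (of_real t * (\<i> * of_real (d i)))) * adj S"
 show "?f 0 = S * adj S" by (simp add: dg_one isom_un[OF assms])
 fix s t
 have "?f s * ?f t = S * (dg m (\<lambda>i. exp (of_real s * (\<i> * of_real (d i)))) * (adj S * S) *
   dg m (\<lambda>i. exp (of_real t * (\<i> * of_real (d i))))) * adj S" by (simp add: mult.assoc)
 also have "\<dots> = ?f (s + t)"
  using assms by (simp add: isom_def dg_un dg_mult exp_add[symmetric] ring_distribs)
 finally show "?f (s + t) = ?f s * ?f t" ..
 show "adj (?f t) = ?f (- t)" by (simp add: mult.assoc cnj_exp_real)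
next
 have "((\<lambda>t. dg m (\<lambda>i. exp (of_real t * (\<i> * of_real (d i))))) has_vector_derivative
   (\<Sum>i<m. (\<i> * of_real (d i) * exp (of_real 0 * (\<i> * of_real (d i)))) *c eu i i)) (at 0)"
  unfolding dg_def by (intro vd_sum bounded_linear.has_vector_derivative[OF bounded_linear_sc] cexp_deriv)
 then have "((\<lambda>t. dg m (\<lambda>i. exp (of_real t * (\<i> * of_real (d i))))) has_vector_derivative
   dg m (\<lambda>i. \<i> * of_real (d i))) (at 0)" by (simp add: dg_def)
 then show "((\<lambda>t. S * dg m (\<lambda>i. exp (of_real t * (\<i> * of_real (d i)))) * adj S) has_vector_derivative
   S * dg m (\<lambda>i. \<i> * of_real (d i)) * adj S) (at 0)" by (intro vd_mult_right vd_mult_left)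
qed

lemma oneparam_deriv:
 assumes "oneparam e M f"
 shows "(f has_vector_derivative M * f t) (at t)" "(f has_vector_derivative f t * M) (at t)"
proof -
 have d: "(f has_vector_derivative M) (at (t + (- t)))" and a: "\<And>s t. f (s + t) = f s * f t"
  using assms by (auto simp: oneparam_def)
 have "((\<lambda>x. f (x + (- t))) has_vector_derivative M) (at t)"
  using vd_affine[of f M 1 t "- t"] d by simp
 from vd_mult_right[OF this, of "f t"] vd_mult_left[OF this, of "f t"]
 show "(f has_vector_derivative M * f t) (at t)" "(f has_vector_derivative f t * M) (at t)"
  unfolding a[symmetric] by simp_all
qed

lemma vd_unique: "(f has_vector_derivative a) (at (x::real)) ==> (f has_vector_derivative b) (at x) ==> a = b"
 by (rule vector_derivative_unique_at)

lemma oneparam_gen: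
 assumes "oneparam e M f" "proj e"
 shows "adj M = - M" "e * M = M" "M * e = M"
proof -
 have d: "(f has_vector_derivative M) (at 0)" "f 0 = e" using assms by (auto simp: oneparam_def)
 show "e * M = M" "M * e = M" using oneparam_deriv[OF assms(1), of 0] d vd_unique by metis+
 have "((\<lambda>t. adj (f t)) has_vector_derivative adj M) (at 0)"
  by (rule bounded_linear.has_vector_derivative[OF bounded_linear_adj d(1)])
 moreover have "((\<lambda>t. f (- t)) has_vector_derivative - M) (at 0)"
  using vd_affine[of f M "-1" 0 0] d by simp
 ultimately show "adj M = - M" using assms(1) vd_unique by (simp add: oneparam_def)
qed

lemma const_of_deriv_0:
 assumes "\<And>t. (f has_vector_derivative 0) (at (t::real))" shows "f t = f 0"
 by (metis assms has_vector_derivative_at_within convex_UNIV has_vector_derivative_zero_constant UNIV_I)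

text \<open>The curve \<open>g (- t) * (T * f t)\<close> has derivative zero, hence keeps its value
  \<open>T\<close> at 0.\<close>

lemma oneparam_intertwine:
 assumes f: "oneparam e M f" and g: "oneparam e' M' g" and T: "T * M = M' * T" "T * e = T" "e' * T = T"
 shows "T * f t = g t * T"
proof -
 have "((\<lambda>t. g (- t) * (T * f t)) has_vector_derivative (g (- t) * (T * (M * f t)) + (-1 *\<^sub>R (g (- t) * M')) * (T * f t))) (at t)" for t
  by (intro bounded_bilinear.has_vector_derivative[OF bounded_bilinear_mult] vd_mult_left oneparam_deriv[OF f])
   (use vd_affine[of g "g (- t) * M'" "-1" t 0] oneparam_deriv(2)[OF g, of "- t"] in simp)
 moreover have "g (- t) * (T * (M * f t)) + (-1 *\<^sub>R (g (- t) * M')) * (T * f t) = 0" for t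
  using T(1) by (simp add: mult.assoc mac[OF T(1)])
 ultimately have "((\<lambda>t. g (- t) * (T * f t)) has_vector_derivative 0) (at t)" for t by metis
 then have "g (- t) * (T * f t) = g (- 0) * (T * f 0)" by (rule const_of_deriv_0)
 also have "\<dots> = T" using f g T by (simp add: oneparam_def)
 finally have "g t * T = g t * g (- t) * (T * f t)" by (simp add: mult.assoc)
 also have "g t * g (- t) = e'" using g unfolding oneparam_def by (metis add.right_inverse)
 also have "e' * (T * f t) = T * f t" using T by (simp add: assoc')
 finally show ?thesis ..
qed

lemma oneparam_unique:
 assumes "oneparam e M f" "oneparam e M g" "proj e" shows "f = g"
proof
 fix t
 have "e * f t = g t * e"
  by (rule oneparam_intertwine[OF assms(1,2)]) (use oneparam_gen[OF assms(1,3)] assms(3) in \<open>auto simp: proj_def\<close>)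
 moreover have "e * f t = f t" "g t * e = g t"
  using assms(1,2) unfolding oneparam_def by (metis add_0) (metis assms(2) oneparam_def add.right_neutral)
 ultimately show "f t = g t" by simp
qed

lemma oneparam_ex:
 assumes "proj e" "e * M = M" "adj M = - M" obtains f where "oneparam e M f"
proof -
 assume that: "\<And>f. oneparam e M f ==> thesis"
 obtain m S d where S: "isom m S" "S * adj S = e" "M = S * dg m (\<lambda>i. \<i> * of_real (d i)) * adj S"
  by (rule skew_diag[OF assms])
 show ?thesis using oneparam_diag[OF S(1), of d] that unfolding S(2,3) by blast
qed

text \<open>The curve \<open>exp (- t c) *c (f t * v)\<close> has derivative zero.\<close>

lemma oneparam_eigen:
 assumes f: "oneparam e M f" and v: "M * v = c *c v" "e * v = v"
 shows "f t * v = exp (of_real t * c) *c v"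
proof -
 have "((\<lambda>t. exp (of_real t * (- c)) *c (f t * v)) has_vector_derivative
  (- c * exp (of_real t * (- c))) *c (f t * v) + exp (of_real t * (- c)) *c (f t * M * v)) (at t)" for t
 proof -
  have bb: "bounded_bilinear (\<lambda>a A. a *c (A::fmat))"
  proof
   show "\<exists>K. \<forall>a (A::fmat). norm (a *c A) \<le> norm a * norm A * K"
    by (rule exI[of _ 1]) (simp add: norm_sc)
  qed (simp_all add: sc_add_left sc_add_right scaleR_fmat_def scaleR_conv_of_real mult.commute)
  have "((\<lambda>t. exp (of_real t * (- c)) *c (f t * v)) has_vector_derivative
   exp (of_real t * (- c)) *c (f t * M * v) + (- c * exp (of_real t * (- c))) *c (f t * v)) (at t)"
   by (intro bounded_bilinear.has_vector_derivative[OF bb] vd_mult_right oneparam_deriv(2)[OF f] cexp_deriv)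
  then show ?thesis by (simp add: add.commute)
 qed
 moreover have "(- c * exp (of_real t * (- c))) *c (f t * v) + exp (of_real t * (- c)) *c (f t * M * v) = 0" for t
  by (simp add: mult.assoc v mult.commute)
 ultimately have "((\<lambda>t. exp (of_real t * (- c)) *c (f t * v)) has_vector_derivative 0) (at t)" for t by metis
 then have "exp (of_real t * (- c)) *c (f t * v) = exp (of_real 0 * (- c)) *c (f 0 * v)"
  by (rule const_of_deriv_0)
 also have "\<dots> = v" using f v by (simp add: oneparam_def)
 finally have "exp (of_real t * c) *c exp (of_real t * (- c)) *c (f t * v) = exp (of_real t * c) *c v" by (simp only:)
 then have "exp (of_real t * c) *c v = (exp (of_real t * c) * exp (of_real t * (- c))) *c (f t * v)" by (simp only: sc_sc)
 also have "exp (of_real t * c) * exp (of_real t * (- c)) = 1" by (simp add: exp_minus)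
 finally show ?thesis by simp
qed

section \<open>The Lie product formula and differentiability of continuous one-parameter
  groups\<close>

lemma norm_contract:
 assumes "adj U * U = e" "proj e" shows "norm (U * Y) \<le> norm Y"
proof -
 obtain n where n: "un {..<n} * Y = Y" "un {..<n} * e = e" using inn_ex2[of Y e] inn_un by blast
 have 1: "proj (un {..<n} - e)" by (rule proj_diff) (use assms n in \<open>auto simp: proj_un\<close>)
 have "tr (adj (U * Y) * (U * Y)) = tr (adj Y * (e * Y))" by (simp add: mult.assoc mac[OF assms(1)])
 also have "\<dots> = tr (adj Y * Y) - tr (adj Y * ((un {..<n} - e) * Y))"
  using n by (simp add: ring_distribs)
 also have "adj Y * ((un {..<n} - e) * Y) = adj ((un {..<n} - e) * Y) * ((un {..<n} - e) * Y)"
  using 1 unfolding proj_def by (metis adj_times mult.assoc)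
 finally have "complex_of_real ((norm (U * Y))\<^sup>2) = of_real ((norm Y)\<^sup>2 - (norm ((un {..<n} - e) * Y))\<^sup>2)"
  unfolding tr_adj_self_norm by simp
 then have "(norm (U * Y))\<^sup>2 = (norm Y)\<^sup>2 - (norm ((un {..<n} - e) * Y))\<^sup>2" unfolding of_real_eq_iff .
 then have "(norm (U * Y))\<^sup>2 \<le> (norm Y)\<^sup>2" by simp
 then show ?thesis by (rule power2_le_imp_le) simp
qed

text \<open>Telescoping of the difference of two \<open>n\<close>-th powers of contractions. Powers
  are iterated left multiplications of \<open>Y\<close>, as the ring has no unit to start
  from.\<close>

lemma telescope:
 fixes U V Y :: fmat
 assumes "\<And>Y. norm (U * Y) \<le> norm Y" "\<And>Y. norm (V * Y) \<le> norm Y"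
 shows "norm (((*) U ^^ n) Y - ((*) V ^^ n) Y) \<le> real n * norm (U - V) * norm Y"
proof -
 have V: "norm (((*) V ^^ n) Y) \<le> norm Y" for n by (induction n) (auto intro: order_trans[OF assms(2)])
 show ?thesis
 proof (induction n)
  case (Suc n)
  have "((*) U ^^ Suc n) Y - ((*) V ^^ Suc n) Y = U * (((*) U ^^ n) Y - ((*) V ^^ n) Y) + (U - V) * ((*) V ^^ n) Y"
   by (simp add: ring_distribs)
  also have "norm \<dots> \<le> norm (U * (((*) U ^^ n) Y - ((*) V ^^ n) Y)) + norm ((U - V) * ((*) V ^^ n) Y)"
   by (rule norm_triangle_ineq)
  also have "\<dots> \<le> real n * norm (U - V) * norm Y + norm (U - V) * norm Y"
   by (intro add_mono order_trans[OF assms(1)] Suc order_trans[OF norm_mult_ineq] mult_left_mono V) auto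
  finally show ?case by (simp add: ring_distribs)
 qed simp
qed

text \<open>The \<open>n\<close>-th powers of \<open>\<psi> (t / n)\<close> and
  \<open>f (t / n)\<close> differ by at most a constant times \<open>n\<close> times the distance of
  the factors, and that distance is \<open>o(1 / n)\<close> because both curves are tangent at 0.
  For \<open>\<psi>\<close> a product of two exponentials this is the Lie product formula.\<close>

lemma lie_product:
 assumes f: "oneparam e M f" and e: "proj e" and psi: "\<And>s. adj (\<psi> s) * \<psi> s = e" "\<psi> 0 = e"
  "(\<psi> has_vector_derivative M) (at 0)"
 shows "(\<lambda>n. ((*) (\<psi> (t / real (Suc n))) ^^ Suc n) e) \<longlonglongrightarrow> f t"
proof -
 have ff: "adj (f s) * f s = e" for s using f unfolding oneparam_def by (metis add.left_inverse)
 have fn: "((*) (f s) ^^ n) e = f (real n * s)" for s n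
  by (induction n) (use f in \<open>auto simp: oneparam_def ring_distribs\<close>)
 have d: "((\<lambda>s. \<psi> s - f s) has_vector_derivative 0) (at 0)"
  using has_vector_derivative_diff[OF psi(3), of f M] f by (simp add: oneparam_def)
 have 0: "\<psi> 0 - f 0 = 0" using psi f by (simp add: oneparam_def)
 have lim: "((\<lambda>s. norm (\<psi> s - f s) / \<bar>s\<bar>) \<longlongrightarrow> 0) (at 0)"
  using d unfolding has_vector_derivative_def has_derivative_at by (simp add: 0)
 have "(\<lambda>n. real (Suc n) * norm (\<psi> (t / real (Suc n)) - f (t / real (Suc n)))) \<longlonglongrightarrow> 0"
 proof (cases "t = 0")
  case False
  have "filterlim (\<lambda>n. t / real (Suc n)) (at 0) sequentially" by (rule filterlim_atI)
    (use False LIMSEQ_Suc[OF lim_const_over_n[of t]] in auto)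
  from filterlim_compose[OF lim this]
  have "(\<lambda>n. \<bar>t\<bar> * (norm (\<psi> (t / real (Suc n)) - f (t / real (Suc n))) / \<bar>t / real (Suc n)\<bar>)) \<longlonglongrightarrow> \<bar>t\<bar> * 0"
   by (intro tendsto_mult tendsto_const)
  moreover have "\<bar>t\<bar> * (x / \<bar>t / real (Suc n)\<bar>) = real (Suc n) * x" for n and x :: real
   using False by (simp add: field_simps)
  ultimately show ?thesis by (simp only: mult_zero_right)
 qed (use 0 in simp)
 then have "(\<lambda>n. real (Suc n) * norm (\<psi> (t / real (Suc n)) - f (t / real (Suc n))) * norm e) \<longlonglongrightarrow> 0 * norm e"
  by (intro tendsto_mult tendsto_const)
 then have "(\<lambda>n. ((*) (\<psi> (t / real (Suc n))) ^^ Suc n) e - f t) \<longlonglongrightarrow> 0"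
 proof (rule Lim_null_comparison[rotated, OF tendsto_eq_rhs], simp, intro always_eventually allI)
  fix n
  have "norm (((*) (\<psi> (t / real (Suc n))) ^^ Suc n) e - ((*) (f (t / real (Suc n))) ^^ Suc n) e)
   \<le> real (Suc n) * norm (\<psi> (t / real (Suc n)) - f (t / real (Suc n))) * norm e"
   by (rule telescope) (rule norm_contract[OF psi(1) e] norm_contract[OF ff e])+
  then show "norm (((*) (\<psi> (t / real (Suc n))) ^^ Suc n) e - f t) \<le>
    real (Suc n) * norm (\<psi> (t / real (Suc n)) - f (t / real (Suc n))) * norm e" unfolding fn by simp
 qed
 then show ?thesis by (simp add: LIM_zero_iff)
qed

text \<open>Takes the place of a Neumann series. If the Hermitian operator \<open>Q * adj Q\<close>
  had eigenvalue 0, its eigenvector would satisfy \<open>adj Q * y = 0\<close> and so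
  \<open>y = adj (e - Q) * y\<close>, against \<open>norm (e - Q) < 1\<close>. Hence it can be
  inverted on its eigenbasis.\<close>

lemma right_inverse_ex:
 assumes e: "proj e" and Q: "norm (e - Q) < 1" "e * Q = Q"
 obtains B where "Q * B = e"
proof -
 define K where "K = Q * adj Q"
 have eK: "e * K = K" by (simp add: K_def mac[OF Q(2)])
 have Kh: "adj K = K" by (simp add: K_def)
 have Ke: "K * e = K" using arg_cong[OF eK, of adj] Kh e by (simp add: proj_def)
 obtain m S d where S: "isom m S" "S * adj S = e" "K * S = S * dg m d"
  by (rule normal_spectral[of K e]) (use e Kh eK Ke in auto)
 have d0: "d i \<noteq> 0" if i: "i < m" for i
 proof
  assume "d i = 0"
  define y where "y = S * eu i 0"
  have "dg m d * eu i 0 = 0" using \<open>d i = 0\<close> by (intro fmat_eqI) (auto simp: ent_times_eu)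
  then have "K * y = 0" unfolding y_def by (simp add: mac[OF S(3)] mult.assoc)
  then have "adj (adj Q * y) * (adj Q * y) = 0" by (simp add: K_def mult.assoc)
  then have "adj Q * y = 0" by (simp only: adj_self_0)
  moreover have ey: "e * y = y" using S isom_un(1)[OF S(1)] by (simp add: y_def S(2)[symmetric] mult.assoc isom_ex_inv[OF S(1)]) (simp add: assoc')
  ultimately have "y = adj (e - Q) * y" using e by (simp add: ring_distribs proj_def)
  then have "norm y \<le> norm (e - Q) * norm y" by (metis norm_mult_ineq norm_adj)
  then have "y = 0" using Q(1) by (metis linorder_not_less mult_cancel_right1 mult_right_mono norm_eq_zero norm_ge_zero order_antisym_conv less_imp_le)
  moreover have "adj S * y = eu i 0"
   using i by (simp add: y_def isom_ex_inv[OF S(1)]) (rule fmat_eqI, auto simp: ent_un_times)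
  ultimately show False by (metis eu_nz mult_zero_right)
 qed
 have "dg m d * dg m (\<lambda>i. 1 / d i) = un {..<m}"
  unfolding dg_mult dg_one[symmetric] by (rule dg_cong) (simp add: d0)
 then have "K * (S * dg m (\<lambda>i. 1 / d i) * adj S) = e"
  by (simp add: assoc' S(3)) (simp add: mult.assoc, simp add: assoc' isom_un[OF S(1)] S(2))
 then show ?thesis using that[of "adj Q * (S * dg m (\<lambda>i. 1 / d i) * adj S)"] by (simp add: K_def mult.assoc)
qed

lemma inn_sandwich: "inn n e ==> e * A = A ==> A * e = A ==> inn n A"
 unfolding inn_un by (metis mult.assoc)

text \<open>Antiderivatives are taken entrywise. The radius 2 leaves room for \<open>t + s\<close>
  when \<open>t\<close> and \<open>s\<close> both lie within distance 1 of the origin.\<close>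

lemma ex_antideriv:
 fixes f :: "real => complex"
 assumes "continuous_on UNIV f"
 shows "\<exists>g. \<forall>x\<in>{-2<..<2}. (g has_vector_derivative f x) (at x)"
proof -
 obtain g where g: "\<And>x. x \<in> {-2..2} ==> (g has_vector_derivative f x) (at x within {-2..2})"
  using antiderivative_continuous[of "-2" 2 f] assms continuous_on_subset by blast
 have "(g has_vector_derivative f x) (at x)" if "x \<in> {-2<..<2}" for x
  using g[of x] that by (simp add: at_within_Icc_at)
 then show ?thesis by blast
qed

text \<open>For an antiderivative \<open>P\<close> of \<open>f\<close> the group law gives
  \<open>P (t + s) - P t = f t * (P s - P 0)\<close>. For a small fixed \<open>s\<close> the last
  factor has a right inverse, so near 0 the curve \<open>f\<close> is a difference of differentiable
  curves times a constant.\<close>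

theorem continuous_oneparam:
 assumes e: "proj e" "f 0 = e" and a: "\<And>s t. f (s + t) = f s * f t" and adj: "\<And>t. adj (f t) = f (- t)"
  and c: "continuous_on UNIV f"
 obtains M where "oneparam e M f"
proof -
 obtain n where n: "inn n e" using inn_ex by blast
 have fe: "e * f t = f t" "f t * e = f t" for t using a[of 0 t] a[of t 0] e by auto
 have fn: "inn n (f t)" for t by (rule inn_sandwich[OF n fe])
 have "\<exists>g. \<forall>x\<in>{-2<..<2}. (g has_vector_derivative ent (f x) i j) (at x)" for i j
  by (rule ex_antideriv) (intro bounded_linear.continuous_on[OF bounded_linear_ent] c)
 then obtain g where g: "\<And>i j x. x \<in> {-2<..<2} ==> (g i j has_vector_derivative ent (f x) i j) (at x)" by metis
 define P where "P x = (\<Sum>i<n. \<Sum>j<n. g i j x *c eu i j)" for x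
 have dP: "(P has_vector_derivative f x) (at x)" if "x \<in> {-2<..<2}" for x
 proof -
  have "(P has_vector_derivative (\<Sum>i<n. \<Sum>j<n. ent (f x) i j *c eu i j)) (at x)"
   unfolding P_def by (intro vd_sum bounded_linear.has_vector_derivative[OF bounded_linear_sc] g that)
  then show ?thesis using fmat_expand[OF fn] by simp
 qed
 have shift: "P (t + s) - P t = f t * (P s - P 0)" if t: "t \<in> {-1<..<1}" and s: "s \<in> {-1<..<1}" for s t
 proof -
  define h where "h s = P (t + s) - f t * P s" for s
  have "(h has_vector_derivative 0) (at x)" if x: "x \<in> {-1<..<1}" for x
  proof -
   have "((\<lambda>x. P (t + x)) has_vector_derivative 1 *\<^sub>R f (t + x)) (at x)"
    using vd_affine[of P "f (t + x)" 1 x t] t x dP[of "t + x"] by (simp add: add.commute)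
   moreover have "((\<lambda>x. f t * P x) has_vector_derivative f t * f x) (at x)"
    by (intro vd_mult_left dP) (use x in auto)
   ultimately have "(h has_vector_derivative 1 *\<^sub>R f (t + x) - f t * f x) (at x)"
    unfolding h_def by (rule has_vector_derivative_diff)
   then show ?thesis by (simp add: a)
  qed
  then have "h s = h 0"
  proof -
   obtain k where "\<And>x. x \<in> {-1<..<1} ==> h x = k"
    by (rule has_vector_derivative_zero_constant[of "{-1<..<1}" h])
     (use \<open>\<And>x. x \<in> {-1<..<1} ==> (h has_vector_derivative 0) (at x)\<close> in \<open>auto intro: has_vector_derivative_at_within\<close>)
   then show ?thesis using s by simp
  qed
  then show ?thesis by (simp add: h_def ring_distribs algebra_simps)
 qed
 have "((\<lambda>s. norm (P s - P 0 - s *\<^sub>R f 0) / norm s) \<longlongrightarrow> 0) (at 0)"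
  using dP[of 0] by (simp add: has_vector_derivative_def has_derivative_at)
 then have "\<forall>\<^sub>F s in at 0. norm (P s - P 0 - s *\<^sub>R f 0) / norm s < 1"
  by (rule order_tendstoD) simp
 moreover have "norm (P s - P 0 - s *\<^sub>R f 0) / norm s = dist ((P s - P 0) /\<^sub>R s) e" if "s \<noteq> 0" for s
 proof -
  have "(P s - P 0) /\<^sub>R s - e = (P s - P 0 - s *\<^sub>R f 0) /\<^sub>R s"
   using that e by (simp add: scaleR_diff_right)
  then show ?thesis by (simp add: dist_norm divide_inverse_commute)
 qed
 ultimately have "\<forall>\<^sub>F s in at 0. dist ((P s - P 0) /\<^sub>R s) e < 1"
  unfolding eventually_at by metis
 then obtain dd where "dd > 0" "\<And>s. s \<noteq> 0 ==> dist s 0 < dd ==> dist ((P s - P 0) /\<^sub>R s) e < 1"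
  unfolding eventually_at by blast
 then have "0 < min (dd / 2) (1 / 2)" "min (dd / 2) (1 / 2) < 1"
   "dist ((P (min (dd / 2) (1 / 2)) - P 0) /\<^sub>R min (dd / 2) (1 / 2)) e < 1" by auto
 then obtain s where s: "0 < s" "s < 1" "dist ((P s - P 0) /\<^sub>R s) e < 1" by blast
 \<comment> \<open>Close to \<open>e\<close>, because the difference quotient of \<open>P\<close> at
   0 tends to \<open>f 0 = e\<close>.\<close>
 define Q where "Q = (P s - P 0) /\<^sub>R s"
 have Pe: "P s - P 0 = e * (P s - P 0)" using shift[of 0 s] s e by simp
 have "norm (e - Q) < 1" using s(3) by (simp add: Q_def dist_norm norm_minus_commute)
 moreover have "e * Q = Q" unfolding Q_def using Pe by (simp only: mult_scaleR_right)
 ultimately obtain B where B: "Q * B = e" using right_inverse_ex[OF e(1)] by blast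
 have ft: "f t = ((P (t + s) - P t) /\<^sub>R s) * B" if "t \<in> {-1<..<1}" for t
 proof -
  have "f t = f t * (Q * B)" using fe B by simp
  then show ?thesis unfolding shift[OF that, of s, simplified s, simplified] Q_def using s
   by (simp add: mult.assoc shift[OF that, of s])
 qed
 have "((\<lambda>t. ((P (t + s) - P t) /\<^sub>R s) * B) has_vector_derivative ((f s - f 0) /\<^sub>R s) * B) (at 0)"
 proof (intro vd_mult_right bounded_linear.has_vector_derivative[OF bounded_linear_scaleR_right] has_vector_derivative_diff)
  have "((\<lambda>x. P (x + s)) has_vector_derivative 1 *\<^sub>R f (0 + s)) (at 0)"
   using vd_affine[of P "f s" 1 0 s] s dP[of s] by simp
  then show "((\<lambda>x. P (x + s)) has_vector_derivative f s) (at 0)" by simp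
 qed (use dP[of 0] in simp)
 then have "(f has_vector_derivative ((f s - f 0) /\<^sub>R s) * B) (at 0)"
  by (rule has_vector_derivative_transform_within_open[of _ _ _ "{-1<..<1}"]) (use ft in auto)
 then show ?thesis using that e a adj unfolding oneparam_def by blast
qed

section \<open>Unitary representations and their differentials\<close>

definition dt :: "nat => fmat => complex" where "dt N A = det (mt N N A)"
definition UU :: "nat => fmat set" where
 "UU N = {g. inn N g \<and> adj g * g = un {..<N} \<and> g * adj g = un {..<N}}"
definition SU :: "nat => fmat set" where "SU N = {g \<in> UU N. dt N g = 1}"
definition su :: "nat => fmat set" where "su N = {X. inn N X \<and> adj X = - X \<and> tr X = 0}"

lemma UU_D: "g \<in> UU N ==> inn N g" "g \<in> UU N ==> adj g * g = un {..<N}" "g \<in> UU N ==> g * adj g = un {..<N}"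
 by (auto simp: UU_def)
lemma SU_UU: "g \<in> SU N ==> g \<in> UU N" by (simp add: SU_def)
lemma UU_un: "g \<in> UU N ==> un {..<N} * g = g" "g \<in> UU N ==> g * un {..<N} = g"
 using UU_D(1) inn_un by blast+
lemma UU_cancel: "g \<in> UU N ==> adj g * (g * X) = un {..<N} * X" "g \<in> UU N ==> g * (adj g * X) = un {..<N} * X"
 by (metis UU_D mult.assoc)+
lemma UU_adj: "g \<in> UU N ==> adj g \<in> UU N" by (simp add: UU_def inn_adj)
lemma UU_mult: "g \<in> UU N ==> h \<in> UU N ==> g * h \<in> UU N"
 by (simp add: UU_def inn_mult mult.assoc)
  (metis (no_types, lifting) inn_adj inn_un mult.assoc)
lemma UU_one: "un {..<N} \<in> UU N" by (simp add: UU_def inn_one)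
lemma UU_isom: "g \<in> UU N ==> isom N g" by (simp add: isom_def UU_D)
lemma isom_UU: "isom N g ==> g * adj g = un {..<N} ==> g \<in> UU N"
proof -
 assume g: "isom N g" "g * adj g = un {..<N}"
 have "un {..<N} * g = g" using isom_un[OF g(1)] g by (metis isom_def mult.assoc)
 then show ?thesis using g isom_un[OF g(1)] by (auto simp: UU_def isom_def inn_un)
qed

lemma dt_mult: "inn N A \<or> inn N B ==> dt N (A * B) = dt N A * dt N B"
 using mt_mult[of N A B N N] det_mult[of "mt N N A" N "mt N N B"] by (auto simp: dt_def)
lemma mt_one: "mt N N (un {..<N}) = 1\<^sub>m N" by (rule eq_matI) (auto simp: ent_un)
lemma dt_one: "dt N (un {..<N}) = 1" by (simp add: dt_def mt_one)
lemma dt_dg: "dt N (dg N d) = (\<Prod>i<N. d i)"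
proof -
 have "dt N (dg N d) = prod_list (diag_mat (mt N N (dg N d)))"
  unfolding dt_def by (rule det_upper_triangular) (auto simp: upper_triangular_def)
 also have "\<dots> = (\<Prod>i<N. d i)"
 proof -
  have "diag_mat (mt N N (dg N d)) = map d [0..<N]" by (simp add: diag_mat_def)
  then show ?thesis using prod.distinct_set_conv_list[of "[0..<N]" d] by (simp add: atLeast0LessThan)
 qed
 finally show ?thesis .
qed
lemma mt_adj: "mt N N (adj A) = mat_adjoint (mt N N A)"
 by (rule eq_matI) (use mat_adjoint_carrier[of "mt N N A" N] in \<open>auto simp: mat_adjoint_index[of "mt N N A" N]\<close>)
lemma dt_adj: "dt N (adj A) = cnj (dt N A)" unfolding dt_def mt_adj by (rule det_mat_adjoint[of _ N]) simp

lemma SU_adj: "g \<in> SU N ==> adj g \<in> SU N" by (simp add: SU_def UU_adj dt_adj)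
lemma SU_mult: "g \<in> SU N ==> h \<in> SU N ==> g * h \<in> SU N"
 by (simp add: SU_def UU_mult) (metis UU_D(1) dt_mult mult_1)
lemma SU_one: "un {..<N} \<in> SU N" by (simp add: SU_def UU_one dt_one)

lemma suD: "X \<in> su N ==> inn N X" "X \<in> su N ==> adj X = - X" "X \<in> su N ==> tr X = 0"
 "X \<in> su N ==> un {..<N} * X = X" "X \<in> su N ==> X * un {..<N} = X"
 by (auto simp: su_def inn_un)
lemma su_add: "X \<in> su N ==> Y \<in> su N ==> X + Y \<in> su N" by (simp add: su_def inn_add)
lemma su_scaleR: "X \<in> su N ==> a *\<^sub>R X \<in> su N" by (simp add: su_def inn_sc scaleR_fmat_def)
lemma su_zero: "0 \<in> su N" by (simp add: su_def inn_def)
lemma su_conj: "X \<in> su N ==> g \<in> UU N ==> g * X * adj g \<in> su N"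
 by (auto simp: su_def inn_mult UU_D inn_adj mult.assoc tr_comm[of g] UU_cancel)
  (metis UU_D(2) inn_un tr_comm mult.assoc)

definition Ex :: "nat => fmat => real => fmat" where
 "Ex N X = (THE f. oneparam (un {..<N}) X f)"

lemma Ex_eqI: "oneparam (un {..<N}) X f ==> Ex N X = f"
 unfolding Ex_def by (rule the_equality) (auto intro: oneparam_unique proj_un)

lemma skew_diag_N:
 assumes "inn N X" "adj X = - X"
 obtains S d where "isom N S" "S * adj S = un {..<N}" "X = S * dg N (\<lambda>i. \<i> * of_real (d i)) * adj S"
  "Ex N X = (\<lambda>t. S * dg N (\<lambda>i. exp (of_real t * (\<i> * of_real (d i)))) * adj S)"
proof -
 obtain m S d where S: "isom m S" "S * adj S = un {..<N}" "X = S * dg m (\<lambda>i. \<i> * of_real (d i)) * adj S"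
  by (rule skew_diag[of "un {..<N}" X]) (use assms in \<open>auto simp: proj_un inn_un\<close>)
 have "m = N" by (rule isom_dim[OF S(1,2)])
 moreover have "Ex N X = (\<lambda>t. S * dg m (\<lambda>i. exp (of_real t * (\<i> * of_real (d i)))) * adj S)"
  by (rule Ex_eqI) (use oneparam_diag[OF S(1), of d] in \<open>simp add: S\<close>)
 ultimately show ?thesis using that S by metis
qed

lemma Ex_oneparam: "X \<in> su N ==> oneparam (un {..<N}) X (Ex N X)"
 by (rule oneparam_ex[of "un {..<N}" X]) (auto simp: proj_un suD Ex_eqI)

lemma Ex_SU: assumes "X \<in> su N" shows "Ex N X t \<in> SU N"
proof -
 obtain S d where S: "isom N S" "S * adj S = un {..<N}" "X = S * dg N (\<lambda>i. \<i> * of_real (d i)) * adj S"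
  "Ex N X = (\<lambda>t. S * dg N (\<lambda>i. exp (of_real t * (\<i> * of_real (d i)))) * adj S)"
  by (rule skew_diag_N[of N X]) (use assms suD in auto)
 have US: "S \<in> UU N" by (rule isom_UU[OF S(1,2)])
 have "tr X = (\<Sum>i<N. \<i> * of_real (d i))"
  unfolding S(3) using tr_comm[of "S * dg N (\<lambda>i. \<i> * of_real (d i))" "adj S"]
  by (simp add: assoc' UU_D[OF US] dg_un tr_dg)
 then have s0: "(\<Sum>i<N. \<i> * of_real (d i)) = 0" using suD[OF assms] by simp
 have "dg N (\<lambda>i. exp (of_real t * (\<i> * of_real (d i)))) \<in> UU N"
  by (simp add: UU_def inn_dg dg_mult dg_one[symmetric] cnj_exp_real exp_add[symmetric])
 then have 1: "Ex N X t \<in> UU N" unfolding S(4) by (intro UU_mult UU_adj US)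
 have "dt N (Ex N X t) = dt N S * dt N (adj S) * (\<Prod>i<N. exp (of_real t * (\<i> * of_real (d i))))"
  unfolding S(4) using US UU_D(1)[OF US] inn_dg[of N] by (simp add: dt_mult inn_mult inn_adj dt_dg)
 also have "dt N S * dt N (adj S) = 1" using dt_mult[of N S "adj S"] S(2) dt_one UU_D(1)[OF US] by simp
 also have "(\<Prod>i<N. exp (of_real t * (\<i> * of_real (d i)))) = exp (of_real t * (\<Sum>i<N. \<i> * of_real (d i)))"
  by (simp add: exp_sum sum_distrib_left)
 finally show ?thesis using 1 s0 by (simp add: SU_def)
qed

lemma Ex_conj: assumes "X \<in> su N" "g \<in> UU N" shows "Ex N (g * X * adj g) t = g * Ex N X t * adj g"
proof -
 have o: "oneparam (un {..<N}) X (Ex N X)" by (rule Ex_oneparam[OF assms(1)])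
 have Eu: "un {..<N} * Ex N X t = Ex N X t" for t by (rule UU_un[OF SU_UU[OF Ex_SU[OF assms(1)]]])
 have "oneparam (un {..<N}) (g * X * adj g) (\<lambda>t. g * Ex N X t * adj g)" unfolding oneparam_def
 proof (intro conjI allI)
  show "g * Ex N X 0 * adj g = un {..<N}" using o assms(2) by (simp add: oneparam_def UU_un UU_D)
  fix s t
  show "g * Ex N X (s + t) * adj g = g * Ex N X s * adj g * (g * Ex N X t * adj g)"
   using o assms(2) by (simp add: oneparam_def UU_cancel mult.assoc mac[OF Eu])
  show "adj (g * Ex N X t * adj g) = g * Ex N X (- t) * adj g" using o by (simp add: oneparam_def mult.assoc)
 qed (use o in \<open>auto simp: oneparam_def intro!: vd_mult_left vd_mult_right\<close>)
 then show ?thesis by (simp add: Ex_eqI)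
qed

lemma oneparam_scale: "oneparam e M f ==> oneparam e (a *\<^sub>R M) (\<lambda>t. f (a * t))"
 using vd_affine[of f M a 0 0] by (auto simp: oneparam_def ring_distribs)

lemma Ex_scale: "X \<in> su N ==> Ex N (a *\<^sub>R X) t = Ex N X (a * t)"
 by (simp add: Ex_eqI[OF oneparam_scale[OF Ex_oneparam]])

lemma normal_diag_N:
 assumes "inn N A" "A * adj A = adj A * A"
 obtains S d where "S \<in> UU N" "A = S * dg N d * adj S" "dg N d = adj S * A * S"
proof -
 obtain m S d where S: "isom m S" "S * adj S = un {..<N}" "A * S = S * dg m d"
  by (rule normal_spectral[of A "un {..<N}"]) (use assms in \<open>auto simp: proj_un inn_un\<close>)
 have m: "m = N" by (rule isom_dim[OF S(1,2)])
 have US: "S \<in> UU N" using isom_UU S(1,2) unfolding m by blast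
 show ?thesis
 proof (rule that[OF US])
  show "A = S * dg N d * adj S" using S assms(1) unfolding m by (metis inn_un mult.assoc)
  show "dg N d = adj S * A * S" using S(3) unfolding m by (simp add: mult.assoc UU_cancel[OF US] dg_un)
 qed
qed

lemma UU_diag:
 assumes "g \<in> UU N"
 obtains S d where "S \<in> UU N" "g = S * dg N d * adj S" "\<And>i. i < N ==> cmod (d i) = 1"
proof -
 obtain S d where S: "S \<in> UU N" "g = S * dg N d * adj S" "dg N d = adj S * g * S"
  using normal_diag_N[OF UU_D(1)[OF assms]] UU_D(2,3)[OF assms] by metis
 have "dg N d \<in> UU N" unfolding S(3) by (intro UU_mult UU_adj S assms)
 then have "dg N (\<lambda>i. cnj (d i) * d i) = dg N (\<lambda>_. 1)" by (simp add: UU_def dg_mult dg_one)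
 then have c: "cnj (d i) * d i = 1" if "i < N" for i using that unfolding dg_eq_iff by blast
 have "cmod (d i) = 1" if "i < N" for i
 proof -
  have "complex_of_real ((cmod (d i))\<^sup>2) = of_real 1"
   using c[OF that] complex_norm_square[of "d i"] by (simp add: mult.commute)
  then have "(cmod (d i))\<^sup>2 = 1" unfolding of_real_eq_iff .
  then show ?thesis using norm_ge_zero[of "d i"] by (simp add: power2_eq_1_iff)
 qed
 then show ?thesis using that S(1,2) by blast
qed

text \<open>The exponential map is onto: diagonalise and take arguments of the eigenvalues. Their
  sum is a multiple of \<open>2 * pi\<close> because the determinant is 1, and correcting the first
  argument by this multiple makes the generator traceless.\<close>

lemma SU_Ex:
 assumes "g \<in> SU N" "N > 0" obtains X where "X \<in> su N" "g = Ex N X 1"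
proof -
 obtain S d where S: "S \<in> UU N" "g = S * dg N d * adj S" "\<And>i. i < N ==> cmod (d i) = 1"
  by (rule UU_diag[OF SU_UU[OF assms(1)]]) blast
 define a where "a i = Arg (d i)" for i
 have a: "d i = exp (\<i> * of_real (a i))" if "i < N" for i
 proof -
  have "d i \<noteq> 0" "sgn (d i) = d i" using S(3)[OF that] by (auto simp: sgn_eq)
  then show ?thesis using cis_Arg[of "d i"] by (simp add: a_def cis_conv_exp)
 qed
 have "dt N g = dt N S * dt N (adj S) * (\<Prod>i<N. d i)"
  unfolding S(2) using UU_D(1)[OF S(1)] inn_dg[of N] by (simp add: dt_mult inn_mult inn_adj dt_dg)
 also have "dt N S * dt N (adj S) = 1" using dt_mult[of N S "adj S"] UU_D[OF S(1)] dt_one by simp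
 finally have "(\<Prod>i<N. exp (\<i> * of_real (a i))) = 1" using assms a by (simp add: SU_def)
 then have "exp (\<i> * of_real (\<Sum>i<N. a i)) = 1" by (simp add: exp_sum sum_distrib_left)
 then obtain k :: int where k: "(\<Sum>i<N. a i) = of_int (2 * k) * pi" unfolding exp_eq_1 by auto
 define b where "b i = (if i = 0 then a 0 - of_int (2 * k) * pi else a i)" for i
 have "(\<Sum>i<N. b i) = (\<Sum>i<N. a i) - of_int (2 * k) * pi"
  using assms(2) by (simp add: b_def sum.remove[of "{..<N}" 0])
 then have b0: "(\<Sum>i<N. b i) = 0" using k by simp
 have db: "d i = exp (\<i> * of_real (b i))" if "i < N" for i
 proof (cases "i = 0")
  case True
  have "exp (\<i> * of_real (b 0)) = exp (\<i> * of_real (a 0) - \<i> * (of_int (2 * k) * of_real pi))"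
   by (simp add: b_def ring_distribs mult_ac)
  also have "\<dots> = exp (\<i> * of_real (a 0))" by (subst exp_eq) (auto intro!: exI[of _ "-k"])
  finally show ?thesis using a that True by simp
 qed (use a that in \<open>simp add: b_def\<close>)
 define X where "X = S * dg N (\<lambda>i. \<i> * of_real (b i)) * adj S"
 have "tr X = (\<Sum>i<N. \<i> * of_real (b i))"
  unfolding X_def using tr_comm[of "S * dg N (\<lambda>i. \<i> * of_real (b i))" "adj S"]
  by (simp add: assoc' UU_D[OF S(1)] dg_un tr_dg)
 also have "\<dots> = \<i> * of_real (\<Sum>i<N. b i)" by (simp add: sum_distrib_left)
 also have "\<dots> = 0" unfolding b0 by simp
 finally have "tr X = 0" .
 then have X: "X \<in> su N" using UU_D(1)[OF S(1)] inn_dg[of N]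
  by (simp add: su_def X_def inn_mult inn_adj mult.assoc) (simp add: minus_mult_right[symmetric] minus_mult_left[symmetric] dg_uminus[symmetric] flip: minus_mult_right minus_mult_left)
 have "Ex N X = (\<lambda>t. S * dg N (\<lambda>i. exp (of_real t * (\<i> * of_real (b i)))) * adj S)"
  by (rule Ex_eqI) (use oneparam_diag[OF UU_isom[OF S(1)], of b] UU_D[OF S(1)] in \<open>simp add: X_def\<close>)
 then have "Ex N X 1 = S * dg N (\<lambda>i. exp (\<i> * of_real (b i))) * adj S" by simp
 also have "dg N (\<lambda>i. exp (\<i> * of_real (b i))) = dg N d" by (rule dg_cong) (simp add: db)
 finally show ?thesis using that[OF X] S(2) by simp
qed

section \<open>The complexification of \<open>su N\<close> inside the matrices\<close>

definition cut :: "nat => fmat => fmat" where "cut N X = un {..<N} * X * un {..<N}"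
definition tlp :: "nat => fmat => fmat" where "tlp N X = cut N X - (tr (cut N X) / of_nat N) *c un {..<N}"
text \<open>Both \<open>skp\<close> and \<open>hep\<close> take values in \<open>su N\<close>, and
  \<open>tlp N X = skp N X + \<i> *c hep N X\<close>; the factor \<open>- \<i> / 2\<close> in
  \<open>hep\<close> makes a Hermitian matrix skew-Hermitian.\<close>

definition skp :: "nat => fmat => fmat" where "skp N X = (1 / 2) *c (tlp N X - adj (tlp N X))"
definition hep :: "nat => fmat => fmat" where "hep N X = (- \<i> / 2) *c (tlp N X + adj (tlp N X))"

lemma cut_inn: "inn N X ==> cut N X = X" by (simp add: cut_def inn_un mult.assoc)
lemma cut_add: "cut N (X + Y) = cut N X + cut N Y" by (simp add: cut_def ring_distribs)
lemma cut_sc: "cut N (c *c X) = c *c cut N X" by (simp add: cut_def)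
lemma cut_adj: "cut N (adj X) = adj (cut N X)" by (simp add: cut_def mult.assoc)
lemma inn_cut: "inn N (cut N X)" by (simp add: cut_def inn_def ent_un_times ent_times_un)
lemma tlp_add: "tlp N (X + Y) = tlp N X + tlp N Y" by (simp add: tlp_def cut_add add_divide_distrib sc_add_left)
lemma tlp_sc: "tlp N (c *c X) = c *c tlp N X" by (simp add: tlp_def cut_sc sc_diff_right)
lemma tlp_adj: "tlp N (adj X) = adj (tlp N X)" by (simp add: tlp_def cut_adj)
lemma tlp_un: "N > 0 ==> tlp N (un {..<N}) = 0" by (simp add: tlp_def cut_inn inn_one tr_un)
lemma tlp_tr: "N > 0 ==> tr (tlp N X) = 0" by (simp add: tlp_def tr_un)
lemma inn_tlp: "inn N (tlp N X)" by (simp add: tlp_def inn_diff inn_cut inn_sc inn_one)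
lemma skp_su: "N > 0 ==> skp N X \<in> su N"
 by (simp add: skp_def su_def tlp_tr inn_sc inn_diff inn_tlp inn_adj) (simp flip: sc_minus_right)
lemma hep_su: "N > 0 ==> hep N X \<in> su N"
 by (simp add: hep_def su_def tlp_tr inn_uminus inn_sc inn_add inn_tlp inn_adj add.commute)
lemma skp_hep: "tlp N X = skp N X + \<i> *c hep N X"
 by (simp add: skp_def hep_def fmat_eq_iff) (simp add: field_simps)
lemma skp_add: "skp N (X + Y) = skp N X + skp N Y" by (simp add: skp_def tlp_add sc_add_right[symmetric] algebra_simps)
lemma hep_add: "hep N (X + Y) = hep N X + hep N Y" by (simp add: hep_def tlp_add sc_add_right[symmetric] algebra_simps del: sc_minus_left)
lemma skp_real: "skp N (of_real a *c X) = a *\<^sub>R skp N X"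
 by (simp add: skp_def tlp_sc scaleR_fmat_def sc_diff_right mult.commute)
lemma hep_real: "hep N (of_real a *c X) = a *\<^sub>R hep N X"
 by (simp add: hep_def tlp_sc scaleR_fmat_def fmat_eq_iff) (simp add: field_simps)
lemma skp_i: "skp N (\<i> *c X) = (-1) *\<^sub>R hep N X"
 by (simp add: skp_def hep_def tlp_sc scaleR_fmat_def fmat_eq_iff) (simp add: field_simps)
lemma hep_i: "hep N (\<i> *c X) = skp N X"
 by (simp add: skp_def hep_def tlp_sc scaleR_fmat_def fmat_eq_iff) (simp add: field_simps)
lemma skp_adj: "skp N (adj X) = (-1) *\<^sub>R skp N X"
 by (simp add: skp_def tlp_adj scaleR_fmat_def fmat_eq_iff) (simp add: field_simps)
lemma hep_adj: "hep N (adj X) = hep N X" by (simp add: hep_def tlp_adj add.commute)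
lemma tlp_su: "X \<in> su N ==> tlp N X = X" by (simp add: tlp_def cut_inn suD)
lemma skp_of_su: "X \<in> su N ==> skp N X = X"
 by (simp add: skp_def tlp_su suD) (simp add: fmat_eq_iff)
lemma hep_of_su: "X \<in> su N ==> hep N X = 0" by (simp add: hep_def tlp_su suD)
lemma tlp_conj: assumes "g \<in> UU N" "inn N X" shows "tlp N (g * X * adj g) = g * tlp N X * adj g"
proof -
 have "tr (g * X * adj g) = tr X" using assms tr_comm[of "g * X" "adj g"] by (simp add: UU_cancel inn_un)
 then show ?thesis using assms UU_D[OF assms(1)]
  by (simp add: tlp_def cut_inn inn_mult inn_adj ring_distribs UU_un)
qed
lemma skp_conj: "g \<in> UU N ==> inn N X ==> skp N (g * X * adj g) = g * skp N X * adj g"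
 by (simp add: skp_def tlp_conj ring_distribs) (simp add: mult.assoc)
lemma hep_conj: "g \<in> UU N ==> inn N X ==> hep N (g * X * adj g) = g * hep N X * adj g"
 by (simp add: hep_def tlp_conj ring_distribs) (simp add: mult.assoc)

section \<open>The differential of a unitary representation\<close>

definition dL :: "nat => fmat => (fmat => fmat) => fmat => fmat" where
 "dL N e r X = (THE M. oneparam e M (\<lambda>t. r (Ex N X t)))"

text \<open>The complex linear extension of the differential, continued by zero to scalars, so that
  matrix units, which are not all traceless, can be used as Lie algebra elements.\<close>

definition Dop :: "nat => fmat => (fmat => fmat) => fmat => fmat" where
 "Dop N e r X = dL N e r (skp N X) + \<i> *c dL N e r (hep N X)"

lemma oneparam_vd: "oneparam e M f ==> (f has_vector_derivative M) (at 0)"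
 by (simp add: oneparam_def)

lemma dL_eqI: "oneparam e M (\<lambda>t. r (Ex N X t)) ==> dL N e r X = M"
 unfolding dL_def by (rule the_equality) (auto dest!: oneparam_vd intro: vd_unique)

text \<open>The space of the representation \<open>r\<close> is the range of the projection \<open>e\<close>; values of \<open>r\<close> outside
 \<open>SU N\<close> are irrelevant.\<close>

locale urep =
 fixes N :: nat and e :: fmat and r :: "fmat => fmat"
 assumes N0: "N > 0" and pe: "proj e"
  and r_mult: "\<And>g h. g \<in> SU N ==> h \<in> SU N ==> r (g * h) = r g * r h"
  and r_one: "r (un {..<N}) = e"
  and r_adj: "\<And>g. g \<in> SU N ==> r (adj g) = adj (r g)"
  and r_cont: "continuous_on (SU N) r"
begin

abbreviation "D \<equiv> Dop N e r"
abbreviation "L \<equiv> dL N e r"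

lemma er: "g \<in> SU N ==> e * r g = r g" "g \<in> SU N ==> r g * e = r g"
 using r_mult[of "un {..<N}" g] r_mult[of g "un {..<N}"] SU_one UU_un[OF SU_UU] r_one by auto
lemma rr: "g \<in> SU N ==> adj (r g) * r g = e" "g \<in> SU N ==> r g * adj (r g) = e"
 by (metis SU_adj SU_UU UU_D(2) r_adj r_mult r_one) (metis SU_adj SU_UU UU_D(3) r_adj r_mult r_one)
lemma ee: "e * e = e" "adj e = e" using pe by (auto simp: proj_def)

lemma L_oneparam: assumes X: "X \<in> su N" shows "oneparam e (L X) (\<lambda>t. r (Ex N X t))"
proof -
 have o: "oneparam (un {..<N}) X (Ex N X)" by (rule Ex_oneparam[OF X])
 have "continuous_on UNIV (Ex N X)"
  using oneparam_deriv[OF o] by (intro continuous_at_imp_continuous_on ballI)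
   (meson has_vector_derivative_continuous)
 then have "continuous_on UNIV (\<lambda>t. r (Ex N X t))"
  using Ex_SU[OF X] r_cont by (intro continuous_on_compose2[OF r_cont]) auto
 then obtain M where "oneparam e M (\<lambda>t. r (Ex N X t))"
  using continuous_oneparam[OF pe, of "\<lambda>t. r (Ex N X t)"] o Ex_SU[OF X] r_mult r_one r_adj[symmetric]
  unfolding oneparam_def by metis
 then show ?thesis using dL_eqI by metis
qed

lemma L_skew: "X \<in> su N ==> adj (L X) = - L X" "X \<in> su N ==> e * L X = L X" "X \<in> su N ==> L X * e = L X"
 using oneparam_gen[OF L_oneparam pe] by auto

lemma L_scale: assumes "X \<in> su N" shows "L (a *\<^sub>R X) = a *\<^sub>R L X"
 by (rule dL_eqI) (simp add: Ex_scale assms oneparam_scale[OF L_oneparam])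

lemma L_uminus: "X \<in> su N ==> L (- X) = - L X" using L_scale[of X "-1"] by simp

lemma L_conj: assumes "X \<in> su N" "g \<in> SU N" shows "L (g * X * adj g) = r g * L X * adj (r g)"
proof (rule dL_eqI)
 have o: "oneparam e (L X) (\<lambda>t. r (Ex N X t))" by (rule L_oneparam[OF assms(1)])
 have eq: "r (Ex N (g * X * adj g) t) = r g * r (Ex N X t) * adj (r g)" for t
  using assms by (simp add: Ex_conj SU_UU r_mult SU_mult SU_adj Ex_SU r_adj)
 have ge: "g * X * adj g \<in> su N" by (rule su_conj[OF assms(1) SU_UU[OF assms(2)]])
 have "((\<lambda>t. r g * r (Ex N X t) * adj (r g)) has_vector_derivative r g * L X * adj (r g)) (at 0)"
  by (intro vd_mult_left vd_mult_right oneparam_vd[OF o])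
 then have "L (g * X * adj g) = r g * L X * adj (r g)"
  using oneparam_vd[OF L_oneparam[OF ge]] vd_unique unfolding eq by blast
 then show "oneparam e (r g * L X * adj (r g)) (\<lambda>t. r (Ex N (g * X * adj g) t))"
  using L_oneparam[OF ge] by simp
qed

lemma r_iter: assumes "g \<in> SU N" shows "r (((*) g ^^ n) (un {..<N})) = ((*) (r g) ^^ n) e \<and> ((*) g ^^ n) (un {..<N}) \<in> SU N"
 by (induction n) (auto simp: r_one SU_one SU_mult r_mult assms)

text \<open>The Lie product formula is applied on both sides of \<open>r\<close>: the approximants
  of the exponential of \<open>X + Y\<close> are products of exponentials, \<open>r\<close> sends
  them to the corresponding approximants, and continuity of \<open>r\<close> identifies the
  limits.\<close>

lemma L_add: assumes X: "X \<in> su N" and Y: "Y \<in> su N" shows "L (X + Y) = L X + L Y"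
proof -
 have XY: "X + Y \<in> su N" by (rule su_add[OF X Y])
 note oX = Ex_oneparam[OF X] and oY = Ex_oneparam[OF Y] and oXY = Ex_oneparam[OF XY]
 define \<psi> where "\<psi> s = Ex N X s * Ex N Y s" for s
 have psi_SU: "\<psi> s \<in> SU N" for s by (simp add: \<psi>_def SU_mult Ex_SU X Y)
 have "(\<psi> has_vector_derivative Ex N X 0 * Y + X * Ex N Y 0) (at 0)"
  unfolding \<psi>_def by (intro bounded_bilinear.has_vector_derivative[OF bounded_bilinear_mult] oneparam_vd[OF oX] oneparam_vd[OF oY])
 then have dpsi: "(\<psi> has_vector_derivative X + Y) (at 0)"
  using oX oY suD(4)[OF Y] suD(5)[OF X] by (simp add: oneparam_def add.commute)
 have lim: "(\<lambda>n. ((*) (\<psi> (t / real (Suc n))) ^^ Suc n) (un {..<N})) \<longlonglongrightarrow> Ex N (X + Y) t" for t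
  by (rule lie_product[OF oXY _ _ _ dpsi])
   (use oX oY UU_D(2)[OF SU_UU[OF psi_SU]] in \<open>auto simp: proj_un \<psi>_def oneparam_def\<close>)
 note aX = L_oneparam[OF X] and aY = L_oneparam[OF Y] and aXY = L_oneparam[OF XY]
 have "((\<lambda>s. r (Ex N X s) * r (Ex N Y s)) has_vector_derivative r (Ex N X 0) * L Y + L X * r (Ex N Y 0)) (at 0)"
  by (intro bounded_bilinear.has_vector_derivative[OF bounded_bilinear_mult] oneparam_vd[OF aX] oneparam_vd[OF aY])
 then have drpsi: "((\<lambda>s. r (\<psi> s)) has_vector_derivative L X + L Y) (at 0)"
  using aX aY L_skew[OF X] L_skew[OF Y] by (simp add: oneparam_def add.commute \<psi>_def r_mult Ex_SU X Y)
 obtain f where f: "oneparam e (L X + L Y) f"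
  by (rule oneparam_ex[OF pe, of "L X + L Y"]) (use L_skew[OF X] L_skew[OF Y] in \<open>auto simp: ring_distribs\<close>)
 have lim2: "(\<lambda>n. ((*) (r (\<psi> (t / real (Suc n)))) ^^ Suc n) e) \<longlonglongrightarrow> f t" for t
  by (rule lie_product[OF f pe _ _ drpsi])
   (use oX oY rr[OF psi_SU] r_one in \<open>auto simp: \<psi>_def oneparam_def\<close>)
 have "r (Ex N (X + Y) t) = f t" for t
 proof -
  have "(\<lambda>n. r (((*) (\<psi> (t / real (Suc n))) ^^ Suc n) (un {..<N}))) \<longlonglongrightarrow> r (Ex N (X + Y) t)"
   by (rule continuous_on_tendsto_compose[OF r_cont lim])
    (use r_iter[OF psi_SU] Ex_SU[OF XY] in \<open>auto simp del: funpow.simps\<close>)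
  moreover have "r (((*) (\<psi> (t / real (Suc n))) ^^ Suc n) (un {..<N})) = ((*) (r (\<psi> (t / real (Suc n)))) ^^ Suc n) e" for n
   using r_iter[OF psi_SU] by blast
  ultimately show ?thesis using lim2[of t] LIMSEQ_unique by simp
 qed
 then have "(\<lambda>t. r (Ex N (X + Y) t)) = f" by auto
 then show ?thesis using oneparam_vd[OF f] oneparam_vd[OF aXY] vd_unique by metis
qed

lemma L_zero: "L 0 = 0" using L_add[OF su_zero su_zero] by simp

lemma D_add: "D (X + Y) = D X + D Y"
 by (simp add: Dop_def skp_add hep_add L_add skp_su hep_su N0 sc_add_right)
lemma D_zero [simp]: "D 0 = 0" using D_add[of 0 0] by simp
lemma D_real: "D (of_real a *c X) = of_real a *c D X"
 by (simp add: Dop_def skp_real hep_real L_scale skp_su hep_su N0 sc_add_right)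
  (simp add: scaleR_fmat_def mult.commute)
lemma D_i: "D (\<i> *c X) = \<i> *c D X"
 by (simp add: Dop_def skp_i hep_i L_uminus skp_su hep_su N0 sc_add_right)
lemma D_sc: "D (c *c X) = c *c D X"
proof -
 have "c *c X = of_real (Re c) *c X + \<i> *c of_real (Im c) *c X"
  by (simp add: sc_add_left[symmetric]) (metis complex_eq)
 then have "D (c *c X) = of_real (Re c) *c D X + \<i> *c of_real (Im c) *c D X"
  by (simp only: D_add D_real D_i)
 also have "\<dots> = c *c D X" by (simp add: sc_add_left[symmetric]) (metis complex_eq)
 finally show ?thesis .
qed
lemma D_uminus: "D (- X) = - D X" using D_sc[of "-1" X] by simp
lemma D_diff: "D (X - Y) = D X - D Y" by (metis D_add D_uminus diff_conv_add_uminus)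
lemma D_sum: "D (\<Sum>x\<in>S. f x) = (\<Sum>x\<in>S. D (f x))"
 by (induction S rule: infinite_finite_induct) (auto simp: D_add)
lemma D_e: "e * D X = D X" "D X * e = D X" by (simp_all add: Dop_def ring_distribs L_skew skp_su hep_su N0)
lemma D_adj: "D (adj X) = adj (D X)" by (simp add: Dop_def skp_adj hep_adj L_uminus L_skew skp_su hep_su N0)
lemma D_su: "X \<in> su N ==> D X = L X" by (simp add: Dop_def skp_of_su hep_of_su L_zero)
lemma D_one: "D (un {..<N}) = 0" by (simp add: Dop_def skp_def hep_def tlp_un N0 L_zero)
lemma D_cut: "D (cut N X) = D X" by (simp add: Dop_def skp_def hep_def tlp_def cut_inn inn_cut)
lemma D_tl: "D (tlp N X) = D X" by (simp add: tlp_def D_diff D_sc D_one D_cut)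
lemma D_conj: assumes "g \<in> SU N" "inn N X" shows "D (g * X * adj g) = r g * D X * adj (r g)"
 using assms by (simp add: Dop_def skp_conj hep_conj SU_UU L_conj skp_su hep_su N0 ring_distribs)

lemma D_expand: "inn N X ==> D X = (\<Sum>i<N. \<Sum>j<N. ent X i j *c D (eu i j))"
 by (subst fmat_expand, assumption) (simp add: D_sum D_sc)

text \<open>Differentiate \<open>D (g * X * adj g) = r g * D X * adj (r g)\<close> along the
  exponential curve of \<open>Y\<close>. Expanding in matrix units shows that the left side is
  linear in the entries and may be differentiated under \<open>D\<close>.\<close>

lemma D_bracket_su:
 assumes Y: "Y \<in> su N" and X: "inn N X"
 shows "D (Y * X - X * Y) = D Y * D X - D X * D Y"
proof -
 note oY = Ex_oneparam[OF Y] and aY = L_oneparam[OF Y]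
 have E: "Ex N Y t \<in> SU N" for t by (rule Ex_SU[OF Y])
 define Z where "Z t = Ex N Y t * X * Ex N Y (- t)" for t
 have Zn: "inn N (Z t)" for t unfolding Z_def by (intro inn_mult UU_D(1) SU_UU E X)
 have dm: "((\<lambda>t. Ex N Y (- t)) has_vector_derivative - Y) (at 0)"
  using vd_affine[of "Ex N Y" Y "-1" 0 0] oneparam_vd[OF oY] by simp
 have "(Z has_vector_derivative (Ex N Y 0 * X) * (- Y) + (Y * X) * Ex N Y (- 0)) (at 0)" unfolding Z_def
  by (intro bounded_bilinear.has_vector_derivative[OF bounded_bilinear_mult] vd_mult_right oneparam_vd[OF oY] dm)
 then have dZ: "(Z has_vector_derivative Y * X - X * Y) (at 0)"
  using oY X mult.assoc[of Y X "un {..<N}"] by (simp add: oneparam_def inn_un)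
 have "((\<lambda>t. \<Sum>i<N. \<Sum>j<N. ent (Z t) i j *c D (eu i j)) has_vector_derivative
   (\<Sum>i<N. \<Sum>j<N. ent (Y * X - X * Y) i j *c D (eu i j))) (at 0)"
  by (intro vd_sum bounded_linear.has_vector_derivative[OF bounded_linear_sc]
   bounded_linear.has_vector_derivative[OF bounded_linear_ent] dZ)
 then have 1: "((\<lambda>t. D (Z t)) has_vector_derivative D (Y * X - X * Y)) (at 0)"
  using D_expand[OF Zn] D_expand[of "Y * X - X * Y"] suD(1)[OF Y] X by (simp add: inn_diff inn_mult)
 have Zr: "D (Z t) = r (Ex N Y t) * D X * r (Ex N Y (- t))" for t
  using D_conj[OF E X] oY aY by (simp add: Z_def oneparam_def)
 have dr: "((\<lambda>t. r (Ex N Y (- t))) has_vector_derivative - L Y) (at 0)"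
  using vd_affine[of "\<lambda>t. r (Ex N Y t)" "L Y" "-1" 0 0] oneparam_vd[OF aY] by simp
 have "((\<lambda>t. D (Z t)) has_vector_derivative (r (Ex N Y 0) * D X) * (- L Y) + (L Y * D X) * r (Ex N Y (- 0))) (at 0)"
  unfolding Zr
  by (intro bounded_bilinear.has_vector_derivative[OF bounded_bilinear_mult] vd_mult_right oneparam_vd[OF aY] dr)
 then have "((\<lambda>t. D (Z t)) has_vector_derivative L Y * D X - D X * L Y) (at 0)"
  using aY D_e mult.assoc[of "L Y" "D X" e] by (simp add: oneparam_def)
 with 1 show ?thesis using vd_unique D_su[OF Y] by metis
qed

theorem D_bracket:
 assumes Y: "inn N Y" and X: "inn N X"
 shows "D (Y * X - X * Y) = D Y * D X - D X * D Y"
proof -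
 define c where "c = tr Y / of_nat N"
 have Y': "Y = skp N Y + \<i> *c hep N Y + c *c un {..<N}"
  using skp_hep[of N Y] Y by (simp add: tlp_def cut_inn c_def diff_eq_eq)
 have "Y * X - X * Y = (skp N Y * X - X * skp N Y) + \<i> *c (hep N Y * X - X * hep N Y)"
  by (subst (1 2) Y') (use X in \<open>simp add: inn_un ring_distribs sc_diff_right\<close>)
 then have "D (Y * X - X * Y) = (D (skp N Y) + \<i> *c D (hep N Y)) * D X - D X * (D (skp N Y) + \<i> *c D (hep N Y))"
  by (simp add: D_add D_sc D_bracket_su skp_su hep_su N0 X ring_distribs sc_diff_right[symmetric])
 also have "D (skp N Y) + \<i> *c D (hep N Y) = D Y" by (simp add: D_su skp_su hep_su N0) (simp add: Dop_def)
 finally show ?thesis .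
qed

lemma D_r_commute: "g \<in> SU N ==> inn N X ==> D (g * X * adj g) * r g = r g * D X"
 by (simp only: D_conj) (simp add: mult.assoc rr D_e)

end

text \<open>From group to algebra by differentiation; back because every group element is an
  exponential and \<open>oneparam_intertwine\<close> integrates the relation.\<close>

lemma urep_intertwine:
 assumes R: "urep N e r" and R': "urep N e' r'" and T: "T * e = T" "e' * T = T"
 shows "(\<forall>g\<in>SU N. T * r g = r' g * T) \<longleftrightarrow> (\<forall>X. T * Dop N e r X = Dop N e' r' X * T)"
proof
 interpret A: urep N e r by (rule R)
 interpret B: urep N e' r' by (rule R')
 {
  assume a: "\<forall>g\<in>SU N. T * r g = r' g * T"
  have "T * A.L X = B.L X * T" if X: "X \<in> su N" for X
  proof -
   have "((\<lambda>t. T * r (Ex N X t)) has_vector_derivative T * A.L X) (at 0)"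
    by (intro vd_mult_left oneparam_vd[OF A.L_oneparam] X)
   moreover have "((\<lambda>t. r' (Ex N X t) * T) has_vector_derivative B.L X * T) (at 0)"
    by (intro vd_mult_right oneparam_vd[OF B.L_oneparam] X)
   moreover have "(\<lambda>t. T * r (Ex N X t)) = (\<lambda>t. r' (Ex N X t) * T)" using a Ex_SU[OF X] by auto
   ultimately show ?thesis using vd_unique by metis
  qed
  then show "\<forall>X. T * A.D X = B.D X * T" by (simp add: Dop_def ring_distribs skp_su hep_su A.N0)
 }
 assume a: "\<forall>X. T * A.D X = B.D X * T"
 show "\<forall>g\<in>SU N. T * r g = r' g * T"
 proof
  fix g assume "g \<in> SU N"
  then obtain X where X: "X \<in> su N" "g = Ex N X 1" using SU_Ex A.N0 by metis
  have "T * A.L X = B.L X * T" using a X(1) A.D_su B.D_su by metis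
  from oneparam_intertwine[OF A.L_oneparam[OF X(1)] B.L_oneparam[OF X(1)] this T]
  show "T * r g = r' g * T" using X(2) by simp
 qed
qed

section \<open>Highest weights\<close>

lemma ip_sum_right: "ip x (sum f S) = (\<Sum>i\<in>S. ip x (f i))" by (simp add: ip_def sum_distrib_left)

text \<open>Words in Lie algebra elements stand in for the universal enveloping algebra.\<close>

definition wd :: "(fmat => fmat) => fmat list => fmat => fmat" where
 "wd D Xs v = foldr (\<lambda>X y. D X * y) Xs v"

lemma wd_simps [simp]: "wd D [] v = v" "wd D (X # Xs) v = D X * wd D Xs v" by (simp_all add: wd_def)
lemma wd_col: "col v ==> col (wd D Xs v)" by (induction Xs) (auto intro: col_mult)
lemma wd_sc: "wd D Xs (c *c v) = c *c wd D Xs v" by (induction Xs) auto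

inductive_set gen :: "nat => (fmat => fmat) => fmat => fmat set" for N D v where
 gen_wd: "\<forall>X\<in>set Xs. inn N X ==> wd D Xs v * B \<in> gen N D v"
| gen_add: "Y \<in> gen N D v ==> Z \<in> gen N D v ==> Y + Z \<in> gen N D v"

lemma hermitian_eigen_real:
 assumes "adj h = h" "h * u = l *c u" "col u" "ip u u = 1" shows "l = of_real (Re l)"
proof -
 have "ip (h * u) u = ip u (h * u)" using assms(1) ip_adj2[of h u u] by simp
 then show ?thesis using assms by (simp add: complex_eq_iff)
qed

definition utri :: "fmat => bool" where "utri U \<longleftrightarrow> (\<forall>i j. j < i --> ent U i j = 0)"

text \<open>The Casimir scalar \<open><w, w + 2 rho>\<close> of the highest weight \<open>w\<close>:
  each pair \<open>i < j\<close> contributes the pairing of \<open>w\<close> with a positive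
  root.\<close>

definition casc :: "nat => (nat => real) => real" where
 "casc N w = (\<Sum>i<N. \<Sum>j<N. if i = j then (w i)\<^sup>2 else if i < j then w i - w j else 0)"

context urep
begin

text \<open>Since \<open>D\<close> kills scalars, the weight is represented by its coordinates with
  sum 0, see \<open>hwv_sum\<close>.\<close>

definition hwv :: "fmat => (nat => real) => bool" where
 "hwv v w \<longleftrightarrow> col v \<and> v \<noteq> 0 \<and> e * v = v \<and> (\<forall>i<N. D (eu i i) * v = of_real (w i) *c v) \<and>
  (\<forall>i j. i < j --> j < N --> D (eu i j) * v = 0)"

lemma D_comm: "inn N Y ==> inn N X ==> D Y * (D X * Z) = D X * (D Y * Z) + D (Y * X - X * Y) * Z"
 by (simp add: D_bracket ring_distribs mult.assoc)

lemma D_ip: "ip (D X * x) y = ip x (D (adj X) * y)" by (simp add: ip_adj2 D_adj)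
lemma D_ip': "ip x (D X * y) = ip (D (adj X) * x) y" by (simp add: ip_adj2 D_adj)

lemma commute_D:
 assumes "e * T = T" "T * e = T"
 shows "(\<forall>g\<in>SU N. T * r g = r g * T) \<longleftrightarrow> (\<forall>X. T * D X = D X * T)"
 by (rule urep_intertwine) (use assms urep_axioms in auto)

lemma ideal_proj_commute:
 assumes Q: "proj Q" "Q \<in> W" "\<And>Y. Y \<in> W ==> Q * Y = Y"
  and inv: "\<And>X Y. inn N X ==> Y \<in> W ==> D X * Y \<in> W"
 shows "D X * Q = Q * D X"
proof -
 have "D X * Q = Q * D X" if "inn N X" for X
  by (rule proj_commute[OF Q(1,3)]) (use inv[OF _ Q(2)] that inn_adj in \<open>auto simp: D_adj[symmetric]\<close>)
 from this[OF inn_cut[of N X]] show ?thesis by (simp add: D_cut)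
qed

text \<open>Raising operators \<open>eu i j\<close> with \<open>i < j\<close> shift the eigenvalue
  of \<open>H\<close> by \<open>j - i\<close>, which is at least 1. On an eigenspace whose
  eigenvalue is within 1 of the supremum they vanish; the diagonal operators preserve that
  eigenspace and commute, so they have a common eigenvector in it.\<close>

lemma hw_exists: assumes "e \<noteq> 0" obtains v w where "hwv v w" "ip v v = 1"
proof -
 define c where "c = dg N (\<lambda>i. - of_nat i)"
 define H where "H = D c"
 have c: "inn N c" "adj c = c" by (simp_all add: c_def inn_dg)
 have Hh: "adj H = H" by (simp add: H_def D_adj[symmetric] c)
 have cb: "c * eu i j - eu i j * c = (of_nat j - of_nat i) *c eu i j" if "i < N" "j < N" for i j
  by (rule fmat_eqI) (use that in \<open>auto simp: ent_times_eu ent_eu_times c_def\<close>)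
 define E where "E = {l::real. \<exists>Y. Y \<noteq> 0 \<and> e * Y = Y \<and> H * Y = of_real l *c Y}"
 have "\<bar>l\<bar> \<le> norm H" if l: "l \<in> E" for l
 proof -
  obtain Y where "Y \<noteq> 0" "H * Y = of_real l *c Y" using l by (auto simp: E_def)
  then have "\<bar>l\<bar> * norm Y \<le> norm H * norm Y" using norm_mult_ineq[of H Y] by (simp add: norm_sc)
  then show ?thesis using \<open>Y \<noteq> 0\<close> by simp
 qed
 then have bdd: "bdd_above E" by (intro bdd_aboveI[of _ "norm H"]) (use abs_le_iff in blast)
 obtain u l where u: "col u" "ip u u = 1" "e * u = u" "H * u = l *c u"
  using eigen_exists[OF pe assms, of H] D_e by (metis H_def mult.assoc)
 have "l = of_real (Re l)" by (rule hermitian_eigen_real[OF Hh u(4,1,2)])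
 moreover have "u \<noteq> 0" using u(2) by auto
 ultimately have "Re l \<in> E" unfolding E_def using u(3,4) by auto
 then have "E \<noteq> {}" by auto
 then obtain l where l: "l \<in> E" "Sup E - 1 < l" using less_cSupE[of "Sup E - 1" E] by auto
 define W where "W = {Y. e * Y = Y \<and> H * Y = of_real l *c Y}"
 have W: "rideal W" by (auto simp: rideal_def W_def ring_distribs sc_add_right assoc')
 obtain Q where Q: "proj Q" "Q \<in> W" "\<And>Y. Y \<in> W ==> Q * Y = Y"
  using rideal_proj[OF W, of e] by (auto simp: W_def)
 obtain Y where "Y \<noteq> 0" "Y \<in> W" using l(1) unfolding E_def W_def by blast
 then have Q0: "Q \<noteq> 0" using Q(3)[of Y] by auto
 have eQ: "e * Q = Q" "H * Q = of_real l *c Q" using Q(2) by (auto simp: W_def)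
 have up: "D (eu i j) * Q = 0" if ij: "i < j" "j < N" for i j
 proof (rule ccontr)
  assume nz: "D (eu i j) * Q \<noteq> 0"
  have "H * (D (eu i j) * Q) = D (eu i j) * (H * Q) + D ((of_nat j - of_nat i) *c eu i j) * Q"
   unfolding H_def by (subst D_comm) (use ij c cb inn_eu in auto)
  also have "\<dots> = of_real (l + (real j - real i)) *c (D (eu i j) * Q)" by (simp add: eQ D_sc sc_add_left)
  finally have "l + (real j - real i) \<in> E"
   unfolding E_def using nz by (auto simp: assoc' D_e intro!: exI[of _ "D (eu i j) * Q"])
  from cSup_upper[OF this bdd] show False using l(2) ij by simp
 qed
 define Hs where "Hs = (\<lambda>i. D (eu i i)) ` {..<N}"
 have dcomm: "D (eu i i) * D c = D c * D (eu i i)" if "i < N" for i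
  using D_bracket[of c "eu i i"] that c cb[of i i] inn_eu[of i N i] by simp
 have hQ: "h * Q = Q * h" if h: "h \<in> Hs" for h
 proof -
  obtain i where i: "h = D (eu i i)" "i < N" using h by (auto simp: Hs_def)
  have "H * (h * Q) = of_real l *c (h * Q)"
   using mac[OF dcomm[OF i(2)], of Q] eQ(2) by (simp add: H_def i mult.assoc)
  then have "h * Q \<in> W" by (simp add: W_def i assoc' D_e)
  then show ?thesis using proj_commute[OF Q(1,3)] by (simp add: i D_adj[symmetric])
 qed
 obtain v where v: "col v" "ip v v = 1" "Q * v = v" "\<And>h. h \<in> Hs ==> \<exists>l. h * v = l *c v"
 proof (rule common_eigen[OF Q(1) Q0, of Hs])
  show "adj h = h" if "h \<in> Hs" for h using that by (auto simp: Hs_def D_adj[symmetric])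
  show "h * k = k * h" if hk: "h \<in> Hs" "k \<in> Hs" for h k
  proof -
   obtain i j where ij: "h = D (eu i i)" "i < N" "k = D (eu j j)" "j < N" using hk by (auto simp: Hs_def)
   have "eu i i * eu j j - eu j j * eu i i = 0" by (simp add: eu_mult)
   then show ?thesis using D_bracket[of "eu i i" "eu j j"] ij inn_eu by simp
  qed
 qed (auto simp: Hs_def hQ)
 have "\<exists>x::real. D (eu i i) * v = of_real x *c v" if i: "i < N" for i
 proof -
  obtain l where l: "D (eu i i) * v = l *c v" using v(4)[of "D (eu i i)"] i by (auto simp: Hs_def)
  then have "l = of_real (Re l)" by (rule hermitian_eigen_real[rotated]) (use v in \<open>auto simp: D_adj[symmetric]\<close>)
  then show ?thesis using l by metis
 qed
 then obtain w where w: "\<And>i. i < N ==> D (eu i i) * v = of_real (w i) *c v" by metis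
 have "hwv v w" unfolding hwv_def
 proof (intro conjI allI impI)
  show "v \<noteq> 0" using v(2) by auto
  show "e * v = v" using eQ(1) v(3) by (metis mult.assoc)
  show "D (eu i j) * v = 0" if "i < j" "j < N" for i j using up[OF that] v(3) by (metis mult.assoc mult_zero_left)
 qed (use v w in auto)
 then show ?thesis using that v(2) by blast
qed

lemma hwv_scale: "hwv v w ==> c \<noteq> 0 ==> hwv (c *c v) w"
 by (auto simp: hwv_def col_sc mult.commute)

lemma hwv_unit: assumes "hwv v w" obtains u where "hwv u w" "ip u u = 1"
proof -
 have "col v" "v \<noteq> 0" using assms by (auto simp: hwv_def)
 then obtain c where "c \<noteq> 0" "ip (c *c v) (c *c v) = 1" by (rule normalise)
 then show ?thesis using that hwv_scale[OF assms] by blast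
qed

text \<open>For a unit highest weight vector \<open>u\<close>, the number \<open>w i - w j\<close>
  is the squared norm of \<open>D (eu j i) * u\<close>.\<close>

lemma hwv_dom:
 assumes v: "hwv v w" and ij: "i < j" "j < N" shows "w j \<le> w i"
proof -
 obtain u where u: "hwv u w" "ip u u = 1" using hwv_unit[OF v] .
 have "ip (D (eu j i) * u) (D (eu j i) * u) = ip u (D (eu i j) * (D (eu j i) * u))" by (simp add: D_ip)
 also have "D (eu i j) * (D (eu j i) * u) = D (eu j i) * (D (eu i j) * u) + D (eu i i - eu j j) * u"
  by (subst D_comm) (use ij in \<open>auto simp: inn_eu eu_mult\<close>)
 also have "\<dots> = of_real (w i - w j) *c u"
  using u ij by (simp add: hwv_def D_diff ring_distribs sc_diff_left)
 finally have "complex_of_real ((norm (D (eu j i) * u))\<^sup>2) = of_real (w i - w j)"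
  using u by (simp add: ip_self[OF col_mult] hwv_def)
 then have "(norm (D (eu j i) * u))\<^sup>2 = w i - w j" unfolding of_real_eq_iff .
 then show ?thesis using zero_le_power2[of "norm (D (eu j i) * u)"] by linarith
qed

lemma hwv_sum: assumes v: "hwv v w" shows "(\<Sum>i<N. w i) = 0"
proof -
 have "0 = D (un {..<N}) * v" by (simp add: D_one)
 also have "\<dots> = (\<Sum>i<N. D (eu i i) * v)" by (simp add: un_sum D_sum sum_distrib_right)
 also have "\<dots> = (\<Sum>i<N. of_real (w i) *c v)" using v by (intro sum.cong) (auto simp: hwv_def)
 also have "\<dots> = of_real (\<Sum>i<N. w i) *c v" by (rule fmat_eqI) (simp add: sum_distrib_right)
 finally have "complex_of_real (\<Sum>i<N. w i) = 0" using v unfolding hwv_def by (metis sc_eq_0)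
 then show ?thesis unfolding of_real_eq_0_iff .
qed

text \<open>The one-parameter group of \<open>\<i> *c (eu i i - eu j j)\<close> returns to the
  identity at time \<open>2 * pi\<close>, where it acts on \<open>v\<close> by the exponential of
  \<open>2 * pi * \<i> * (w i - w j)\<close>.\<close>

lemma hwv_int: assumes v: "hwv v w" and ij: "i < N" "j < N" shows "w i - w j \<in> \<int>"
proof (cases "i = j")
 case False
 define X where "X = \<i> *c (eu i i - eu j j)"
 have X: "X \<in> su N" using ij by (simp add: X_def su_def inn_sc inn_diff inn_eu tr_eu)
 define d where "d k = (if k = i then 1 else if k = j then - 1 else 0 :: real)" for k
 have Xd: "X = un {..<N} * dg N (\<lambda>k. \<i> * of_real (d k)) * adj (un {..<N})"
  by (rule fmat_eqI) (use ij False in \<open>auto simp: X_def d_def ent_un_times ent_times_un\<close>)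
 have "oneparam (un {..<N}) X (\<lambda>t. un {..<N} * dg N (\<lambda>k. exp (of_real t * (\<i> * of_real (d k)))) * adj (un {..<N}))"
  using oneparam_diag[of N "un {..<N}" d] Xd by (simp add: isom_def)
 then have "Ex N X (2 * pi) = un {..<N} * dg N (\<lambda>k. exp (of_real (2 * pi) * (\<i> * of_real (d k)))) * adj (un {..<N})"
  by (simp add: Ex_eqI)
 also have "dg N (\<lambda>k. exp (of_real (2 * pi) * (\<i> * of_real (d k)))) = dg N (\<lambda>_. 1)"
  by (rule dg_cong) (auto simp: d_def exp_eq_1 intro: exI[of _ "-1 :: int"])
 finally have E: "Ex N X (2 * pi) = un {..<N}" by (simp add: dg_one)
 have "D X * v = (\<i> * of_real (w i - w j)) *c v"
  using v ij by (simp add: X_def D_sc D_diff hwv_def ring_distribs sc_diff_right sc_diff_left)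
 then have "L X * v = (\<i> * of_real (w i - w j)) *c v" using D_su[OF X] by simp
 from oneparam_eigen[OF L_oneparam[OF X] this, of "2 * pi"] v
 have "exp (of_real (2 * pi) * (\<i> * of_real (w i - w j))) *c v = 1 *c v" by (simp add: E r_one hwv_def)
 then have "exp (of_real (2 * pi) * (\<i> * of_real (w i - w j))) = 1"
  using v unfolding sc_eq_iff hwv_def by blast
 then obtain k :: int where "2 * pi * (w i - w j) = of_int (2 * k) * pi" unfolding exp_eq_1 by auto
 then have "w i - w j = of_int k" by simp
 then show ?thesis by simp
qed simp

text \<open>The correction words have the length of \<open>Ys\<close>, one letter being replaced by
  a commutator. This keeps the inductions on word length below well-founded: moving \<open>U\<close>
  out of a word leaves only shorter words.\<close>

lemma commute_word:
 assumes "inn N U" "\<forall>X\<in>set Ys. inn N X"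
 shows "D U * wd D Ys v = (\<Sum>k<length Ys. wd D (Ys[k := U * Ys ! k - Ys ! k * U]) v) + wd D Ys (D U * v)"
 using assms(2)
proof (induction Ys)
 case (Cons Y Ys)
 have "D U * wd D (Y # Ys) v = D Y * (D U * wd D Ys v) + D (U * Y - Y * U) * wd D Ys v"
  using Cons assms(1) by (simp add: D_comm)
 also have "\<dots> = (\<Sum>k<length Ys. wd D (Y # Ys[k := U * Ys ! k - Ys ! k * U]) v) + wd D (Y # Ys) (D U * v) + D (U * Y - Y * U) * wd D Ys v"
  using Cons by (simp add: ring_distribs sum_distrib_left)
 also have "\<dots> = (\<Sum>k<length (Y # Ys). wd D ((Y # Ys)[k := U * (Y # Ys) ! k - (Y # Ys) ! k * U]) v) + wd D (Y # Ys) (D U * v)"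
  by (simp only: length_Cons sum.lessThan_Suc_shift) (simp add: algebra_simps)
 finally show ?case .
qed simp

lemma hwv_utri:
 assumes v: "hwv v w" and U: "inn N U" "utri U"
 shows "D U * v = (\<Sum>i<N. ent U i i * of_real (w i)) *c v"
proof -
 have "D U * v = (\<Sum>i<N. \<Sum>j<N. ent U i j *c (D (eu i j) * v))"
  by (subst D_expand[OF U(1)]) (simp add: sum_distrib_right)
 also have "\<dots> = (\<Sum>i<N. \<Sum>j<N. if j = i then (ent U i i * of_real (w i)) *c v else 0)"
 proof (intro sum.cong refl)
  fix i j assume ij: "i \<in> {..<N}" "j \<in> {..<N}"
  consider "j < i" | "j = i" | "i < j" by linarith
  then show "ent U i j *c (D (eu i j) * v) = (if j = i then (ent U i i * of_real (w i)) *c v else 0)"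
   using v U(2) ij by cases (auto simp: hwv_def utri_def)
 qed
 also have "\<dots> = (\<Sum>i<N. ent U i i * of_real (w i)) *c v"
  by (rule fmat_eqI) (simp add: sum_distrib_right)
 finally show ?thesis .
qed

lemma gen_props: assumes "e * v = v"
 shows "rideal (gen N D v)" "\<And>Y. Y \<in> gen N D v ==> e * Y = Y"
  "\<And>X Y. inn N X ==> Y \<in> gen N D v ==> D X * Y \<in> gen N D v"
proof -
 have 1: "Y * B \<in> gen N D v" if "Y \<in> gen N D v" for Y B
  using that by (induction) (auto simp: mult.assoc ring_distribs intro: gen.intros)
 have 0: "0 \<in> gen N D v" using gen_wd[of "[]" N D v 0] by simp
 show "rideal (gen N D v)" unfolding rideal_def using 0 1 gen_add by blast
 have ew: "e * wd D Xs v = wd D Xs v" for Xs by (cases Xs) (simp_all add: assms assoc' D_e)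
 show "e * Y = Y" if "Y \<in> gen N D v" for Y using that by (induction) (auto simp: assoc' ew ring_distribs)
 show "D X * Y \<in> gen N D v" if "inn N X" "Y \<in> gen N D v" for X Y using that(2)
 proof induction
  case (gen_wd Xs B)
  then show ?case using gen.gen_wd[of "X # Xs" N D v B] that(1) by (simp add: mult.assoc)
 qed (auto simp: ring_distribs intro: gen.intros)
qed

text \<open>The Casimir operator in terms of matrix units and their duals for the trace form;
  \<open>CAS_basis\<close> identifies it with the sum over an orthonormal basis of
  \<open>su N\<close>.\<close>

definition CAS :: fmat where "CAS = (\<Sum>i<N. \<Sum>j<N. D (eu i j) * D (eu j i))"

lemma CAS_e: "e * CAS = CAS" "CAS * e = CAS"
 by (simp_all add: CAS_def sum_distrib_left sum_distrib_right mult.assoc D_e) (simp add: assoc' D_e)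

lemma CAS_commute_eu:
 assumes ab: "a < N" "b < N"
 shows "D (eu a b) * CAS = CAS * D (eu a b)"
proof -
 let ?E = "\<lambda>i j. D (eu i j)"
 have br: "?E a b * ?E i j - ?E i j * ?E a b = (if b = i then ?E a j else 0) - (if j = a then ?E i b else 0)"
  if "i < N" "j < N" for i j
  using D_bracket[of "eu a b" "eu i j"] ab that by (auto simp: inn_eu eu_mult D_diff)
 have "?E a b * CAS - CAS * ?E a b =
  (\<Sum>i<N. \<Sum>j<N. (?E a b * ?E i j - ?E i j * ?E a b) * ?E j i + ?E i j * (?E a b * ?E j i - ?E j i * ?E a b))"
  unfolding CAS_def sum_distrib_left sum_distrib_right sum_subtractf[symmetric]
  by (intro sum.cong refl) (simp add: ring_distribs mult.assoc)
 also have "\<dots> = (\<Sum>i<N. \<Sum>j<N. (if i = b then ?E a j * ?E j b else 0) - (if j = a then ?E i b * ?E a i else 0)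
   + ((if j = b then ?E i b * ?E a i else 0) - (if i = a then ?E a j * ?E j b else 0)))"
  by (intro sum.cong refl) (simp add: br ring_distribs)
 also have "\<dots> = (\<Sum>j<N. ?E a j * ?E j b) - (\<Sum>i<N. ?E i b * ?E a i) + ((\<Sum>i<N. ?E i b * ?E a i) - (\<Sum>j<N. ?E a j * ?E j b))"
 proof -
  have s1: "(\<Sum>i<N. \<Sum>j<N. if i = c then f j else 0) = (\<Sum>j<N. f j)" if "c < N" for c and f :: "nat => fmat"
   using that by (subst sum.swap) simp
  have s2: "(\<Sum>i<N. \<Sum>j<N. if j = c then f i else 0) = (\<Sum>j<N. f j)" if "c < N" for c and f :: "nat => fmat"
   using that by simp
  show ?thesis unfolding sum.distrib sum_subtractf s1[OF ab(1)] s1[OF ab(2)] s2[OF ab(1)] s2[OF ab(2)] ..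
 qed
 finally show ?thesis by simp
qed

lemma CAS_commute: "D X * CAS = CAS * D X"
proof -
 have "D X = (\<Sum>i<N. \<Sum>j<N. ent (cut N X) i j *c D (eu i j))"
  using D_expand[OF inn_cut[of N X]] by (simp add: D_cut)
 then show ?thesis by (simp add: sum_distrib_left sum_distrib_right CAS_commute_eu)
qed

lemma CAS_hwv: assumes v: "hwv v w" shows "CAS * v = of_real (casc N w) *c v"
proof -
 have "CAS * v = (\<Sum>i<N. \<Sum>j<N. D (eu i j) * (D (eu j i) * v))"
  by (simp add: CAS_def sum_distrib_right mult.assoc)
 also have "\<dots> = (\<Sum>i<N. \<Sum>j<N. of_real (if i = j then (w i)\<^sup>2 else if i < j then w i - w j else 0) *c v)"
 proof (intro sum.cong refl)
  fix i j assume ij: "i \<in> {..<N}" "j \<in> {..<N}"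
  consider "i = j" | "i < j" | "j < i" by linarith
  then show "D (eu i j) * (D (eu j i) * v) = of_real (if i = j then (w i)\<^sup>2 else if i < j then w i - w j else 0) *c v"
  proof cases
   case 1 then show ?thesis using v ij by (simp add: hwv_def power2_eq_square)
  next
   case 2
   have "D (eu i j) * (D (eu j i) * v) = D (eu j i) * (D (eu i j) * v) + D (eu i i - eu j j) * v"
    by (subst D_comm) (use ij 2 in \<open>auto simp: inn_eu eu_mult\<close>)
   then show ?thesis using v ij 2 by (simp add: hwv_def D_diff ring_distribs sc_diff_left)
  next
   case 3 then show ?thesis using v ij by (simp add: hwv_def)
  qed
 qed
 also have "\<dots> = of_real (casc N w) *c v"
  unfolding casc_def of_real_sum by (rule fmat_eqI) (simp add: sum_distrib_right)
 finally show ?thesis .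
qed

end

section \<open>Irreducible representations, Schur's lemma and uniqueness by highest weight\<close>

locale irr = urep +
 assumes e_nz: "e \<noteq> 0"
  and irr: "\<And>P. proj P ==> e * P = P ==> (\<And>g. g \<in> SU N ==> P * r g = r g * P) ==> P = 0 \<or> P = e"
begin

text \<open>The projection onto an invariant subspace commutes with the Lie algebra, hence with the
  group by \<open>commute_D\<close>, and irreducibility leaves only \<open>0\<close> and
  \<open>e\<close>.\<close>

lemma irr_ideal:
 assumes W: "rideal W" "\<And>Y. Y \<in> W ==> e * Y = Y" "\<And>X Y. inn N X ==> Y \<in> W ==> D X * Y \<in> W"
  and Y: "Y \<in> W" "Y \<noteq> 0"
 shows "e \<in> W"
proof -
 obtain Q where Q: "proj Q" "Q \<in> W" "\<And>Y. Y \<in> W ==> Q * Y = Y"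
  using rideal_proj[OF W(1,2)] by blast
 have "\<forall>X. Q * D X = D X * Q" using ideal_proj_commute[OF Q W(3)] by simp
 moreover have eQ: "e * Q = Q" by (rule W(2)[OF Q(2)])
 moreover have "Q * e = Q" using arg_cong[OF eQ, of adj] Q(1) ee by (simp add: proj_def)
 ultimately have "\<forall>g\<in>SU N. Q * r g = r g * Q" by (simp add: commute_D)
 then have "Q = 0 \<or> Q = e" using irr[OF Q(1) eQ] by blast
 then show ?thesis using Q(2,3) Y by auto
qed

text \<open>An eigenspace of \<open>A\<close> is invariant and non-zero, so it is
  everything.\<close>

theorem schur:
 assumes A: "e * A = A" "A * e = A" "\<And>X. inn N X ==> A * D X = D X * A"
 obtains l where "A = l *c e"
proof -
 obtain u l where u: "col u" "ip u u = 1" "e * u = u" "A * u = l *c u"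
  using eigen_exists[OF pe e_nz, of A] A by (metis mult.assoc)
 define W where "W = {Y. e * Y = Y \<and> A * Y = l *c Y}"
 have "e \<in> W"
 proof (rule irr_ideal[of W u])
  show "rideal W" by (auto simp: rideal_def W_def ring_distribs sc_add_right assoc')
  show "D X * Y \<in> W" if "inn N X" "Y \<in> W" for X Y
   using that mac[OF A(3)[OF that(1)], of Y] by (simp add: W_def mult.assoc) (simp add: assoc' D_e)
 qed (use u in \<open>auto simp: W_def\<close>)
 then show ?thesis using that A by (auto simp: W_def)
qed

lemma e_gen: "v \<noteq> 0 ==> e * v = v ==> e \<in> gen N D v"
proof -
 assume v: "v \<noteq> 0" "e * v = v"
 obtain n where "v * un {..<n} = v" using ex_unit by blast
 then have "v \<in> gen N D v" using gen_wd[of "[]" N D v "un {..<n}"] by simp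
 then show ?thesis using irr_ideal[OF gen_props[OF v(2)]] v(1) by blast
qed

text \<open>Words applied to a non-zero vector span the representation space, so an operator is
  determined by its values on them.\<close>

lemma words_total:
 assumes v: "v \<noteq> 0" "e * v = v" and T: "\<And>Xs. \<forall>X\<in>set Xs. inn N X ==> T * wd D Xs v = T' * wd D Xs v"
 shows "T * e = T' * e"
proof -
 have "T * Y = T' * Y" if "Y \<in> gen N D v" for Y
  using that by induction (auto simp: T assoc' ring_distribs)
 then show ?thesis using e_gen[OF v] by blast
qed

lemma CAS_scalar: "hwv v w ==> CAS = of_real (casc N w) *c e"
proof -
 assume v: "hwv v w"
 obtain l where l: "CAS = l *c e" using schur[OF CAS_e] CAS_commute by metis
 then have "CAS * v = l *c v" using v by (simp add: hwv_def)
 then have "l = of_real (casc N w)" using CAS_hwv[OF v] v unfolding hwv_def by (metis sc_eq_iff)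
 then show ?thesis using l by simp
qed

end

lemma lower_split: assumes "inn N X"
 obtains U Lo where "X = U + Lo" "inn N U" "inn N Lo" "utri U" "\<And>i j. i \<le> j ==> ent Lo i j = 0"
proof -
 define U where "U = Fmat (\<lambda>i j. if i \<le> j \<and> j < N then ent X i j else 0)"
 have eU: "ent U i j = (if i \<le> j \<and> j < N then ent X i j else 0)" for i j
  unfolding U_def by (subst Fmat_finite[of "{..<N}"]) (auto split: if_splits)
 show ?thesis by (rule that[of U "X - U"]) (use assms in \<open>auto simp: inn_def utri_def eU\<close>)
qed

text \<open>The coefficient can be computed from the weight alone. Split the first letter of the
  word: its strictly lower part, moved to the other side of the inner product, is a raising operator
  and kills \<open>v\<close>; its upper part is pushed through the rest of the word, leaving shorter
  words, until it acts on \<open>v\<close> by a scalar determined by \<open>w\<close>.\<close>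

lemma words_universal:
 assumes A: "urep N e r" and B: "urep N e' r'"
  and v: "urep.hwv N e r v w" "ip v v = 1" and v': "urep.hwv N e' r' v' w" "ip v' v' = 1"
  and Xs: "\<forall>X\<in>set Xs. inn N X"
 shows "ip v (wd (Dop N e r) Xs v) = ip v' (wd (Dop N e' r') Xs v')"
proof -
 interpret A: urep N e r by (rule A)
 interpret B: urep N e' r' by (rule B)
 show ?thesis using Xs
 proof (induction "length Xs" arbitrary: Xs rule: less_induct)
  case less
  show ?case
  proof (cases Xs)
   case Nil then show ?thesis using v v' by simp
  next
   case (Cons X Ys)
   have inX: "inn N X" and inY: "\<forall>X\<in>set Ys. inn N X" using less(2) Cons by auto
   obtain U Lo where UL: "X = U + Lo" "inn N U" "inn N Lo" "utri U" "\<And>i j. i \<le> j ==> ent Lo i j = 0"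
    using lower_split[OF inX] by metis
   have inL: "inn N (adj Lo)" "utri (adj Lo)" using UL by (auto simp: inn_adj utri_def)
   have diag0: "(\<Sum>i<N. ent (adj Lo) i i * of_real (w i)) = 0" using UL(5) by simp
   have L: "A.D (adj Lo) * v = 0" "B.D (adj Lo) * v' = 0"
    using A.hwv_utri[OF v(1) inL] B.hwv_utri[OF v'(1) inL] diag0 by auto
   have comm_inn: "\<forall>X\<in>set (Ys[k := U * Ys ! k - Ys ! k * U]). inn N X" if "k < length Ys" for k
    using inY that UL(2) by (auto dest!: set_update_subset_insert[THEN subsetD] simp: inn_diff inn_mult)
   have "ip v (wd A.D Xs v) = ip v (A.D U * wd A.D Ys v) + ip v (A.D Lo * wd A.D Ys v)"
    by (simp add: Cons UL(1) A.D_add ring_distribs ip_add_right)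
   also have "ip v (A.D Lo * wd A.D Ys v) = 0" by (simp add: A.D_ip' L)
   also have "ip v (A.D U * wd A.D Ys v) = (\<Sum>k<length Ys. ip v (wd A.D (Ys[k := U * Ys ! k - Ys ! k * U]) v))
     + (\<Sum>i<N. ent U i i * of_real (w i)) * ip v (wd A.D Ys v)"
    unfolding A.commute_word[OF UL(2) inY] A.hwv_utri[OF v(1) UL(2,4)]
    by (simp add: wd_sc ip_add_right ip_sum_right)
   also have "\<dots> = (\<Sum>k<length Ys. ip v' (wd B.D (Ys[k := U * Ys ! k - Ys ! k * U]) v'))
     + (\<Sum>i<N. ent U i i * of_real (w i)) * ip v' (wd B.D Ys v')"
   proof -
    have "ip v (wd A.D (Ys[k := U * Ys ! k - Ys ! k * U]) v) = ip v' (wd B.D (Ys[k := U * Ys ! k - Ys ! k * U]) v')"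
     if "k < length Ys" for k by (rule less(1)) (use comm_inn[OF that] Cons in auto)
    moreover have "ip v (wd A.D Ys v) = ip v' (wd B.D Ys v')" by (rule less(1)) (use Cons inY in auto)
    ultimately show ?thesis by simp
   qed
   also have "\<dots> = ip v' (B.D U * wd B.D Ys v')"
    unfolding B.commute_word[OF UL(2) inY] B.hwv_utri[OF v'(1) UL(2,4)]
    by (simp add: wd_sc ip_add_right ip_sum_right)
   also have "\<dots> + 0 = ip v' (wd B.D Xs v')"
    by (simp add: Cons UL(1) B.D_add ring_distribs ip_add_right B.D_ip' L)
   finally show ?thesis .
  qed
 qed
qed

lemma (in urep) ip_words:
 "ip (wd D Us v) (wd D Xs v) = ip v (wd D (map adj (rev Us) @ Xs) v)"
proof (induction Us arbitrary: Xs)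
 case (Cons U Us)
 have "ip (wd D (U # Us) v) (wd D Xs v) = ip (wd D Us v) (wd D (adj U # Xs) v)" by (simp add: D_ip)
 also have "\<dots> = ip v (wd D (map adj (rev Us) @ adj U # Xs) v)" by (rule Cons)
 finally show ?case by simp
qed simp

text \<open>By \<open>words_universal\<close> the words applied to \<open>x\<close> and those
  applied to \<open>y\<close> have the same Gram matrix, so sending the former to the latter is well
  defined; it is equivariant by construction.\<close>

theorem hw_unique:
 assumes A: "irr N e r" and B: "irr N e' r'"
  and v: "urep.hwv N e r v w" and v': "urep.hwv N e' r' v' w"
 obtains T where "T \<noteq> 0" "T * e = T" "e' * T = T" "\<And>g. g \<in> SU N ==> T * r g = r' g * T"
proof -
 interpret A: irr N e r by (rule A)
 interpret B: irr N e' r' by (rule B)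
 obtain x where x: "A.hwv x w" "ip x x = 1" using A.hwv_unit[OF v] .
 obtain y where y: "B.hwv y w" "ip y y = 1" using B.hwv_unit[OF v'] .
 have cx: "col x" "e * x = x" "x \<noteq> 0" and cy: "col y" "e' * y = y" "y \<noteq> 0" using x y by (auto simp: A.hwv_def B.hwv_def)
 have gram: "adj (wd A.D Us x) * wd A.D Xs x = adj (wd B.D Us y) * wd B.D Xs y"
  if "\<forall>X\<in>set Us. inn N X" "\<forall>X\<in>set Xs. inn N X" for Us Xs
 proof -
  have "ip (wd A.D Us x) (wd A.D Xs x) = ip (wd B.D Us y) (wd B.D Xs y)" unfolding A.ip_words B.ip_words
   by (rule words_universal[OF A.urep_axioms B.urep_axioms x y]) (use that in \<open>auto simp: inn_adj\<close>)
  then show ?thesis by (simp add: adj_mult_col wd_col cx cy)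
 qed
 \<comment> \<open>Every element generated by \<open>x\<close> has a counterpart with the same
   pairings with all words. Applied to \<open>e\<close> itself, this produces the operator
   \<open>T\<close>.\<close>
 have "\<exists>Y'. e' * Y' = Y' \<and> (\<forall>Us. (\<forall>X\<in>set Us. inn N X) --> adj (wd A.D Us x) * Y = adj (wd B.D Us y) * Y')"
  if "Y \<in> gen N A.D x" for Y using that
 proof induction
  case (gen_wd Xs Z)
  have "wd B.D Xs y * Z \<in> gen N B.D y" using gen_wd by (rule gen.gen_wd)
  then have "e' * (wd B.D Xs y * Z) = wd B.D Xs y * Z" by (rule B.gen_props[OF cy(2)])
  then show ?case using gram gen_wd by (intro exI[of _ "wd B.D Xs y * Z"]) (simp add: assoc')
 next
  case (gen_add Y Z)
  then obtain Y' Z' where "e' * Y' = Y'" "e' * Z' = Z'"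
   "\<forall>Us. (\<forall>X\<in>set Us. inn N X) --> adj (wd A.D Us x) * Y = adj (wd B.D Us y) * Y'"
   "\<forall>Us. (\<forall>X\<in>set Us. inn N X) --> adj (wd A.D Us x) * Z = adj (wd B.D Us y) * Z'" by blast
  then show ?case by (intro exI[of _ "Y' + Z'"]) (simp add: ring_distribs)
 qed
 from this[OF A.e_gen[OF cx(3,2)]] obtain T where T: "e' * T = T"
  "\<And>Us. \<forall>X\<in>set Us. inn N X ==> adj (wd A.D Us x) * e = adj (wd B.D Us y) * T" by blast
 have Tw: "T * wd A.D Xs x = wd B.D Xs y" if Xs: "\<forall>X\<in>set Xs. inn N X" for Xs
 proof -
  have ew: "e * wd A.D Xs x = wd A.D Xs x" "e' * wd B.D Xs y = wd B.D Xs y"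
   by (cases Xs; simp add: cx cy assoc' A.D_e B.D_e)+
  have "adj (T * wd A.D Xs x - wd B.D Xs y) * wd B.D Us y = 0 * wd B.D Us y" if Us: "\<forall>X\<in>set Us. inn N X" for Us
  proof -
   have "adj (wd B.D Us y) * (T * wd A.D Xs x - wd B.D Xs y) = adj (wd A.D Us x) * (e * wd A.D Xs x) - adj (wd B.D Us y) * wd B.D Xs y"
    using T(2)[OF Us] by (simp add: ring_distribs assoc')
   also have "\<dots> = 0" using gram[OF Us Xs] ew by simp
   finally show ?thesis by (metis adj_adj adj_times adj_zero mult_zero_left)
  qed
  from B.words_total[OF cy(3,2) this] have "adj (T * wd A.D Xs x - wd B.D Xs y) * e' = 0" by simp
  then have "e' * (T * wd A.D Xs x - wd B.D Xs y) = 0" by (metis B.ee(2) adj_adj adj_times adj_zero)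
  then show ?thesis using T(1) ew by (simp add: ring_distribs mac[OF T(1)])
 qed
 define S where "S = T * e"
 have Se: "S * e = S" "e' * S = S" using A.ee T(1) by (auto simp: S_def mult.assoc mac[OF T(1)])
 have Sw: "S * wd A.D Xs x = wd B.D Xs y" if "\<forall>X\<in>set Xs. inn N X" for Xs
 proof -
  have "e * wd A.D Xs x = wd A.D Xs x" by (cases Xs; simp add: cx assoc' A.D_e)
  then show ?thesis using Tw[OF that] by (simp add: S_def mult.assoc)
 qed
 have "S * A.D X = B.D X * S" if X: "inn N X" for X
 proof -
  have "(S * A.D X) * e = (B.D X * S) * e"
  proof (rule A.words_total[OF cx(3,2)])
   fix Xs :: "fmat list" assume Xs: "\<forall>X\<in>set Xs. inn N X"
   show "S * A.D X * wd A.D Xs x = B.D X * S * wd A.D Xs x"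
    using Sw[of "X # Xs"] Sw[OF Xs] X Xs by (simp add: mult.assoc)
  qed
  then show ?thesis using Se A.D_e by (simp add: mult.assoc)
 qed
 then have "S * A.D X = B.D X * S" for X using A.D_cut B.D_cut inn_cut by metis
 then have "\<forall>g\<in>SU N. S * r g = r' g * S"
  using urep_intertwine[OF A.urep_axioms B.urep_axioms Se] by blast
 moreover have "S \<noteq> 0" using Sw[of "[]"] cy(3) by auto
 ultimately show ?thesis using that Se by blast
qed

text \<open>Schur's lemma for \<open>adj T * T\<close> and for \<open>T * adj T\<close>. The two
  scalars agree because both describe \<open>T * adj T * T\<close>, and the trace shows that they
  are positive.\<close>

lemma intertwiner_iso:
 assumes A: "irr N e r" and B: "irr N e' r'" and T: "T \<noteq> 0" "T * e = T" "e' * T = T" "\<And>g. g \<in> SU N ==> T * r g = r' g * T"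
 obtains c where "c > 0" "adj T * T = of_real c *c e" "T * adj T = of_real c *c e'"
proof -
 interpret A: irr N e r by (rule A)
 interpret B: irr N e' r' by (rule B)
 have TD: "T * A.D X = B.D X * T" for X
  using urep_intertwine[OF A.urep_axioms B.urep_axioms T(2,3)] T(4) by blast
 have TD': "adj T * B.D X = A.D X * adj T" for X
  using arg_cong[OF TD[of "adj X"], of adj] by (simp add: A.D_adj[symmetric] B.D_adj[symmetric])
 have Te': "e * adj T = adj T" "adj T * e' = adj T"
  using arg_cong[OF T(2), of adj] arg_cong[OF T(3), of adj] by (simp_all add: A.ee B.ee)
 obtain a where a: "adj T * T = a *c e"
  by (rule A.schur[of "adj T * T"]) (use Te' T TD TD' in \<open>auto simp: mult.assoc mac[OF Te'(1)] mac[OF TD']\<close>)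
 obtain b where b: "T * adj T = b *c e'"
  by (rule B.schur[of "T * adj T"]) (use Te' T TD TD' in \<open>auto simp: mult.assoc mac[OF T(3)] mac[OF TD]\<close>)
 have "T * (adj T * T) = a *c T" using a T(2) by simp
 moreover have "T * (adj T * T) = b *c T" using mac[OF b, of T] T(3) by simp
 ultimately have ab: "a = b" using T(1) by (metis sc_eq_iff)
 have "tr (adj T * T) = a * tr e" using a by simp
 then have "of_real ((norm T)\<^sup>2) = a * of_real ((norm e)\<^sup>2)" using tr_adj_self_norm[of T] tr_proj[OF A.pe] by simp
 then have a': "a = of_real ((norm T)\<^sup>2 / (norm e)\<^sup>2)" using A.e_nz by (simp add: field_simps)
 have "(norm T)\<^sup>2 / (norm e)\<^sup>2 > 0" using A.e_nz T(1) by simp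
 then show ?thesis using that a b ab a' by blast
qed

section \<open>Equivariant maps and the Iwasawa decomposition\<close>

lemma bounded_bilinear_sc: "bounded_bilinear (\<lambda>a A. a *c (A::fmat))"
proof
 show "\<exists>K. \<forall>a (A::fmat). norm (a *c A) \<le> norm a * norm A * K"
  by (rule exI[of _ 1]) (simp add: norm_sc)
qed (simp_all add: sc_add_left sc_add_right scaleR_fmat_def scaleR_conv_of_real mult.commute)

definition KK :: "nat => fmat set" where
 "KK n = {k \<in> SU (Suc n). \<forall>i<n. ent k i n = 0 \<and> ent k n i = 0}"

definition kblock :: "nat => fmat => bool" where
 "kblock n X \<longleftrightarrow> (\<forall>i<n. ent X i n = 0 \<and> ent X n i = 0)"

text \<open>A matrix equivariant in the following sense is the same thing as a \<open>K\<close>-equivariant map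
 from the standard representation tensored with the inverse of its last character, i.e. from the
 sum of the trivial representation (last column) and the holomorphic isotropy representation.\<close>

definition kequiv :: "nat => fmat => (fmat => fmat) => fmat => bool" where
 "kequiv n e r \<Xi> \<longleftrightarrow> e * \<Xi> = \<Xi> \<and> \<Xi> * un {..<Suc n} = \<Xi> \<and>
  (\<forall>k\<in>KK n. r k * \<Xi> = cnj (ent k n n) *c (\<Xi> * k))"

lemma kequiv_lincomb: "kequiv n e r A ==> kequiv n e r B ==> kequiv n e r (a *c A + b *c B)"
 by (auto simp: kequiv_def ring_distribs sc_add_right mult_ac[where 'a=complex])

text \<open>Rotation in the plane of the basis vectors 0 and \<open>n\<close>, the one-parameter
  group generated by \<open>eu n 0 - eu 0 n\<close>. At \<open>pi / 4\<close> it carries the line of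
  \<open>fv n\<close> to the line of the last basis vector.\<close>

definition rf :: "nat => real => fmat" where
 "rf n t = un {1..<n} + of_real (cos t) *c (eu 0 0 + eu n n) + of_real (sin t) *c (eu n 0 - eu 0 n)"

lemma un_eu: "finite S ==> un S * eu i j = (if i \<in> S then eu i j else 0)"
 by (rule fmat_eqI) (auto simp: ent_un_times)
lemma eu_un': "finite S ==> eu i j * un S = (if j \<in> S then eu i j else 0)"
 by (rule fmat_eqI) (auto simp: ent_times_un)

lemma rf_oneparam: assumes "n \<ge> 1" shows "oneparam (un {..<Suc n}) (eu n 0 - eu 0 n) (rf n)"
 unfolding oneparam_def
proof (intro conjI allI)
 show "rf n 0 = un {..<Suc n}" by (rule fmat_eqI) (use assms in \<open>auto simp: rf_def ent_un\<close>)
 fix s t :: real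
 have n: "(0 = n) = False" "(n = 0) = False" using assms by auto
 have c: "cos (s + t) = cos s * cos t - sin s * sin t" "sin (s + t) = sin s * cos t + cos s * sin t"
  by (simp_all add: cos_add sin_add)
 show "rf n (s + t) = rf n s * rf n t" unfolding rf_def c
  by (simp add: ring_distribs un_eu eu_un' eu_mult n sc_add_right sc_diff_right sc_add_left sc_diff_left)
   (simp add: fmat_eq_iff mult_ac)
 show "adj (rf n t) = rf n (- t)" by (rule fmat_eqI) (use n in \<open>auto simp: rf_def ent_un\<close>)
next
 have 1: "((\<lambda>t. complex_of_real (cos t)) has_vector_derivative of_real 0) (at 0)"
  "((\<lambda>t. complex_of_real (sin t)) has_vector_derivative of_real 1) (at 0)"
  by (intro has_vector_derivative_of_real; auto intro!: derivative_eq_intros)+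
 have "((\<lambda>t. un {1..<n} + of_real (cos t) *c (eu 0 0 + eu n n) + of_real (sin t) *c (eu n 0 - eu 0 n)) has_vector_derivative
  0 + of_real 0 *c (eu 0 0 + eu n n) + of_real 1 *c (eu n 0 - eu 0 n)) (at 0)"
  by (intro has_vector_derivative_add has_vector_derivative_const bounded_linear.has_vector_derivative[OF bounded_linear_sc] 1)
 then show "(rf n has_vector_derivative eu n 0 - eu 0 n) (at 0)" unfolding rf_def by simp
qed

definition fv :: "nat => fmat" where "fv n = eu 0 0 + eu n 0"
text \<open>Matrices preserving the line of \<open>fv n\<close> and its orthogonal complement: the
  complexified isotropy algebra moved by \<open>cc n\<close>. Together with the upper triangular
  matrices the original copy fails to span, as it misses the units \<open>eu n j\<close> with
  \<open>j < n\<close>; the moved copy succeeds.\<close>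

definition kf :: "nat => fmat => complex => bool" where
 "kf n X \<kappa> \<longleftrightarrow> inn (Suc n) X \<and> X * fv n = \<kappa> *c fv n \<and> adj X * fv n = cnj \<kappa> *c fv n"

lemma kf_adj: "kf n X \<kappa> ==> kf n (adj X) (cnj \<kappa>)" by (simp add: kf_def inn_adj)

definition cc :: "nat => fmat" where "cc n = rf n (pi / 4)"

lemma cc_SU: assumes "n \<ge> 1" shows "cc n \<in> SU (Suc n)"
proof -
 have "eu n 0 - eu 0 n \<in> su (Suc n)" using assms by (simp add: su_def inn_diff inn_eu tr_eu)
 then show ?thesis using Ex_SU Ex_eqI[OF rf_oneparam[OF assms]] unfolding cc_def by metis
qed

lemma cc_fv: assumes "n \<ge> 1" shows "cc n * fv n = of_real (sqrt 2) *c eu n 0" "adj (cc n) * eu n 0 = of_real (1 / sqrt 2) *c fv n"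
proof -
 have 2: "complex_of_real (sqrt 2) / 2 + of_real (sqrt 2) / 2 = of_real (sqrt 2)" by simp
 show "cc n * fv n = of_real (sqrt 2) *c eu n 0"
  using assms by (simp add: cc_def rf_def fv_def ring_distribs un_eu eu_mult cos_45 sin_45)
   (simp add: fmat_eq_iff)
 have "sqrt 2 = 2 / sqrt 2" by (simp add: real_div_sqrt)
 then have "complex_of_real (sqrt 2) = of_real (2 / sqrt 2)" by (simp only:)
 then have "complex_of_real (sqrt 2) = 2 / complex_of_real (sqrt 2)" by simp
 then show "adj (cc n) * eu n 0 = of_real (1 / sqrt 2) *c fv n"
  using assms by (simp add: cc_def rf_def fv_def ring_distribs un_eu eu_mult cos_45 sin_45)
   (simp add: fmat_eq_iff)
qed

lemma kf_kblock: assumes "n \<ge> 1" "kf n X \<kappa>"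
 shows "kblock n (cc n * X * adj (cc n))" "ent (cc n * X * adj (cc n)) n n = \<kappa>"
proof -
 have r: "complex_of_real (1 / sqrt 2) * of_real (sqrt 2) = 1" by (simp flip: of_real_mult)
 have cl: "cc n * X * adj (cc n) * eu n 0 = \<kappa> *c eu n 0" if "kf n X \<kappa>" for X \<kappa>
 proof -
  have "cc n * X * adj (cc n) * eu n 0 = of_real (1 / sqrt 2) *c (cc n * (X * fv n))"
   by (simp add: mult.assoc cc_fv[OF assms(1)])
  also have "\<dots> = (\<kappa> * (of_real (1 / sqrt 2) * of_real (sqrt 2))) *c eu n 0"
   using that by (simp add: kf_def cc_fv[OF assms(1)] mult_ac)
  finally show ?thesis unfolding r by simp
 qed
 then have e: "ent (cc n * X * adj (cc n)) i n = (if i = n then \<kappa> else 0)" if "kf n X \<kappa>" for X \<kappa> i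
  using arg_cong[OF cl[OF that], of "\<lambda>A. ent A i 0"] by (simp add: ent_times_eu)
 show "ent (cc n * X * adj (cc n)) n n = \<kappa>" using e[OF assms(2)] by simp
 have "ent (cc n * X * adj (cc n)) n i = cnj (ent (cc n * adj X * adj (cc n)) i n)" for i
  using ent_adj[of "cc n * X * adj (cc n)" i n] by (simp add: mult.assoc)
 then show "kblock n (cc n * X * adj (cc n))"
  using e[OF assms(2)] e[OF kf_adj[OF assms(2)]] by (simp add: kblock_def)
qed

section \<open>Equivariant maps evaluated at a highest weight vector\<close>

locale kirr = irr "Suc n" e r for n e r +
 assumes n2: "n \<ge> 2"
begin

lemma n1: "n \<ge> 1" using n2 by simp

text \<open>Equivariance differentiated along the exponential of \<open>X\<close>; the twist by the
  last character turns into the term with \<open>ent X n n\<close>.\<close>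

lemma kequiv_su:
 assumes \<Xi>: "kequiv n e r \<Xi>" and X: "X \<in> su (Suc n)" "kblock n X"
 shows "D X * \<Xi> = \<Xi> * X - ent X n n *c \<Xi>"
proof -
 note o = Ex_oneparam[OF X(1)]
 have X0: "ent X i n = 0" "ent X n i = 0" if "i \<noteq> n" for i
  using X suD(1)[OF X(1)] that unfolding kblock_def inn_def by (metis Suc_leI linorder_neqE_nat)+
 have "X * eu n 0 = ent X n n *c eu n 0" by (rule fmat_eqI) (use X0 in \<open>auto simp: ent_times_eu\<close>)
 from oneparam_eigen[OF o this]
 have E: "Ex (Suc n) X t * eu n 0 = exp (of_real t * ent X n n) *c eu n 0" for t by (simp add: un_eu)
 have E1: "ent (Ex (Suc n) X t) i n = (if i = n then exp (of_real t * ent X n n) else 0)" for i t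
  using arg_cong[OF E, of "\<lambda>A. ent A i 0" t] by (simp add: ent_times_eu)
 have "ent (Ex (Suc n) X t) n i = cnj (ent (Ex (Suc n) X (- t)) i n)" for i t
  using o unfolding oneparam_def by (metis ent_adj complex_cnj_cnj)
 then have K: "Ex (Suc n) X t \<in> KK n" for t using E1 Ex_SU[OF X(1)] by (simp add: KK_def)
 have "((\<lambda>t. r (Ex (Suc n) X t) * \<Xi>) has_vector_derivative L X * \<Xi>) (at 0)"
  by (intro vd_mult_right oneparam_vd[OF L_oneparam[OF X(1)]])
 moreover have "((\<lambda>t. exp (of_real t * cnj (ent X n n)) *c (\<Xi> * Ex (Suc n) X t)) has_vector_derivative
   exp (of_real 0 * cnj (ent X n n)) *c (\<Xi> * X) + (cnj (ent X n n) * exp (of_real 0 * cnj (ent X n n))) *c (\<Xi> * Ex (Suc n) X 0)) (at 0)"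
  by (intro bounded_bilinear.has_vector_derivative[OF bounded_bilinear_sc] vd_mult_left oneparam_vd[OF o] cexp_deriv)
 moreover have "r (Ex (Suc n) X t) * \<Xi> = exp (of_real t * cnj (ent X n n)) *c (\<Xi> * Ex (Suc n) X t)" for t
  using \<Xi> K[of t] E1[of t n] by (simp add: kequiv_def cnj_exp_real)
 ultimately have "L X * \<Xi> = \<Xi> * X + cnj (ent X n n) *c (\<Xi> * Ex (Suc n) X 0)"
  using vd_unique by simp
 moreover have "cnj (ent X n n) = - ent X n n"
  using arg_cong[OF suD(2)[OF X(1)], of "\<lambda>A. ent A n n"] by simp
 ultimately show ?thesis using o \<Xi> by (simp add: D_su[OF X(1)] oneparam_def kequiv_def)
qed

lemma kequiv_D:
 assumes \<Xi>: "kequiv n e r \<Xi>" and X: "inn (Suc n) X" "kblock n X"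
 shows "D X * \<Xi> = \<Xi> * X - ent X n n *c \<Xi>"
proof -
 define c where "c = tr X / of_nat (Suc n)"
 have X': "X = skp (Suc n) X + \<i> *c hep (Suc n) X + c *c un {..<Suc n}"
  using skp_hep[of "Suc n" X] X by (simp add: tlp_def cut_inn c_def diff_eq_eq)
 have kb: "kblock n (skp (Suc n) X)" "kblock n (hep (Suc n) X)"
  using X by (auto simp: kblock_def skp_def hep_def tlp_def cut_inn ent_un)
 have "D X * \<Xi> = D (skp (Suc n) X) * \<Xi> + \<i> *c (D (hep (Suc n) X) * \<Xi>)"
  by (simp add: D_su skp_su hep_su) (simp add: Dop_def ring_distribs)
 also have "\<dots> = \<Xi> * skp (Suc n) X - ent (skp (Suc n) X) n n *c \<Xi> + \<i> *c (\<Xi> * hep (Suc n) X - ent (hep (Suc n) X) n n *c \<Xi>)"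
  by (simp add: kequiv_su[OF \<Xi>] skp_su hep_su kb)
 also have "\<dots> = \<Xi> * (skp (Suc n) X + \<i> *c hep (Suc n) X + c *c un {..<Suc n})
   - ent (skp (Suc n) X + \<i> *c hep (Suc n) X + c *c un {..<Suc n}) n n *c \<Xi>"
  using \<Xi> by (simp add: kequiv_def ring_distribs ent_un sc_add_left sc_diff_right)
 finally show ?thesis unfolding X'[symmetric] .
qed

text \<open>Moves an equivariant map to the rotated copy of the isotropy group and takes the
  adjoint, so that it becomes a map out of the irreducible representation and can be evaluated at a
  highest weight vector.\<close>

definition rot :: "fmat => fmat" where "rot \<Xi> = adj (r (adj (cc n)) * \<Xi> * cc n)"

lemma rot_zero: "\<Xi> * un {..<Suc n} = \<Xi> ==> e * \<Xi> = \<Xi> ==> rot \<Xi> = 0 ==> \<Xi> = 0"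
proof -
 assume x: "\<Xi> * un {..<Suc n} = \<Xi>" "e * \<Xi> = \<Xi>" "rot \<Xi> = 0"
 have c: "cc n \<in> SU (Suc n)" by (rule cc_SU[OF n1])
 have "r (adj (cc n)) * \<Xi> * cc n = 0" using x(3) unfolding rot_def adj_eq_zero .
 then have "r (cc n) * (r (adj (cc n)) * \<Xi> * cc n) * adj (cc n) = 0" by simp
 moreover have "r (cc n) * (r (adj (cc n)) * \<Xi> * cc n) * adj (cc n) = (r (cc n) * r (adj (cc n))) * \<Xi> * (cc n * adj (cc n))"
  by (simp add: mult.assoc)
 ultimately show ?thesis using c x(1,2) by (simp add: r_adj rr UU_D[OF SU_UU])
qed

lemma rot_lincomb: "rot (a *c A + b *c B) = cnj a *c rot A + cnj b *c rot B"
 by (simp add: rot_def ring_distribs)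

lemma rot_un: "un {..<Suc n} * rot \<Xi> = rot \<Xi>" "rot \<Xi> * e = rot \<Xi>"
proof -
 have c: "cc n \<in> SU (Suc n)" by (rule cc_SU[OF n1])
 have "un {..<Suc n} * adj (cc n) = adj (cc n)" using UU_un(1)[OF UU_adj[OF SU_UU[OF c]]] .
 then show "un {..<Suc n} * rot \<Xi> = rot \<Xi>" by (simp add: rot_def assoc')
 have "adj (r (adj (cc n))) * e = adj (r (adj (cc n)))" using c by (simp add: r_adj er SU_adj)
 then show "rot \<Xi> * e = rot \<Xi>" by (simp add: rot_def mult.assoc)
qed

lemma rot_D:
 assumes \<Xi>: "kequiv n e r \<Xi>" and X: "kf n X \<kappa>"
 shows "rot \<Xi> * D X = (X - \<kappa> *c un {..<Suc n}) * rot \<Xi>"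
proof -
 have c: "cc n \<in> SU (Suc n)" by (rule cc_SU[OF n1])
 define Z where "Z = r (adj (cc n)) * \<Xi> * cc n"
 have DZ: "D X * Z = Z * X - \<kappa> *c Z" if X: "kf n X \<kappa>" for X \<kappa>
 proof -
  have inX: "inn (Suc n) X" using X by (simp add: kf_def)
  let ?Y = "cc n * X * adj (cc n)"
  have Y: "inn (Suc n) ?Y" using UU_D(1)[OF SU_UU[OF c]] inX by (simp add: inn_mult inn_adj)
  have Yc: "?Y * cc n = cc n * X" using UU_D(2)[OF SU_UU[OF c]] inX by (simp add: mult.assoc inn_un)
  have "D X * r (adj (cc n)) = r (adj (cc n)) * D ?Y"
   using c inX by (simp add: D_conj r_adj assoc' rr) (simp add: D_e mult.assoc)
  then have "D X * (r (adj (cc n)) * \<Xi> * cc n) = r (adj (cc n)) * (D ?Y * \<Xi>) * cc n"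
   by (simp add: assoc')
  also have "\<dots> = r (adj (cc n)) * (\<Xi> * ?Y - \<kappa> *c \<Xi>) * cc n"
   by (simp only: kequiv_D[OF \<Xi> Y kf_kblock(1)[OF n1 X]] kf_kblock(2)[OF n1 X])
  also have "\<dots> = r (adj (cc n)) * \<Xi> * (?Y * cc n) - \<kappa> *c (r (adj (cc n)) * \<Xi> * cc n)"
   by (simp add: ring_distribs mult.assoc)
  finally show ?thesis unfolding Yc Z_def by (simp add: mult.assoc)
 qed
 have "adj Z * D X = X * adj Z - \<kappa> *c adj Z"
  using arg_cong[OF DZ[OF kf_adj[OF X]], of adj] by (simp add: D_adj)
 moreover have "adj Z = rot \<Xi>" unfolding Z_def rot_def ..
 ultimately show ?thesis using rot_un(1) by (simp add: ring_distribs)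
qed

text \<open>Iwasawa decomposition: upper triangular matrices together with a conjugate of the
 complexified isotropy algebra span all matrices, so a functional equivariant under the latter is
 determined by its value at a highest weight vector.\<close>

lemma iwasawa:
 assumes T: "T * e = T" "\<And>X \<kappa>. kf n X \<kappa> ==> \<exists>M. T * D X = M * T" and v: "hwv v w" "T * v = 0"
 shows "T = 0"
proof -
 \<comment> \<open>Matrices that split into an upper triangular part and a part that passes through
   \<open>T\<close> as a left multiplication. The aim is that every matrix of the corner is of this
   kind.\<close>
 define S where "S = {X. \<exists>U K. X = U + K \<and> inn (Suc n) U \<and> utri U \<and> (\<exists>M. T * D K = M * T)}"
 have S_add: "X + Y \<in> S" if X: "X \<in> S" and Y: "Y \<in> S" for X Y
 proof -
  obtain U K M where U: "X = U + K" "inn (Suc n) U" "utri U" "T * D K = M * T" using X by (auto simp: S_def)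
  obtain U' K' M' where U': "Y = U' + K'" "inn (Suc n) U'" "utri U'" "T * D K' = M' * T" using Y by (auto simp: S_def)
  have "T * D (K + K') = (M + M') * T" using U(4) U'(4) by (simp add: D_add ring_distribs)
  then show ?thesis unfolding S_def using U U'
   by (intro CollectI exI[of _ "U + U'"] exI[of _ "K + K'"]) (auto simp: inn_add utri_def)
 qed
 have S_sc: "c *c X \<in> S" if X: "X \<in> S" for X c
 proof -
  obtain U K M where U: "X = U + K" "inn (Suc n) U" "utri U" "T * D K = M * T" using X by (auto simp: S_def)
  have "T * D (c *c K) = (c *c M) * T" using U(4) by (simp add: D_sc)
  then have "c *c X = c *c U + c *c K \<and> inn (Suc n) (c *c U) \<and> utri (c *c U) \<and> (\<exists>M. T * D (c *c K) = M * T)"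
   using U by (auto simp: inn_sc utri_def sc_add_right intro: exI[of _ "c *c M"])
  then show ?thesis unfolding S_def by blast
 qed
 have S0: "0 \<in> S" unfolding S_def
  by (intro CollectI exI[of _ 0]) (auto simp: inn_def utri_def intro!: exI[of _ 0])
 have S_upper: "U \<in> S" if "inn (Suc n) U" "utri U" for U
 proof -
  have "U = U + 0 \<and> inn (Suc n) U \<and> utri U \<and> T * D 0 = 0 * T" using that by simp
  then show ?thesis unfolding S_def by blast
 qed
 have S_k: "K \<in> S" if "kf n K \<kappa>" for K \<kappa>
 proof -
  have "K = 0 + K \<and> inn (Suc n) 0 \<and> utri 0 \<and> (\<exists>M. T * D K = M * T)"
   using T(2)[OF that] by (simp add: inn_def utri_def)
  then show ?thesis unfolding S_def by blast
 qed
 have S_eu: "eu i j \<in> S" if ij: "i < Suc n" "j < Suc n" for i j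
 proof -
  have u: "eu i j \<in> S" if "i \<le> j" "j < Suc n" for i j
   by (rule S_upper) (use that in \<open>auto simp: inn_eu utri_def\<close>)
  have diff: "X - Y \<in> S" if "X \<in> S" "Y \<in> S" for X Y
   using S_add[OF that(1) S_sc[OF that(2), of "-1"]] by simp
  have add: "X \<in> S" if "X - Y \<in> S" "Y \<in> S" for X Y using S_add[OF that] by simp
  \<comment> \<open>Below the diagonal, a unit with both indices strictly between 0 and
    \<open>n\<close> kills \<open>fv n\<close> itself. In the other cases it is combined with a unit
    above the diagonal so that the result and its adjoint kill \<open>fv n\<close> or, for
    \<open>eu n 0 + eu 0 n\<close>, fix it.\<close>
  consider "i \<le> j" | "0 < j" "j < i" "i < n" | "j = 0" "0 < i" "i < n" | "i = n" "0 < j" "j < n" | "i = n" "j = 0"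
   using ij by linarith
  then show ?thesis
  proof cases
   case 1 then show ?thesis using u ij by blast
  next
   case 2 then show ?thesis by (intro S_k[of _ 0]) (auto simp: kf_def fv_def inn_eu ring_distribs eu_mult)
  next
   case 3
   then have "eu i 0 - eu i n \<in> S"
    by (intro S_k[of _ 0]) (auto simp: kf_def fv_def inn_eu inn_diff ring_distribs eu_mult)
   then show ?thesis using add[of "eu i 0" "eu i n"] u[of i n] 3 by simp
  next
   case 4
   then have "eu n j - eu 0 j \<in> S"
    by (intro S_k[of _ 0]) (auto simp: kf_def fv_def inn_eu inn_diff ring_distribs eu_mult)
   then show ?thesis using add[of "eu n j" "eu 0 j"] u[of 0 j] 4 by simp
  next
   case 5
   have "eu n 0 + eu 0 n \<in> S"
    using n2 by (intro S_k[of _ 1]) (auto simp: kf_def fv_def inn_eu inn_add ring_distribs eu_mult)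
   from diff[OF this u[of 0 n]] show ?thesis using 5 by simp
  qed
 qed
 have S_all: "X \<in> S" if "inn (Suc n) X" for X
 proof -
  have sum: "sum f I \<in> S" if "finite I" "\<And>i. i \<in> I ==> f i \<in> S" for f :: "nat => fmat" and I
   using that by induction (auto simp: S0 S_add)
  show ?thesis by (subst fmat_expand[OF that]) (intro sum S_sc S_eu; simp)
 qed
 \<comment> \<open>In the first letter, the upper triangular part moves right towards
   \<open>v\<close> and the other part moves left through \<open>T\<close>; either way shorter words
   remain.\<close>
 have "T * wd D Xs v = 0" if "\<forall>X\<in>set Xs. inn (Suc n) X" for Xs using that
 proof (induction "length Xs" arbitrary: Xs rule: less_induct)
  case less
  show ?case
  proof (cases Xs)
   case Nil then show ?thesis using v by simp
  next
   case (Cons X Ys)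
   have inX: "inn (Suc n) X" and inY: "\<forall>X\<in>set Ys. inn (Suc n) X" using less(2) Cons by auto
   obtain U K M where U: "X = U + K" "inn (Suc n) U" "utri U" "T * D K = M * T"
    using S_all[OF inX] by (auto simp: S_def)
   have comm_inn: "\<forall>X\<in>set (Ys[k := U * Ys ! k - Ys ! k * U]). inn (Suc n) X" if "k < length Ys" for k
    using inY that U(2) by (auto dest!: set_update_subset_insert[THEN subsetD] simp: inn_diff inn_mult)
   have 0: "T * wd D Ys v = 0" by (rule less(1)) (use Cons inY in auto)
   have 1: "T * wd D (Ys[k := U * Ys ! k - Ys ! k * U]) v = 0" if "k < length Ys" for k
    by (rule less(1)) (use comm_inn[OF that] Cons in auto)
   have "T * (D U * wd D Ys v) = 0" unfolding commute_word[OF U(2) inY] hwv_utri[OF v(1) U(2,3)]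
    by (simp add: ring_distribs wd_sc 0 1 sum_distrib_left)
   moreover have "T * (D K * wd D Ys v) = 0" using mac[OF U(4), of "wd D Ys v"] 0 by (simp add: mult.assoc)
   ultimately show ?thesis by (simp add: Cons U(1) D_add ring_distribs)
  qed
 qed
 then have "T * e = 0 * e" using v(1) by (intro words_total[of v]) (auto simp: hwv_def)
 then show ?thesis using T(1) by simp
qed

lemma kequiv_rot_inj:
 assumes "kequiv n e r \<Xi>" "hwv v w" "rot \<Xi> * v = 0" shows "\<Xi> = 0"
proof -
 have "rot \<Xi> = 0" by (rule iwasawa[OF rot_un(2) _ assms(2,3)]) (use rot_D[OF assms(1)] in blast)
 then show ?thesis using assms(1) rot_zero by (simp add: kequiv_def)
qed

text \<open>The rotated isotropy algebra still contains \<open>eu j j\<close> for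
  \<open>0 < j < n\<close> and \<open>eu 0 0 + eu n n\<close>. Each of them acts on \<open>v\<close>
  by a weight and, on the other side of \<open>rot \<Xi>\<close>, on the coordinates of the
  value.\<close>

lemma rot_weights:
 assumes \<Xi>: "kequiv n e r \<Xi>" and v: "hwv v w"
 defines "y \<equiv> \<lambda>i. ent (rot \<Xi> * v) i 0"
 shows "\<And>i j. 0 < j ==> j < n ==> of_real (w j) * y i = (if i = j then y j else 0)"
  "\<And>j. 0 < j ==> j < n ==> of_real (w 0 + w n) * y j = - y j"
  "\<And>j. j = 0 \<or> j = n ==> of_real (w 0 + w n) * y j = 0"
proof -
 have y: "un {..<Suc n} * (rot \<Xi> * v) = rot \<Xi> * v" by (simp add: assoc' rot_un)
 {
  fix i j assume j: "0 < j" "j < n"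
  have "kf n (eu j j) 0" using j by (auto simp: kf_def fv_def inn_eu ring_distribs eu_mult)
  from rot_D[OF \<Xi> this] have "rot \<Xi> * (D (eu j j) * v) = eu j j * (rot \<Xi> * v)"
   by (simp add: assoc')
  then have "of_real (w j) *c (rot \<Xi> * v) = eu j j * (rot \<Xi> * v)" using v j by (simp add: hwv_def)
  from arg_cong[OF this, of "\<lambda>A. ent A i 0"]
  show "of_real (w j) * y i = (if i = j then y j else 0)" by (simp add: y_def ent_eu_times)
 }
 have "kf n (eu 0 0 + eu n n) 1" using n2 by (auto simp: kf_def fv_def inn_eu inn_add ring_distribs eu_mult)
 from rot_D[OF \<Xi> this]
 have "rot \<Xi> * (D (eu 0 0 + eu n n) * v) = (eu 0 0 + eu n n) * (rot \<Xi> * v) - rot \<Xi> * v"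
  using y by (simp add: assoc' ring_distribs)
 then have eq: "of_real (w 0 + w n) *c (rot \<Xi> * v) = (eu 0 0 + eu n n) * (rot \<Xi> * v) - rot \<Xi> * v"
  using v by (simp add: hwv_def D_add ring_distribs sc_add_left)
 show "of_real (w 0 + w n) * y j = - y j" if "0 < j" "j < n" for j
  using arg_cong[OF eq, of "\<lambda>A. ent A j 0"] that by (simp add: y_def ring_distribs ent_eu_times)
 show "of_real (w 0 + w n) * y j = 0" if "j = 0 \<or> j = n" for j
  using arg_cong[OF eq, of "\<lambda>A. ent A j 0"] that n2 by (auto simp: y_def ring_distribs ent_eu_times)
qed

text \<open>The two shapes of weight that \<open>rot_weights\<close> permits: in type A the value
  lives in the coordinates 0 and \<open>n\<close>, in type B in coordinate 1.\<close>

definition typeA :: "(nat => real) => bool" where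
 "typeA w \<longleftrightarrow> (\<forall>j. 0 < j --> j < n --> w j = 0) \<and> w 0 + w n = 0"
definition typeB :: "(nat => real) => bool" where
 "typeB w \<longleftrightarrow> w 1 = 1 \<and> (\<forall>j. 1 < j --> j < n --> w j = 0) \<and> w 0 + w n = -1"

lemma ent_rot_ge: "n < i ==> ent (rot \<Xi> * v) i j = 0"
proof -
 assume "n < i"
 have "ent (rot \<Xi> * v) i j = ent (un {..<Suc n} * (rot \<Xi> * v)) i j" by (simp add: assoc' rot_un)
 then show ?thesis using \<open>n < i\<close> by (simp add: ent_un_times)
qed

lemma kequiv_type:
 assumes \<Xi>: "kequiv n e r \<Xi>" "\<Xi> \<noteq> 0" and v: "hwv v w"
 shows "typeA w \<or> typeB w"
proof -
 define y where "y i = ent (rot \<Xi> * v) i 0" for i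
 note eqs = rot_weights[OF \<Xi>(1) v, folded y_def]
 have "rot \<Xi> * v \<noteq> 0" using kequiv_rot_inj[OF \<Xi>(1) v] \<Xi>(2) by blast
 moreover have "col (rot \<Xi> * v)" using v by (simp add: hwv_def col_mult)
 ultimately obtain i where i: "y i \<noteq> 0"
  unfolding y_def col_def by (metis ent_times_eu ent_zero fmat_eqI)
 then have "i \<le> n" using ent_rot_ge unfolding y_def by (meson not_le)
 then consider "0 < i" "i < n" | "i = 0 \<or> i = n" by linarith
 then show ?thesis
 proof cases
  case 1
  have wi: "w i = 1" using eqs(1)[OF 1, of i] i by simp
  have wj: "w j = 0" if "0 < j" "j < n" "j \<noteq> i" for j using eqs(1)[OF that(1,2), of i] i that by simp
  have "complex_of_real (w 0 + w n) = - 1" using eqs(2)[OF 1] i by (metis mult_cancel_right mult_minus1)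
  then have "complex_of_real (w 0 + w n) = of_real (- 1)" by simp
  then have w0: "w 0 + w n = -1" unfolding of_real_eq_iff .
  \<comment> \<open>Dominance: the entry 1 at a later index would exceed the entry 0 at index
    1.\<close>
  have "i = 1"
  proof (rule ccontr)
   assume "i \<noteq> 1"
   then have "w i \<le> w 1" using hwv_dom[OF v, of 1 i] 1 by simp
   then show False using wi wj[of 1] \<open>i \<noteq> 1\<close> 1 by simp
  qed
  then show ?thesis using wi wj w0 by (auto simp: typeB_def)
 next
  case 2
  have wj: "w j = 0" if "0 < j" "j < n" for j using eqs(1)[OF that(1,2), of i] i that 2 by auto
  have "complex_of_real (w 0 + w n) = 0" using eqs(3)[OF 2] i by simp
  then have "w 0 + w n = 0" unfolding of_real_eq_0_iff .
  then show ?thesis using wj by (auto simp: typeA_def)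
 qed
qed

lemma typeB_rot:
 assumes \<Xi>: "kequiv n e r \<Xi>" and v: "hwv v w" "typeB w"
 obtains z where "rot \<Xi> * v = z *c eu 1 0"
proof -
 define y where "y i = ent (rot \<Xi> * v) i 0" for i
 note eqs = rot_weights[OF \<Xi>(1) v(1), folded y_def]
 have "y i = 0" if "i \<noteq> 1" for i
 proof (cases "n < i")
  case True then show ?thesis by (simp add: y_def ent_rot_ge)
 next
  case False
  have "of_real (w 1) * y i = 0" using eqs(1)[of 1 i] n2 that by simp
  then show ?thesis using v(2) by (simp add: typeB_def)
 qed
 moreover have "ent (rot \<Xi> * v) i j = 0" if "j \<noteq> 0" for i j
  using v(1) that unfolding hwv_def by (metis col_mult col_def ent_times_eu)
 ultimately have "ent (rot \<Xi> * v) i j = ent (y 1 *c eu 1 0) i j" for i j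
  by (cases "j = 0"; cases "i = 1") (auto simp: y_def)
 then have "rot \<Xi> * v = y 1 *c eu 1 0" by (rule fmat_eqI)
 then show ?thesis using that by blast
qed

lemma lastcol_rot:
 assumes "\<Xi> * eu n n = \<Xi>" "col v" obtains z where "rot \<Xi> * v = z *c fv n"
proof -
 have "rot \<Xi> * v = adj (cc n) * (adj \<Xi> * adj (r (adj (cc n))) * v)" by (simp add: rot_def mult.assoc)
 also have "adj \<Xi> = eu n n * adj \<Xi>" using arg_cong[OF assms(1), of adj] by simp
 also have "eu n n * adj \<Xi> * adj (r (adj (cc n))) * v = eu n n * (adj \<Xi> * adj (r (adj (cc n))) * v) * eu 0 0"
  using col_mult[OF assms(2)] by (simp add: mult.assoc col_def)
 also have "adj (cc n) * \<dots> = (ent (adj \<Xi> * adj (r (adj (cc n))) * v) n 0 * of_real (1 / sqrt 2)) *c fv n"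
  unfolding eu_sandwich using cc_fv(2)[OF n1] by simp
 finally show ?thesis using that by blast
qed

text \<open>A map supported in the last column has its value on the line of \<open>fv n\<close>,
  which involves coordinate 0, whereas type B forces the value onto the line of
  \<open>eu 1 0\<close>.\<close>

lemma lastcol_typeA:
 assumes \<Xi>: "kequiv n e r \<Xi>" "\<Xi> \<noteq> 0" "\<Xi> * eu n n = \<Xi>" and v: "hwv v w"
 shows "typeA w"
proof (rule ccontr)
 assume "\<not> typeA w"
 then have B: "typeB w" using kequiv_type[OF \<Xi>(1,2) v] by blast
 obtain z where z: "rot \<Xi> * v = z *c fv n" using lastcol_rot[OF \<Xi>(3)] v by (auto simp: hwv_def)
 obtain z' where z': "rot \<Xi> * v = z' *c eu 1 0" using typeB_rot[OF \<Xi>(1) v B] .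
 have "z = 0" using arg_cong[OF z, of "\<lambda>A. ent A 0 0"] unfolding z' by (simp add: fv_def)
   (use n2 in auto)
 then show False using kequiv_rot_inj[OF \<Xi>(1) v] z \<Xi>(2) by simp
qed

text \<open>If both values lie on one line, some combination has value 0 and vanishes by
  \<open>kequiv_rot_inj\<close>. The coefficients are conjugated because \<open>rot\<close> is
  antilinear.\<close>

lemma mult_one:
 assumes \<Xi>: "kequiv n e r A" "kequiv n e r B" and v: "hwv v w"
  and z: "rot A * v = a *c z" "rot B * v = b *c z"
 shows "\<exists>s t. (s \<noteq> 0 \<or> t \<noteq> 0) \<and> s *c A + t *c B = 0"
proof (cases "b = 0")
 case True
 then have "B = 0" using kequiv_rot_inj[OF \<Xi>(2) v] z by simp
 then show ?thesis by (intro exI[of _ 0] exI[of _ 1]) simp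
next
 case False
 have "rot (cnj b *c A + (- cnj a) *c B) * v = 0"
  unfolding rot_lincomb by (simp add: ring_distribs z mult.commute)
 then have "cnj b *c A + (- cnj a) *c B = 0" by (rule kequiv_rot_inj[OF kequiv_lincomb[OF \<Xi>] v])
 then show ?thesis using False by (metis complex_cnj_zero_iff)
qed

lemma mult_typeB:
 assumes "kequiv n e r A" "kequiv n e r B" "hwv v w" "typeB w"
 shows "\<exists>s t. (s \<noteq> 0 \<or> t \<noteq> 0) \<and> s *c A + t *c B = 0"
 using typeB_rot[OF assms(1,3,4)] typeB_rot[OF assms(2,3,4)] mult_one[OF assms(1-3)] by metis

lemma mult_lastcol:
 assumes "kequiv n e r A" "kequiv n e r B" "A * eu n n = A" "B * eu n n = B" "hwv v w"
 shows "\<exists>s t. (s \<noteq> 0 \<or> t \<noteq> 0) \<and> s *c A + t *c B = 0"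
 using lastcol_rot[OF assms(3)] lastcol_rot[OF assms(4)] mult_one[OF assms(1,2,5)] assms(5)
 unfolding hwv_def by metis

end

section \<open>The two families of weights and their Casimir scalars\<close>

definition wA :: "nat => nat => nat => real" where
 "wA n k i = (if i = 0 then real k else if i = n then - real k else 0)"
definition wB :: "nat => nat => nat => real" where
 "wB n k i = (if i = 0 then real k else if i = 1 then 1 else if i = n then - real k - 1 else 0)"

lemma (in urep) hwv_cong: "(\<And>i. i < N ==> w i = w' i) ==> hwv v w ==> hwv v w'"
 by (simp add: hwv_def)

text \<open>As \<open>n \<ge> 2\<close>, index 1 lies strictly between 0 and \<open>n\<close>, so
  \<open>w 1 = 0\<close>; integrality of differences and dominance then make \<open>w 0\<close> a
  natural number.\<close>

lemma (in kirr) typeA_wA: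
 assumes v: "hwv v w" "typeA w" obtains k where "hwv v (wA n k)"
proof -
 have "w 0 - w 1 \<in> \<int>" "w 1 \<le> w 0" using hwv_int[OF v(1), of 0 1] hwv_dom[OF v(1), of 0 1] n2 by auto
 moreover have "w 1 = 0" using v(2) n2 by (simp add: typeA_def)
 ultimately have "w 0 \<in> \<nat>" by (simp add: Nats_altdef2)
 then obtain k where k: "w 0 = real k" by (auto simp: Nats_def)
 have "hwv v (wA n k)" by (rule hwv_cong[OF _ v(1)]) (use v(2) k n2 in \<open>auto simp: wA_def typeA_def\<close>)
 then show ?thesis using that by blast
qed

lemma (in kirr) typeB_wB:
 assumes v: "hwv v w" "typeB w" obtains k where "k \<ge> 1" "hwv v (wB n k)"
proof -
 have "w 0 - w 1 \<in> \<int>" "w 1 \<le> w 0" using hwv_int[OF v(1), of 0 1] hwv_dom[OF v(1), of 0 1] n2 by auto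
 moreover have "w 1 = 1" using v(2) by (simp add: typeB_def)
 ultimately have "w 0 \<in> \<int>" "1 \<le> w 0" by (metis Ints_1 Ints_add diff_add_cancel, simp)
 then have "w 0 \<in> \<nat>" by (simp add: Nats_altdef2)
 then obtain k where k: "w 0 = real k" by (auto simp: Nats_def)
 have "hwv v (wB n k)" by (rule hwv_cong[OF _ v(1)]) (use v(2) k n2 in \<open>auto simp: wB_def typeB_def\<close>)
 then show ?thesis using that[of k] k \<open>1 \<le> w 0\<close> by simp
qed

text \<open>Collecting the pairwise differences by index gives the coordinates
  \<open>n - 2 i\<close> of \<open>2 rho\<close>.\<close>

lemma casc_Suc: "casc (Suc n) w = (\<Sum>i\<le>n. (w i)\<^sup>2 + w i * (real n - 2 * real i))"
proof -
 have "(\<Sum>i<N. \<Sum>j<N. if i = j then (w i)\<^sup>2 else if i < j then w i - w j else 0)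
  = (\<Sum>i<N. (w i)\<^sup>2 + w i * (real N - 1 - 2 * real i))" for N
 proof (induction N)
  case (Suc N)
  have "(\<Sum>i<Suc N. \<Sum>j<Suc N. if i = j then (w i)\<^sup>2 else if i < j then w i - w j else 0)
   = (\<Sum>i<N. (\<Sum>j<N. if i = j then (w i)\<^sup>2 else if i < j then w i - w j else 0) + (w i - w N)) + (w N)\<^sup>2"
   by (simp add: sum.distrib)
  also have "\<dots> = (\<Sum>i<N. (w i)\<^sup>2 + w i * (real N - 1 - 2 * real i)) + (\<Sum>i<N. w i) - real N * w N + (w N)\<^sup>2"
   by (simp add: sum.distrib Suc sum_subtractf)
  also have "\<dots> = (\<Sum>i<N. (w i)\<^sup>2 + w i * (real (Suc N) - 1 - 2 * real i)) - real N * w N + (w N)\<^sup>2"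
   by (simp add: sum.distrib ring_distribs sum_subtractf)
  finally show ?case by (simp add: algebra_simps power2_eq_square)
 qed simp
 from this[of "Suc n"] show ?thesis unfolding casc_def by (simp add: lessThan_Suc_atMost)
qed

lemma casc_wA: "n \<ge> 1 ==> casc (Suc n) (wA n k) = 2 * real k * (real k + real n)"
proof -
 assume n: "n \<ge> 1"
 have "casc (Suc n) (wA n k) = (\<Sum>i\<in>{0, n}. (wA n k i)\<^sup>2 + wA n k i * (real n - 2 * real i))"
  unfolding casc_Suc by (rule sum.mono_neutral_right) (auto simp: wA_def)
 then show ?thesis using n by (simp add: wA_def algebra_simps power2_eq_square)
qed

lemma casc_wB: "n \<ge> 2 ==> casc (Suc n) (wB n k) = 2 * (real k + 1) * (real k + real n)"
proof -
 assume n: "n \<ge> 2"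
 have "casc (Suc n) (wB n k) = (\<Sum>i\<in>{0, 1, n}. (wB n k i)\<^sup>2 + wB n k i * (real n - 2 * real i))"
  unfolding casc_Suc by (rule sum.mono_neutral_right) (use n in \<open>auto simp: wB_def\<close>)
 then show ?thesis using n by (simp add: wB_def algebra_simps power2_eq_square)
qed

section \<open>Tensor powers\<close>

text \<open>Pairs of indices are coded as single natural numbers, so that tensor products stay in
  the type.\<close>

definition kron :: "fmat => fmat => fmat" where
 "kron A B = Fmat (\<lambda>a b. ent A (fst (prod_decode a)) (fst (prod_decode b)) * ent B (snd (prod_decode a)) (snd (prod_decode b)))"
text \<open>Tensors a column vector onto each column of \<open>Y\<close> without recoding the column
  index; thus inner products factor as in \<open>rk_adj_rk\<close>.\<close>

definition rk :: "fmat => fmat => fmat" where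
 "rk u Y = Fmat (\<lambda>a b. ent u (fst (prod_decode a)) 0 * ent Y (snd (prod_decode a)) b)"

definition PX :: "nat set => nat set => nat set" where "PX A B = prod_encode ` (A \<times> B)"

lemma PX_iff: "a \<in> PX A B \<longleftrightarrow> fst (prod_decode a) \<in> A \<and> snd (prod_decode a) \<in> B"
 unfolding PX_def by (metis (no_types, lifting) SigmaE SigmaI fst_conv imageE image_eqI prod.collapse prod_decode_inverse prod_encode_inverse snd_conv)
lemma finite_PX: "finite A ==> finite B ==> finite (PX A B)" by (simp add: PX_def)
lemma sum_PX: "(\<Sum>a\<in>PX A B. f a) = (\<Sum>i\<in>A. \<Sum>j\<in>B. f (prod_encode (i, j)))"
 unfolding PX_def by (subst sum.reindex) (auto simp: inj_prod_encode sum.cartesian_product intro!: sum.cong)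

lemma ent_kron: "ent (kron A B) a b = ent A (fst (prod_decode a)) (fst (prod_decode b)) * ent B (snd (prod_decode a)) (snd (prod_decode b))"
proof -
 obtain n where n: "inn n A" "inn n B" using inn_ex2 by blast
 show ?thesis unfolding kron_def
  by (subst Fmat_finite[of "PX {..<n} {..<n}"]) (use n in \<open>auto simp: finite_PX PX_iff inn_def not_le[symmetric]\<close>)
qed

lemma ent_rk: "ent (rk u Y) a b = ent u (fst (prod_decode a)) 0 * ent Y (snd (prod_decode a)) b"
proof -
 obtain n where n: "inn n u" "inn n Y" using inn_ex2 by blast
 show ?thesis unfolding rk_def
  by (subst Fmat_finite[of "PX {..<n} {..<n} \<union> {..<n}"]) (use n in \<open>auto simp: finite_PX PX_iff inn_def not_le[symmetric]\<close>)
qed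

lemma kron_mult: "kron A B * kron C D = kron (A * C) (B * D)"
proof (rule fmat_eqI)
 fix a b
 obtain n where n: "inn n A" "inn n B" using inn_ex2 by blast
 have "ent (kron A B * kron C D) a b = (\<Sum>c\<in>PX {..<n} {..<n}. ent (kron A B) a c * ent (kron C D) c b)"
  by (rule ent_times_S) (use n in \<open>auto simp: finite_PX PX_iff ent_kron inn_def not_le[symmetric]\<close>)
 also have "\<dots> = (\<Sum>i<n. ent A (fst (prod_decode a)) i * ent C i (fst (prod_decode b))) *
   (\<Sum>j<n. ent B (snd (prod_decode a)) j * ent D j (snd (prod_decode b)))"
  unfolding sum_PX sum_product by (intro sum.cong) (auto simp: ent_kron mult_ac)
 finally show "ent (kron A B * kron C D) a b = ent (kron (A * C) (B * D)) a b"
  using n by (simp add: ent_kron ent_times_n[of n])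
qed

lemma kron_rk: "kron A B * rk u Y = rk (A * u) (B * Y)"
proof (rule fmat_eqI)
 fix a b
 obtain n where n: "inn n A" "inn n B" using inn_ex2 by blast
 have "ent (kron A B * rk u Y) a b = (\<Sum>c\<in>PX {..<n} {..<n}. ent (kron A B) a c * ent (rk u Y) c b)"
  by (rule ent_times_S) (use n in \<open>auto simp: finite_PX PX_iff ent_kron inn_def not_le[symmetric]\<close>)
 also have "\<dots> = (\<Sum>i<n. ent A (fst (prod_decode a)) i * ent u i 0) *
   (\<Sum>j<n. ent B (snd (prod_decode a)) j * ent Y j b)"
  unfolding sum_PX sum_product by (intro sum.cong) (auto simp: ent_kron ent_rk mult_ac)
 finally show "ent (kron A B * rk u Y) a b = ent (rk (A * u) (B * Y)) a b"
  using n by (simp add: ent_rk ent_times_n[of n])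
qed

lemma rk_adj_rk: "adj (rk u Y) * rk u' Y' = ip u u' *c (adj Y * Y')"
proof (rule fmat_eqI)
 fix a b
 obtain n where n: "inn n u" "inn n Y" using inn_ex2 by blast
 have "ent (adj (rk u Y) * rk u' Y') a b = (\<Sum>c\<in>PX {..<n} {..<n}. ent (adj (rk u Y)) a c * ent (rk u' Y') c b)"
  by (rule ent_times_S) (use n in \<open>auto simp: finite_PX PX_iff ent_rk inn_def not_le[symmetric]\<close>)
 also have "\<dots> = (\<Sum>i<n. cnj (ent u i 0) * ent u' i 0) * (\<Sum>j<n. cnj (ent Y j a) * ent Y' j b)"
  unfolding sum_PX sum_product by (intro sum.cong) (auto simp: ent_rk mult_ac)
 finally show "ent (adj (rk u Y) * rk u' Y') a b = ent (ip u u' *c (adj Y * Y')) a b"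
  using n inn_adj[of n u] inn_adj[of n Y] by (simp add: ip_def ent_times_n[of n])
qed

lemma rk_mult: "rk u Y * Z = rk u (Y * Z)"
proof (rule fmat_eqI)
 fix a b
 obtain n where n: "inn n Z" using inn_ex by blast
 show "ent (rk u Y * Z) a b = ent (rk u (Y * Z)) a b"
  using n by (simp add: ent_rk ent_times_n[of n] sum_distrib_left mult.assoc)
qed

lemma kron_lin: "kron (A + A') B = kron A B + kron A' B" "kron A (B + B') = kron A B + kron A B'"
 "kron (c *c A) B = c *c kron A B" "kron A (c *c B) = c *c kron A B"
 "kron (A - A') B = kron A B - kron A' B" "kron (- A) B = - kron A B" "kron A (- B) = - kron A B"
 "kron 0 B = 0" "kron A 0 = 0" by (rule fmat_eqI; simp add: ent_kron ring_distribs)+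
lemma rk_lin: "rk (A + A') B = rk A B + rk A' B" "rk A (B + B') = rk A B + rk A B'"
 "rk (c *c A) B = c *c rk A B" "rk A (c *c B) = c *c rk A B"
 "rk (- A) B = - rk A B" "rk A (- B) = - rk A B"
 "rk (A - A') B = rk A B - rk A' B" "rk A (B - B') = rk A B - rk A B'"
 "rk 0 B = 0" "rk A 0 = 0" by (rule fmat_eqI; simp add: ent_rk ring_distribs)+
lemma rk_sum: "rk (sum f S) B = (\<Sum>i\<in>S. rk (f i) B)" "rk A (sum f S) = (\<Sum>i\<in>S. rk A (f i))"
 by (rule fmat_eqI; simp add: ent_rk sum_distrib_left sum_distrib_right)+
lemma kron_adj: "adj (kron A B) = kron (adj A) (adj B)" by (rule fmat_eqI) (simp add: ent_kron)
lemma code_eq: "a = b \<longleftrightarrow> fst (prod_decode a) = fst (prod_decode b) \<and> snd (prod_decode a) = snd (prod_decode b)"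
 by (simp add: prod_eq_iff[symmetric] inj_eq[OF inj_prod_decode])
lemma kron_un: "finite A ==> finite B ==> kron (un A) (un B) = un (PX A B)"
proof (rule fmat_eqI)
 fix a b assume "finite A" "finite B"
 then show "ent (kron (un A) (un B)) a b = ent (un (PX A B)) a b"
  using code_eq[of a b] by (auto simp: ent_kron ent_un finite_PX PX_iff)
qed
lemma tr_kron: "tr (kron A B) = tr A * tr B"
proof -
 obtain n where n: "inn n A" "inn n B" using inn_ex2 by blast
 have "tr (kron A B) = (\<Sum>c\<in>PX {..<n} {..<n}. ent (kron A B) c c)"
  by (rule tr_S) (use n in \<open>auto simp: finite_PX PX_iff ent_kron inn_def not_le[symmetric]\<close>)
 also have "\<dots> = tr A * tr B" unfolding sum_PX tr_n[OF n(1)] tr_n[OF n(2)] sum_product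
  by (intro sum.cong) (auto simp: ent_kron)
 finally show ?thesis .
qed
lemma norm_kron: "norm (kron A B) = norm A * norm B"
proof -
 have "complex_of_real ((norm (kron A B))\<^sup>2) = of_real ((norm A * norm B)\<^sup>2)"
  unfolding tr_adj_self_norm[symmetric] kron_adj kron_mult tr_kron
  by (simp add: tr_adj_self_norm power_mult_distrib)
 then show ?thesis unfolding of_real_eq_iff by simp
qed
lemma bounded_bilinear_kron: "bounded_bilinear kron"
proof
 show "\<exists>K. \<forall>a b. norm (kron a b) \<le> norm a * norm b * K"
  by (rule exI[of _ 1]) (simp add: norm_kron)
qed (simp_all add: kron_lin scaleR_fmat_def)
lemma norm_cj: "norm (cj A) = norm A"
proof -
 have "complex_of_real ((norm (cj A))\<^sup>2) = of_real ((norm A)\<^sup>2)"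
  using tr_cj[of "adj A * A"] tr_adj_self_norm[of A] tr_adj_self_norm[of "cj A"] by (simp add: cj_adj)
 then show ?thesis unfolding of_real_eq_iff by simp
qed
lemma bounded_linear_cj: "bounded_linear cj"
 by (rule bounded_linear_intro[where K = 1]) (simp_all add: scaleR_fmat_def norm_cj)

text \<open>A pattern is a list of letters; letter 1 stands for the complex conjugate of the standard
 representation, all other letters for the standard representation. Letters 0 and 2 differ in the
 vectors \<open>xv\<close> below, where they carry independent arguments.\<close>

definition lt :: "nat => fmat => fmat" where "lt c g = (if c = 1 then cj g else g)"
definition lv :: "nat => fmat => fmat => fmat" where
 "lv c z v = (if c = 1 then cj z else if c = 2 then v else z)"
text \<open>On \<open>su N\<close> the value \<open>- cj (adj X)\<close> equals \<open>cj X\<close>,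
  the differential of conjugation; in this form, as minus the transpose, it is complex linear in
  \<open>X\<close>.\<close>

definition lD :: "nat => fmat => fmat" where "lD c X = (if c = 1 then - cj (adj X) else X)"

fun rho :: "nat list => fmat => fmat" where
 "rho [] g = eu 0 0" | "rho (c # s) g = kron (lt c g) (rho s g)"
fun xv :: "nat list => fmat => fmat => fmat" where
 "xv [] z v = eu 0 0" | "xv (c # s) z v = rk (lv c z v) (xv s z v)"
fun IX :: "nat => nat list => nat set" where
 "IX N [] = {0}" | "IX N (c # s) = PX {..<N} (IX N s)"
fun Ds :: "nat => nat list => fmat => fmat" where
 "Ds N [] X = 0" | "Ds N (c # s) X = kron (lD c X) (un (IX N s)) + kron (un {..<N}) (Ds N s X)"

lemma finite_IX [simp]: "finite (IX N s)" by (induction s) (auto simp: finite_PX)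
lemma rho_one: "rho s (un {..<N}) = un (IX N s)"
proof (induction s)
 case Nil show ?case by (simp add: un_sum)
qed (simp add: lt_def kron_un)
lemma rho_mult: "rho s (g * h) = rho s g * rho s h" by (induction s) (simp_all add: lt_def kron_mult eu_mult)
lemma rho_adj: "rho s (adj g) = adj (rho s g)" by (induction s) (simp_all add: lt_def kron_adj cj_adj)
lemma rho_cont: "continuous_on A (rho s)"
proof (induction s)
 case (Cons c s)
 have "continuous_on A (lt c)" unfolding lt_def
  by (cases "c = 1") (auto intro: linear_continuous_on bounded_linear_cj)
 then show ?case using Cons by (simp add: bounded_bilinear.continuous_on[OF bounded_bilinear_kron])
qed simp
lemma rho_xv: "rho s g * xv s z v = xv s (g * z) (g * v)"
 by (induction s) (auto simp: lt_def lv_def kron_rk eu_mult)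
lemma col_xv: "col (xv s z v)" by (induction s) (auto simp: col_def rk_mult eu_mult)
lemma rho_un: "inn N g ==> un (IX N s) * rho s g = rho s g" "inn N g ==> rho s g * un (IX N s) = rho s g"
 unfolding rho_one[symmetric] rho_mult[symmetric] by (simp_all add: inn_un)
lemma xv_un: "un {..<N} * z = z ==> un {..<N} * v = v ==> un (IX N s) * xv s z v = xv s z v"
 unfolding rho_one[symmetric] rho_xv by simp

lemma urep_rho: "N > 0 ==> urep N (un (IX N s)) (rho s)"
 by unfold_locales (auto simp: proj_un rho_mult rho_one rho_adj rho_cont)

lemma rho_deriv:
 assumes X: "X \<in> su N"
 shows "((\<lambda>t. rho s (Ex N X t)) has_vector_derivative Ds N s X) (at 0)"
proof (induction s)
 case (Cons c s)
 have o: "(Ex N X has_vector_derivative X) (at 0)" "Ex N X 0 = un {..<N}"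
  using Ex_oneparam[OF X] by (auto simp: oneparam_def)
 have 1: "((\<lambda>t. lt c (Ex N X t)) has_vector_derivative lD c X) (at 0)"
  using o bounded_linear.has_vector_derivative[OF bounded_linear_cj o(1)] suD(2)[OF X] by (auto simp: lt_def lD_def)
 show ?case using bounded_bilinear.has_vector_derivative[OF bounded_bilinear_kron 1 Cons]
  by (simp add: o(2) rho_one lt_def add.commute cong: if_cong)
qed simp

lemma Ds_lin: "Ds N s (X + Y) = Ds N s X + Ds N s Y" "Ds N s (c *c X) = c *c Ds N s X"
 by (induction s) (auto simp: lD_def kron_lin sc_add_right cj_adj algebra_simps)

text \<open>A conjugate letter contributes -1 and any other letter +1. A balanced pattern therefore
  kills scalars, as \<open>Dop\<close> does, and \<open>Ds\<close> computes \<open>Dop\<close> on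
  the whole corner.\<close>

lemma Ds_one: "Ds N s (un {..<N}) = (of_nat (count_list s 0) + of_nat (count_list s 2) - of_nat (count_list s 1)) *c un (IX N s)"
 if "set s \<subseteq> {0,1,2}" using that
proof (induction s)
 case (Cons c s)
 have kk: "kron (un {..<N}) (un (IX N s)) = un (PX {..<N} (IX N s))" by (simp add: kron_un)
 have "kron (lD c (un {..<N})) (un (IX N s)) = (if c = 1 then -1 else 1) *c un (PX {..<N} (IX N s))"
  by (simp add: lD_def kron_lin kk)
 then have "Ds N (c # s) (un {..<N}) = ((if c = 1 then -1 else 1) +
   (of_nat (count_list s 0) + of_nat (count_list s 2) - of_nat (count_list s 1))) *c un (PX {..<N} (IX N s))"
  using Cons by (simp only: Ds.simps kron_lin kk sc_add_left) (simp add: kron_lin kk)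
 moreover have "(if c = 1 then -1 else 1) + (of_nat (count_list s 0) + of_nat (count_list s 2) - of_nat (count_list s 1)) =
   (of_nat (count_list (c # s) 0) + of_nat (count_list (c # s) 2) - of_nat (count_list (c # s) 1) :: complex)"
  using Cons(2) by auto
 ultimately show ?case by simp
qed simp

lemma Dop_rho:
 assumes N: "N > 0" and s: "set s \<subseteq> {0,1,2}" "count_list s 0 + count_list s 2 = count_list s 1" and X: "inn N X"
 shows "Dop N (un (IX N s)) (rho s) X = Ds N s X"
proof -
 interpret urep N "un (IX N s)" "rho s" by (rule urep_rho[OF N])
 have L: "L X = Ds N s X" if "X \<in> su N" for X
  using oneparam_vd[OF L_oneparam[OF that]] rho_deriv[OF that] vd_unique by metis
 have 0: "Ds N s (un {..<N}) = 0" unfolding Ds_one[OF s(1)] using s(2) by (metis diff_self of_nat_add sc_0)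
 have "D X = Ds N s (tlp N X)" by (simp add: Dop_def L skp_su hep_su N skp_hep Ds_lin)
 moreover have "Ds N s X = Ds N s (tlp N X) + (tr X / of_nat N) *c Ds N s (un {..<N})"
  unfolding Ds_lin(2)[symmetric] Ds_lin(1)[symmetric] using X by (simp add: tlp_def cut_inn)
 ultimately show ?thesis using 0 by simp
qed

lemma Ds_rk: "un (IX N s) * Y = Y ==> un {..<N} * u = u ==>
 Ds N (c # s) X * rk u Y = rk (lD c X * u) Y + rk u (Ds N s X * Y)" by (simp add: ring_distribs kron_rk)

text \<open>Only conjugate letters lower a diagonal eigenvalue, each by at most 1. At
  \<open>i = n\<close> this will cap the index of the weights occurring in a model.\<close>

lemma Ds_diag:
 assumes "set s \<subseteq> {0,1,2}"
 shows "\<exists>d. (\<forall>a b. ent (Ds N s (eu i i)) a b = (if a = b then complex_of_real (d a) else 0)) \<and>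
  (\<forall>a. - real (count_list s 1) \<le> d a)" using assms
proof (induction s)
 case Nil then show ?case by (intro exI[of _ "\<lambda>_. 0"]) simp
next
 case (Cons c s)
 then obtain d where d: "\<And>a b. ent (Ds N s (eu i i)) a b = (if a = b then complex_of_real (d a) else 0)"
  "\<And>a. - real (count_list s 1) \<le> d a" by auto
 define d' where "d' a = (if fst (prod_decode a) = i \<and> snd (prod_decode a) \<in> IX N s then if c = 1 then -1 else 1 else 0)
  + (if fst (prod_decode a) < N then d (snd (prod_decode a)) else 0)" for a
 have eq: "prod_decode a = prod_decode b \<longleftrightarrow> a = b" for a b by (metis prod_decode_inverse)
 have "ent (Ds N (c # s) (eu i i)) a b = (if a = b then complex_of_real (d' a) else 0)" for a b
  by (auto simp: ent_kron lD_def d ent_un d'_def eq[of a b, symmetric] prod_eq_iff)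
 moreover have "- real (count_list (c # s) 1) \<le> d' a" for a
  using d(2)[of "snd (prod_decode a)"] by (auto simp: d'_def)
 ultimately show ?case by blast
qed

lemma Ds_eigen_ge:
 assumes "set s \<subseteq> {0,1,2}" "Ds N s (eu i i) * v = of_real x *c v" "v \<noteq> 0"
 shows "- real (count_list s 1) \<le> x"
proof -
 obtain d where d: "\<And>a b. ent (Ds N s (eu i i)) a b = (if a = b then complex_of_real (d a) else 0)"
  "\<And>a. - real (count_list s 1) \<le> d a" using Ds_diag[OF assms(1)] by blast
 obtain a b where ab: "ent v a b \<noteq> 0" using assms(3) by (auto simp: fmat_eq_iff)
 have "ent (Ds N s (eu i i) * v) a b = of_real (d a) * ent v a b"
  by (subst ent_times_S[of "{a}"]) (auto simp: d split: if_splits)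
 then have "complex_of_real (d a) = of_real x" using assms(2) ab by simp
 then show ?thesis using d(2)[of a] by simp
qed

text \<open>Coordinate \<open>a\<close> of the pure tensor \<open>xv\<close> as a function of
  \<open>(z, v)\<close>: a monomial in \<open>z\<close>, \<open>cnj z\<close> and \<open>v\<close>.
  It is multiplicative in the pair, which makes \<open>dedekind\<close> applicable.\<close>

fun chi :: "nat list => nat => (nat => complex) \<times> (nat => complex) => complex" where
 "chi [] a zv = 1"
| "chi (c # s) a zv = (let i = fst (prod_decode a) in if c = 1 then cnj (fst zv i) else if c = 2 then snd zv i else fst zv i) *
  chi s (snd (prod_decode a)) zv"

definition cv :: "nat => (nat => complex) => fmat" where "cv N f = (\<Sum>i<N. f i *c eu i 0)"
lemma ent_cv: "ent (cv N f) i j = (if i < N \<and> j = 0 then f i else 0)"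
 unfolding cv_def by (auto simp: if_distrib cong: if_cong)
lemma col_cv: "col (cv N f)" by (simp add: col_def fmat_eq_iff ent_times_eu ent_cv)
lemma cv_un: "un {..<N} * cv N f = cv N f" by (rule fmat_eqI) (simp add: ent_un_times ent_cv)
lemma cv_ent: "col z ==> un {..<N} * z = z ==> z = cv N (\<lambda>i. ent z i 0)"
 by (rule fmat_eqI) (metis col_def ent_cv ent_times_eu ent_un_times finite_lessThan lessThan_iff)

lemma xv_chi: "ent (xv s (cv N f) (cv N h)) a j = (if a \<in> IX N s \<and> j = 0 then chi s a (f, h) else 0)"
 by (induction s arbitrary: a) (auto simp: ent_rk lv_def ent_cv PX_iff Let_def)

lemma chi_mult: "chi s a (\<lambda>i. f i * f' i, \<lambda>i. h i * h' i) = chi s a (f, h) * chi s a (f', h')"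
 by (induction s arbitrary: a) (auto simp: Let_def)
lemma chi_one: "chi s a (\<lambda>_. 1, \<lambda>_. 1) = 1" by (induction s arbitrary: a) (auto simp: Let_def)

text \<open>Independence of distinct multiplicative functions: translating a relation by
  \<open>x\<close> and subtracting \<open>\<psi> x\<close> times the relation removes the term of
  \<open>\<psi>\<close>.\<close>

lemma dedekind:
 fixes F :: "('m => complex) set" and x1 :: 'm and mul :: "'m => 'm => 'm"
 assumes "finite F" "\<And>\<phi> x y. \<phi> \<in> F ==> \<phi> (mul x y) = \<phi> x * \<phi> y" "\<And>\<phi>. \<phi> \<in> F ==> \<phi> x1 = 1"
  "\<And>x. (\<Sum>\<phi>\<in>F. c \<phi> * \<phi> x) = 0" "\<phi> \<in> F"
 shows "c \<phi> = 0" using assms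
proof (induction F arbitrary: c \<phi>)
 case (insert \<psi> F)
 have F0: "c \<phi> = 0" if \<phi>: "\<phi> \<in> F" for \<phi>
 proof -
  have "\<phi> \<noteq> \<psi>" using \<phi> insert by auto
  then obtain x where x: "\<phi> x \<noteq> \<psi> x" by blast
  have "(\<Sum>\<phi>\<in>F. (c \<phi> * (\<phi> x - \<psi> x)) * \<phi> y) = 0" for y
  proof -
   have "0 = (\<Sum>\<phi>\<in>insert \<psi> F. c \<phi> * \<phi> (mul x y)) - \<psi> x * (\<Sum>\<phi>\<in>insert \<psi> F. c \<phi> * \<phi> y)"
    using insert(6) by simp
   also have "\<dots> = (\<Sum>\<phi>\<in>insert \<psi> F. (c \<phi> * (\<phi> x - \<psi> x)) * \<phi> y)"
    unfolding sum_distrib_left sum_subtractf[symmetric]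
    by (intro sum.cong) (auto simp: insert(4) algebra_simps)
   also have "\<dots> = (\<Sum>\<phi>\<in>F. (c \<phi> * (\<phi> x - \<psi> x)) * \<phi> y)" using insert(1,2) by simp
   finally show ?thesis by simp
  qed
  from insert.IH[OF _ _ this \<phi>] insert(4,5) have "c \<phi> * (\<phi> x - \<psi> x) = 0" by simp
  then show ?thesis using x by simp
 qed
 have "(\<Sum>\<phi>\<in>insert \<psi> F. c \<phi> * \<phi> x1) = 0" by (rule insert(6))
 then have "c \<psi> = 0" using insert(1,2) insert(5)[of \<psi>] F0 by simp
 then show ?case using insert(7) F0 by auto
qed simp

section \<open>The span of the pure tensors and its projection\<close>

inductive_set xgen :: "nat => nat list => fmat set" for N s where
 xgen_x: "xv s (cv N f) (cv N h) * B \<in> xgen N s"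
| xgen_add: "Y \<in> xgen N s ==> Z \<in> xgen N s ==> Y + Z \<in> xgen N s"

lemma xgen_rideal: "rideal (xgen N s)"
proof -
 have 1: "Y * B \<in> xgen N s" if "Y \<in> xgen N s" for Y B
  using that by induction (auto simp: mult.assoc ring_distribs intro: xgen.intros)
 have "0 \<in> xgen N s" using xgen_x[of s N "\<lambda>_. 0" "\<lambda>_. 0" 0] by simp
 then show ?thesis unfolding rideal_def using 1 xgen_add by blast
qed

lemma xgen_e: "Y \<in> xgen N s ==> un (IX N s) * Y = Y"
 by (induction rule: xgen.induct) (auto simp: ring_distribs assoc' xv_un cv_un)

definition PI :: "nat => nat list => fmat" where
 "PI N s = (SOME Q. proj Q \<and> Q \<in> xgen N s \<and> (\<forall>Y\<in>xgen N s. Q * Y = Y))"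

lemma PI: "proj (PI N s)" "PI N s \<in> xgen N s" "Y \<in> xgen N s ==> PI N s * Y = Y"
proof -
 obtain Q where "proj Q" "Q \<in> xgen N s" "\<And>Y. Y \<in> xgen N s ==> Q * Y = Y"
  using rideal_proj[of "xgen N s" "un (IX N s)", OF xgen_rideal xgen_e] by metis
 then have "proj Q \<and> Q \<in> xgen N s \<and> (\<forall>Y\<in>xgen N s. Q * Y = Y)" by blast
 then have "proj (PI N s) \<and> PI N s \<in> xgen N s \<and> (\<forall>Y\<in>xgen N s. PI N s * Y = Y)"
  unfolding PI_def by (rule someI)
 then show "proj (PI N s)" "PI N s \<in> xgen N s" "Y \<in> xgen N s ==> PI N s * Y = Y" by auto
qed

lemma xv_xgen: "xv s (cv N f) (cv N h) \<in> xgen N s"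
 using xgen_x[of s N f h "eu 0 0"] col_xv by (simp add: col_def)

lemma PI_xv: "PI N s * xv s (cv N f) (cv N h) = xv s (cv N f) (cv N h)" by (rule PI(3)[OF xv_xgen])

lemma PI_un: "un (IX N s) * PI N s = PI N s" "PI N s * un (IX N s) = PI N s"
proof -
 show 1: "un (IX N s) * PI N s = PI N s" by (rule xgen_e[OF PI(2)])
 show "PI N s * un (IX N s) = PI N s" using arg_cong[OF 1, of adj] PI(1) by (simp add: proj_def)
qed

lemma PI_zero: "(\<And>f h. B * xv s (cv N f) (cv N h) = 0) ==> B * PI N s = 0"
proof -
 assume a: "\<And>f h. B * xv s (cv N f) (cv N h) = 0"
 have "B * Y = 0" if "Y \<in> xgen N s" for Y using that by induction (auto simp: assoc' a ring_distribs)
 then show ?thesis using PI(2) by blast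
qed

text \<open>\<open>rho s g\<close> maps pure tensors to pure tensors for every \<open>g\<close> in
  the corner. Later this is applied to unitary diagonalisers of arbitrary determinant.\<close>

lemma PI_commute: assumes g: "inn N g" shows "rho s g * PI N s = PI N s * rho s g"
proof -
 have 1: "rho s g * Y \<in> xgen N s" if "inn N g" "Y \<in> xgen N s" for g Y using that(2)
 proof induction
  case (xgen_x f h B)
  have "rho s g * xv s (cv N f) (cv N h) = xv s (g * cv N f) (g * cv N h)" by (rule rho_xv)
  also have "g * cv N f = cv N (\<lambda>i. ent (g * cv N f) i 0)"
   by (rule cv_ent) (use that(1) in \<open>auto simp: col_mult col_cv assoc' inn_un\<close>)
  also have "g * cv N h = cv N (\<lambda>i. ent (g * cv N h) i 0)"
   by (rule cv_ent) (use that(1) in \<open>auto simp: col_mult col_cv assoc' inn_un\<close>)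
  finally show ?case by (simp add: assoc' xgen.xgen_x)
 qed (auto simp: ring_distribs intro: xgen.intros)
 show ?thesis
  by (rule proj_commute[OF PI(1,3)]) (use 1[OF g PI(2)] 1[OF inn_adj[OF g] PI(2)] in \<open>auto simp: rho_adj\<close>)
qed

definition cls :: "nat => nat list => nat => nat set" where
 "cls N s a = {b \<in> IX N s. chi s b = chi s a}"

text \<open>The projection averages over coordinates carrying the same monomial. That averaging
  operator \<open>E\<close> fixes all pure tensors. The columns of \<open>E - PI N s\<close> are
  orthogonal to all of them, so by independence of the monomials their sums over each class vanish;
  hence \<open>E\<close> annihilates \<open>E - PI N s\<close>, which gives equality.\<close>

lemma PI_ent: "ent (PI N s) a b = (if a \<in> IX N s \<and> b \<in> cls N s a then 1 / of_nat (card (cls N s a)) else 0)"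
proof -
 define E where "E = Fmat (\<lambda>a b. if a \<in> IX N s \<and> b \<in> cls N s a then 1 / complex_of_nat (card (cls N s a)) else 0)"
 have cI: "cls N s a \<subseteq> IX N s" for a by (auto simp: cls_def)
 have fc: "finite (cls N s a)" for a by (rule finite_subset[OF cI finite_IX])
 have cl: "cls N s b = cls N s a" if "b \<in> cls N s a" for a b using that by (auto simp: cls_def)
 have self: "a \<in> cls N s a" if "a \<in> IX N s" for a using that by (auto simp: cls_def)
 have pos: "card (cls N s a) \<noteq> 0" if "a \<in> IX N s" for a using self[OF that] fc by auto
 have eE: "ent E a b = (if a \<in> IX N s \<and> b \<in> cls N s a then 1 / complex_of_nat (card (cls N s a)) else 0)" for a b
  unfolding E_def by (subst Fmat_finite[of "IX N s"]) (use cI in \<open>auto split: if_splits\<close>)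
 have Emult: "ent (E * Y) a j = (if a \<in> IX N s then (\<Sum>b\<in>cls N s a. ent Y b j) / of_nat (card (cls N s a)) else 0)" for Y a j
  by (subst ent_times_S[of "cls N s a"]) (auto simp: fc eE sum_divide_distrib split: if_splits)
 have Eh: "adj E = E" by (rule fmat_eqI) (auto simp: eE dest: cl, auto simp: cls_def)
 have Ex: "E * xv s (cv N f) (cv N h) = xv s (cv N f) (cv N h)" for f h
 proof (rule fmat_eqI)
  fix a j
  show "ent (E * xv s (cv N f) (cv N h)) a j = ent (xv s (cv N f) (cv N h)) a j"
  proof (cases "a \<in> IX N s \<and> j = 0")
   case True
   have "(\<Sum>b\<in>cls N s a. ent (xv s (cv N f) (cv N h)) b j) = (\<Sum>b\<in>cls N s a. chi s a (f, h))"
    using True by (intro sum.cong) (auto simp: xv_chi cls_def)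
   then show ?thesis using True pos by (simp add: Emult xv_chi)
  qed (auto simp: Emult xv_chi intro!: sum.neutral)
 qed
 have EE: "E * E = E"
 proof (rule fmat_eqI)
  fix a b
  have 1: "ent E c b = ent E a b" if "a \<in> IX N s" "c \<in> cls N s a" for c
   using that cl[OF that(2)] cI[of a] by (auto simp: eE)
  show "ent (E * E) a b = ent E a b"
  proof (cases "a \<in> IX N s")
   case True
   have "(\<Sum>c\<in>cls N s a. ent E c b) = (\<Sum>c\<in>cls N s a. ent E a b)"
    by (rule sum.cong) (auto simp: 1[OF True])
   then show ?thesis using True pos[OF True] by (simp add: Emult)
  qed (simp add: Emult, simp add: eE)
 qed
 define Q where "Q = PI N s"
 have "(E - un (IX N s)) * Q = 0" unfolding Q_def by (rule PI_zero) (simp add: ring_distribs Ex xv_un cv_un)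
 then have EQ: "E * Q = Q" by (simp add: ring_distribs Q_def PI_un)
 define C where "C = E - Q * E"
 have QE: "Q * E = adj (E * Q)" using PI(1) Eh by (simp add: Q_def proj_def)
 then have "Q * E = Q" by (metis EQ PI(1) Q_def projD(1))
 then have C: "C = E - Q" by (simp add: C_def)
 have Cx: "adj C * xv s (cv N f) (cv N h) = 0" for f h
  using PI(1) by (simp add: C Eh Q_def projD ring_distribs Ex PI_xv)
 have "E * C = 0"
 proof (rule fmat_eqI)
  fix a j
  have "(\<Sum>b\<in>cls N s a. ent C b j) = 0" if a: "a \<in> IX N s"
  proof -
   define F where "F = chi s ` IX N s"
   define c where "c \<phi> = (\<Sum>b\<in>{b \<in> IX N s. chi s b = \<phi>}. cnj (ent C b j))" for \<phi>
   have "c (chi s a) = 0"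
   proof (rule dedekind[where F = F and c = c and \<phi> = "chi s a" and mul = "\<lambda>x y. (\<lambda>i. fst x i * fst y i, \<lambda>i. snd x i * snd y i)" and ?x1.0 = "(\<lambda>_. 1, \<lambda>_. 1)"])
    fix x :: "(nat => complex) \<times> (nat => complex)"
    have "0 = ent (adj C * xv s (cv N (fst x)) (cv N (snd x))) j 0" by (simp add: Cx)
    also have "\<dots> = (\<Sum>b\<in>IX N s. cnj (ent C b j) * chi s b x)"
     by (subst ent_times_S[of "IX N s"]) (auto simp: xv_chi split: if_splits)
    also have "\<dots> = (\<Sum>\<phi>\<in>F. \<Sum>b\<in>{b \<in> IX N s. chi s b = \<phi>}. cnj (ent C b j) * chi s b x)"
     unfolding F_def by (rule sum.image_gen) simp
    also have "\<dots> = (\<Sum>\<phi>\<in>F. c \<phi> * \<phi> x)"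
     unfolding c_def by (intro sum.cong) (auto simp: sum_distrib_right intro!: sum.cong)
    finally show "(\<Sum>\<phi>\<in>F. c \<phi> * \<phi> x) = 0" by simp
   qed (use a in \<open>auto simp: F_def chi_one chi_mult\<close>)
   then have "cnj (c (chi s a)) = 0" by simp
   then show ?thesis by (simp add: c_def cls_def)
  qed
  then show "ent (E * C) a j = ent 0 a j" by (simp add: Emult)
 qed
 then have "E = Q" by (simp add: C ring_distribs EE EQ)
 then show ?thesis using eE Q_def by simp
qed

lemma rho_dg: "ent (rho s (dg N d)) a b = (if a = b \<and> a \<in> IX N s then chi s a (d, d) else 0)"
proof (induction s arbitrary: a b)
 case (Cons c s)
 have eq: "a = b \<longleftrightarrow> fst (prod_decode a) = fst (prod_decode b) \<and> snd (prod_decode a) = snd (prod_decode b)"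
  by (metis prod.collapse prod_decode_inverse)
 show ?case unfolding eq by (auto simp: ent_kron Cons lt_def PX_iff Let_def)
qed auto

text \<open>A class of \<open>c\<close> coordinates contributes \<open>c\<close> diagonal entries
  \<open>1 / c\<close>, so each distinct monomial counts once.\<close>

lemma tr_PI_rho_dg: "tr (PI N s * rho s (dg N d)) = (\<Sum>\<phi>\<in>chi s ` IX N s. \<phi> (d, d))"
proof -
 have fc: "finite (cls N s a)" for a by (rule finite_subset[of _ "IX N s"]) (auto simp: cls_def)
 have e: "ent (PI N s * rho s (dg N d)) a a = ent (PI N s) a a * chi s a (d, d)" if "a \<in> IX N s" for a
  by (subst ent_times_S[of "{a}"]) (use that in \<open>auto simp: rho_dg split: if_splits\<close>)
 have z: "ent (PI N s * rho s (dg N d)) a a = 0" if "a \<notin> IX N s" for a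
  by (subst ent_times_S[of "{}"]) (use that in \<open>auto simp: rho_dg split: if_splits\<close>)
 have "tr (PI N s * rho s (dg N d)) = (\<Sum>a\<in>IX N s. ent (PI N s) a a * chi s a (d, d))"
  by (subst tr_S[of "IX N s"]) (use z e in auto)
 also have "\<dots> = (\<Sum>\<phi>\<in>chi s ` IX N s. \<Sum>a\<in>{a \<in> IX N s. chi s a = \<phi>}. ent (PI N s) a a * chi s a (d, d))"
  by (rule sum.image_gen) simp
 also have "\<dots> = (\<Sum>\<phi>\<in>chi s ` IX N s. \<phi> (d, d))"
 proof (intro sum.cong refl)
  fix \<phi> assume "\<phi> \<in> chi s ` IX N s"
  then obtain b where b: "b \<in> IX N s" "\<phi> = chi s b" by auto
  have c: "{a \<in> IX N s. chi s a = \<phi>} = cls N s b" by (auto simp: b cls_def)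
  have "(\<Sum>a\<in>cls N s b. ent (PI N s) a a * chi s a (d, d)) = (\<Sum>a\<in>cls N s b. 1 / of_nat (card (cls N s b)) * \<phi> (d, d))"
  proof (intro sum.cong refl)
   fix a assume a: "a \<in> cls N s b"
   then have "cls N s a = cls N s b" "a \<in> IX N s" "chi s a = \<phi>" by (auto simp: cls_def b)
   then show "ent (PI N s) a a * chi s a (d, d) = 1 / of_nat (card (cls N s b)) * \<phi> (d, d)"
    using a by (simp add: PI_ent)
  qed
  also have "\<dots> = \<phi> (d, d)" using fc[of b] b(1) by (auto simp: cls_def)
  finally show "(\<Sum>a\<in>{a \<in> IX N s. chi s a = \<phi>}. ent (PI N s) a a * chi s a (d, d)) = \<phi> (d, d)" unfolding c .
 qed
 finally show ?thesis .
qed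

section \<open>Monomials and complete homogeneous symmetric polynomials\<close>

type_synonym expo = "(nat => nat) \<times> (nat => nat) \<times> (nat => nat)"

definition mono3 :: "nat => expo => (nat => complex) \<times> (nat => complex) => complex" where
 "mono3 N x zv = (\<Prod>i<N. fst zv i ^ fst x i) * (\<Prod>i<N. cnj (fst zv i) ^ fst (snd x) i) * (\<Prod>i<N. snd zv i ^ snd (snd x) i)"

definition inc :: "nat => (nat => nat) => nat => nat" where "inc i f = f(i := Suc (f i))"

fun ex :: "nat list => nat => expo" where
 "ex [] a = (\<lambda>_. 0, \<lambda>_. 0, \<lambda>_. 0)"
| "ex (c # s) a = (let i = fst (prod_decode a); (p, q, u) = ex s (snd (prod_decode a)) in
  if c = 1 then (p, inc i q, u) else if c = 2 then (p, q, inc i u) else (inc i p, q, u))"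

definition CC :: "nat => nat => (nat => nat) set" where
 "CC N k = {f. (\<forall>i\<ge>N. f i = 0) \<and> (\<Sum>i<N. f i) = k}"

lemma prod_inc: "i < N ==> (\<Prod>j<N. x j ^ inc i f j) = x i * (\<Prod>j<N. x j ^ f j)" for x :: "nat => complex"
 by (simp add: inc_def prod.remove[of "{..<N}" i] mult.assoc)

lemma chi_mono3: "a \<in> IX N s ==> chi s a zv = mono3 N (ex s a) zv"
proof (induction s arbitrary: a)
 case (Cons c s)
 then show ?case by (auto simp: PX_iff Let_def mono3_def prod_inc split: prod.splits)
qed (simp add: mono3_def)

lemma CC_0: "CC N 0 = {\<lambda>_. 0}" by (auto simp: CC_def fun_eq_iff) (metis lessThan_iff not_le)
lemma inc_CC: "f \<in> CC N k ==> i < N ==> inc i f \<in> CC N (Suc k)"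
 by (auto simp: CC_def inc_def sum.remove[of "{..<N}" i])
lemma CC_inc: assumes "f \<in> CC N (Suc k)" obtains i g where "i < N" "g \<in> CC N k" "f = inc i g"
proof -
 have "\<exists>i<N. f i \<noteq> 0"
 proof (rule ccontr)
  assume "\<not> (\<exists>i<N. f i \<noteq> 0)"
  then have "(\<Sum>i<N. f i) = 0" by simp
  then show False using assms by (simp add: CC_def)
 qed
 then obtain i where i: "i < N" "f i \<noteq> 0" by blast
 have "f = inc i (f(i := f i - 1))" using i by (auto simp: inc_def)
 moreover have "f(i := f i - 1) \<in> CC N k" using assms i by (auto simp: CC_def sum.remove[of "{..<N}" i])
 ultimately show ?thesis using that i by blast
qed

lemma ex_image: "set s \<subseteq> {0,1,2} ==> ex s ` IX N s = CC N (count_list s 0) \<times> CC N (count_list s 1) \<times> CC N (count_list s 2)"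
proof (induction s)
 case Nil then show ?case by (simp add: CC_0)
next
 case (Cons c s)
 define up where "up i x = (case x of (p, q, u) => if c = 1 then (p, inc i q, u) else if c = 2 then (p, q, inc i u) else (inc i p, q, u))"
  for i :: nat and x :: expo
 have "ex (c # s) ` IX N (c # s) = (\<lambda>(i, b). up i (ex s b)) ` ({..<N} \<times> IX N s)"
 proof -
  have "ex (c # s) (prod_encode (i, b)) = up i (ex s b)" for i b by (cases "ex s b") (simp add: up_def)
  then show ?thesis by (simp add: PX_def image_image case_prod_unfold)
 qed
 also have "\<dots> = (\<lambda>(i, x). up i x) ` ({..<N} \<times> ex s ` IX N s)"
  by (auto simp: image_iff) blast+
 also have "ex s ` IX N s = CC N (count_list s 0) \<times> CC N (count_list s 1) \<times> CC N (count_list s 2)" using Cons by simp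
 also have "(\<lambda>(i, x). up i x) ` ({..<N} \<times> \<dots>) = CC N (count_list (c # s) 0) \<times> CC N (count_list (c # s) 1) \<times> CC N (count_list (c # s) 2)"
 proof -
  have im: "CC N (Suc k) = (\<lambda>(i, f). inc i f) ` ({..<N} \<times> CC N k)" for k
   by (auto simp: inc_CC elim!: CC_inc)
  have "c = 0 \<or> c = 1 \<or> c = 2" using Cons by auto
  then show ?thesis by (elim disjE; auto simp: up_def im image_iff; blast)
 qed
 finally show ?case .
qed

lemma exp_i_inj: "exp (\<i> * of_real x) = exp (\<i> * of_real y) ==> \<bar>x - y\<bar> < 1 ==> x = y"
proof -
 assume a: "exp (\<i> * of_real x) = exp (\<i> * of_real y)" "\<bar>x - y\<bar> < 1"
 then obtain k :: int where "\<i> * of_real x = \<i> * of_real y + of_int (2 * k) * of_real pi * \<i>"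
  unfolding exp_eq by auto
 then have "Im (\<i> * of_real x) = Im (\<i> * of_real y + of_int (2 * k) * of_real pi * \<i>)" by simp
 then have k: "x - y = of_int (2 * k) * pi" by simp
 have "k = 0"
 proof (rule ccontr)
  assume "k \<noteq> 0"
  then have "1 * 6 \<le> \<bar>of_int (k)\<bar> * (2 * pi)" using pi_gt3 by (intro mult_mono) auto
  moreover have "\<bar>x - y\<bar> = \<bar>of_int k\<bar> * (2 * pi)" unfolding k by (simp add: abs_mult)
  ultimately show False using a(2) by linarith
 qed
 then show ?thesis using k by simp
qed

text \<open>The exponents can be read off from values: those of \<open>v\<close> by setting one
  coordinate to 2; at a coordinate of \<open>z\<close> the value 2 gives the sum of both exponents
  and a point of the unit circle their difference.\<close>

lemma mono3_inj:
 assumes "x \<in> CC N k \<times> CC N l \<times> CC N m" "y \<in> CC N k \<times> CC N l \<times> CC N m" "mono3 N x = mono3 N y"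
 shows "x = y"
proof -
 obtain p q u where x: "x = (p, q, u)" by (cases x)
 obtain p' q' u' where y: "y = (p', q', u')" by (cases y)
 have pr: "(\<Prod>j<N. (if j = i then c else 1) ^ f j) = c ^ f i" if "i < N" for i c and f :: "nat => nat"
  using that by (subst prod.remove[of "{..<N}" i]) (auto intro!: prod.neutral)
 have u: "u i = u' i" if i: "i < N" for i
 proof -
  have "mono3 N x (\<lambda>_. 1, \<lambda>j. if j = i then 2 else 1) = mono3 N y (\<lambda>_. 1, \<lambda>j. if j = i then 2 else 1)"
   using assms(3) by simp
  then have "(2::complex) ^ u i = 2 ^ u' i" by (simp add: mono3_def x y pr[OF i])
  then have "norm ((2::complex) ^ u i) = norm ((2::complex) ^ u' i)" by simp
  then show ?thesis by (simp add: norm_power)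
 qed
 have pq: "p i = p' i \<and> q i = q' i" if i: "i < N" for i
 proof -
  have ev: "c ^ p i * cnj c ^ q i = c ^ p' i * cnj c ^ q' i" for c
  proof -
   have "mono3 N x (\<lambda>j. if j = i then c else 1, \<lambda>_. 1) = mono3 N y (\<lambda>j. if j = i then c else 1, \<lambda>_. 1)"
    using assms(3) by simp
   then show ?thesis by (simp add: mono3_def x y pr[OF i] if_distrib[of cnj] cong: if_cong)
  qed
  have "(2::complex) ^ (p i + q i) = 2 ^ (p' i + q' i)" using ev[of 2] by (simp add: power_add)
  then have "norm ((2::complex) ^ (p i + q i)) = norm ((2::complex) ^ (p' i + q' i))" by simp
  then have s: "p i + q i = p' i + q' i" by (simp add: norm_power)
  \<comment> \<open>\<open>L\<close> exceeds the distance of the two exponent differences, so the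
    angles differ by less than 1 and \<open>exp_i_inj\<close> applies.\<close>
  define L where "L = 1 + real (p i + q i) + real (p' i + q' i)"
  have L: "L \<ge> 1" by (simp add: L_def)
  define c where "c = exp (\<i> * of_real (1 / L))"
  have "c ^ a * cnj c ^ b = exp (\<i> * of_real ((real a - real b) / L))" for a b
   unfolding c_def cnj_exp_real exp_of_nat_mult[symmetric] exp_add[symmetric]
   by (rule arg_cong[of _ _ exp]) (simp add: field_simps diff_divide_distrib)
  then have "exp (\<i> * of_real ((real (p i) - real (q i)) / L)) = exp (\<i> * of_real ((real (p' i) - real (q' i)) / L))"
   using ev[of c] by metis
  moreover have "\<bar>(real (p i) - real (q i)) / L - (real (p' i) - real (q' i)) / L\<bar> < 1"
  proof -
   have "(real (p i) - real (q i)) / L - (real (p' i) - real (q' i)) / L = ((real (p i) - real (q i)) - (real (p' i) - real (q' i))) / L"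
    by (simp add: diff_divide_distrib)
   moreover have "\<bar>(real (p i) - real (q i)) - (real (p' i) - real (q' i))\<bar> < L" by (simp add: L_def)
   ultimately show ?thesis using L by simp
  qed
  ultimately have "(real (p i) - real (q i)) / L = (real (p' i) - real (q' i)) / L" by (rule exp_i_inj)
  then have "real (p i) - real (q i) = real (p' i) - real (q' i)" using L by simp
  then show ?thesis using s by linarith
 qed
 have "f = f'" if "f \<in> CC N a" "f' \<in> CC N a" "\<And>i. i < N ==> f i = f' i" for f f' a
  using that by (auto simp: CC_def fun_eq_iff) (metis not_le)
 then show ?thesis using assms(1,2) u pq unfolding x y by blast
qed

text \<open>The complete homogeneous symmetric polynomial of degree \<open>k\<close> in
  \<open>d 0, ..., d (N - 1)\<close>.\<close>

definition hh :: "nat => (nat => complex) => nat => complex" where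
 "hh N d k = (\<Sum>f\<in>CC N k. \<Prod>i<N. d i ^ f i)"

theorem tr_PI_hh:
 assumes s: "set s \<subseteq> {0,1,2}"
 shows "tr (PI N s * rho s (dg N d)) = hh N d (count_list s 0) * hh N (\<lambda>i. cnj (d i)) (count_list s 1) * hh N d (count_list s 2)"
proof -
 let ?C = "CC N (count_list s 0) \<times> CC N (count_list s 1) \<times> CC N (count_list s 2)"
 have "chi s ` IX N s = mono3 N ` ex s ` IX N s"
  unfolding image_image by (intro image_cong refl ext) (simp add: chi_mono3)
 also have "\<dots> = mono3 N ` ?C" unfolding ex_image[OF s] ..
 finally have "tr (PI N s * rho s (dg N d)) = (\<Sum>\<phi>\<in>mono3 N ` ?C. \<phi> (d, d))" using tr_PI_rho_dg by simp
 also have "\<dots> = (\<Sum>x\<in>?C. mono3 N x (d, d))"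
 proof -
  have "inj_on (mono3 N) ?C" by (rule inj_onI) (rule mono3_inj)
  then show ?thesis by (simp add: sum.reindex)
 qed
 also have "\<dots> = (\<Sum>p\<in>CC N (count_list s 0). \<Sum>q\<in>CC N (count_list s 1). \<Sum>u\<in>CC N (count_list s 2).
   (\<Prod>i<N. d i ^ p i) * (\<Prod>i<N. cnj (d i) ^ q i) * (\<Prod>i<N. d i ^ u i))"
  by (simp add: sum.cartesian_product mono3_def case_prod_unfold)
 also have "\<dots> = hh N d (count_list s 0) * hh N (\<lambda>i. cnj (d i)) (count_list s 1) * hh N d (count_list s 2)"
  unfolding hh_def by (simp only: sum_distrib_left[symmetric] sum_distrib_right[symmetric])
 finally show ?thesis .
qed

section \<open>Decomposition into irreducible representations\<close>

lemma (in urep) subrep: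
 assumes P: "proj P" "e * P = P" "\<And>g. g \<in> SU N ==> P * r g = r g * P"
 shows "urep N P (\<lambda>g. P * r g)" "Dop N P (\<lambda>g. P * r g) X = P * D X" "P * D X = D X * P"
proof -
 have Pe: "P * e = P" using arg_cong[OF P(2), of adj] P(1) ee by (simp add: proj_def)
 show U: "urep N P (\<lambda>g. P * r g)"
 proof
  fix g h assume "g \<in> SU N" "h \<in> SU N"
  then show "P * r (g * h) = P * r g * (P * r h)"
   using P(1) by (simp add: r_mult mult.assoc mac[OF P(3)[of g, symmetric]] mac[OF projD(2)[OF P(1)]])
 next
  fix g assume g: "g \<in> SU N"
  show "P * r (adj g) = adj (P * r g)" using P(1) P(3)[OF SU_adj[OF g]] g by (simp add: r_adj proj_def)
 qed (use N0 P Pe r_one r_cont in \<open>auto intro!: continuous_intros\<close>)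
 have "\<forall>g\<in>SU N. P * r g = (P * r g) * P"
  using P by (simp add: mult.assoc P(3)[symmetric] mac[OF projD(2)[OF P(1)]])
 then have "P * D X = Dop N P (\<lambda>g. P * r g) X * P" for X
  using urep_intertwine[OF urep_axioms U Pe projD(2)[OF P(1)]] by blast
 then show "Dop N P (\<lambda>g. P * r g) X = P * D X" using urep.D_e(2)[OF U] by simp
 show "P * D X = D X * P" using commute_D[OF P(2) Pe] P(3) by blast
qed

lemma (in urep) subrep_hwv:
 assumes P: "proj P" "e * P = P" "\<And>g. g \<in> SU N ==> P * r g = r g * P"
 shows "urep.hwv N P (\<lambda>g. P * r g) v w \<longleftrightarrow> hwv v w \<and> P * v = v"
proof -
 interpret S: urep N P "\<lambda>g. P * r g" by (rule subrep(1)[OF P])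
 have SD: "S.D X = P * D X" for X by (rule subrep(2)[OF P])
 have "P * D X * v = D X * v" if "P * v = v" for X using subrep(3)[OF P, of X] that by (simp add: mult.assoc)
 moreover have "e * v = v" if "P * v = v" using P(2) that by (metis mult.assoc)
 ultimately show ?thesis using SD unfolding S.hwv_def hwv_def by auto
qed

lemma proj_norm_ge1: assumes "proj P" "P \<noteq> 0" shows "1 \<le> (norm P)\<^sup>2"
proof -
 obtain u l where u: "col u" "ip u u = 1" "P * u = u" "0 * u = l *c u"
  using eigen_exists[OF assms, of 0] by auto
 show ?thesis using tr_proj_ge1(2)[OF assms(1) u(1-3)] zero_le_power2[of "norm (P - u * adj u)"] by linarith
qed

text \<open>A commuting projection strictly between 0 and \<open>P\<close> splits the rank into two
  parts that are both at least 1, so induction on a bound for the rank applies to each part.\<close>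

theorem (in urep) decompose:
 assumes P: "proj P" "e * P = P" "\<And>g. g \<in> SU N ==> P * r g = r g * P"
 obtains PS where "finite PS" "P = \<Sum>PS" "\<And>Q. Q \<in> PS ==> irr N Q (\<lambda>g. Q * r g)"
  "\<And>Q. Q \<in> PS ==> proj Q \<and> P * Q = Q \<and> (\<forall>g\<in>SU N. Q * r g = r g * Q)"
  "\<And>Q Q'. Q \<in> PS ==> Q' \<in> PS ==> Q \<noteq> Q' ==> Q * Q' = 0"
proof -
 have claim: "\<exists>PS. finite PS \<and> P = \<Sum>PS \<and> (\<forall>Q\<in>PS. irr N Q (\<lambda>g. Q * r g)) \<and>
   (\<forall>Q\<in>PS. proj Q \<and> P * Q = Q \<and> (\<forall>g\<in>SU N. Q * r g = r g * Q)) \<and>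
   (\<forall>Q\<in>PS. \<forall>Q'\<in>PS. Q \<noteq> Q' --> Q * Q' = 0)"
  if "proj P" "e * P = P" "\<And>g. g \<in> SU N ==> P * r g = r g * P" "(norm P)\<^sup>2 < real k" for k P
  using that
 proof (induction k arbitrary: P)
  case 0 then show ?case by simp
 next
  case (Suc k)
  note P = Suc(2,3,4)
  consider "P = 0" | "P \<noteq> 0" "irr N P (\<lambda>g. P * r g)" | "P \<noteq> 0" "\<not> irr N P (\<lambda>g. P * r g)" by blast
  then show ?case
  proof cases
   case 1 then show ?thesis by (intro exI[of _ "{}"]) auto
  next
   case 2 then show ?thesis by (intro exI[of _ "{P}"]) (use P in \<open>auto simp: proj_def\<close>)
  next
   case 3
   then obtain Q where Q: "proj Q" "P * Q = Q" "\<And>g. g \<in> SU N ==> Q * (P * r g) = P * r g * Q" "Q \<noteq> 0" "Q \<noteq> P"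
    using subrep(1)[OF P] unfolding irr_def irr_axioms_def by blast
   have QP: "Q * P = Q" by (rule proj_diff(2)[OF P(1) Q(1,2)])
   have eQ: "e * Q = Q" using P(2) Q(2) by (metis mult.assoc)
   have Qr: "Q * r g = r g * Q" if "g \<in> SU N" for g
    using Q(3)[OF that] P(3)[OF that] Q(2) QP by (metis mult.assoc)
   define Q' where "Q' = P - Q"
   have Q': "proj Q'" "P * Q' = Q'" "e * Q' = Q'" "Q' \<noteq> 0" "\<And>g. g \<in> SU N ==> Q' * r g = r g * Q'" "Q * Q' = 0" "Q' * Q = 0"
    unfolding Q'_def using proj_diff[OF P(1) Q(1,2)] P Q QP eQ Qr by (auto simp: ring_distribs proj_def)
   have "complex_of_real ((norm Q')\<^sup>2) = of_real ((norm P)\<^sup>2 - (norm Q)\<^sup>2)"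
    using tr_proj[OF Q'(1)] tr_proj[OF P(1)] tr_proj[OF Q(1)] by (simp add: Q'_def)
   then have n: "(norm Q')\<^sup>2 = (norm P)\<^sup>2 - (norm Q)\<^sup>2" unfolding of_real_eq_iff .
   obtain A where A: "finite A" "Q = \<Sum>A" "\<forall>Q\<in>A. irr N Q (\<lambda>g. Q * r g)"
    "\<forall>R\<in>A. proj R \<and> Q * R = R \<and> (\<forall>g\<in>SU N. R * r g = r g * R)" "\<forall>Q\<in>A. \<forall>Q'\<in>A. Q \<noteq> Q' --> Q * Q' = 0"
    using Suc.IH[OF Q(1) eQ Qr] proj_norm_ge1[OF Q'(1,4)] n Suc(5) by auto
   obtain B where B: "finite B" "Q' = \<Sum>B" "\<forall>Q\<in>B. irr N Q (\<lambda>g. Q * r g)"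
    "\<forall>R\<in>B. proj R \<and> Q' * R = R \<and> (\<forall>g\<in>SU N. R * r g = r g * R)" "\<forall>Q\<in>B. \<forall>Q'\<in>B. Q \<noteq> Q' --> Q * Q' = 0"
    using Suc.IH[OF Q'(1,3,5)] proj_norm_ge1[OF Q(1,4)] n Suc(5) by auto
   have AB: "R * R' = 0" "R' * R = 0" if "R \<in> A" "R' \<in> B" for R R'
   proof -
    have R: "R = Q * R" "R = R * Q" "R' = Q' * R'" "R' = R' * Q'"
     using A(4) B(4) that proj_diff(2)[OF Q(1), of R] proj_diff(2)[OF Q'(1), of R'] by auto
    have "R * R' = R * (Q * Q') * R'" using R by (metis mult.assoc)
    then show "R * R' = 0" using Q'(6) by simp
    have "R' * R = R' * (Q' * Q) * R" using R by (metis mult.assoc)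
    then show "R' * R = 0" using Q'(7) by simp
   qed
   have disj: "A \<inter> B = {}"
   proof (rule ccontr)
    assume "A \<inter> B \<noteq> {}"
    then obtain R where R: "R \<in> A" "R \<in> B" by blast
    then have "R = 0" using AB[OF R] A(4) R(1) by (simp add: proj_def)
    then show False using A(3) R(1) irr.e_nz by blast
   qed
   have "P = Q + Q'" by (simp add: Q'_def)
   then have "P = \<Sum>(A \<union> B)" using A(2) B(2) sum.union_disjoint[OF A(1) B(1) disj, of "\<lambda>x. x"] by simp
   moreover have "\<forall>R\<in>A \<union> B. P * R = R" using A(4) B(4) Q(2) Q'(2) by (metis Un_iff mult.assoc)
   ultimately show ?thesis using A B AB by (intro exI[of _ "A \<union> B"]) auto
  qed
 qed
 obtain k where k: "(norm P)\<^sup>2 < real k" using reals_Archimedean2 by blast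
 show ?thesis by (rule exE[OF claim[OF P(1,2) _ k]], erule P(3), elim conjE, rule that) blast+
qed

text \<open>The mean of the character, which \<open>average\<close> identifies with the trace of the
  projection onto the invariants.\<close>

definition nG :: "fmat set => (fmat => fmat) => complex" where
 "nG \<Gamma> r = (\<Sum>\<gamma>\<in>\<Gamma>. tr (r \<gamma>)) / of_nat (card \<Gamma>)"

lemma tr_iso:
 assumes A: "irr N e r" and B: "irr N e' r'" and T: "T \<noteq> 0" "T * e = T" "e' * T = T" "\<And>g. g \<in> SU N ==> T * r g = r' g * T"
  and g: "g \<in> SU N"
 shows "tr (r' g) = tr (r g)"
proof -
 interpret A: irr N e r by (rule A)
 interpret B: irr N e' r' by (rule B)
 obtain c where c: "c > 0" "adj T * T = of_real c *c e" "T * adj T = of_real c *c e'"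
  by (rule intertwiner_iso[OF A B T])
 have "of_real c * tr (r' g) = tr (T * adj T * r' g)" by (simp add: c(3) B.er g)
 also have "\<dots> = tr (adj T * (r' g * T))" using tr_comm[of T "adj T * r' g"] by (simp add: mult.assoc)
 also have "\<dots> = tr (adj T * T * r g)" using T(4)[OF g] by (simp add: mult.assoc)
 also have "\<dots> = of_real c * tr (r g)" by (simp add: c(2) A.er g)
 finally show ?thesis using c(1) by simp
qed

lemma hw_tr:
 assumes "irr N e r" "irr N e' r'" "urep.hwv N e r v w" "urep.hwv N e' r' v' w" "g \<in> SU N"
 shows "tr (r' g) = tr (r g)"
proof -
 obtain T where T: "T \<noteq> 0" "T * e = T" "e' * T = T" "\<And>g. g \<in> SU N ==> T * r g = r' g * T"
  using hw_unique[OF assms(1-4)] by blast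
 show ?thesis by (rule tr_iso[OF assms(1,2) T assms(5)])
qed

text \<open>The number of invariants of an irreducible representation depends on its highest weight only;
 \<open>nW\<close> is junk at weights that are not highest weights.\<close>

definition nW :: "nat => fmat set => (nat => real) => complex" where
 "nW N \<Gamma> w = (SOME x. \<exists>e r v. irr N e r \<and> urep.hwv N e r v w \<and> x = nG \<Gamma> r)"

lemma nW_eq:
 assumes "irr N e r" "urep.hwv N e r v w" "\<Gamma> \<subseteq> SU N"
 shows "nG \<Gamma> r = nW N \<Gamma> w"
proof -
 have "\<exists>e r v. irr N e r \<and> urep.hwv N e r v w \<and> nW N \<Gamma> w = nG \<Gamma> r"
  unfolding nW_def using someI[of "\<lambda>x. \<exists>e r v. irr N e r \<and> urep.hwv N e r v w \<and> x = nG \<Gamma> r" "nG \<Gamma> r"] assms by blast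
 then obtain e' r' v' where "irr N e' r'" "urep.hwv N e' r' v' w" "nW N \<Gamma> w = nG \<Gamma> r'" by blast
 moreover have "tr (r' \<gamma>) = tr (r \<gamma>)" if "\<gamma> \<in> \<Gamma>" for \<gamma>
  using hw_tr[OF assms(1) calculation(1) assms(2) calculation(2)] that assms(3) by blast
 ultimately show ?thesis by (simp add: nG_def)
qed

section \<open>The tensor models and their equivariant maps\<close>

fun pat :: "nat list => nat => nat list" where
 "pat b 0 = b" | "pat b (Suc k) = 0 # 1 # pat b k"

lemma pat_set: "set b \<subseteq> {0,1,2} ==> set (pat b k) \<subseteq> {0,1,2}" by (induction k) auto
lemma pat_count: "count_list (pat b k) 0 = count_list b 0 + k" "count_list (pat b k) 1 = count_list b 1 + k"
 "count_list (pat b k) 2 = count_list b 2" by (induction k) auto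

lemma xv_scale: "set s \<subseteq> {0,1,2} ==> xv s (c *c z) v = (c ^ count_list s 0 * cnj c ^ count_list s 1) *c xv s z v"
 by (induction s) (auto simp: lv_def rk_lin mult_ac)

text \<open>Complete \<open>z\<close> to an orthonormal basis with \<open>z\<close> in column
  \<open>n\<close>, then correct the determinant in column 0, which is a different column because
  \<open>n \<ge> 1\<close>.\<close>

lemma SU_transitive:
 assumes n: "n \<ge> 1" and z: "col z" "un {..<Suc n} * z = z" "ip z z = 1"
 obtains g where "g \<in> SU (Suc n)" "g * eu n 0 = z"
proof -
 have 1: "proj (un {..<Suc n} - z * adj z)" by (rule tr_proj_ge1(1)) (use z in \<open>auto simp: proj_un\<close>)
 obtain m S where S: "isom m S" "S * adj S = un {..<Suc n} - z * adj z" using proj_isom[OF 1] .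
 have pU: "proj (un {..<Suc n})" by (simp add: proj_un)
 define S' where "S' = S + z * eu 0 m"
 note ext = isom_extend[OF S pU z(1,3,2), folded S'_def]
 have "Suc m = Suc n" by (rule isom_dim[OF ext])
 then have m: "m = n" by simp
 have U: "S' \<in> UU (Suc n)" using isom_UU[of "Suc n" S'] ext m by simp
 have S'e: "S' * eu n 0 = z" using isom_eu[OF S(1)] z(1) by (simp add: S'_def ring_distribs mult.assoc eu_mult m col_def)
 define d where "d i = (if i = 0 then cnj (dt (Suc n) S') else 1)" for i :: nat
 have dt1: "dt (Suc n) S' * cnj (dt (Suc n) S') = 1"
  using dt_mult[of "Suc n" S' "adj S'"] UU_D[OF U] by (simp add: dt_adj dt_one)
 have Ud: "dg (Suc n) d \<in> UU (Suc n)"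
  unfolding UU_def using dt1 by (auto simp: inn_dg dg_mult dg_one[symmetric] d_def mult.commute intro!: dg_cong)
 have "dt (Suc n) (S' * dg (Suc n) d) = dt (Suc n) S' * (\<Prod>i<Suc n. d i)"
  using UU_D(1)[OF U] by (simp add: dt_mult dt_dg)
 also have "(\<Prod>i<Suc n. d i) = cnj (dt (Suc n) S')"
  by (subst prod.remove[of "{..<Suc n}" 0]) (auto simp: d_def intro!: prod.neutral)
 finally have "S' * dg (Suc n) d \<in> SU (Suc n)" using dt1 UU_mult[OF U Ud] by (simp add: SU_def)
 moreover have "dg (Suc n) d * eu n 0 = eu n 0" using n by (intro fmat_eqI) (auto simp: ent_times_eu d_def)
 ultimately show ?thesis using that[of "S' * dg (Suc n) d"] S'e by (simp add: mult.assoc)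
qed

text \<open>Every \<open>z\<close> is a multiple of some \<open>g * eu n 0\<close>, the pure tensor
  is homogeneous in \<open>z\<close>, and \<open>B\<close> is equivariant; the other argument is
  absorbed by replacing it with its image under \<open>adj g\<close>.\<close>

lemma xv_generate:
 assumes n: "n \<ge> 1" and s: "set s \<subseteq> {0,1,2}"
  and B: "\<And>g. g \<in> SU (Suc n) ==> B * rho s g = r' g * B"
  and 0: "\<And>h. B * xv s (eu n 0) (cv (Suc n) h) = 0"
 shows "B * PI (Suc n) s = 0"
proof (rule PI_zero)
 fix f h
 define z where "z = cv (Suc n) f"
 have z: "col z" "un {..<Suc n} * z = z" by (simp_all add: z_def col_cv cv_un)
 obtain c y where cy: "z = c *c y" "col y" "un {..<Suc n} * y = y" "ip y y = 1"
 proof (cases "z = 0")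
  case True
  have "ip (eu n 0) (eu n 0) = 1" by (simp add: ip_def eu_mult)
  then show ?thesis using True that[of 0 "eu n 0"] by (simp add: col_euI un_eu)
 next
  case False
  then obtain c where c: "c \<noteq> 0" "ip (c *c z) (c *c z) = 1" using normalise[OF z(1)] by blast
  then show ?thesis using that[of "1 / c" "c *c z"] z by (simp add: col_sc)
 qed
 obtain g where g: "g \<in> SU (Suc n)" "g * eu n 0 = y" using SU_transitive[OF n cy(2-4)] .
 have U: "g \<in> UU (Suc n)" by (rule SU_UU[OF g(1)])
 define v where "v = adj g * cv (Suc n) h"
 have v: "v = cv (Suc n) (\<lambda>i. ent v i 0)"
  by (rule cv_ent) (use UU_un[OF UU_adj[OF U]] in \<open>auto simp: v_def col_mult col_cv assoc'\<close>)
 have gv: "g * v = cv (Suc n) h" by (simp add: v_def UU_cancel[OF U] cv_un)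
 have "xv s y (cv (Suc n) h) = rho s g * xv s (eu n 0) v" by (simp add: rho_xv g gv)
 then have "B * xv s y (cv (Suc n) h) = r' g * (B * xv s (eu n 0) v)" using B[OF g(1)] by (simp add: mac assoc')
 also have "\<dots> = 0" using 0 v by (metis mult_zero_right)
 finally show "B * xv s (cv (Suc n) f) (cv (Suc n) h) = 0" using cy(1) s by (simp add: z_def[symmetric] xv_scale)
qed

definition bQ :: "nat list" where "bQ = []"
definition bR :: "nat list" where "bR = [1, 2]"

lemma bQR_set [simp]: "set bQ \<subseteq> {0,1,2}" "set bR \<subseteq> {0,1,2}" by (auto simp: bQ_def bR_def)
lemma bQR_count: "count_list (pat bQ k) 0 = k" "count_list (pat bQ k) 1 = k" "count_list (pat bQ k) 2 = 0"
 "count_list (pat bR k) 0 = k" "count_list (pat bR k) 1 = Suc k" "count_list (pat bR k) 2 = 1"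
 by (auto simp: pat_count[simplified] bQ_def bR_def)

lemma xv_bQ: "xv (pat bQ k) z v = xv (pat bQ k) z v'" by (induction k) (auto simp: bQ_def lv_def)
lemma xv_bR_lin: "xv (pat bR k) z (\<Sum>i\<in>S. f i *c v i) = (\<Sum>i\<in>S. f i *c xv (pat bR k) z (v i))"
proof (induction k)
 case 0 show ?case by (simp add: bR_def lv_def rk_sum rk_lin)
qed (simp add: lv_def rk_sum rk_lin)

text \<open>The pure tensors over the base point \<open>z = eu n 0\<close>. If the letter 2 occurs
  they depend linearly on \<open>v\<close>, which becomes the argument of the map; otherwise a
  single fixed vector remains and is stored in the last column.\<close>

definition X0 :: "nat => nat list => fmat" where
 "X0 n s = (if count_list s 2 = 0 then xv s (eu n 0) 0 * eu 0 n
  else (\<Sum>l<Suc n. xv s (eu n 0) (eu l 0) * eu 0 l))"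

definition good :: "nat list => bool" where "good b \<longleftrightarrow> b = bQ \<or> b = bR"

lemma good_set: "good b ==> set (pat b k) \<subseteq> {0,1,2}"
 using pat_set[OF bQR_set(1), of k] pat_set[OF bQR_set(2), of k] by (auto simp: good_def)
lemma good_count: "good b ==> count_list (pat b k) 0 + count_list (pat b k) 2 = count_list (pat b k) 1"
 by (auto simp: good_def bQR_count[simplified])

lemma X0_cols:
 assumes b: "good b" and B: "B * X0 n (pat b k) = 0"
 shows "B * xv (pat b k) (eu n 0) (cv (Suc n) h) = 0" using b unfolding good_def
proof
 assume b: "b = bQ"
 then have "B * (xv (pat b k) (eu n 0) 0 * eu 0 n) = 0" using B bQR_count by (simp add: X0_def)
 then have "B * (xv (pat b k) (eu n 0) 0 * eu 0 n) * eu n 0 = 0" by simp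
 then have "B * xv (pat b k) (eu n 0) 0 = 0" using col_xv by (simp add: mult.assoc eu_mult col_def)
 then show ?thesis using xv_bQ b by metis
next
 assume b: "b = bR"
 have "B * xv (pat b k) (eu n 0) (eu m 0) = 0" if m: "m < Suc n" for m
 proof -
  have "X0 n (pat b k) * eu m 0 = (\<Sum>l<Suc n. xv (pat b k) (eu n 0) (eu l 0) * (eu 0 l * eu m 0))"
   using b bQR_count(6) by (simp add: X0_def sum_distrib_right mult.assoc del: sum.lessThan_Suc)
  also have "\<dots> = (\<Sum>l<Suc n. if l = m then xv (pat b k) (eu n 0) (eu l 0) else 0)"
   using col_xv by (intro sum.cong) (auto simp: eu_mult col_def)
  also have "\<dots> = xv (pat b k) (eu n 0) (eu m 0)" using m by simp
  finally show ?thesis using B by (metis mult.assoc mult_zero_left)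
 qed
 then show ?thesis unfolding cv_def b xv_bR_lin by (simp add: sum_distrib_left b del: sum.lessThan_Suc)
qed

text \<open>An isotropy element scales the base point by a number \<open>c\<close> of modulus 1.
  Each pair of letters 0 and 1 contributes \<open>c * cnj c = 1\<close>, and the additional
  conjugate letter of \<open>bR\<close> leaves the required factor \<open>cnj c\<close>.\<close>

lemma X0_kequiv:
 assumes b: "good b" and n: "n \<ge> 1"
 shows "kequiv n (un (IX (Suc n) (pat b k))) (rho (pat b k)) (X0 n (pat b k))" unfolding kequiv_def
proof (intro conjI ballI)
 let ?s = "pat b k"
 have e0: "un {..<Suc n} * eu l 0 = eu l 0" if "l < Suc n" for l using that by (simp add: un_eu)
 have ux: "un (IX (Suc n) ?s) * xv ?s (eu n 0) (eu l 0) = xv ?s (eu n 0) (eu l 0)" if "l < Suc n" for l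
  using that by (intro xv_un) (auto simp: un_eu)
 show "un (IX (Suc n) ?s) * X0 n ?s = X0 n ?s"
  using ux xv_un[of "Suc n" "eu n 0" 0 ?s] e0 by (auto simp: X0_def sum_distrib_left assoc' intro!: sum.cong simp del: sum.lessThan_Suc)
 show "X0 n ?s * un {..<Suc n} = X0 n ?s"
  by (auto simp: X0_def sum_distrib_right mult.assoc eu_un' intro!: sum.cong simp del: sum.lessThan_Suc)
 fix g assume g: "g \<in> KK n"
 have gS: "g \<in> UU (Suc n)" and z: "\<And>i. i < n ==> ent g i n = 0 \<and> ent g n i = 0"
  using g by (auto simp: KK_def SU_UU)
 have g0: "ent g i n = 0 \<and> ent g n i = 0" if "i \<noteq> n" for i
  by (cases "i < n") (use z[of i] UU_D(1)[OF gS] that in \<open>auto simp: inn_def\<close>)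
 have ge: "g * eu n 0 = ent g n n *c eu n 0" by (rule fmat_eqI) (auto simp: ent_times_eu g0)
 have eg: "eu 0 n * g = ent g n n *c eu 0 n" by (rule fmat_eqI) (auto simp: ent_eu_times g0)
 have "adj g * (g * eu n 0) = eu n 0" by (simp add: UU_cancel[OF gS] un_eu)
 moreover have "adj g * eu n 0 = cnj (ent g n n) *c eu n 0" using arg_cong[OF eg, of adj] by simp
 ultimately have "(ent g n n * cnj (ent g n n)) *c eu n 0 = 1 *c eu n 0" by (simp add: ge)
 then have c1: "ent g n n * cnj (ent g n n) = 1" unfolding sc_eq_iff by simp
 have cp: "ent g n n ^ k * cnj (ent g n n) ^ k = 1" by (simp add: power_mult_distrib[symmetric] c1)
 show "rho ?s g * X0 n ?s = cnj (ent g n n) *c (X0 n ?s * g)" using b unfolding good_def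
 proof
  assume b: "b = bQ"
  have "rho ?s g * X0 n ?s = xv ?s (ent g n n *c eu n 0) (g * 0) * eu 0 n"
   using bQR_count(3) b by (simp add: X0_def assoc' rho_xv ge)
  also have "\<dots> = X0 n ?s" using bQR_count b pat_set[OF bQR_set(1)] cp by (simp add: X0_def xv_scale)
  also have "X0 n ?s = (cnj (ent g n n) * ent g n n) *c X0 n ?s" using c1 by (simp add: mult.commute)
  also have "\<dots> = cnj (ent g n n) *c (X0 n ?s * g)"
   using bQR_count(3) b eg by (simp add: X0_def mult.assoc)
  finally show ?thesis .
 next
  assume b: "b = bR"
  have gl: "g * eu l 0 = (\<Sum>i<Suc n. ent g i l *c eu i 0)" for l
   using UU_D(1)[OF gS] by (intro fmat_eqI) (auto simp: ent_times_eu if_distrib inn_def cong: if_cong simp del: sum.lessThan_Suc)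
  have lg: "(\<Sum>l<Suc n. ent g i l *c eu 0 l) = eu 0 i * g" if "i < Suc n" for i
   using UU_D(1)[OF gS] by (intro fmat_eqI) (auto simp: ent_eu_times if_distrib inn_def cong: if_cong simp del: sum.lessThan_Suc)
  have X: "X0 n ?s = (\<Sum>l<Suc n. xv ?s (eu n 0) (eu l 0) * eu 0 l)" using bQR_count(6) b by (simp add: X0_def)
  have "rho ?s g * X0 n ?s = (\<Sum>l<Suc n. xv ?s (ent g n n *c eu n 0) (g * eu l 0) * eu 0 l)"
   unfolding X by (simp add: sum_distrib_left assoc' rho_xv ge del: sum.lessThan_Suc)
  also have "\<dots> = (\<Sum>l<Suc n. cnj (ent g n n) *c (\<Sum>i<Suc n. ent g i l *c xv ?s (eu n 0) (eu i 0)) * eu 0 l)"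
  proof (intro sum.cong refl)
   fix l
   have cp': "ent g n n ^ k * cnj (ent g n n) ^ Suc k = cnj (ent g n n)" using cp by (simp add: mult_ac)
   have "xv ?s (ent g n n *c eu n 0) (g * eu l 0) = cnj (ent g n n) *c xv ?s (eu n 0) (g * eu l 0)"
    using pat_set[OF bQR_set(2), of k] cp' by (simp only: b xv_scale bQR_count(4,5))
   also have "xv ?s (eu n 0) (g * eu l 0) = (\<Sum>i<Suc n. ent g i l *c xv ?s (eu n 0) (eu i 0))"
    unfolding gl b xv_bR_lin ..
   finally show "xv ?s (ent g n n *c eu n 0) (g * eu l 0) * eu 0 l = cnj (ent g n n) *c (\<Sum>i<Suc n. ent g i l *c xv ?s (eu n 0) (eu i 0)) * eu 0 l" by simp
  qed
  also have "\<dots> = cnj (ent g n n) *c (\<Sum>l<Suc n. \<Sum>i<Suc n. xv ?s (eu n 0) (eu i 0) * (ent g i l *c eu 0 l))"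
   by (simp add: sc_sum_right sum_distrib_right del: sum.lessThan_Suc)
  also have "(\<Sum>l<Suc n. \<Sum>i<Suc n. xv ?s (eu n 0) (eu i 0) * (ent g i l *c eu 0 l)) =
    (\<Sum>i<Suc n. xv ?s (eu n 0) (eu i 0) * (\<Sum>l<Suc n. ent g i l *c eu 0 l))"
   unfolding sum_distrib_left by (rule sum.swap)
  also have "\<dots> = X0 n ?s * g"
   unfolding X sum_distrib_right by (intro sum.cong) (auto simp: lg mult.assoc simp del: sum.lessThan_Suc)
  finally show ?thesis .
 qed
qed

section \<open>Explicit highest weight vectors\<close>

fun yA :: "nat => nat => fmat" where
 "yA n 0 = eu 0 0" | "yA n (Suc k) = rk (eu 0 0) (rk (eu n 0) (yA n k))"
text \<open>Antisymmetric in the basis vectors 0 and 1 at the letters 0 and 2, hence killed by the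
  raising operator \<open>eu 0 1\<close>; both conjugate letters carry the vector \<open>n\<close>.
  The weight is \<open>(1, 1, 0, ..., 0, -2)\<close>.\<close>

definition yB1 :: "nat => fmat" where
 "yB1 n = rk (eu 0 0) (rk (eu n 0) (rk (eu n 0) (rk (eu 1 0) (eu 0 0)))) -
  rk (eu 1 0) (rk (eu n 0) (rk (eu n 0) (rk (eu 0 0) (eu 0 0))))"
fun yB :: "nat => nat => fmat" where
 "yB n 0 = yB1 n" | "yB n (Suc k) = rk (eu 0 0) (rk (eu n 0) (yB n k))"

definition hwD :: "nat => nat list => fmat => (nat => real) => bool" where
 "hwD n s y w \<longleftrightarrow> col y \<and> un (IX (Suc n) s) * y = y \<and> (\<forall>i<Suc n. Ds (Suc n) s (eu i i) * y = of_real (w i) *c y) \<and>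
  (\<forall>i j. i < j --> j < Suc n --> Ds (Suc n) s (eu i j) * y = 0)"

lemma col_rk: "col Y ==> col (rk u Y)" by (simp add: col_def rk_mult)

lemma un_rk: "un {..<N} * u = u ==> un (IX N s) * Y = Y ==> un (IX N (c # s)) * rk u Y = rk u Y"
 by (metis IX.simps(2) finite_IX finite_lessThan kron_rk kron_un)

text \<open>The two new factors are highest weight vectors of the standard representation and of its
  conjugate, so the weights add up.\<close>

lemma hwD_step:
 assumes y: "hwD n s y w" and n: "n \<ge> 1"
 shows "hwD n (0 # 1 # s) (rk (eu 0 0) (rk (eu n 0) y)) (\<lambda>i. wA n 1 i + w i)"
proof -
 have u: "un {..<Suc n} * eu 0 0 = eu 0 0" "un {..<Suc n} * eu n 0 = eu n 0" by (simp_all add: un_eu)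
 have y': "un (IX (Suc n) s) * y = y" "col y" using y by (auto simp: hwD_def)
 have u1: "un (IX (Suc n) (1 # s)) * rk (eu n 0) y = rk (eu n 0) y" by (rule un_rk[OF u(2) y'(1)])
 have D: "Ds (Suc n) (0 # 1 # s) X * rk (eu 0 0) (rk (eu n 0) y) =
   rk (X * eu 0 0) (rk (eu n 0) y) + rk (eu 0 0) (rk (- cj (adj X) * eu n 0) y + rk (eu n 0) (Ds (Suc n) s X * y))" for X
  by (subst Ds_rk[OF u1 u(1)], subst Ds_rk[OF y'(1) u(2)]) (simp add: lD_def)
 have cje: "cj (eu a b) = eu a b" for a b by (rule fmat_eqI) simp
 show ?thesis unfolding hwD_def
 proof (intro conjI allI impI)
  show "un (IX (Suc n) (0 # 1 # s)) * rk (eu 0 0) (rk (eu n 0) y) = rk (eu 0 0) (rk (eu n 0) y)"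
   by (rule un_rk[OF u(1) u1])
  fix i assume "i < Suc n"
  then show "Ds (Suc n) (0 # 1 # s) (eu i i) * rk (eu 0 0) (rk (eu n 0) y) = of_real (wA n 1 i + w i) *c rk (eu 0 0) (rk (eu n 0) y)"
   unfolding D using y n by (auto simp: hwD_def cje eu_mult wA_def rk_lin sc_add_left)
 next
  fix i j assume "i < j" "j < Suc n"
  then show "Ds (Suc n) (0 # 1 # s) (eu i j) * rk (eu 0 0) (rk (eu n 0) y) = 0"
   unfolding D using y by (auto simp: hwD_def cje eu_mult rk_lin)
 qed (use y' in \<open>auto intro: col_rk\<close>)
qed

lemma hwD_cong: "hwD n s y w ==> (\<And>i. i < Suc n ==> w i = w' i) ==> hwD n s y w'"
 by (auto simp: hwD_def)

lemma yA_hw: assumes "n \<ge> 1" shows "hwD n (pat bQ k) (yA n k) (wA n k)"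
proof (induction k)
 case 0 then show ?case by (auto simp: hwD_def bQ_def un_eu col_euI wA_def)
next
 case (Suc k)
 have "hwD n (0 # 1 # pat bQ k) (rk (eu 0 0) (rk (eu n 0) (yA n k))) (wA n (Suc k))"
  by (rule hwD_cong[OF hwD_step[OF Suc assms]]) (auto simp: wA_def)
 then show ?case by simp
qed

lemma yB1_hw: assumes n: "n \<ge> 2" shows "hwD n (pat bR 1) (yB1 n) (wB n 1)"
proof -
 have u: "un {..<Suc n} * eu i 0 = eu i 0" if "i \<le> n" for i using that by (simp add: un_eu)
 have cje: "cj (eu a b) = eu a b" for a b by (rule fmat_eqI) simp
 have u0: "un (IX (Suc n) []) * eu 0 0 = eu 0 0" by (simp add: un_eu)
 have u4: "un (IX (Suc n) [2]) * rk (eu d 0) (eu 0 0) = rk (eu d 0) (eu 0 0)" if "d \<le> n" for d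
  by (rule un_rk[OF u[OF that] u0])
 have u3: "un (IX (Suc n) [1, 2]) * rk (eu n 0) (rk (eu d 0) (eu 0 0)) = rk (eu n 0) (rk (eu d 0) (eu 0 0))" if "d \<le> n" for d
  by (rule un_rk[OF u u4[OF that]]) simp
 have u2: "un (IX (Suc n) [1, 1, 2]) * rk (eu n 0) (rk (eu n 0) (rk (eu d 0) (eu 0 0))) = rk (eu n 0) (rk (eu n 0) (rk (eu d 0) (eu 0 0)))" if "d \<le> n" for d
  by (rule un_rk[OF u u3[OF that]]) simp
 have u1: "un (IX (Suc n) [0, 1, 1, 2]) * rk (eu a 0) (rk (eu n 0) (rk (eu n 0) (rk (eu d 0) (eu 0 0)))) = rk (eu a 0) (rk (eu n 0) (rk (eu n 0) (rk (eu d 0) (eu 0 0))))" if "a \<le> n" "d \<le> n" for a d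
  by (rule un_rk[OF u u2]) (use that in auto)
 have D: "Ds (Suc n) [0, 1, 1, 2] X * rk (eu a 0) (rk (eu n 0) (rk (eu n 0) (rk (eu d 0) (eu 0 0)))) =
   rk (X * eu a 0) (rk (eu n 0) (rk (eu n 0) (rk (eu d 0) (eu 0 0))))
  + rk (eu a 0) (rk (- cj (adj X) * eu n 0) (rk (eu n 0) (rk (eu d 0) (eu 0 0)))
  + rk (eu n 0) (rk (- cj (adj X) * eu n 0) (rk (eu d 0) (eu 0 0))
  + rk (eu n 0) (rk (X * eu d 0) (eu 0 0))))" if "a \<le> n" "d \<le> n" for X a d
  by (subst Ds_rk[OF u2[OF that(2)] u[OF that(1)]], subst Ds_rk[OF u3[OF that(2)] u[OF order_refl]],
    subst Ds_rk[OF u4[OF that(2)] u[OF order_refl]], subst Ds_rk[OF u0 u[OF that(2)]])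
   (simp add: lD_def rk_lin)
 have n1: "1 \<le> n" "0 \<le> n" using n by auto
 have p: "pat bR 1 = [0, 1, 1, 2]" by (simp add: bR_def)
 show ?thesis unfolding hwD_def p
 proof (intro conjI allI impI)
  show "col (yB1 n)" by (auto simp: yB1_def intro!: col_diff col_rk col_euI)
  show "un (IX (Suc n) [0, 1, 1, 2]) * yB1 n = yB1 n"
   unfolding yB1_def right_diff_distrib using u1[OF n1(2,1)] u1[OF n1] by simp
  fix i assume i: "i < Suc n"
  show "Ds (Suc n) [0, 1, 1, 2] (eu i i) * yB1 n = of_real (wB n 1 i) *c yB1 n"
   unfolding yB1_def right_diff_distrib D[OF n1(2,1)] D[OF n1]
   using n by (auto simp: cje eu_mult wB_def rk_lin sc_diff_right[symmetric]) (simp_all add: fmat_eq_iff)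
 next
  fix i j assume ij: "i < j" "j < Suc n"
  show "Ds (Suc n) [0, 1, 1, 2] (eu i j) * yB1 n = 0"
   unfolding yB1_def right_diff_distrib D[OF n1(2,1)] D[OF n1] using n ij by (auto simp: cje eu_mult rk_lin)
 qed
qed

lemma yB_hw: assumes n: "n \<ge> 2" shows "hwD n (pat bR (Suc k)) (yB n k) (wB n (Suc k))"
proof (induction k)
 case 0 then show ?case using yB1_hw[OF n] by simp
next
 case (Suc k)
 have n1: "n \<ge> 1" using n by simp
 have "hwD n (0 # 1 # pat bR (Suc k)) (rk (eu 0 0) (rk (eu n 0) (yB n k))) (wB n (Suc (Suc k)))"
  by (rule hwD_cong[OF hwD_step[OF Suc n1]]) (use n in \<open>auto simp: wA_def wB_def\<close>)
 then show ?case by simp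
qed

lemma ip_eu_cv: "ip (eu i 0) (cv N f) = (if i < N then f i else 0)" by (simp add: ip_def ent_eu_times ent_cv)
lemma cj_cv: "cj (cv N f) = cv N (\<lambda>i. cnj (f i))" by (rule fmat_eqI) (simp add: ent_cv)

text \<open>A non-zero pairing with one pure tensor shows that the highest weight vector has a
  non-zero component in their span, which \<open>dbase\<close> exploits.\<close>

lemma yA_xv: "adj (yA n k) * xv (pat bQ k) (cv (Suc n) (\<lambda>_. 1)) v = eu 0 0"
 by (induction k) (auto simp: bQ_def eu_mult lv_def rk_adj_rk cj_cv ip_eu_cv)
text \<open>Taking for \<open>v\<close> the basis vector 1 removes the second term of
  \<open>yB1\<close>, so the two terms cannot cancel.\<close>

lemma yB_xv:
 assumes "n \<ge> 2"
 shows "adj (yB n k) * xv (pat bR (Suc k)) (cv (Suc n) (\<lambda>_. 1)) (cv (Suc n) (\<lambda>i. if i = 1 then 1 else 0)) = eu 0 0"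
proof (induction k)
 case 0
 show ?case using assms
  by (simp add: yB1_def bR_def lv_def left_diff_distrib rk_adj_rk cj_cv ip_eu_cv eu_mult)
next
 case (Suc k)
 then show ?case by (simp add: lv_def rk_adj_rk cj_cv ip_eu_cv)
qed

section \<open>Multiplicities in tensor powers\<close>

definition isdec :: "nat => nat list => nat => fmat set => bool" where
 "isdec n b k PS \<longleftrightarrow> finite PS \<and> PI (Suc n) (pat b k) = \<Sum>PS \<and>
  (\<forall>Q\<in>PS. irr (Suc n) Q (\<lambda>g. Q * rho (pat b k) g)) \<and>
  (\<forall>Q\<in>PS. proj Q \<and> PI (Suc n) (pat b k) * Q = Q \<and> (\<forall>g\<in>SU (Suc n). Q * rho (pat b k) g = rho (pat b k) g * Q)) \<and>
  (\<forall>Q\<in>PS. \<forall>Q'\<in>PS. Q \<noteq> Q' --> Q * Q' = 0)"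

lemma dec_ex: "\<exists>PS. isdec n b k PS"
proof -
 interpret U: urep "Suc n" "un (IX (Suc n) (pat b k))" "rho (pat b k)" by (rule urep_rho) simp
 have c: "PI (Suc n) (pat b k) * rho (pat b k) g = rho (pat b k) g * PI (Suc n) (pat b k)" if "g \<in> SU (Suc n)" for g
  using PI_commute[OF UU_D(1)[OF SU_UU[OF that]]] by simp
 show ?thesis by (rule U.decompose[OF PI(1) PI_un(1) c], assumption) (unfold isdec_def, blast)
qed

definition ov :: "nat => nat list => nat => fmat => fmat => (nat => real) => bool" where
 "ov n b k Q v w \<longleftrightarrow> urep.hwv (Suc n) Q (\<lambda>g. Q * rho (pat b k) g) v w"

locale dec =
 fixes n b k PS
 assumes n2: "n \<ge> 2" and gb: "good b" and dec: "isdec n b k PS"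
begin

abbreviation "N \<equiv> Suc n"
abbreviation "s \<equiv> pat b k"
abbreviation "R \<equiv> rho s"
abbreviation "P0 \<equiv> PI N s"

lemma n1: "n \<ge> 1" using n2 by simp

sublocale U: urep N "un (IX N s)" R by (rule urep_rho) simp

lemma dirr: "Q \<in> PS ==> irr N Q (\<lambda>g. Q * R g)" using dec by (simp add: isdec_def)
lemma dkirr: "Q \<in> PS ==> kirr n Q (\<lambda>g. Q * R g)"
 using dirr n2 by (simp add: kirr_def kirr_axioms_def)
lemma dQ: "Q \<in> PS ==> proj Q" "Q \<in> PS ==> P0 * Q = Q" "Q \<in> PS ==> g \<in> SU N ==> Q * R g = R g * Q"
 "Q \<in> PS ==> Q' \<in> PS ==> Q \<noteq> Q' ==> Q * Q' = 0"
 using dec unfolding isdec_def by auto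
lemma dQP: "Q \<in> PS ==> Q * P0 = Q" using dQ(1,2) PI(1) proj_diff(2) by blast
lemma dQe: "Q \<in> PS ==> un (IX N s) * Q = Q" using dQ(2) PI_un(1) by (metis mult.assoc)
lemma dfin: "finite PS" and dsum: "P0 = \<Sum>PS" using dec by (simp_all add: isdec_def)

text \<open>The orbit of the base point spans the model, so an intertwiner is determined by its
  value on \<open>X0\<close>.\<close>

lemma gen_zero:
 assumes "\<And>g. g \<in> SU N ==> B * R g = r' g * B" "B * X0 n s = 0" "B * P0 = B" shows "B = 0"
 using xv_generate[OF n1 good_set[OF gb] assms(1) X0_cols[OF gb assms(2)]] assms(3) by metis

lemma kequiv_mult:
 assumes e': "e' * B = B" and B: "\<And>g. g \<in> SU N ==> B * R g = r' g * B"
 shows "kequiv n e' r' (B * X0 n s)"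
proof -
 have X: "X0 n s * un {..<Suc n} = X0 n s" "\<And>g. g \<in> KK n ==> R g * X0 n s = cnj (ent g n n) *c (X0 n s * g)"
  using X0_kequiv[OF gb n1, of k] by (auto simp: kequiv_def)
 show ?thesis unfolding kequiv_def
 proof (intro conjI ballI)
  show "e' * (B * X0 n s) = B * X0 n s" using e' by (simp add: assoc')
  show "B * X0 n s * un {..<Suc n} = B * X0 n s" using X by (simp add: mult.assoc)
  fix g assume g: "g \<in> KK n"
  then have "g \<in> SU N" by (simp add: KK_def)
  then have "r' g * (B * X0 n s) = B * (R g * X0 n s)" using B by (metis mult.assoc)
  then show "r' g * (B * X0 n s) = cnj (ent g n n) *c (B * X0 n s * g)" using X(2)[OF g] by (simp add: mult.assoc)
 qed
qed

lemma Qint: "Q \<in> PS ==> g \<in> SU N ==> Q * R g = (Q * R g) * Q"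
 using dQ(1,3) by (metis mult.assoc projD(2))

text \<open>As \<open>X0\<close> generates the model, it has a non-zero component in every
  irreducible summand; therefore only weights of types A and B can occur.\<close>

lemma QX: assumes "Q \<in> PS" shows "kequiv n Q (\<lambda>g. Q * R g) (Q * X0 n s)" "Q * X0 n s \<noteq> 0"
proof -
 show "kequiv n Q (\<lambda>g. Q * R g) (Q * X0 n s)" by (rule kequiv_mult) (use assms dQ Qint in \<open>auto simp: proj_def\<close>)
 show "Q * X0 n s \<noteq> 0"
  using gen_zero[of Q R] dQ(3)[OF assms] dQP[OF assms] irr.e_nz[OF dirr[OF assms]] by metis
qed

lemma bQ_lastcol: "b = bQ ==> B * X0 n s * eu n n = B * X0 n s"
 using bQR_count(3)[of k] by (simp add: X0_def mult.assoc eu_mult)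

lemma hwvQ: "Q \<in> PS ==> ov n b k Q v w \<longleftrightarrow> U.hwv v w \<and> Q * v = v"
 unfolding ov_def by (rule U.subrep_hwv) (use dQ dQe in auto)

lemma dtype:
 assumes Q: "Q \<in> PS"
 shows "(\<exists>j v. ov n b k Q v (wA n j)) \<or> (\<exists>j v. 1 \<le> j \<and> b = bR \<and> ov n b k Q v (wB n j))"
proof -
 interpret Q: kirr n Q "\<lambda>g. Q * R g" by (rule dkirr[OF Q])
 obtain v w where v: "Q.hwv v w" by (rule Q.hw_exists[OF Q.e_nz])
 have t: "Q.typeA w \<or> Q.typeB w" by (rule Q.kequiv_type[OF QX[OF Q] v])
 show ?thesis
 proof (cases "Q.typeA w")
  case True
  then show ?thesis using Q.typeA_wA[OF v] unfolding ov_def by metis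
 next
  case False
  then have "b = bR" using Q.lastcol_typeA[OF QX[OF Q] bQ_lastcol v] gb unfolding good_def by blast
  then show ?thesis using Q.typeB_wB[OF v] t False unfolding ov_def by metis
 qed
qed

lemma dbound:
 assumes Q: "Q \<in> PS" and v: "ov n b k Q v w" shows "- real (count_list s 1) \<le> w n"
proof -
 have v': "U.hwv v w" using v hwvQ[OF Q] by blast
 have "Dop N (un (IX N s)) R (eu n n) = Ds N s (eu n n)"
  by (rule Dop_rho) (use good_set[OF gb] good_count[OF gb] inn_eu in auto)
 then have "Ds N s (eu n n) * v = of_real (w n) *c v" using v' unfolding U.hwv_def by (metis lessI)
 then show ?thesis using Ds_eigen_ge[OF good_set[OF gb]] v' by (simp add: U.hwv_def)
qed

text \<open>Let \<open>T\<close> identify a second summand \<open>Q'\<close> with \<open>Q\<close>.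
  Then \<open>Q * X0\<close> and \<open>T * X0\<close> are equivariant maps into \<open>Q\<close>
  with values on a common line, so a combination \<open>x *c Q + y *c T\<close> kills
  \<open>X0\<close> and hence vanishes. Multiplying by \<open>Q'\<close> from the right gives
  \<open>y = 0\<close>, and then \<open>x = 0\<close>. In the second model this is claimed for type
  B only, since a value of type A may involve the two coordinates 0 and \<open>n\<close>.\<close>

lemma dunique:
 assumes Q: "Q \<in> PS" "Q' \<in> PS" and v: "ov n b k Q v w" "ov n b k Q' v' w" and w: "b = bQ \<or> w = wB n j"
 shows "Q = Q'"
proof (rule ccontr)
 assume ne: "Q \<noteq> Q'"
 interpret Q: kirr n Q "\<lambda>g. Q * R g" by (rule dkirr[OF Q(1)])
 interpret Q': kirr n Q' "\<lambda>g. Q' * R g" by (rule dkirr[OF Q(2)])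
 have hv: "Q.hwv v w" "Q'.hwv v' w" using v by (auto simp: ov_def)
 obtain T where T: "T \<noteq> 0" "T * Q' = T" "Q * T = T" "\<And>g. g \<in> SU N ==> T * (Q' * R g) = Q * R g * T"
  using hw_unique[OF Q'.irr_axioms Q.irr_axioms hv(2,1)] by blast
 have TR: "T * R g = Q * R g * T" if "g \<in> SU N" for g using T(4)[OF that] T(2) by (metis mult.assoc)
 have KT: "kequiv n Q (\<lambda>g. Q * R g) (T * X0 n s)" by (rule kequiv_mult[OF T(3) TR])
 have "\<exists>x y. (x \<noteq> 0 \<or> y \<noteq> 0) \<and> x *c (Q * X0 n s) + y *c (T * X0 n s) = 0"
 proof (cases "b = bQ")
  case True
  then show ?thesis by (intro Q.mult_lastcol[OF QX(1)[OF Q(1)] KT _ _ hv(1)] bQ_lastcol)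
 next
  case False
  then have "Q.typeB w" using w n2 by (auto simp: Q.typeB_def wB_def)
  then show ?thesis by (rule Q.mult_typeB[OF QX(1)[OF Q(1)] KT hv(1)])
 qed
 then obtain x y where xy: "x \<noteq> 0 \<or> y \<noteq> 0" "(x *c Q + y *c T) * X0 n s = 0" by (auto simp: ring_distribs)
 have "x *c Q + y *c T = 0"
 proof (rule gen_zero[OF _ xy(2)])
  show "(x *c Q + y *c T) * R g = (\<lambda>g. Q * R g) g * (x *c Q + y *c T)" if "g \<in> SU N" for g
   using TR[OF that] Qint[OF Q(1) that] by (simp add: ring_distribs)
  have "T * P0 = T" using T(2) dQP[OF Q(2)] by (metis mult.assoc)
  then show "(x *c Q + y *c T) * P0 = x *c Q + y *c T" using dQP[OF Q(1)] by (simp add: ring_distribs)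
 qed
 then have "(x *c Q + y *c T) * Q' = 0" by simp
 then have "y *c T = 0" using dQ(4)[OF Q ne] T(2) by (simp add: ring_distribs)
 then have "y = 0" using T(1) by simp
 then show False using xy(1) \<open>x *c Q + y *c T = 0\<close> Q.e_nz by simp
qed

text \<open>Since \<open>y\<close> is not orthogonal to the span of the pure tensors, some summand
  has a non-zero component of \<open>y\<close>, and this is a highest weight vector of the same
  weight.\<close>

lemma dbase:
 assumes y: "hwD n s y w" and x: "adj y * xv s (cv N f) (cv N h) \<noteq> 0"
 shows "\<exists>Q\<in>PS. \<exists>v. ov n b k Q v w"
proof -
 have "\<exists>Q\<in>PS. Q * y \<noteq> 0"
 proof (rule ccontr)
  assume a: "\<not> (\<exists>Q\<in>PS. Q * y \<noteq> 0)"
  have "P0 * y = (\<Sum>Q\<in>PS. Q * y)" by (subst dsum) (simp add: sum_distrib_right)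
  also have "\<dots> = 0" using a by simp
  finally have "adj (P0 * y) * xv s (cv N f) (cv N h) = 0" by simp
  then have "adj y * (P0 * xv s (cv N f) (cv N h)) = 0" using PI(1) by (simp add: proj_def mult.assoc)
  then show False using x PI_xv by simp
 qed
 then obtain Q where Q: "Q \<in> PS" "Q * y \<noteq> 0" by blast
 have QD: "U.D X * Q = Q * U.D X" for X using U.subrep(3)[of Q X] dQ dQe Q by metis
 have DD: "U.D X * (Q * y) = Q * (Ds N s X * y)" if "inn N X" for X
  using Dop_rho[OF _ good_set[OF gb] good_count[OF gb] that] QD[of X] by (metis mult.assoc zero_less_Suc)
 have "U.hwv (Q * y) w" unfolding U.hwv_def
 proof (intro conjI allI impI)
  show "Submission.col (Q * y)" using y by (simp add: hwD_def col_mult)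
  show "un (IX N s) * (Q * y) = Q * y" using dQe[OF Q(1)] by (simp add: assoc')
 qed (use y Q(2) in \<open>auto simp: DD inn_eu hwD_def\<close>)
 moreover have "Q * (Q * y) = Q * y" using dQ(1)[OF Q(1)] by (simp add: proj_def assoc')
 ultimately show ?thesis using Q(1) hwvQ[OF Q(1)] by blast
qed

end

lemma hwv_transport:
 assumes A: "irr N e r" and B: "irr N e' r'" and T: "T \<noteq> 0" "T * e = T" "e' * T = T" "\<And>g. g \<in> SU N ==> T * r g = r' g * T"
  and v: "urep.hwv N e r v w"
 shows "urep.hwv N e' r' (T * v) w"
proof -
 interpret A: irr N e r by (rule A)
 interpret B: irr N e' r' by (rule B)
 have TD: "T * A.D X = B.D X * T" for X
  using urep_intertwine[OF A.urep_axioms B.urep_axioms T(2,3)] T(4) by blast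
 have D: "B.D X * (T * v) = T * (A.D X * v)" for X using TD[of X] by (metis mult.assoc)
 obtain c where c: "c > 0" "adj T * T = of_real c *c e" using intertwiner_iso[OF A B T] by metis
 have "adj T * (T * v) = of_real c *c v" using v by (simp add: mac[OF c(2)] A.hwv_def)
 then have "T * v \<noteq> 0" using c(1) v by (auto simp: A.hwv_def)
 then show ?thesis using v mac[OF T(3), of v] unfolding B.hwv_def A.hwv_def by (auto simp: D col_mult)
qed

text \<open>Tensoring with the invariant element, the sum of the basis vectors tensored with their
  conjugates; it maps the tensor power of \<open>s\<close> equivariantly into that of
  \<open>0 # 1 # s\<close>.\<close>

definition iota :: "nat => nat list => fmat" where
 "iota N s = (\<Sum>i<N. rk (eu i 0) (rk (eu i 0) (un (IX N s))))"

lemma iota_rho: assumes g: "g \<in> UU N" shows "rho (0 # 1 # s) g * iota N s = iota N s * rho s g"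
proof -
 have inn: "inn N g" by (rule UU_D(1)[OF g])
 have L: "rho (0 # 1 # s) g * iota N s = (\<Sum>i<N. rk (g * eu i 0) (rk (cj g * eu i 0) (rho s g)))"
  using rho_un[OF inn] by (simp add: iota_def sum_distrib_left kron_rk lt_def)
 have R: "iota N s * rho s g = (\<Sum>i<N. rk (eu i 0) (rk (eu i 0) (rho s g)))"
  using rho_un[OF inn] by (simp add: iota_def sum_distrib_right rk_mult)
 show ?thesis unfolding L R
 proof (rule fmat_eqI)
  fix p q
  define a where "a = fst (prod_decode p)"
  define c where "c = fst (prod_decode (snd (prod_decode p)))"
  define y where "y = ent (rho s g) (snd (prod_decode (snd (prod_decode p)))) q"
  have "ent (\<Sum>i<N. rk (g * eu i 0) (rk (cj g * eu i 0) (rho s g))) p q = (\<Sum>i<N. ent g a i * cnj (ent g c i)) * y"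
   by (simp add: ent_rk ent_times_eu a_def c_def y_def sum_distrib_right mult.assoc)
  also have "(\<Sum>i<N. ent g a i * cnj (ent g c i)) = ent (g * adj g) a c"
   using inn by (simp add: ent_times_n[of N])
  also have "\<dots> = (if a = c \<and> a < N then 1 else 0)" using UU_D(3)[OF g] by (simp add: ent_un)
  also have "\<dots> * y = (\<Sum>i<N. if i = a then (if c = a then y else 0) else 0)" by simp
  also have "\<dots> = (\<Sum>i<N. (if a = i then 1 else 0) * ((if c = i then 1 else 0) * y))"
   by (intro sum.cong) auto
  also have "\<dots> = ent (\<Sum>i<N. rk (eu i 0) (rk (eu i 0) (rho s g))) p q"
   by (simp add: ent_rk a_def c_def y_def)
  finally show "ent (\<Sum>i<N. rk (g * eu i 0) (rk (cj g * eu i 0) (rho s g))) p q =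
   ent (\<Sum>i<N. rk (eu i 0) (rk (eu i 0) (rho s g))) p q" .
 qed
qed

lemma iota_xv: "n < N ==> adj (iota N s) * xv (0 # 1 # s) (eu n 0) v = un (IX N s) * xv s (eu n 0) v"
proof -
 assume n: "n < N"
 have cje: "cj (eu n 0) = eu n 0" by (rule fmat_eqI) simp
 have "adj (iota N s) * xv (0 # 1 # s) (eu n 0) v = (\<Sum>i<N. if i = n then un (IX N s) * xv s (eu n 0) v else 0)"
  unfolding iota_def adj_sum sum_distrib_right
  by (intro sum.cong) (auto simp: lv_def rk_adj_rk cje ip_def eu_mult)
 then show ?thesis using n by simp
qed

text \<open>The adjoint of \<open>iota\<close> contracts the first pair, and at the base point it
  returns the shorter pure tensor. Hence \<open>Q\<close> is seen from the longer model: some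
  summand \<open>Q'\<close> there is linked to it by a non-zero intertwiner, which transports the
  highest weight vector.\<close>

lemma dstep:
 assumes A: "dec n b k PS" and B: "dec n b (Suc k) PS'" and Q: "Q \<in> PS" "ov n b k Q v w"
 shows "\<exists>Q'\<in>PS'. \<exists>v'. ov n b (Suc k) Q' v' w"
proof -
 interpret A: dec n b k PS by (rule A)
 interpret B: dec n b "Suc k" PS' by (rule B)
 have U: "g \<in> UU (Suc n)" if "g \<in> SU (Suc n)" for g using that by (rule SU_UU)
 have "\<exists>Q'\<in>PS'. Q' * iota (Suc n) A.s * Q \<noteq> 0"
 proof (rule ccontr)
  assume a: "\<not> (\<exists>Q'\<in>PS'. Q' * iota (Suc n) A.s * Q \<noteq> 0)"
  have "B.P0 * (iota (Suc n) A.s * Q) = (\<Sum>Q'\<in>PS'. Q' * iota (Suc n) A.s * Q)"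
   by (subst B.dsum) (simp add: sum_distrib_right mult.assoc)
  also have "\<dots> = 0" using a by simp
  finally have "adj (B.P0 * (iota (Suc n) A.s * Q)) = 0" by simp
  then have 0: "Q * (adj (iota (Suc n) A.s) * B.P0) = 0"
   using PI(1) A.dQ(1)[OF Q(1)] by (simp add: proj_def mult.assoc)
  have "Q * xv A.s (eu n 0) (cv (Suc n) h) = 0" for h
  proof -
   have e: "eu n 0 = cv (Suc n) (\<lambda>i. if i = n then 1 else 0)" by (rule fmat_eqI) (auto simp: ent_cv)
   have "Q * (adj (iota (Suc n) A.s) * B.P0) * xv B.s (eu n 0) (cv (Suc n) h) = 0" by (simp only: 0 mult_zero_left)
   then have "Q * (adj (iota (Suc n) A.s) * xv B.s (eu n 0) (cv (Suc n) h)) = 0"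
    unfolding mult.assoc using PI_xv[of "Suc n" B.s "\<lambda>i. if i = n then 1 else 0" h] by (simp only: e)
   moreover have "adj (iota (Suc n) A.s) * xv (0 # 1 # A.s) (eu n 0) (cv (Suc n) h) = un (IX (Suc n) A.s) * xv A.s (eu n 0) (cv (Suc n) h)"
    by (rule iota_xv) simp
   ultimately have "Q * (un (IX (Suc n) A.s) * xv A.s (eu n 0) (cv (Suc n) h)) = 0" by (simp only: pat.simps)
   moreover have "un (IX (Suc n) A.s) * xv A.s (eu n 0) (cv (Suc n) h) = xv A.s (eu n 0) (cv (Suc n) h)"
    by (rule xv_un) (auto simp: un_eu cv_un)
   ultimately show ?thesis by simp
  qed
  from xv_generate[OF A.n1 good_set[OF A.gb] A.dQ(3)[OF Q(1)] this] have "Q * A.P0 = 0" by blast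
  then show False using A.dQP[OF Q(1)] irr.e_nz[OF A.dirr[OF Q(1)]] by simp
 qed
 then obtain Q' where Q': "Q' \<in> PS'" "Q' * iota (Suc n) A.s * Q \<noteq> 0" by blast
 define T where "T = Q' * iota (Suc n) A.s * Q"
 have i: "iota (Suc n) A.s * A.R g = B.R g * iota (Suc n) A.s" if "g \<in> SU (Suc n)" for g
  using iota_rho[OF U[OF that], of A.s] by simp
 have "T * (Q * A.R g) = Q' * B.R g * T" if g: "g \<in> SU (Suc n)" for g
 proof -
  have "T * (Q * A.R g) = Q' * iota (Suc n) A.s * (A.R g * Q)"
  proof -
   have "Q * (Q * A.R g) = Q * A.R g" using A.dQ(1)[OF Q(1)] by (simp add: assoc' proj_def)
   also have "\<dots> = A.R g * Q" by (rule A.dQ(3)[OF Q(1) g])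
   finally have "Q * (Q * A.R g) = A.R g * Q" .
   then show ?thesis by (simp add: T_def mult.assoc)
  qed
  also have "\<dots> = Q' * (B.R g * (iota (Suc n) A.s * Q))" using i[OF g] by (metis mult.assoc)
  also have "\<dots> = Q' * B.R g * T" using B.Qint[OF Q'(1) g] by (metis T_def mult.assoc)
  finally show ?thesis .
 qed
 moreover have "T * Q = T" "Q' * T = T" using A.dQ(1)[OF Q(1)] B.dQ(1)[OF Q'(1)]
  by (simp_all add: T_def mult.assoc proj_def) (metis mult.assoc)
 moreover have "T \<noteq> 0" using Q'(2) by (simp add: T_def)
 ultimately have "urep.hwv (Suc n) Q' (\<lambda>g. Q' * B.R g) (T * v) w"
  using hwv_transport[OF A.dirr[OF Q(1)] B.dirr[OF Q'(1)], of T] Q(2) unfolding ov_def by blast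
 then show ?thesis using Q'(1) unfolding ov_def by blast
qed

lemma dexists:
 assumes base: "\<And>PS. dec n b j PS ==> \<exists>Q\<in>PS. \<exists>v. ov n b j Q v w" and D: "dec n b k PS" and jk: "j \<le> k"
 shows "\<exists>Q\<in>PS. \<exists>v. ov n b k Q v w" using jk D
proof (induction k arbitrary: PS rule: dec_induct)
 case base then show ?case using assms(1) by blast
next
 case (step k)
 obtain PS0 where "isdec n b k PS0" using dec_ex by blast
 then have "dec n b k PS0" using step(4) by (simp add: dec_def)
 then show ?case using step(3) dstep[OF _ step(4)] by blast
qed

lemma dexists_A: assumes "dec n bQ k PS" "j \<le> k" shows "\<exists>Q\<in>PS. \<exists>v. ov n bQ k Q v (wA n j)"
proof (rule dexists[OF _ assms])
 fix PS assume D: "dec n bQ j PS"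
 then have "n \<ge> 1" by (rule dec.n1)
 then show "\<exists>Q\<in>PS. \<exists>v. ov n bQ j Q v (wA n j)"
  using dec.dbase[OF D yA_hw[of n j], of "\<lambda>_. 1" "\<lambda>_. 0"] yA_xv by simp
qed

lemma dexists_B: assumes "dec n bR k PS" "1 \<le> j" "j \<le> k" shows "\<exists>Q\<in>PS. \<exists>v. ov n bR k Q v (wB n j)"
proof (rule dexists[OF _ assms(1,3)])
 fix PS assume D: "dec n bR j PS"
 obtain i where j: "j = Suc i" using assms(2) by (cases j) auto
 have n: "n \<ge> 2" using D by (simp add: dec_def)
 show "\<exists>Q\<in>PS. \<exists>v. ov n bR j Q v (wB n j)"
  using dec.dbase[OF D, unfolded j, OF yB_hw[OF n]] yB_xv[OF n, of i] unfolding j by (metis eu_nz)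
qed

text \<open>By Schur's lemma two highest weights of one summand can be compared through their
  Casimir scalars, which are injective on each family.\<close>

lemma casc_unique:
 assumes "irr N e r" "urep.hwv N e r v w" "urep.hwv N e r v' w'" shows "casc N w = casc N w'"
proof -
 interpret irr N e r by (rule assms)
 have "complex_of_real (casc N w) *c e = of_real (casc N w') *c e"
  using CAS_scalar[OF assms(2)] CAS_scalar[OF assms(3)] by simp
 then show ?thesis using e_nz unfolding sc_eq_iff by simp
qed

section \<open>Separation of the weights by their Casimir scalars\<close>

lemma half_eq: "2 * x = 2 * y ==> x = (y::real)" by simp

lemma casc_A_inj: assumes "n \<ge> 1" "casc (Suc n) (wA n i) = casc (Suc n) (wA n j)" shows "i = j"
proof -
 have "i * (i + n) = j * (j + n)"
 proof -
  have "2 * (real i * (real i + real n)) = 2 * (real j * (real j + real n))"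
   using assms(2) by (simp only: casc_wA[OF assms(1)] mult.assoc)
  then have "real i * (real i + real n) = real j * (real j + real n)" by (rule half_eq)
  then have "real (i * (i + n)) = real (j * (j + n))" by simp
  then show ?thesis by (simp only: of_nat_eq_iff)
 qed
 moreover have "i * (i + n) < j * (j + n)" if "i < j" for i j
  using that by (intro mult_strict_mono) (use assms in auto)
 ultimately show ?thesis by (metis linorder_neqE_nat less_irrefl)
qed

lemma casc_B_inj: assumes "n \<ge> 2" "casc (Suc n) (wB n i) = casc (Suc n) (wB n j)" shows "i = j"
proof -
 have "(i + 1) * (i + n) = (j + 1) * (j + n)"
 proof -
  have "2 * ((real i + 1) * (real i + real n)) = 2 * ((real j + 1) * (real j + real n))"
   using assms(2) by (simp only: casc_wB[OF assms(1)] mult.assoc)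
  then have "(real i + 1) * (real i + real n) = (real j + 1) * (real j + real n)" by (rule half_eq)
  then have "real ((i + 1) * (i + n)) = real ((j + 1) * (j + n))" by (simp add: algebra_simps)
  then show ?thesis by (simp only: of_nat_eq_iff)
 qed
 moreover have "(i + 1) * (i + n) < (j + 1) * (j + n)" if "i < j" for i j
  using that by (intro mult_strict_mono) auto
 ultimately show ?thesis by (metis linorder_neqE_nat less_irrefl)
qed

lemma casc_AB: assumes "n \<ge> 2" shows "casc (Suc n) (wA n i) \<noteq> casc (Suc n) (wB n j)"
proof
 assume "casc (Suc n) (wA n i) = casc (Suc n) (wB n j)"
 moreover have "n \<ge> 1" using assms by simp
 ultimately have "2 * (real i * (real i + real n)) = 2 * ((real j + 1) * (real j + real n))"
  by (simp only: casc_wA casc_wB[OF assms] mult.assoc)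
 then have "real i * (real i + real n) = (real j + 1) * (real j + real n)" by (rule half_eq)
 then have "real (i * (i + n)) = real ((j + 1) * (j + n))" by (simp add: algebra_simps)
 then have eq: "i * (i + n) = (j + 1) * (j + n)" by (simp only: of_nat_eq_iff)
 show False
 proof (cases "i \<le> j")
  case True
  then have "i * (i + n) \<le> j * (j + n)" by (intro mult_mono) auto
  also have "\<dots> < (j + 1) * (j + n)" using assms by simp
  finally show False using eq by simp
 next
  case False
  then have "(j + 1) * (j + n) < (j + 1) * (i + n)" by (intro mult_strict_left_mono) auto
  also have "\<dots> \<le> i * (i + n)" using False by (intro mult_mono) auto
  finally show False using eq by simp
 qed
qed

definition tT :: "nat => nat list => fmat set => nat => complex" where
 "tT n b \<Gamma> k = nG \<Gamma> (\<lambda>g. PI (Suc n) (pat b k) * rho (pat b k) g)"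

lemma (in dec) tT_sum: "tT n b \<Gamma> k = (\<Sum>Q\<in>PS. nG \<Gamma> (\<lambda>g. Q * R g))"
proof -
 have "tr (P0 * R g) = (\<Sum>Q\<in>PS. tr (Q * R g))" for g by (subst dsum) (simp add: sum_distrib_right)
 then have "tT n b \<Gamma> k = (\<Sum>g\<in>\<Gamma>. \<Sum>Q\<in>PS. tr (Q * R g)) / of_nat (card \<Gamma>)" by (simp add: tT_def nG_def)
 then show ?thesis by (subst (asm) sum.swap) (simp add: nG_def sum_divide_distrib)
qed

text \<open>Among the summands each index occurs at most once by \<open>dunique\<close>, at least
  once up to \<open>k\<close> by \<open>dexists_A\<close>, and none exceeds \<open>k\<close> by
  \<open>dbound\<close>.\<close>

lemma tT_Q:
 assumes n: "n \<ge> 2" and \<Gamma>: "\<Gamma> \<subseteq> SU (Suc n)"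
 shows "tT n bQ \<Gamma> k = (\<Sum>j\<le>k. nW (Suc n) \<Gamma> (wA n j))"
proof -
 obtain PS where "isdec n bQ k PS" using dec_ex by blast
 then have D: "dec n bQ k PS" using n by (simp add: dec_def good_def)
 interpret dec n bQ k PS by (rule D)
 have "\<exists>j v. ov n bQ k Q v (wA n j)" if "Q \<in> PS" for Q
  using dtype[OF that] by (auto simp: bQ_def bR_def)
 then obtain h where h: "\<And>Q. Q \<in> PS ==> \<exists>v. ov n bQ k Q v (wA n (h Q))" by metis
 have inj: "inj_on h PS" using h dunique by (intro inj_onI) metis
 have img: "h ` PS = {..k}"
 proof
  show "h ` PS \<subseteq> {..k}"
  proof
   fix j assume "j \<in> h ` PS"
   then obtain Q where Q0: "Q \<in> PS" "j = h Q" by auto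
   then obtain v where Q: "Q \<in> PS" "ov n bQ k Q v (wA n j)" using h by auto
   from dbound[OF this] show "j \<in> {..k}" using n bQR_count(2)[of k] by (simp add: wA_def)
  qed
  show "{..k} \<subseteq> h ` PS"
  proof
   fix j assume "j \<in> {..k}"
   then obtain Q v where Q: "Q \<in> PS" "ov n bQ k Q v (wA n j)" using dexists_A[OF D, of j] by auto
   obtain v' where "ov n bQ k Q v' (wA n (h Q))" using h[OF Q(1)] by blast
   then have "casc N (wA n j) = casc N (wA n (h Q))"
    using casc_unique[OF dirr[OF Q(1)]] Q(2) unfolding ov_def by blast
   then have "j = h Q" by (rule casc_A_inj[OF n1])
   then show "j \<in> h ` PS" using Q(1) by blast
  qed
 qed
 have "tT n bQ \<Gamma> k = (\<Sum>Q\<in>PS. nW N \<Gamma> (wA n (h Q)))" unfolding tT_sum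
 proof (intro sum.cong refl)
  fix Q assume Q: "Q \<in> PS"
  obtain v where "ov n bQ k Q v (wA n (h Q))" using h[OF Q] by blast
  then show "nG \<Gamma> (\<lambda>g. Q * R g) = nW N \<Gamma> (wA n (h Q))"
   using nW_eq[OF dirr[OF Q] _ \<Gamma>] unfolding ov_def by blast
 qed
 also have "\<dots> = (\<Sum>j\<in>h ` PS. nW N \<Gamma> (wA n j))" using inj by (simp add: sum.reindex)
 finally show ?thesis unfolding img .
qed

text \<open>Only the difference of the two groups is computed, because the number of summands of
  type A in this model is left open; their contributions cancel by the assumption
  \<open>A\<close>.\<close>

lemma tT_R:
 assumes n: "n \<ge> 2" and \<Gamma>: "\<Gamma> \<subseteq> SU (Suc n)" "\<Gamma>' \<subseteq> SU (Suc n)"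
  and A: "\<And>j. nW (Suc n) \<Gamma> (wA n j) = nW (Suc n) \<Gamma>' (wA n j)"
 shows "tT n bR \<Gamma> k - tT n bR \<Gamma>' k = (\<Sum>j=1..k. nW (Suc n) \<Gamma> (wB n j) - nW (Suc n) \<Gamma>' (wB n j))"
proof -
 obtain PS where "isdec n bR k PS" using dec_ex by blast
 then have D: "dec n bR k PS" using n by (simp add: dec_def good_def)
 interpret dec n bR k PS by (rule D)
 define d where "d Q = nG \<Gamma> (\<lambda>g. Q * R g) - nG \<Gamma>' (\<lambda>g. Q * R g)" for Q
 have dn: "d Q = nW N \<Gamma> w - nW N \<Gamma>' w" if "Q \<in> PS" "ov n bR k Q v w" for Q v w
  using nW_eq[OF dirr[OF that(1)] _ \<Gamma>(1)] nW_eq[OF dirr[OF that(1)] _ \<Gamma>(2)] that(2) unfolding ov_def d_def by metis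
 define PB where "PB = {Q \<in> PS. \<exists>j v. 1 \<le> j \<and> ov n bR k Q v (wB n j)}"
 have "tT n bR \<Gamma> k - tT n bR \<Gamma>' k = (\<Sum>Q\<in>PS. d Q)" by (simp add: tT_sum d_def sum_subtractf)
 also have "\<dots> = (\<Sum>Q\<in>PB. d Q)"
 proof (rule sum.mono_neutral_right[OF dfin])
  show "\<forall>Q\<in>PS - PB. d Q = 0"
  proof
   fix Q assume Q: "Q \<in> PS - PB"
   then obtain j v where "ov n bR k Q v (wA n j)" using dtype[of Q] unfolding PB_def by blast
   then show "d Q = 0" using dn Q A by simp
  qed
 qed (auto simp: PB_def)
 also have "\<dots> = (\<Sum>j=1..k. nW (Suc n) \<Gamma> (wB n j) - nW (Suc n) \<Gamma>' (wB n j))"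
 proof -
  have "\<exists>j. 1 \<le> j \<and> (\<exists>v. ov n bR k Q v (wB n j))" if "Q \<in> PB" for Q using that by (auto simp: PB_def)
  then obtain h where h: "\<And>Q. Q \<in> PB ==> 1 \<le> h Q \<and> (\<exists>v. ov n bR k Q v (wB n (h Q)))" by metis
  have PBS: "Q \<in> PS" if "Q \<in> PB" for Q using that by (simp add: PB_def)
  have inj: "inj_on h PB"
  proof (rule inj_onI)
   fix Q Q' assume Q: "Q \<in> PB" "Q' \<in> PB" "h Q = h Q'"
   obtain v v' where "ov n bR k Q v (wB n (h Q))" "ov n bR k Q' v' (wB n (h Q))"
    using h[OF Q(1)] h[OF Q(2)] Q(3) by auto
   then show "Q = Q'" by (rule dunique[OF PBS[OF Q(1)] PBS[OF Q(2)]]) blast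
  qed
  have img: "h ` PB = {1..k}"
  proof
   show "h ` PB \<subseteq> {1..k}"
   proof
    fix j assume "j \<in> h ` PB"
    then obtain Q where Q0: "Q \<in> PB" "j = h Q" by auto
    then obtain v where Q: "Q \<in> PB" "1 \<le> j" "ov n bR k Q v (wB n j)" using h by auto
    from dbound[OF PBS[OF Q(1)] Q(3)] show "j \<in> {1..k}" using Q(2) n bQR_count(5)[of k] by (simp add: wB_def)
   qed
   show "{1..k} \<subseteq> h ` PB"
   proof
    fix j assume j: "j \<in> {1..k}"
    then obtain Q v where Q: "Q \<in> PS" "ov n bR k Q v (wB n j)" using dexists_B[OF D, of j] by auto
    then have QB: "Q \<in> PB" using j by (auto simp: PB_def)
    obtain v' where "ov n bR k Q v' (wB n (h Q))" using h[OF QB] by blast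
    then have "casc N (wB n j) = casc N (wB n (h Q))"
     using casc_unique[OF dirr[OF Q(1)]] Q(2) unfolding ov_def by blast
    then have "j = h Q" by (rule casc_B_inj[OF n])
    then show "j \<in> h ` PB" using QB by blast
   qed
  qed
  have "(\<Sum>Q\<in>PB. d Q) = (\<Sum>Q\<in>PB. nW N \<Gamma> (wB n (h Q)) - nW N \<Gamma>' (wB n (h Q)))"
  proof (intro sum.cong refl)
   fix Q assume Q: "Q \<in> PB"
   obtain v where "ov n bR k Q v (wB n (h Q))" using h[OF Q] by blast
   then show "d Q = nW N \<Gamma> (wB n (h Q)) - nW N \<Gamma>' (wB n (h Q))" by (rule dn[OF PBS[OF Q]])
  qed
  also have "\<dots> = (\<Sum>j\<in>h ` PB. nW N \<Gamma> (wB n j) - nW N \<Gamma>' (wB n j))" using inj by (simp add: sum.reindex)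
  finally show ?thesis unfolding img .
 qed
 finally show ?thesis .
qed

section \<open>Polynomial and quasi-polynomial sequences\<close>

fun pd :: "nat => (nat => complex) => bool" where
 "pd 0 a \<longleftrightarrow> (\<forall>q. a q = 0)" | "pd (Suc D) a \<longleftrightarrow> pd D (\<lambda>q. a (Suc q) - a q)"

text \<open>Under \<open>pd D a\<close> the sequence \<open>a\<close> is polynomial of degree less than \<open>D\<close>.\<close>

lemma pd_zero: "pd D (\<lambda>_. 0)" by (induction D) auto
lemma pd_Suc: "pd D a ==> pd (Suc D) a"
proof (induction D arbitrary: a)
 case 0 then show ?case by simp
next
 case (Suc D)
 have "pd (Suc D) (\<lambda>q. a (Suc q) - a q)" by (rule Suc.IH) (use Suc.prems in simp)
 then show ?case by (simp only: pd.simps)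
qed
lemma pd_mono: "pd D a ==> D \<le> E ==> pd E a"
 by (induction E) (auto simp: le_Suc_eq intro: pd_Suc simp del: pd.simps)
lemma pd_add: "pd D a ==> pd D c ==> pd D (\<lambda>q. a q + c q)"
proof (induction D arbitrary: a c)
 case (Suc D)
 have "(\<lambda>q. a (Suc q) + c (Suc q) - (a q + c q)) = (\<lambda>q. (a (Suc q) - a q) + (c (Suc q) - c q))" by auto
 then show ?case using Suc by simp
qed simp
lemma pd_const_mult: "pd D a ==> pd D (\<lambda>q. x * a q)"
proof (induction D arbitrary: a)
 case (Suc D)
 have "(\<lambda>q. x * a (Suc q) - x * a q) = (\<lambda>q. x * (a (Suc q) - a q))" by (auto simp: ring_distribs)
 then show ?case using Suc by simp
qed simp
lemma pd_shift: "pd D a ==> pd D (\<lambda>q. a (Suc q))" by (induction D arbitrary: a) auto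
text \<open>Leibniz rule for differences, with induction on the sum of the two degree
  bounds.\<close>

lemma pd_mult: "pd D a ==> pd E c ==> \<exists>F. pd F (\<lambda>q. a q * c q)"
proof (induction "D + E" arbitrary: D E a c)
 case 0 then show ?case by (intro exI[of _ 0]) simp
next
 case (Suc m)
 show ?case
 proof (cases D)
  case 0 then show ?thesis using Suc by (intro exI[of _ 0]) simp
 next
  case D: (Suc D')
  show ?thesis
  proof (cases E)
   case 0 then show ?thesis using Suc by (intro exI[of _ 0]) simp
  next
   case E: (Suc E')
   have 1: "pd D' (\<lambda>q. a (Suc q) - a q)" "pd E' (\<lambda>q. c (Suc q) - c q)" using Suc(3,4) D E by auto
   have m1: "m = D' + E" "m = D + E'" using Suc(2) D E by auto
   obtain F where F: "pd F (\<lambda>q. (a (Suc q) - a q) * c q)" using Suc(1)[OF m1(1) 1(1) Suc(4)] by blast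
   obtain G where G: "pd G (\<lambda>q. a (Suc q) * (c (Suc q) - c q))" using Suc(1)[OF m1(2) pd_shift[OF Suc(3)] 1(2)] by blast
   have "pd (max F G) (\<lambda>q. (a (Suc q) - a q) * c q + a (Suc q) * (c (Suc q) - c q))"
    by (intro pd_add pd_mono[OF F] pd_mono[OF G]) auto
   also have "(\<lambda>q. (a (Suc q) - a q) * c q + a (Suc q) * (c (Suc q) - c q)) = (\<lambda>q. a (Suc q) * c (Suc q) - a q * c q)"
    by (auto simp: algebra_simps)
   finally show ?thesis by (intro exI[of _ "Suc (max F G)"]) simp
  qed
 qed
qed
text \<open>By induction the difference sequence is zero, so the sequence is constant, and its value
  at \<open>J\<close> is 0.\<close>

lemma pd_eventually_0: "pd D a ==> (\<And>q. q \<ge> J ==> a q = 0) ==> a q = 0"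
proof (induction D arbitrary: a q)
 case (Suc D)
 have "a (Suc q) - a q = 0" for q by (rule Suc.IH) (use Suc(2,3) in auto)
 then have e: "a q = a 0" for q by (induction q) auto
 have "a J = 0" using Suc(3) by simp
 then show ?case using e[of q] e[of J] by simp
qed simp

text \<open>Quasi-polynomial with period \<open>m\<close>: polynomial along each progression of step
  \<open>m\<close>.\<close>

definition qp :: "nat => (nat => complex) => bool" where
 "qp m f \<longleftrightarrow> (\<forall>r. \<exists>D. pd D (\<lambda>q. f (m * q + r)))"

lemma qp_zero: "qp m (\<lambda>_. 0)" unfolding qp_def using pd_zero by blast
lemma qp_add: "qp m f ==> qp m g ==> qp m (\<lambda>k. f k + g k)"
proof -
 assume f: "qp m f" and g: "qp m g"
 have "\<exists>D. pd D (\<lambda>q. f (m * q + r) + g (m * q + r))" for r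
 proof -
  obtain D E where "pd D (\<lambda>q. f (m * q + r))" "pd E (\<lambda>q. g (m * q + r))"
   using f g unfolding qp_def by metis
  then have "pd (max D E) (\<lambda>q. f (m * q + r) + g (m * q + r))"
   by (intro pd_add) (blast intro: pd_mono max.cobounded1 max.cobounded2)+
  then show ?thesis by blast
 qed
 then show ?thesis by (simp add: qp_def)
qed
lemma qp_const_mult: "qp m f ==> qp m (\<lambda>k. x * f k)" unfolding qp_def using pd_const_mult by blast
lemma qp_mult: "qp m f ==> qp m g ==> qp m (\<lambda>k. f k * g k)" unfolding qp_def using pd_mult by metis
lemma qp_shift: "qp m f ==> qp m (\<lambda>k. f (k + i))" unfolding qp_def by (simp add: add.assoc)
lemma qp_diff: "qp m f ==> qp m g ==> qp m (\<lambda>k. f k - g k)"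
 using qp_add[of m f "\<lambda>k. -1 * g k"] qp_const_mult[of m g "-1"] by simp
lemma qp_sum: "(\<And>i. i \<in> S ==> qp m (f i)) ==> qp m (\<lambda>k. \<Sum>i\<in>S. f i k)"
 by (induction S rule: infinite_finite_induct) (auto simp: qp_zero qp_add)
lemma qp_eventually_0: "qp m f ==> m \<ge> 1 ==> (\<And>k. k \<ge> J ==> f k = 0) ==> f k = 0"
proof -
 assume f: "qp m f" "m \<ge> 1" "\<And>k. k \<ge> J ==> f k = 0"
 obtain D where "pd D (\<lambda>q. f (m * q + k))" using f(1) by (auto simp: qp_def)
 then have "f (m * 0 + k) = 0"
 proof (rule pd_eventually_0[where J = J])
  fix q assume "J \<le> q"
  moreover have "q \<le> m * q" using f(2) by simp
  ultimately show "f (m * q + k) = 0" by (intro f(3)) linarith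
 qed
 then show ?thesis by simp
qed

text \<open>Exponent vectors are split according to whether the last variable occurs.\<close>

lemma hh_Suc: "hh (Suc N) d (Suc k) = d N * hh (Suc N) d k + hh N d (Suc k)"
proof -
 have fin: "finite (CC N k)" for N k
 proof -
  have "CC N k \<subseteq> {f. \<forall>i. (i \<in> {..<N} --> f i \<in> {..k}) \<and> (i \<notin> {..<N} --> f i = 0)}"
  proof
   fix f assume f: "f \<in> CC N k"
   have "f i \<le> k" if "i < N" for i using member_le_sum[of i "{..<N}" f] that f by (simp add: CC_def)
   then show "f \<in> {f. \<forall>i. (i \<in> {..<N} --> f i \<in> {..k}) \<and> (i \<notin> {..<N} --> f i = 0)}"
    using f by (auto simp: CC_def)
  qed
  then show ?thesis by (rule finite_subset) (rule finite_set_of_finite_funs; simp)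
 qed
 have C: "CC (Suc N) (Suc k) = inc N ` CC (Suc N) k \<union> CC N (Suc k)"
 proof
  show "CC (Suc N) (Suc k) \<subseteq> inc N ` CC (Suc N) k \<union> CC N (Suc k)"
  proof
   fix f assume f: "f \<in> CC (Suc N) (Suc k)"
   show "f \<in> inc N ` CC (Suc N) k \<union> CC N (Suc k)"
   proof (cases "f N = 0")
    case True
    have "f i = 0" if "i \<ge> N" for i using True f that by (cases "i = N") (auto simp: CC_def)
    then have "f \<in> CC N (Suc k)" using f True by (simp add: CC_def)
    then show ?thesis by blast
   next
    case False
    have "f = inc N (f(N := f N - 1))" using False by (auto simp: inc_def)
    moreover have "f(N := f N - 1) \<in> CC (Suc N) k" using f False by (auto simp: CC_def)
    ultimately show ?thesis by blast
   qed
  qed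
  show "inc N ` CC (Suc N) k \<union> CC N (Suc k) \<subseteq> CC (Suc N) (Suc k)"
   by (auto simp: inc_CC) (auto simp: CC_def)
 qed
 have disj: "inc N ` CC (Suc N) k \<inter> CC N (Suc k) = {}" by (auto simp: CC_def inc_def) 
 have inj: "inj_on (inc N) (CC (Suc N) k)" by (rule inj_onI) (auto simp: inc_def fun_eq_iff split: if_splits)
 have "hh (Suc N) d (Suc k) = (\<Sum>f\<in>CC (Suc N) k. \<Prod>i<Suc N. d i ^ inc N f i) + (\<Sum>f\<in>CC N (Suc k). \<Prod>i<Suc N. d i ^ f i)"
  unfolding hh_def C by (subst sum.union_disjoint) (use fin disj inj in \<open>auto simp: sum.reindex simp del: prod.lessThan_Suc\<close>)
 also have "(\<Sum>f\<in>CC (Suc N) k. \<Prod>i<Suc N. d i ^ inc N f i) = d N * hh (Suc N) d k"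
  unfolding hh_def sum_distrib_left by (intro sum.cong refl prod_inc) simp
 also have "(\<Sum>f\<in>CC N (Suc k). \<Prod>i<Suc N. d i ^ f i) = hh N d (Suc k)"
  unfolding hh_def by (intro sum.cong refl) (auto simp: CC_def)
 finally show ?thesis .
qed

lemma hh_0: "hh N d 0 = 1" by (simp add: hh_def CC_0)

lemma hh_iter: "hh (Suc N) d (k + i) = d N ^ i * hh (Suc N) d k + (\<Sum>l<i. d N ^ (i - 1 - l) * hh N d (k + l + 1))"
proof (induction i)
 case (Suc i)
 have "(\<Sum>l<i. d N * (d N ^ (i - 1 - l) * hh N d (k + l + 1))) = (\<Sum>l<i. d N ^ (i - l) * hh N d (k + l + 1))"
 proof (intro sum.cong refl)
  fix l assume "l \<in> {..<i}"
  then have "i - l = Suc (i - 1 - l)" by auto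
  then show "d N * (d N ^ (i - 1 - l) * hh N d (k + l + 1)) = d N ^ (i - l) * hh N d (k + l + 1)" by simp
 qed
 then show ?case using Suc hh_Suc[of N d "k + i"] by (simp add: ring_distribs sum_distrib_left mult.assoc)
qed simp

text \<open>The \<open>m\<close>-th power of the last variable is 1, so by \<open>hh_iter\<close>
  raising the degree by \<open>m\<close> changes \<open>hh\<close> only by shifted terms in one
  variable less. By induction the difference with step \<open>m\<close> is quasi-polynomial, and
  summation raises the degree by one.\<close>

lemma hh_qp:
 assumes "\<And>i. i < Suc N ==> d i ^ m = 1" "m \<ge> 1" shows "qp m (hh (Suc N) d)"
 using assms(1)
proof (induction N)
 case 0
 have e: "hh (Suc 0) d k = d 0 ^ k" for k
 proof (induction k)
  case (Suc k)
  have "CC 0 (Suc k) = {}" by (auto simp: CC_def)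
  then have "hh 0 d (Suc k) = 0" by (simp add: hh_def)
  then show ?case using hh_Suc[of 0 d k] Suc by simp
 qed (simp add: hh_0)
 have "pd 1 (\<lambda>q. hh (Suc 0) d (m * q + r))" for r using 0 by (simp add: e power_add power_mult)
 then show ?case unfolding qp_def by blast
next
 case (Suc N)
 have IH: "qp m (hh (Suc N) d)" using Suc by simp
 have "qp m (\<lambda>k. \<Sum>l<m. d (Suc N) ^ (m - 1 - l) * hh (Suc N) d (k + (l + 1)))"
  by (intro qp_sum qp_const_mult qp_shift IH)
 then have q: "qp m (\<lambda>k. hh (Suc (Suc N)) d (k + m) - hh (Suc (Suc N)) d k)"
  using hh_iter[of "Suc N" d _ m] Suc(2)[of "Suc N"] by (simp add: add.assoc)
 show ?case unfolding qp_def
 proof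
  fix r
  obtain D where "pd D (\<lambda>q. hh (Suc (Suc N)) d (m * q + r + m) - hh (Suc (Suc N)) d (m * q + r))"
   using q unfolding qp_def by blast
  then have "pd (Suc D) (\<lambda>q. hh (Suc (Suc N)) d (m * q + r))" by (simp add: add.commute add.left_commute)
  then show "\<exists>D. pd D (\<lambda>q. hh (Suc (Suc N)) d (m * q + r))" by blast
 qed
qed

text \<open>Closure under inverses follows from finiteness, see \<open>fgrp_adj\<close>.\<close>

definition fgrp :: "nat => fmat set => bool" where
 "fgrp N \<Gamma> \<longleftrightarrow> finite \<Gamma> \<and> \<Gamma> \<subseteq> SU N \<and> un {..<N} \<in> \<Gamma> \<and> (\<forall>a\<in>\<Gamma>. \<forall>c\<in>\<Gamma>. a * c \<in> \<Gamma>)"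

text \<open>Two powers of \<open>g\<close> coincide because the group is finite; comparing them in
  an eigenbasis shows that the eigenvalues are roots of unity.\<close>

lemma fgrp_diag:
 assumes \<Gamma>: "fgrp N \<Gamma>" and g: "g \<in> \<Gamma>"
 obtains S d m where "S \<in> UU N" "g = S * dg N d * adj S" "m \<ge> 1" "\<And>i. i < N ==> d i ^ m = 1"
proof -
 have gU: "g \<in> UU N" using \<Gamma> g by (auto simp: fgrp_def SU_def)
 obtain S d where S: "S \<in> UU N" "g = S * dg N d * adj S" "\<And>i. i < N ==> cmod (d i) = 1"
  using UU_diag[OF gU] by metis
 define pw where "pw i = ((*) g ^^ i) (un {..<N})" for i
 have pw: "pw i = S * dg N (\<lambda>l. d l ^ i) * adj S" for i
 proof (induction i)
  case 0 then show ?case using UU_D[OF S(1)] UU_un[OF S(1)] by (simp add: pw_def dg_one)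
 next
  case (Suc i)
  have "pw (Suc i) = g * pw i" by (simp add: pw_def)
  also have "\<dots> = S * (dg N d * (un {..<N} * (dg N (\<lambda>l. d l ^ i) * adj S)))"
   unfolding Suc S(2) by (simp add: mult.assoc UU_cancel[OF S(1)])
  also have "\<dots> = S * (dg N d * dg N (\<lambda>l. d l ^ i)) * adj S" by (simp add: assoc' dg_un)
  finally show ?case by (simp add: dg_mult)
 qed
 have "pw i \<in> \<Gamma>" for i by (induction i) (use \<Gamma> g in \<open>auto simp: pw_def fgrp_def\<close>)
 then have "finite (range pw)" using \<Gamma> finite_subset[of "range pw" \<Gamma>] by (auto simp: fgrp_def)
 then have "\<not> inj pw" using finite_imageD infinite_UNIV_nat by blast
 then obtain a c where ac: "a < c" "pw a = pw c" unfolding inj_def by (metis linorder_neqE_nat)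
 have "dg N (\<lambda>l. d l ^ i) = adj S * pw i * S" for i
  unfolding pw by (simp add: mult.assoc UU_cancel[OF S(1)] UU_D[OF S(1)] dg_un)
 then have "dg N (\<lambda>l. d l ^ a) = dg N (\<lambda>l. d l ^ c)" using ac(2) by metis
 then have e: "d l ^ a = d l ^ c" if "l < N" for l using that by (simp add: dg_eq_iff)
 have "d l ^ (c - a) = 1" if "l < N" for l
 proof -
  have "d l \<noteq> 0" using S(3)[OF that] by auto
  moreover have "d l ^ c = d l ^ a * d l ^ (c - a)" using ac(1) by (simp add: power_add[symmetric])
  ultimately show ?thesis using e[OF that] by simp
 qed
 then show ?thesis using that[OF S(1,2), of "c - a"] ac(1) by simp
qed

text \<open>The projection commutes with \<open>rho\<close> of the diagonaliser, which therefore
  cancels in the trace. The statement covers all multiples of \<open>m\<close>, so that the periods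
  of finitely many elements can be merged into their product.\<close>

lemma tr_PI_qp:
 assumes b: "good b" and \<Gamma>: "fgrp (Suc n) \<Gamma>" and g: "g \<in> \<Gamma>"
 shows "\<exists>m\<ge>1. \<forall>M\<ge>1. m dvd M --> qp M (\<lambda>k. tr (PI (Suc n) (pat b k) * rho (pat b k) g))"
proof -
 obtain S d m where S: "S \<in> UU (Suc n)" "g = S * dg (Suc n) d * adj S" "m \<ge> 1" "\<And>i. i < Suc n ==> d i ^ m = 1"
  using fgrp_diag[OF \<Gamma> g] by metis
 have t: "tr (PI (Suc n) s * rho s g) = tr (PI (Suc n) s * rho s (dg (Suc n) d))" for s
 proof -
  have c: "PI (Suc n) s * rho s S = rho s S * PI (Suc n) s" using PI_commute[OF UU_D(1)[OF S(1)]] by simp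
  have "tr (PI (Suc n) s * rho s g) = tr (rho s S * (PI (Suc n) s * rho s (dg (Suc n) d) * rho s (adj S)))"
   unfolding S(2) rho_mult using mac[OF c] by (simp add: mult.assoc)
  also have "\<dots> = tr (PI (Suc n) s * rho s (dg (Suc n) d * (adj S * S)))"
   by (subst tr_comm) (simp add: rho_mult mult.assoc)
  finally show ?thesis by (simp add: UU_D[OF S(1)] dg_un)
 qed
 have "qp M (\<lambda>k. tr (PI (Suc n) (pat b k) * rho (pat b k) g))" if M: "M \<ge> 1" "m dvd M" for M
 proof -
  have dM: "d i ^ M = 1" if "i < Suc n" for i using S(4)[OF that] M(2) by (auto simp: dvd_def power_mult)
  have cM: "cnj (d i) ^ M = 1" if "i < Suc n" for i using dM[OF that] by (metis complex_cnj_one complex_cnj_power)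
  have 1: "qp M (hh (Suc n) d)" "qp M (hh (Suc n) (\<lambda>i. cnj (d i)))"
   by (intro hh_qp dM cM M(1); assumption)+
  have tt: "tr (PI (Suc n) (pat b k) * rho (pat b k) g) =
    hh (Suc n) d (count_list (pat b k) 0) * hh (Suc n) (\<lambda>i. cnj (d i)) (count_list (pat b k) 1) * hh (Suc n) d (count_list (pat b k) 2)" for k
   unfolding t by (rule tr_PI_hh[OF good_set[OF b]])
  have "qp M (\<lambda>k. hh (Suc n) d (count_list b 2) * (hh (Suc n) d (k + count_list b 0) * hh (Suc n) (\<lambda>i. cnj (d i)) (k + count_list b 1)))"
   by (intro qp_const_mult qp_mult qp_shift 1)
  moreover have "tr (PI (Suc n) (pat b k) * rho (pat b k) g) = hh (Suc n) d (count_list b 2) * (hh (Suc n) d (k + count_list b 0) * hh (Suc n) (\<lambda>i. cnj (d i)) (k + count_list b 1))" for k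
   unfolding tt pat_count by (simp add: mult_ac add.commute)
  ultimately show ?thesis by simp
 qed
 then show ?thesis using S(3) by blast
qed

lemma tT_qp:
 assumes b: "good b" and \<Gamma>: "fgrp (Suc n) \<Gamma>"
 shows "\<exists>m\<ge>1. \<forall>M\<ge>1. m dvd M --> qp M (tT n b \<Gamma>)"
proof -
 obtain m where m: "\<And>g. g \<in> \<Gamma> ==> m g \<ge> (1::nat) \<and> (\<forall>M\<ge>1. m g dvd M --> qp M (\<lambda>k. tr (PI (Suc n) (pat b k) * rho (pat b k) g)))"
  using tr_PI_qp[OF b \<Gamma>] by metis
 have fin: "finite \<Gamma>" using \<Gamma> by (simp add: fgrp_def)
 have "(\<Prod>g\<in>\<Gamma>. m g) \<ge> 1" using m by (intro prod_ge_1) auto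
 moreover have "qp M (tT n b \<Gamma>)" if M: "M \<ge> 1" "(\<Prod>g\<in>\<Gamma>. m g) dvd M" for M
 proof -
  have "m g dvd M" if "g \<in> \<Gamma>" for g using dvd_prodI[OF fin that, of m] M(2) dvd_trans by blast
  then have "qp M (\<lambda>k. (1 / of_nat (card \<Gamma>)) * (\<Sum>g\<in>\<Gamma>. tr (PI (Suc n) (pat b k) * rho (pat b k) g)))"
   using m M(1) by (intro qp_const_mult qp_sum) auto
  then show ?thesis by (simp add: tT_def[abs_def] nG_def)
 qed
 ultimately show ?thesis by blast
qed

text \<open>The step from \<open>k\<close> to \<open>k + 1\<close> isolates the weight with index
  \<open>k + 1\<close>, whence the first difference in \<open>k\<close>.\<close>

lemma tT_diff_qp:
 assumes b: "good b" and \<Gamma>: "fgrp (Suc n) \<Gamma>" "fgrp (Suc n) \<Gamma>'"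
 obtains M where "M \<ge> 1" "qp M (\<lambda>k. (tT n b \<Gamma> (k + 1) - tT n b \<Gamma>' (k + 1)) - (tT n b \<Gamma> k - tT n b \<Gamma>' k))"
proof -
 obtain m where m: "m \<ge> 1" "\<forall>M\<ge>1. m dvd M --> qp M (tT n b \<Gamma>)" using tT_qp[OF b \<Gamma>(1)] by blast
 obtain m' where m': "m' \<ge> 1" "\<forall>M\<ge>1. m' dvd M --> qp M (tT n b \<Gamma>')" using tT_qp[OF b \<Gamma>(2)] by blast
 have M: "m * m' \<ge> 1" using m m' by simp
 then have "qp (m * m') (tT n b \<Gamma>)" "qp (m * m') (tT n b \<Gamma>')" using m(2) m'(2) by auto
 then have "qp (m * m') (\<lambda>k. (tT n b \<Gamma> (k + 1) - tT n b \<Gamma>' (k + 1)) - (tT n b \<Gamma> k - tT n b \<Gamma>' k))"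
  by (intro qp_diff qp_shift)
 then show ?thesis using that[OF M] by blast
qed

theorem nW_A_all:
 assumes n: "n \<ge> 2" and \<Gamma>: "fgrp (Suc n) \<Gamma>" "fgrp (Suc n) \<Gamma>'"
  and ev: "\<And>j. j \<ge> J ==> nW (Suc n) \<Gamma> (wA n j) = nW (Suc n) \<Gamma>' (wA n j)"
 shows "nW (Suc n) \<Gamma> (wA n j) = nW (Suc n) \<Gamma>' (wA n j)"
proof -
 have sub: "\<Gamma> \<subseteq> SU (Suc n)" "\<Gamma>' \<subseteq> SU (Suc n)" using \<Gamma> by (auto simp: fgrp_def)
 have g: "good bQ" by (simp add: good_def)
 obtain M where M: "M \<ge> 1" "qp M (\<lambda>k. (tT n bQ \<Gamma> (k + 1) - tT n bQ \<Gamma>' (k + 1)) - (tT n bQ \<Gamma> k - tT n bQ \<Gamma>' k))"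
  using tT_diff_qp[OF g \<Gamma>] .
 have d: "(tT n bQ \<Gamma> (k + 1) - tT n bQ \<Gamma>' (k + 1)) - (tT n bQ \<Gamma> k - tT n bQ \<Gamma>' k) =
   nW (Suc n) \<Gamma> (wA n (Suc k)) - nW (Suc n) \<Gamma>' (wA n (Suc k))" for k
  by (simp add: tT_Q[OF n sub(1)] tT_Q[OF n sub(2)])
 have S: "nW (Suc n) \<Gamma> (wA n (Suc k)) - nW (Suc n) \<Gamma>' (wA n (Suc k)) = 0" for k
  using qp_eventually_0[OF M(2,1), of J k] ev unfolding d by simp
 \<comment> \<open>First differences only reach indices from 1 on. Index 0 is read off from the
   model with \<open>k = 0\<close>, on which every element has trace 1.\<close>
 have 0: "nW (Suc n) \<Gamma> (wA n 0) = 1" if \<Gamma>: "fgrp (Suc n) \<Gamma>" for \<Gamma>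
 proof -
  have sub: "\<Gamma> \<subseteq> SU (Suc n)" and fin: "finite \<Gamma>" "card \<Gamma> \<noteq> 0" using \<Gamma> by (auto simp: fgrp_def)
  have "tr (PI (Suc n) [] * rho [] g) = 1" for g
   using tr_PI_hh[of "[]" "Suc n" "\<lambda>_. 1"] by (simp add: hh_0)
  then have "tT n bQ \<Gamma> 0 = 1" using fin by (simp add: tT_def nG_def bQ_def)
  then show ?thesis using tT_Q[OF n sub, of 0] by simp
 qed
 show ?thesis using S 0[OF \<Gamma>(1)] 0[OF \<Gamma>(2)] by (cases j) auto
qed

theorem nW_B_all:
 assumes n: "n \<ge> 2" and \<Gamma>: "fgrp (Suc n) \<Gamma>" "fgrp (Suc n) \<Gamma>'"
  and A: "\<And>j. nW (Suc n) \<Gamma> (wA n j) = nW (Suc n) \<Gamma>' (wA n j)"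
  and ev: "\<And>j. j \<ge> J ==> nW (Suc n) \<Gamma> (wB n j) = nW (Suc n) \<Gamma>' (wB n j)" and j: "j \<ge> 1"
 shows "nW (Suc n) \<Gamma> (wB n j) = nW (Suc n) \<Gamma>' (wB n j)"
proof -
 have sub: "\<Gamma> \<subseteq> SU (Suc n)" "\<Gamma>' \<subseteq> SU (Suc n)" using \<Gamma> by (auto simp: fgrp_def)
 have g: "good bR" by (simp add: good_def)
 obtain M where M: "M \<ge> 1" "qp M (\<lambda>k. (tT n bR \<Gamma> (k + 1) - tT n bR \<Gamma>' (k + 1)) - (tT n bR \<Gamma> k - tT n bR \<Gamma>' k))"
  using tT_diff_qp[OF g \<Gamma>] .
 have d: "(tT n bR \<Gamma> (k + 1) - tT n bR \<Gamma>' (k + 1)) - (tT n bR \<Gamma> k - tT n bR \<Gamma>' k) =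
   nW (Suc n) \<Gamma> (wB n (Suc k)) - nW (Suc n) \<Gamma>' (wB n (Suc k))" for k
  unfolding tT_R[OF n sub A] by simp
 have S: "nW (Suc n) \<Gamma> (wB n (Suc k)) - nW (Suc n) \<Gamma>' (wB n (Suc k)) = 0" for k
  using qp_eventually_0[OF M(2,1), of J k] ev unfolding d by simp
 show ?thesis using S[of "j - 1"] j by simp
qed

section \<open>The matrix representations in the unitary dual\<close>

definition vf :: "complex vec => fmat" where
 "vf v = Fmat (\<lambda>i j. if i < dim_vec v \<and> j = 0 then v $ i else 0)"
definition vt :: "nat => fmat => complex vec" where "vt d A = vec d (\<lambda>i. ent A i 0)"

lemma ent_vf: "ent (vf v) i j = (if i < dim_vec v \<and> j = 0 then v $ i else 0)"
 unfolding vf_def by (subst Fmat_finite[of "{..dim_vec v}"]) (auto split: if_splits)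
lemma vt_carrier [simp]: "vt d A \<in> carrier_vec d" by (simp add: vt_def)
lemma vt_vf: "v \<in> carrier_vec d ==> vt d (vf v) = v" by (auto simp: vt_def ent_vf)
lemma col_vf: "Submission.col (vf v)" unfolding Submission.col_def by (rule fmat_eqI) (auto simp: ent_times_eu ent_vf)
lemma vf_un: "v \<in> carrier_vec d ==> un {..<d} * vf v = vf v"
 by (rule fmat_eqI) (auto simp: ent_un_times ent_vf)
lemma vf_vt: assumes "Submission.col A" "un {..<d} * A = A" shows "vf (vt d A) = A"
proof (rule fmat_eqI)
 fix i j
 have "ent A i j = ent (un {..<d} * (A * eu 0 0)) i j" using assms by (simp add: Submission.col_def)
 then have "ent A i j = (if i < d \<and> j = 0 then ent A i 0 else 0)"
  by (simp add: ent_un_times ent_times_eu)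
 then show "ent (vf (vt d A)) i j = ent A i j" by (simp add: ent_vf vt_def)
qed
lemma vf_mult: assumes "M \<in> carrier_mat r c" "v \<in> carrier_vec c" shows "vf (M *\<^sub>v v) = fm M * vf v"
proof (rule fmat_eqI)
 fix i j
 have "ent (fm M * vf v) i j = (\<Sum>l<c. ent (fm M) i l * ent (vf v) l j)"
  by (rule ent_times_S) (use assms in \<open>auto simp: ent_vf split: if_splits\<close>)
 then show "ent (vf (M *\<^sub>v v)) i j = ent (fm M * vf v) i j"
  using assms by (auto simp: ent_vf ent_fm scalar_prod_def atLeast0LessThan)
qed
lemma vf_inj: "v \<in> carrier_vec d ==> w \<in> carrier_vec d ==> vf v = vf w \<longleftrightarrow> v = w" by (metis vt_vf)
lemma vf_add: "v \<in> carrier_vec d ==> w \<in> carrier_vec d ==> vf (v + w) = vf v + vf w"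
 by (rule fmat_eqI) (auto simp: ent_vf)
lemma vf_smult: "vf (c \<cdot>\<^sub>v v) = c *c vf v" by (rule fmat_eqI) (auto simp: ent_vf)
lemma vf_zero: "vf (0\<^sub>v d) = 0" by (rule fmat_eqI) (auto simp: ent_vf)
lemma vt_add: "vt d (A + B) = vt d A + vt d B" by (auto simp: vt_def)
lemma vt_sc: "vt d (c *c A) = c \<cdot>\<^sub>v vt d A" by (auto simp: vt_def)
lemma vt_zero: "vt d 0 = 0\<^sub>v d" by (auto simp: vt_def)

lemma vec_subspace:
 assumes "W \<subseteq> carrier_vec d" "0\<^sub>v d \<in> W" "\<And>v w. v \<in> W ==> w \<in> W ==> v + w \<in> W" "\<And>c v. v \<in> W ==> c \<cdot>\<^sub>v v \<in> W"
 shows "VectorSpace.subspace class_ring W (module_vec TYPE(complex) d)"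
proof -
 interpret V: vec_space "TYPE(complex)" d .
 have "submodule class_ring W (module_vec TYPE(complex) d)"
  by (rule submodule.intro) (use assms V.module_axioms in \<open>auto simp: module_vec_simps class_ring_simps\<close>)
 then show ?thesis using V.vectorspace_axioms by (simp add: VectorSpace.subspace_def)
qed

lemma vec_subspaceD:
 assumes "VectorSpace.subspace class_ring W (module_vec TYPE(complex) d)"
 shows "W \<subseteq> carrier_vec d" "0\<^sub>v d \<in> W" "\<And>v w. v \<in> W ==> w \<in> W ==> v + w \<in> W" "\<And>c v. v \<in> W ==> c \<cdot>\<^sub>v v \<in> W"
proof -
 have s: "submodule class_ring W (module_vec TYPE(complex) d)" using assms by (simp add: VectorSpace.subspace_def)
 show "W \<subseteq> carrier_vec d" "0\<^sub>v d \<in> W" using submodule.subset[OF s] submodule.zero_closed[OF s] by (simp_all add: module_vec_simps)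
 show "v + w \<in> W" if "v \<in> W" "w \<in> W" for v w using submodule.m_closed[OF s that] by (simp add: module_vec_simps)
 show "c \<cdot>\<^sub>v v \<in> W" if "v \<in> W" for c v using submodule.smult_closed[OF s _ that, of c] by (simp add: module_vec_simps class_ring_simps)
qed

lemma fm_mult_adj:
 assumes U: "M \<in> carrier (U_group d)"
 shows "adj (fm M) * fm M = un {..<d}" "fm M * adj (fm M) = un {..<d}"
proof -
 have c: "M \<in> carrier_mat d d" using U by (simp add: U_group_def)
 note c' = mat_adjoint_carrier[OF c]
 show "adj (fm M) * fm M = un {..<d}" "fm M * adj (fm M) = un {..<d}"
  using fm_mult[OF c' c] fm_mult[OF c c'] U_group_adjoint(2,3)[OF U] by (simp_all add: fm_adj[OF c] fm_one)
qed

lemma SU_fm: assumes "M \<in> carrier (SU_group N)" shows "M \<in> carrier_mat N N" "fm M \<in> SU N"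
proof -
 have U: "M \<in> carrier (U_group N)" and d: "Determinant.det M = 1" using assms by (auto simp: SU_group_def)
 show c: "M \<in> carrier_mat N N" using U by (simp add: U_group_def)
 show "fm M \<in> SU N" using fm_mult_adj[OF U] d by (simp add: SU_def UU_def inn_fm c dt_def mt_fm)
qed

lemma SU_mt: assumes "g \<in> SU N" shows "mt N N g \<in> carrier (SU_group N)"
proof -
 have "mat_adjoint (mt N N g) * mt N N g = mt N N (adj g * g)"
  using UU_D(1)[OF SU_UU[OF assms]] by (simp add: mt_mult[of N] mt_adj)
 then show ?thesis
  using assms UU_D(2)[OF SU_UU[OF assms]] by (simp add: SU_group_def U_group_def mt_one SU_def dt_def)
qed

lemma fm_mt_UU: "g \<in> UU N ==> fm (mt N N g) = g" by (simp add: fm_mt UU_un)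
lemma fm_mt_SU: "g \<in> SU N ==> fm (mt N N g) = g" by (simp add: fm_mt_UU SU_UU)

definition rfm :: "nat => mat_rep => fmat => fmat" where "rfm N \<sigma> g = fm (snd \<sigma> (mt N N g))"
abbreviation "rid \<sigma> \<equiv> un {..<fst (\<sigma> :: mat_rep)}"

lemma irrepD:
 assumes "\<sigma> \<in> unitary_irreps N"
 shows "M \<in> carrier (SU_group N) ==> snd \<sigma> M \<in> carrier_mat (fst \<sigma>) (fst \<sigma>)"
  "M \<in> carrier (SU_group N) ==> snd \<sigma> M \<in> carrier (U_group (fst \<sigma>))"
  "M \<in> carrier (SU_group N) ==> M' \<in> carrier (SU_group N) ==> snd \<sigma> (M * M') = snd \<sigma> M * snd \<sigma> M'"
  "snd \<sigma> (1\<^sub>m N) = 1\<^sub>m (fst \<sigma>)"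
  "mat_continuous_on N (carrier (SU_group N)) (fst \<sigma>) (snd \<sigma>)" "fst \<sigma> > 0"
  "VectorSpace.subspace class_ring W (module_vec TYPE(complex) (fst \<sigma>)) ==>
   (\<And>g w. g \<in> carrier (SU_group N) ==> w \<in> W ==> snd \<sigma> g *\<^sub>v w \<in> W) ==>
     W = {0\<^sub>v (fst \<sigma>)} \<or> W = carrier_vec (fst \<sigma>)"
proof -
 have h: "snd \<sigma> \<in> hom (SU_group N) (U_group (fst \<sigma>))" using assms by (auto simp: unitary_irreps_def)
 show U: "M \<in> carrier (SU_group N) ==> snd \<sigma> M \<in> carrier (U_group (fst \<sigma>))" for M using h by (auto simp: hom_def)
 show "M \<in> carrier (SU_group N) ==> snd \<sigma> M \<in> carrier_mat (fst \<sigma>) (fst \<sigma>)" using U[of M] by (simp add: U_group_def)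
 show "M \<in> carrier (SU_group N) ==> M' \<in> carrier (SU_group N) ==> snd \<sigma> (M * M') = snd \<sigma> M * snd \<sigma> M'"
  using hom_mult[OF h, of M M'] by (simp add: SU_group_def U_group_def)
 show "snd \<sigma> (1\<^sub>m N) = 1\<^sub>m (fst \<sigma>)"
  using hom_one[OF h group_SU group_U] by (simp add: SU_group_def U_group_def)
 show "mat_continuous_on N (carrier (SU_group N)) (fst \<sigma>) (snd \<sigma>)" "fst \<sigma> > 0"
  using assms by (auto simp: unitary_irreps_def)
 show "VectorSpace.subspace class_ring W (module_vec TYPE(complex) (fst \<sigma>)) ==>
   (\<And>g w. g \<in> carrier (SU_group N) ==> w \<in> W ==> snd \<sigma> g *\<^sub>v w \<in> W) ==>
     W = {0\<^sub>v (fst \<sigma>)} \<or> W = carrier_vec (fst \<sigma>)"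
  using assms unfolding unitary_irreps_def by (auto simp: case_prod_beta)
qed

lemma irrep_urep:
 assumes s: "\<sigma> \<in> unitary_irreps N" and N: "N > 0"
 shows "urep N (rid \<sigma>) (rfm N \<sigma>)"
proof
 note D = irrepD[OF s]
 show "0 < N" "proj (rid \<sigma>)" using N by (simp_all add: proj_un)
 have m: "rfm N \<sigma> (g * h) = rfm N \<sigma> g * rfm N \<sigma> h" if "g \<in> SU N" "h \<in> SU N" for g h
 proof -
  have "mt N N (g * h) = mt N N g * mt N N h" using UU_D(1)[OF SU_UU[OF that(1)]] by (simp add: mt_mult)
  then show ?thesis unfolding rfm_def using D(1,3)[OF SU_mt[OF that(1)]] D(1)[OF SU_mt[OF that(2)]] SU_mt[OF that(2)]
   by (simp add: fm_mult[of _ "fst \<sigma>" "fst \<sigma>"])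
 qed
 then show "\<And>g h. g \<in> SU N ==> h \<in> SU N ==> rfm N \<sigma> (g * h) = rfm N \<sigma> g * rfm N \<sigma> h" .
 show o: "rfm N \<sigma> (un {..<N}) = rid \<sigma>" by (simp add: rfm_def mt_one D(4) fm_one)
 show "rfm N \<sigma> (adj g) = adj (rfm N \<sigma> g)" if g: "g \<in> SU N" for g
 proof -
  have c: "snd \<sigma> (mt N N g) \<in> carrier_mat (fst \<sigma>) (fst \<sigma>)" "snd \<sigma> (mt N N (adj g)) \<in> carrier_mat (fst \<sigma>) (fst \<sigma>)"
   using D(1) SU_mt g SU_adj by blast+
  have 1: "rfm N \<sigma> (adj g) * rfm N \<sigma> g = rid \<sigma>"
   using m[OF SU_adj[OF g] g] UU_D(2)[OF SU_UU[OF g]] o by simp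
  have 2: "rfm N \<sigma> g * adj (rfm N \<sigma> g) = rid \<sigma>"
   using fm_mult_adj(2)[OF D(2)[OF SU_mt[OF g]]] by (simp add: rfm_def)
  have "rfm N \<sigma> (adj g) = rfm N \<sigma> (adj g) * (rfm N \<sigma> g * adj (rfm N \<sigma> g))"
   unfolding 2 using fm_un(2)[OF c(2)] by (simp add: rfm_def)
  also have "\<dots> = rid \<sigma> * adj (rfm N \<sigma> g)" using 1 by (metis mult.assoc)
  also have "\<dots> = adj (rfm N \<sigma> g)"
   using fm_un(2)[OF c(1)] by (metis adj_times adj_un finite_lessThan rfm_def)
  finally show ?thesis .
 qed
 show "continuous_on (SU N) (rfm N \<sigma>)" unfolding continuous_on_sequentially
 proof (intro ballI allI impI)
  fix A X assume A: "A \<in> SU N" and X: "(\<forall>k. X k \<in> SU N) \<and> X \<longlonglongrightarrow> A"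
  have "(\<lambda>k. snd \<sigma> (mt N N (X k)) $$ (i, j)) \<longlonglongrightarrow> snd \<sigma> (mt N N A) $$ (i, j)" if "i < fst \<sigma>" "j < fst \<sigma>" for i j
   using D(5) that SU_mt A X bounded_linear.tendsto[OF bounded_linear_ent, of X A]
   unfolding mat_continuous_on_def by (auto elim!: allE[of _ "\<lambda>k. mt N N (X k)"] allE[of _ "mt N N A"])
  then show "(rfm N \<sigma> \<circ> X) \<longlonglongrightarrow> rfm N \<sigma> A" unfolding o_def rfm_def
   by (intro tendsto_fmat[of "fst \<sigma>"] inn_fm D(1) SU_mt)
    (use X A carrier_matD[OF D(1)[OF SU_mt]] in \<open>auto simp: ent_fm\<close>)
 qed
qed

text \<open>A commuting projection is matched with the invariant subspace of the vectors it
  fixes.\<close>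

lemma irrep_irr:
 assumes s: "\<sigma> \<in> unitary_irreps N" and N: "N > 0"
 shows "irr N (rid \<sigma>) (rfm N \<sigma>)"
proof -
 interpret urep N "rid \<sigma>" "rfm N \<sigma>" by (rule irrep_urep[OF s N])
 note D = irrepD[OF s]
 let ?d = "fst \<sigma>"
 show ?thesis
 proof
  have "ent (rid \<sigma>) 0 0 \<noteq> 0" using D(6) by (simp add: ent_un)
  then show "rid \<sigma> \<noteq> 0" by auto
 next
  fix P assume P: "proj P" "rid \<sigma> * P = P" "\<And>g. g \<in> SU N ==> P * rfm N \<sigma> g = rfm N \<sigma> g * P"
  have Pu: "P * rid \<sigma> = P" using arg_cong[OF P(2), of adj] P(1) by (simp add: proj_def)
  define W where "W = {v \<in> carrier_vec ?d. P * vf v = vf v}"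
  have "VectorSpace.subspace class_ring W (module_vec TYPE(complex) ?d)"
   by (rule vec_subspace) (auto simp: W_def vf_zero vf_add[of _ ?d] vf_smult ring_distribs)
  moreover have "snd \<sigma> g *\<^sub>v w \<in> W" if "g \<in> carrier (SU_group N)" "w \<in> W" for g w
  proof -
   have w: "w \<in> carrier_vec ?d" "P * vf w = vf w" using that by (auto simp: W_def)
   have "rfm N \<sigma> (fm g) = fm (snd \<sigma> g)" using SU_fm[OF that(1)] by (simp add: rfm_def mt_fm)
   then have "P * fm (snd \<sigma> g) = fm (snd \<sigma> g) * P" using P(3)[OF SU_fm(2)[OF that(1)]] by simp
   then have "P * (fm (snd \<sigma> g) * vf w) = fm (snd \<sigma> g) * vf w" using w(2) by (metis mult.assoc)
   then show ?thesis using D(1)[OF that(1)] w by (simp add: W_def vf_mult[of _ ?d ?d])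
  qed
  ultimately consider "W = {0\<^sub>v ?d}" | "W = carrier_vec ?d" using D(7) by blast
  then show "P = 0 \<or> P = rid \<sigma>"
  proof cases
   case 1
   have "P * eu j 0 = 0" for j
   proof -
    have v: "vf (vt ?d (P * eu j 0)) = P * eu j 0" by (rule vf_vt[OF col_eu]) (simp add: assoc' P(2))
    have "vt ?d (P * eu j 0) \<in> W" using P(1) by (simp add: W_def v assoc' proj_def)
    then show ?thesis using 1 v by (simp add: vf_zero)
   qed
   then show ?thesis using eq_zero_cols by blast
  next
   case 2
   have "(P - rid \<sigma>) * eu j 0 = 0" for j
   proof (cases "j < ?d")
    case True
    have v: "vf (vt ?d (eu j 0)) = eu j 0"
     by (rule vf_vt[OF col_euI]) (use True in \<open>simp add: un_eu\<close>)
    have "vt ?d (eu j 0) \<in> W" using 2 by simp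
    then show ?thesis using True by (simp add: W_def v ring_distribs un_eu)
   next
    case False
    then have u: "rid \<sigma> * eu j 0 = 0" by (simp add: un_eu)
    then have "P * eu j 0 = 0" using Pu by (metis mult.assoc mult_zero_right)
    then show ?thesis using u by (simp add: ring_distribs)
   qed
   then have "P - rid \<sigma> = 0" using eq_zero_cols by blast
   then show ?thesis by simp
  qed
 qed
qed

text \<open>The representation on the range of \<open>S * adj S\<close>, written in the orthonormal
  basis formed by the columns of \<open>S\<close>.\<close>

definition mrep :: "nat => fmat => (fmat => fmat) => mat_rep" where
 "mrep m S r = (m, \<lambda>M. mt m m (adj S * r (fm M) * S))"

lemma mrep_rfm:
 assumes "isom m S" "g \<in> SU N" shows "rfm N (mrep m S r) g = adj S * r g * S"
proof -
 have "rfm N (mrep m S r) g = fm (mt m m (adj S * r g * S))"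
  by (simp only: rfm_def mrep_def snd_conv fm_mt_SU[OF assms(2)])
 also have "\<dots> = adj S * r g * S"
  using isom_un[OF assms(1)] by (simp add: fm_mt mult.assoc mac[of "un {..<m}" "adj S" "adj S"])
 finally show ?thesis .
qed

lemma mrep_irrep:
 assumes I: "irr N e r" and S: "isom m S" "S * adj S = e"
 shows "mrep m S r \<in> unitary_irreps N"
proof -
 interpret irr N e r by (rule I)
 have u: "S * un {..<m} = S" "un {..<m} * adj S = adj S" by (rule isom_un[OF S(1)])+
 have aS: "adj S * S = un {..<m}" using S(1) by (simp add: isom_def)
 have eS: "e * S = S" "adj S * e = adj S" unfolding S(2)[symmetric] by (simp_all add: mult.assoc aS u) (simp add: assoc' aS u)
 define \<rho> where "\<rho> = snd (mrep m S r)"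
 have rho: "\<rho> M = mt m m (adj S * r (fm M) * S)" for M by (simp add: \<rho>_def mrep_def)
 have frho: "fm (\<rho> M) = adj S * r (fm M) * S" for M
  using u by (simp add: rho fm_mt mult.assoc mac[of "un {..<m}" "adj S" "adj S"])
 have rc: "\<rho> M \<in> carrier_mat m m" for M by (simp add: rho)
 have mulr: "\<rho> (M * M') = \<rho> M * \<rho> M'" if "M \<in> carrier (SU_group N)" "M' \<in> carrier (SU_group N)" for M M'
 proof -
  have c: "M \<in> carrier_mat N N" "M' \<in> carrier_mat N N" "fm M \<in> SU N" "fm M' \<in> SU N" using that SU_fm by blast+
  have "fm (\<rho> (M * M')) = adj S * (r (fm M) * (e * r (fm M'))) * S"
   unfolding frho fm_mult[OF c(1,2)] r_mult[OF c(3,4)] er(1)[OF c(4)] by simp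
  also have "\<dots> = fm (\<rho> M) * fm (\<rho> M')" unfolding frho S(2)[symmetric] by (simp add: mult.assoc)
  finally have "fm (\<rho> (M * M')) = fm (\<rho> M * \<rho> M')" by (simp add: fm_mult[OF rc rc])
  then show ?thesis using fm_inj rc by (metis mult_carrier_mat)
 qed
 have U: "\<rho> M \<in> carrier (U_group m)" if "M \<in> carrier (SU_group N)" for M
 proof -
  have g: "fm M \<in> SU N" using SU_fm that by blast
  have "fm (mat_adjoint (\<rho> M) * \<rho> M) = adj S * (adj (r (fm M)) * (e * r (fm M))) * S"
   unfolding fm_mult[OF mat_adjoint_carrier[OF rc] rc] fm_adj[OF rc] frho S(2)[symmetric] by (simp add: mult.assoc)
  also have "\<dots> = fm (1\<^sub>m m)" using er(1)[OF g] rr(1)[OF g] by (simp add: eS aS fm_one)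
  finally have "mat_adjoint (\<rho> M) * \<rho> M = 1\<^sub>m m"
   using fm_inj[of "mat_adjoint (\<rho> M) * \<rho> M" m m "1\<^sub>m m"] mult_carrier_mat[OF mat_adjoint_carrier[OF rc] rc] by simp
  then show ?thesis using rc by (simp add: U_group_def)
 qed
 have "\<rho> \<in> hom (SU_group N) (U_group m)"
  using U mulr by (auto simp: hom_def SU_group_def U_group_def)
 moreover have "mat_continuous_on N (carrier (SU_group N)) m \<rho>" unfolding mat_continuous_on_def
 proof (intro allI impI)
  fix X A i j assume a: "(\<forall>k. X k \<in> carrier (SU_group N)) \<and> A \<in> carrier (SU_group N) \<and>
    (\<forall>i<N. \<forall>j<N. (\<lambda>k. X k $$ (i, j)) \<longlonglongrightarrow> A $$ (i, j))" and ij: "i < m" "j < m"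
  have c: "X k \<in> carrier_mat N N" "A \<in> carrier_mat N N" "fm (X k) \<in> SU N" "fm A \<in> SU N" for k using a SU_fm by blast+
  have "(\<lambda>k. fm (X k)) \<longlonglongrightarrow> fm A"
   by (rule tendsto_fmat[of N]) (use a c inn_fm in \<open>auto simp: ent_fm carrier_matD[OF c(1)] carrier_matD[OF c(2)]\<close>)
  then have "(\<lambda>k. r (fm (X k))) \<longlonglongrightarrow> r (fm A)"
   using r_cont[unfolded continuous_on_sequentially, rule_format, of "fm A" "\<lambda>k. fm (X k)"] c(3,4)
   by (simp add: o_def)
  then have "(\<lambda>k. adj S * r (fm (X k)) * S) \<longlonglongrightarrow> adj S * r (fm A) * S"
   by (intro tendsto_mult tendsto_const)
  then show "(\<lambda>k. \<rho> (X k) $$ (i, j)) \<longlonglongrightarrow> \<rho> A $$ (i, j)"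
   using ij bounded_linear.tendsto[OF bounded_linear_ent] by (simp add: rho)
 qed
 moreover have "m > 0"
 proof (rule ccontr)
  assume "\<not> m > 0"
  then have "un {..<m} = 0" by (intro fmat_eqI) (simp add: ent_un)
  then have "S = 0" using aS adj_self_0 by metis
  then show False using S(2) e_nz by simp
 qed
 moreover have "W = {0\<^sub>v m} \<or> W = carrier_vec m"
  if W: "VectorSpace.subspace class_ring W (module_vec TYPE(complex) m)"
   and inv: "\<forall>g \<in> carrier (SU_group N). \<forall>w \<in> W. \<rho> g *\<^sub>v w \<in> W" for W
 proof -
  note WD = vec_subspaceD[OF W]
  \<comment> \<open>The right ideal belonging to \<open>W\<close>: matrices in the range of
    \<open>e\<close> all of whose columns have coordinates in \<open>W\<close> with respect to the
    basis \<open>S\<close>.\<close>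
  define Z where "Z = {A. e * A = A \<and> (\<forall>j. vt m (adj S * A * eu j 0) \<in> W)}"
  have sumW: "vt m (\<Sum>k\<in>K. f k *c A k) \<in> W" if "\<And>k. vt m (A k) \<in> W" "finite K" for K :: "nat set" and f A
   using that(2) by (induction K rule: finite_induct) (auto simp: vt_zero vt_add vt_sc WD that(1))
  have colsum: "\<exists>n. B * eu j 0 = (\<Sum>k<n. ent B k j *c eu k 0)" for B j
  proof -
   obtain n where n: "inn n B" using inn_ex by blast
   have "B * eu j 0 = (\<Sum>k<n. ent B k j *c eu k 0)"
   proof (rule fmat_eqI)
    fix i l
    have "ent (\<Sum>k<n. ent B k j *c eu k 0) i l = (\<Sum>k<n. if k = i then (if l = 0 then ent B i j else 0) else 0)"
     unfolding ent_sum by (rule sum.cong) auto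
    also have "\<dots> = ent (B * eu j 0) i l" using n by (auto simp: ent_times_eu inn_def sum.delta)
    finally show "ent (B * eu j 0) i l = ent (\<Sum>k<n. ent B k j *c eu k 0) i l" by simp
   qed
   then show ?thesis by blast
  qed
  have RZ: "rideal Z" unfolding rideal_def
  proof (intro conjI ballI allI)
   show "0 \<in> Z" by (simp add: Z_def vt_zero WD(2))
   fix A assume A: "A \<in> Z"
   show "A + B \<in> Z" if "B \<in> Z" for B using A that by (simp add: Z_def ring_distribs vt_add WD(3))
   fix B
   have "vt m (adj S * (A * B) * eu j 0) \<in> W" for j
   proof -
    obtain n where n: "B * eu j 0 = (\<Sum>k<n. ent B k j *c eu k 0)" using colsum by blast
    have "adj S * (A * B) * eu j 0 = adj S * (A * (B * eu j 0))" by (simp add: mult.assoc)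
    also have "\<dots> = (\<Sum>k<n. ent B k j *c (adj S * A * eu k 0))"
     unfolding n by (simp add: sum_distrib_left mult.assoc)
    finally show ?thesis using sumW[of "\<lambda>k. adj S * A * eu k 0" "{..<n}"] A by (simp add: Z_def)
   qed
   then show "A * B \<in> Z" using A by (simp add: Z_def assoc')
  qed
  have eZ: "e * Y = Y" if "Y \<in> Z" for Y using that by (simp add: Z_def)
  obtain Q where Q: "proj Q" "Q \<in> Z" "\<And>Y. Y \<in> Z ==> Q * Y = Y"
   using rideal_proj[OF RZ eZ] by metis
  have rZ: "r g * A \<in> Z" if g: "g \<in> SU N" and A: "A \<in> Z" for g A
  proof -
   have "vt m (adj S * (r g * A) * eu j 0) \<in> W" for j
   proof -
    let ?M = "mt N N g"
    have M: "?M \<in> carrier (SU_group N)" "fm ?M = g" by (rule SU_mt[OF g]) (rule fm_mt_SU[OF g])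
    define w where "w = vt m (adj S * A * eu j 0)"
    have w: "w \<in> W" "w \<in> carrier_vec m" using A by (auto simp: w_def Z_def)
    have vw: "vf w = adj S * A * eu j 0" unfolding w_def by (rule vf_vt) (simp_all add: col_eu assoc' u)
    have "vf (\<rho> ?M *\<^sub>v w) = adj S * r g * (S * adj S) * A * eu j 0"
     by (simp add: vf_mult[OF rc w(2)] frho M vw mult.assoc)
    also have "\<dots> = adj S * (r g * A) * eu j 0" by (simp add: S(2) mult.assoc mac[OF er(2)[OF g]])
    finally have "vt m (adj S * (r g * A) * eu j 0) = \<rho> ?M *\<^sub>v w"
     by (metis vt_vf rc mult_mat_vec_carrier w(2))
    then show ?thesis using inv M(1) w(1) by simp
   qed
   then show ?thesis using A by (simp add: Z_def assoc' er(1)[OF g])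
  qed
  have "Q * r g = r g * Q" if g: "g \<in> SU N" for g
   using proj_commute[where W = Z and B = "r g", OF Q(1) Q(3)] rZ[OF g Q(2)] rZ[OF SU_adj[OF g] Q(2)] r_adj[OF g] by simp
  then have "Q = 0 \<or> Q = e" using irr[OF Q(1)] Q(2) by (simp add: Z_def)
  then show ?thesis
  proof
   assume Q0: "Q = 0"
   have "w = 0\<^sub>v m" if w: "w \<in> W" for w
   proof -
    have wc: "w \<in> carrier_vec m" using w WD(1) by blast
    have "vt m (adj S * (S * vf w) * eu j 0) \<in> W" for j
    proof (cases "j = 0")
     case True
     have "adj S * (S * vf w) * eu j 0 = vf w"
      using vf_un[OF wc] col_vf[of w] True by (simp add: Submission.col_def mac[OF aS])
     then show ?thesis using w wc by (simp add: vt_vf)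
    next
     case False
     have "vf w * eu j 0 = 0" by (rule fmat_eqI) (use False in \<open>simp add: ent_times_eu ent_vf\<close>)
     then show ?thesis by (simp add: mult.assoc vt_zero WD(2))
    qed
    then have "S * vf w \<in> Z" by (simp add: Z_def assoc' eS)
    then have "S * vf w = 0" using Q(3) Q0 by fastforce
    then have "vf w = 0" using vf_un[OF wc] by (metis aS mult.assoc mult_zero_right)
    then show ?thesis using vt_vf[OF wc] by (simp add: vt_zero)
   qed
   then show ?thesis using WD(2) by blast
  next
   assume Qe: "Q = e"
   have "w \<in> W" if wc: "w \<in> carrier_vec m" for w
   proof -
    have "e * (S * vf w) \<in> Z" using Q(2) \<open>rideal Z\<close> by (simp add: Qe rideal_def)
    then have "vt m (adj S * (S * vf w) * eu 0 0) \<in> W" by (simp add: Z_def assoc' eS)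
    moreover have "adj S * (S * vf w) * eu 0 0 = vf w"
     using vf_un[OF wc] col_vf[of w] by (simp add: Submission.col_def mac[OF aS])
    ultimately show ?thesis by (simp add: vt_vf wc)
   qed
   then show ?thesis using WD(1) by blast
  qed
 qed
 ultimately show ?thesis by (simp add: unitary_irreps_def mrep_def rho[abs_def])
qed

section \<open>Invariants and the Casimir eigenvalue\<close>

text \<open>Dimension is imported from coordinate space along an explicit surjective linear
  map.\<close>

lemma linear_vec:
 assumes V: "vectorspace class_ring V" and T: "\<And>v. v \<in> carrier_vec m ==> T v \<in> carrier V"
  "\<And>v w. v \<in> carrier_vec m ==> w \<in> carrier_vec m ==> T (v + w) = T v \<oplus>\<^bsub>V\<^esub> T w"
  "\<And>c v. v \<in> carrier_vec m ==> T (c \<cdot>\<^sub>v v) = (c :: complex) \<odot>\<^bsub>V\<^esub> T v"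
  and surj: "carrier V \<subseteq> T ` carrier_vec m"
 shows "vectorspace.fin_dim class_ring V"
  "inj_on T (carrier_vec m) ==> vectorspace.dim class_ring V = m"
proof -
 interpret U: vec_space "TYPE(complex)" m .
 interpret V: vectorspace class_ring V by (rule V)
 have h: "T \<in> module_hom class_ring (module_vec TYPE(complex) m) V"
  using T by (auto simp: module_hom_def module_vec_simps class_ring_simps)
 interpret L: linear_map class_ring "module_vec TYPE(complex) m" V T
  unfolding linear_map_def mod_hom_def mod_hom_axioms_def
  using U.vectorspace_axioms V U.module_axioms V.module_axioms h by blast
 have s: "T ` carrier (module_vec TYPE(complex) m) = carrier V"
  using T(1) surj by (auto simp: module_vec_simps)
 show "vectorspace.fin_dim class_ring V" by (rule L.surj_fin_dim[OF _ s]) simp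
 show "inj_on T (carrier_vec m) ==> vectorspace.dim class_ring V = m"
  using L.dim_eq[OF _ _ s] U.dim_is_n by (simp add: module_vec_simps)
qed

text \<open>The isometry \<open>S\<close> identifies the range with a coordinate space of dimension
  \<open>m\<close>, and \<open>m\<close> is also the trace of \<open>P\<close>.\<close>

lemma dim_range_proj:
 assumes P: "proj P" "un {..<d} * P = P"
 shows "of_nat (vectorspace.dim class_ring ((module_vec TYPE(complex) d)\<lparr>carrier :=
  {v \<in> carrier_vec d. P * vf v = vf v}\<rparr>)) = tr P"
proof -
 obtain m S where S: "isom m S" "S * adj S = P" using proj_isom[OF P(1)] .
 have aS: "adj S * S = un {..<m}" using S(1) by (simp add: isom_def)
 have u: "S * un {..<m} = S" "un {..<m} * adj S = adj S" by (rule isom_un[OF S(1)])+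
 have PS: "P * S = S" unfolding S(2)[symmetric] by (simp add: mult.assoc aS u)
 have dS: "un {..<d} * S = S" using P(2) PS by (metis mult.assoc)
 define W where "W = {v \<in> carrier_vec d. P * vf v = vf v}"
 define T where "T v = vt d (S * vf v)" for v
 have vT: "vf (T v) = S * vf v" for v unfolding T_def
  by (rule vf_vt[OF col_mult[OF col_vf]]) (simp add: assoc' dS)
 interpret U: vec_space "TYPE(complex)" d .
 have sub: "VectorSpace.subspace class_ring W (module_vec TYPE(complex) d)"
  by (rule vec_subspace) (auto simp: W_def vf_zero vf_add[of _ d] vf_smult ring_distribs)
 have V: "vectorspace class_ring ((module_vec TYPE(complex) d)\<lparr>carrier := W\<rparr>)"
  by (rule U.subspace_is_vs[OF sub])
 have "vectorspace.dim class_ring ((module_vec TYPE(complex) d)\<lparr>carrier := W\<rparr>) = m"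
 proof (rule linear_vec(2)[OF V, of m T])
  show "T v \<in> carrier ((module_vec TYPE(complex) d)\<lparr>carrier := W\<rparr>)" for v
   using vT[of v] by (simp add: W_def mac[OF PS]) (simp add: T_def)
  show "T (v + w) = T v \<oplus>\<^bsub>(module_vec TYPE(complex) d)\<lparr>carrier := W\<rparr>\<^esub> T w"
   if "v \<in> carrier_vec m" "w \<in> carrier_vec m" for v w
   using that by (simp add: module_vec_simps T_def vf_add[of _ m] ring_distribs vt_add)
  show "T (c \<cdot>\<^sub>v v) = c \<odot>\<^bsub>(module_vec TYPE(complex) d)\<lparr>carrier := W\<rparr>\<^esub> T v" for c v
   by (simp add: module_vec_simps T_def vf_smult vt_sc)
  show "carrier ((module_vec TYPE(complex) d)\<lparr>carrier := W\<rparr>) \<subseteq> T ` carrier_vec m"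
  proof
   fix v assume "v \<in> carrier ((module_vec TYPE(complex) d)\<lparr>carrier := W\<rparr>)"
   then have v: "v \<in> carrier_vec d" "P * vf v = vf v" by (auto simp: W_def)
   have w: "vf (vt m (adj S * vf v)) = adj S * vf v"
    by (rule vf_vt[OF col_mult[OF col_vf]]) (simp add: assoc' u)
   have "vf (T (vt m (adj S * vf v))) = vf v" unfolding vT w using v(2) S(2) by (simp add: assoc')
   then have "T (vt m (adj S * vf v)) = v" using v(1) by (metis T_def vt_carrier vt_vf)
   then show "v \<in> T ` carrier_vec m" by (metis imageI vt_carrier)
  qed
  show "inj_on T (carrier_vec m)"
  proof (rule inj_onI)
   fix v w assume v: "v \<in> carrier_vec m" "w \<in> carrier_vec m" "T v = T w"
   then have "adj S * (S * vf v) = adj S * (S * vf w)" using vT by metis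
   then show "v = w" using v vf_inj[of v m w] by (simp add: mac[OF aS] vf_un)
  qed
 qed
 moreover have "tr P = of_nat m" unfolding S(2)[symmetric] by (simp add: tr_comm[of S] aS tr_un)
 ultimately show ?thesis by (simp add: W_def)
qed

lemma fgrp_shift: assumes G: "fgrp N \<Gamma>" and g: "g \<in> \<Gamma>" shows "bij_betw ((*) g) \<Gamma> \<Gamma>"
proof -
 have gU: "g \<in> UU N" using G g by (auto simp: fgrp_def SU_def)
 have inj: "inj_on ((*) g) \<Gamma>"
 proof (rule inj_onI)
  fix x y assume x: "x \<in> \<Gamma>" "y \<in> \<Gamma>" "g * x = g * y"
  then have "x \<in> UU N" "y \<in> UU N" using G by (auto simp: fgrp_def SU_def)
  then show "x = y" using UU_cancel(1)[OF gU, of x] UU_cancel(1)[OF gU, of y] UU_un(1) x(3) by metis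
 qed
 have "(*) g ` \<Gamma> = \<Gamma>" by (rule endo_inj_surj) (use G g inj in \<open>auto simp: fgrp_def\<close>)
 then show ?thesis using inj by (simp add: bij_betw_def)
qed

lemma fgrp_adj: assumes G: "fgrp N \<Gamma>" and g: "g \<in> \<Gamma>" shows "adj g \<in> \<Gamma>"
proof -
 have gU: "g \<in> UU N" using G g by (auto simp: fgrp_def SU_def)
 obtain h where h: "h \<in> \<Gamma>" "g * h = un {..<N}"
  using fgrp_shift[OF G g] G by (auto simp: bij_betw_def fgrp_def image_iff set_eq_iff) metis
 have hU: "h \<in> UU N" using G h(1) by (auto simp: fgrp_def SU_def)
 have "h = adj g * (g * h)" using UU_cancel(1)[OF gU, of h] UU_un(1)[OF hU] by simp
 also have "\<dots> = adj g" using h(2) UU_un(2)[OF UU_adj[OF gU]] by simp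
 finally show ?thesis using h(1) by simp
qed

text \<open>The mean of \<open>r\<close> over the group absorbs left translations, hence is
  idempotent with the invariants as its range; it is Hermitian because inversion permutes the
  group.\<close>

lemma (in urep) average:
 assumes G: "fgrp N \<Gamma>"
 obtains A where "proj A" "e * A = A" "tr A = nG \<Gamma> r" "\<And>v. A * v = v \<longleftrightarrow> e * v = v \<and> (\<forall>g\<in>\<Gamma>. r g * v = v)"
proof -
 define c where "c = 1 / complex_of_nat (card \<Gamma>)"
 define A where "A = c *c (\<Sum>g\<in>\<Gamma>. r g)"
 have fin: "finite \<Gamma>" "\<Gamma> \<noteq> {}" "\<Gamma> \<subseteq> SU N" using G by (auto simp: fgrp_def)
 have c: "c * of_nat (card \<Gamma>) = 1" using fin by (simp add: c_def)
 have gA: "r g * A = A" if g: "g \<in> \<Gamma>" for g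
 proof -
  have "(\<Sum>h\<in>\<Gamma>. r g * r h) = (\<Sum>h\<in>\<Gamma>. r (g * h))"
   by (rule sum.cong) (use fin g in \<open>auto simp: r_mult subset_iff\<close>)
  also have "\<dots> = (\<Sum>h\<in>\<Gamma>. r h)" by (rule sum.reindex_bij_betw[OF fgrp_shift[OF G g]])
  finally show ?thesis by (simp add: A_def sum_distrib_left)
 qed
 have eA: "e * A = A" using fin er(1) by (simp add: A_def sum_distrib_left subset_iff)
 have avg: "A * v = v" if "\<forall>g\<in>\<Gamma>. r g * v = v" for v
 proof -
  have "A * v = c *c (\<Sum>g\<in>\<Gamma>. v)" using that by (simp add: A_def sum_distrib_right)
  also have "\<dots> = (c * of_nat (card \<Gamma>)) *c v" by (simp add: fmat_eq_iff)
  finally show ?thesis by (simp add: c)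
 qed
 have "adj A = A"
 proof -
  have "adj A = c *c (\<Sum>g\<in>\<Gamma>. r (adj g))" using fin by (simp add: A_def c_def r_adj subset_iff)
  also have "(\<Sum>g\<in>\<Gamma>. r (adj g)) = (\<Sum>g\<in>\<Gamma>. r g)"
   by (rule sum.reindex_bij_betw, rule bij_betw_byWitness[where f' = adj]) (use fgrp_adj[OF G] in auto)
  finally show ?thesis by (simp add: A_def)
 qed
 moreover have "A * A = A" using avg gA by blast
 ultimately have P: "proj A" by (simp add: proj_def)
 have "tr A = nG \<Gamma> r" by (simp add: A_def nG_def c_def)
 moreover have "A * v = v \<longleftrightarrow> e * v = v \<and> (\<forall>g\<in>\<Gamma>. r g * v = v)" for v
  using avg gA eA by (metis mult.assoc)
 ultimately show ?thesis using that P eA by blast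
qed

lemma fgrp_subgroup:
 assumes "subgroup \<Gamma> (SU_group N)" "finite \<Gamma>" shows "fgrp N (fm ` \<Gamma>)"
proof -
 have s: "\<Gamma> \<subseteq> carrier (SU_group N)" using subgroup.subset[OF assms(1)] .
 have "1\<^sub>m N \<in> \<Gamma>" using subgroup.one_closed[OF assms(1)] by (simp add: SU_group_def U_group_def)
 then have "un {..<N} \<in> fm ` \<Gamma>" using fm_one by (metis imageI)
 moreover have "fm a * fm b \<in> fm ` \<Gamma>" if "a \<in> \<Gamma>" "b \<in> \<Gamma>" for a b
 proof -
  have "a * b \<in> \<Gamma>" using subgroup.m_closed[OF assms(1) that] by (simp add: SU_group_def U_group_def)
  moreover have "fm (a * b) = fm a * fm b" using that s SU_fm(1) by (intro fm_mult) blast+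
  ultimately show ?thesis by (metis imageI)
 qed
 ultimately show ?thesis using assms(2) s SU_fm(2) by (auto simp: fgrp_def)
qed

lemma n_inv_nG:
 assumes s: "\<sigma> \<in> unitary_irreps N" and N: "N > 0" and G: "subgroup \<Gamma> (SU_group N)" "finite \<Gamma>"
 shows "of_nat (n_inv \<Gamma> \<sigma>) = nG (fm ` \<Gamma>) (rfm N \<sigma>)"
proof -
 interpret urep N "rid \<sigma>" "rfm N \<sigma>" by (rule irrep_urep[OF s N])
 obtain A where A: "proj A" "rid \<sigma> * A = A" "tr A = nG (fm ` \<Gamma>) (rfm N \<sigma>)"
  "\<And>v. A * v = v \<longleftrightarrow> rid \<sigma> * v = v \<and> (\<forall>g\<in>fm ` \<Gamma>. rfm N \<sigma> g * v = v)"
  using average[OF fgrp_subgroup[OF G]] by blast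
 have "(\<forall>\<gamma>\<in>\<Gamma>. snd \<sigma> \<gamma> *\<^sub>v v = v) \<longleftrightarrow> A * vf v = vf v" if v: "v \<in> carrier_vec (fst \<sigma>)" for v
 proof -
  have "snd \<sigma> \<gamma> *\<^sub>v v = v \<longleftrightarrow> rfm N \<sigma> (fm \<gamma>) * vf v = vf v" if "\<gamma> \<in> \<Gamma>" for \<gamma>
  proof -
   have g: "\<gamma> \<in> carrier (SU_group N)" using subgroup.subset[OF G(1)] that by blast
   note c = irrepD(1)[OF s g]
   have "vf (snd \<sigma> \<gamma> *\<^sub>v v) = rfm N \<sigma> (fm \<gamma>) * vf v"
    using vf_mult[OF c v] SU_fm(1)[OF g] by (simp add: rfm_def mt_fm)
   then show ?thesis using vf_inj[of "snd \<sigma> \<gamma> *\<^sub>v v" "fst \<sigma>" v] c v by simp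
  qed
  then show ?thesis using A(4)[of "vf v"] vf_un[OF v] by auto
 qed
 then have "{v \<in> carrier_vec (fst \<sigma>). \<forall>\<gamma>\<in>\<Gamma>. snd \<sigma> \<gamma> *\<^sub>v v = v} = {v \<in> carrier_vec (fst \<sigma>). A * vf v = vf v}" by blast
 then show ?thesis unfolding n_inv_def using dim_range_proj[OF A(1,2)] A(3) by simp
qed

section \<open>The Casimir eigenvalue of a matrix representation\<close>

lemma su_alg_fm: assumes "X \<in> su_alg N" shows "X \<in> carrier_mat N N" "fm X \<in> su N"
proof -
 show c: "X \<in> carrier_mat N N" using assms by (simp add: su_alg_def)
 have "adj (fm X) = - fm X" using assms by (simp add: fm_adj[OF c, symmetric] su_alg_def fm_uminus)
 moreover have "tr (fm X) = 0"
 proof -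
  have "(\<Sum>i<N. X $$ (i, i)) = 0" using assms unfolding su_alg_iff by blast
  then show ?thesis using c by (simp add: tr_n[OF inn_fm[OF c]] ent_fm)
 qed
 ultimately show "fm X \<in> su N" by (simp add: su_def inn_fm[OF c])
qed

lemma su_mt: assumes X: "X \<in> su N" shows "mt N N X \<in> su_alg N" "fm (mt N N X) = X"
proof -
 have e: "ent X j i = - cnj (ent X i j)" for i j
 proof -
  have "cnj (ent X i j) = - ent X j i" using arg_cong[OF suD(2)[OF X], of "\<lambda>A. ent A j i"] by (simp only: ent_adj ent_uminus)
  then show ?thesis by simp
 qed
 show "mt N N X \<in> su_alg N" unfolding su_alg_iff
 proof (intro conjI allI impI)
  show "(\<Sum>i<N. mt N N X $$ (i, i)) = 0" using suD(3)[OF X] tr_n[OF suD(1)[OF X]] by simp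
  fix i j assume "i < N" "j < N"
  then show "mt N N X $$ (j, i) = - cnj (mt N N X $$ (i, j))" using e[of j i] by (simp only: mt_index)
 qed simp
 show "fm (mt N N X) = X" using suD(4,5)[OF X] by (simp add: fm_mt)
qed

text \<open>In an eigenbasis of \<open>X\<close> each entry of the power series is a finite
  combination of scalar exponential series.\<close>

lemma mat_exp_Ex:
 assumes X: "X \<in> su_alg N" shows "mat_exp N (of_real t \<cdot>\<^sub>m X) = mt N N (Ex N (fm X) t)"
proof -
 have c: "X \<in> carrier_mat N N" and sX: "fm X \<in> su N" using su_alg_fm[OF X] by auto
 obtain S d where S: "isom N S" "S * adj S = un {..<N}" "fm X = S * dg N (\<lambda>i. \<i> * of_real (d i)) * adj S"
  "Ex N (fm X) = (\<lambda>t. S * dg N (\<lambda>i. exp (of_real t * (\<i> * of_real (d i)))) * adj S)"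
  using skew_diag_N[OF suD(1,2)[OF sX]] by blast
 define f where "f l = of_real t * (\<i> * of_real (d l))" for l
 have SU: "S \<in> UU N" by (rule isom_UU[OF S(1,2)])
 have iS: "inn N S" by (rule UU_D(1)[OF SU])
 have e: "ent (S * dg N a * adj S) i j = (\<Sum>l<N. ent S i l * cnj (ent S j l) * a l)" for a i j
  using iS by (subst ent_times_n[of N]) (auto simp: inn_mult inn_dg ent_times_n[of N] inn_adj
    if_distrib[where f="\<lambda>x. _ * x"] sum.If_cases intro!: sum.cong cong: if_cong)
 have tX: "fm (of_real t \<cdot>\<^sub>m X) = S * dg N f * adj S"
  by (simp add: fm_smult S(3) f_def[abs_def] sc_dg[symmetric])
 have pow: "fm ((of_real t \<cdot>\<^sub>m X) ^\<^sub>m k) = S * dg N (\<lambda>l. f l ^ k) * adj S" for k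
 proof (induction k)
  case 0
  have "S * dg N (\<lambda>l. 1) * adj S = un {..<N}" using SU by (simp add: dg_one UU_un UU_D)
  then show ?case using c by (simp add: fm_one)
 next
  case (Suc k)
  have "fm ((of_real t \<cdot>\<^sub>m X) ^\<^sub>m Suc k) = fm ((of_real t \<cdot>\<^sub>m X) ^\<^sub>m k) * fm (of_real t \<cdot>\<^sub>m X)"
   using fm_mult[OF pow_carrier_mat[of "of_real t \<cdot>\<^sub>m X" N k], of "of_real t \<cdot>\<^sub>m X" N] c by simp
  also have "\<dots> = S * (dg N (\<lambda>l. f l ^ k) * dg N f) * adj S"
   unfolding Suc tX by (simp add: mult.assoc UU_cancel[OF SU]) (simp add: assoc' dg_un)
  also have "\<dots> = S * dg N (\<lambda>l. f l ^ Suc k) * adj S" by (simp add: dg_mult mult.commute)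
  finally show ?case .
 qed
 show ?thesis
 proof (rule eq_matI)
  fix i j assume ij: "i < dim_row (mt N N (Ex N (fm X) t))" "j < dim_col (mt N N (Ex N (fm X) t))"
  have ex: "(\<lambda>k. x ^ k / fact k) sums exp x" for x :: complex
   using exp_converges[of x] by (simp add: scaleR_conv_of_real divide_inverse mult.commute)
  have "(\<lambda>k. \<Sum>l<N. ent S i l * cnj (ent S j l) * (f l ^ k / fact k)) sums (\<Sum>l<N. ent S i l * cnj (ent S j l) * exp (f l))"
   by (intro sums_sum sums_mult ex)
  moreover have "((of_real t \<cdot>\<^sub>m X) ^\<^sub>m k) $$ (i, j) / fact k = (\<Sum>l<N. ent S i l * cnj (ent S j l) * (f l ^ k / fact k))" for k
  proof -
   have "((of_real t \<cdot>\<^sub>m X) ^\<^sub>m k) $$ (i, j) = ent (fm ((of_real t \<cdot>\<^sub>m X) ^\<^sub>m k)) i j"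
    using ij c pow_carrier_mat[of "of_real t \<cdot>\<^sub>m X" N k] by (simp add: ent_fm)
   then show ?thesis by (simp add: pow e sum_divide_distrib)
  qed
  ultimately have "(\<Sum>k. ((of_real t \<cdot>\<^sub>m X) ^\<^sub>m k) $$ (i, j) / fact k) = (\<Sum>l<N. ent S i l * cnj (ent S j l) * exp (f l))"
   by (simp add: sums_unique[symmetric])
  then show "mat_exp N (of_real t \<cdot>\<^sub>m X) $$ (i, j) = mt N N (Ex N (fm X) t) $$ (i, j)"
   using ij by (simp add: mat_exp_def S(4) e f_def)
 qed (simp_all add: mat_exp_def)
qed

lemma rep_deriv_L:
 assumes s: "\<sigma> \<in> unitary_irreps N" and N: "N > 0" and X: "X \<in> su_alg N"
 shows "rep_deriv N \<sigma> X = mt (fst \<sigma>) (fst \<sigma>) (dL N (rid \<sigma>) (rfm N \<sigma>) (fm X))"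
proof (rule eq_matI)
 interpret urep N "rid \<sigma>" "rfm N \<sigma>" by (rule irrep_urep[OF s N])
 have sX: "fm X \<in> su N" by (rule su_alg_fm[OF X])
 fix i j assume ij: "i < dim_row (mt (fst \<sigma>) (fst \<sigma>) (L (fm X)))" "j < dim_col (mt (fst \<sigma>) (fst \<sigma>) (L (fm X)))"
 have "snd \<sigma> (mat_exp N (of_real t \<cdot>\<^sub>m X)) $$ (i, j) = ent (rfm N \<sigma> (Ex N (fm X) t)) i j" for t
  using irrepD(1)[OF s SU_mt[OF Ex_SU[OF sX]], of t] ij by (simp add: rfm_def mat_exp_Ex[OF X] ent_fm)
 moreover have "((\<lambda>t. ent (rfm N \<sigma> (Ex N (fm X) t)) i j) has_vector_derivative ent (L (fm X)) i j) (at 0)"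
  by (rule bounded_linear.has_vector_derivative[OF bounded_linear_ent oneparam_vd[OF L_oneparam[OF sX]]])
 ultimately show "rep_deriv N \<sigma> X $$ (i, j) = mt (fst \<sigma>) (fst \<sigma>) (L (fm X)) $$ (i, j)"
  using ij by (simp add: rep_deriv_def vector_derivative_at)
qed (simp_all add: rep_deriv_def)

lemma casimir_op_L:
 assumes s: "\<sigma> \<in> unitary_irreps N" and N: "N > 0" and B: "B \<subseteq> su_alg N"
 shows "casimir_op N B \<sigma> = mt (fst \<sigma>) (fst \<sigma>)
  (- (\<Sum>X\<in>fm ` B. dL N (rid \<sigma>) (rfm N \<sigma>) X * dL N (rid \<sigma>) (rfm N \<sigma>) X))" (is "_ = mt ?d ?d _")
proof (rule eq_matI)
 interpret urep N "rid \<sigma>" "rfm N \<sigma>" by (rule irrep_urep[OF s N])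
 have inj: "inj_on fm B" by (rule inj_onI) (use B su_alg_fm(1) fm_inj in blast)
 fix i j assume ij: "i < dim_row (mt ?d ?d (- (\<Sum>X\<in>fm ` B. L X * L X)))" "j < dim_col (mt ?d ?d (- (\<Sum>X\<in>fm ` B. L X * L X)))"
 have "(rep_deriv N \<sigma> X * rep_deriv N \<sigma> X) $$ (i, j) = ent (L (fm X) * L (fm X)) i j" if "X \<in> B" for X
 proof -
  have X: "X \<in> su_alg N" using that B by blast
  have "L (fm X) * rid \<sigma> = L (fm X)" by (rule L_skew(3)[OF su_alg_fm(2)[OF X]])
  then have "mt ?d ?d (L (fm X)) * mt ?d ?d (L (fm X)) = mt ?d ?d (L (fm X) * L (fm X))"
   by (intro mt_mult[symmetric]) blast
  then show ?thesis using ij by (simp add: rep_deriv_L[OF s N X])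
 qed
 then show "casimir_op N B \<sigma> $$ (i, j) = mt ?d ?d (- (\<Sum>X\<in>fm ` B. L X * L X)) $$ (i, j)"
  using ij by (simp add: casimir_op_def sum.reindex[OF inj])
qed (simp_all add: casimir_op_def)

text \<open>The trace form gives the coefficients in the basis: \<open>tlp N (eu i j)\<close> is
  minus the sum of the \<open>ent Y j i *c Y\<close>. Substituting this for the first factor of each
  term of \<open>CAS\<close>, the sum over \<open>i\<close> and \<open>j\<close> of the second
  factors reassembles \<open>L Y\<close>.\<close>

lemma (in urep) CAS_basis:
 assumes B: "finite B" "B \<subseteq> su N" and on: "\<And>X Y. X \<in> B ==> Y \<in> B ==> Re (tr (X * Y)) = (if X = Y then - 1 else 0)"
  and span: "\<And>X. X \<in> su N ==> \<exists>c :: fmat => real. X = (\<Sum>Y\<in>B. of_real (c Y) *c Y)"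
 shows "CAS = - (\<Sum>Y\<in>B. L Y * L Y)"
proof -
 \<comment> \<open>Only the real part is given, but the trace of a product of two skew-Hermitian
   matrices is real.\<close>
 have on': "tr (X * Y) = (if X = Y then - 1 else 0)" if "X \<in> B" "Y \<in> B" for X Y
 proof -
  have "cnj (tr (X * Y)) = tr (adj (X * Y))" by (simp only: tr_adj)
  also have "adj (X * Y) = Y * X" using that B(2) suD(2)[of X N] suD(2)[of Y N] by (simp add: subset_iff)
  also have "tr (Y * X) = tr (X * Y)" by (rule tr_comm)
  finally have "Im (tr (X * Y)) = 0" by (simp add: complex_eq_iff)
  then show ?thesis using on[OF that] by (auto simp: complex_eq_iff)
 qed
 have exp_su: "X = - (\<Sum>Y\<in>B. tr (Y * X) *c Y)" if X: "X \<in> su N" for X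
 proof -
  obtain c :: "fmat => real" where c: "X = (\<Sum>Y\<in>B. of_real (c Y) *c Y)" using span[OF X] by blast
  have "tr (Y * X) = - of_real (c Y)" if "Y \<in> B" for Y
  proof -
   have "tr (Y * X) = (\<Sum>Z\<in>B. of_real (c Z) * tr (Y * Z))" by (subst c) (simp add: sum_distrib_left)
   also have "\<dots> = (\<Sum>Z\<in>B. if Y = Z then - of_real (c Z) else 0)"
    by (rule sum.cong) (auto simp: on'[OF that])
   finally show ?thesis using that B(1) by (simp add: sum.delta)
  qed
  then have "(\<Sum>Y\<in>B. tr (Y * X) *c Y) = - (\<Sum>Y\<in>B. of_real (c Y) *c Y)" by (simp add: sum_negf)
  then show ?thesis using c by simp
 qed
 have exp_tl: "tlp N Z = - (\<Sum>Y\<in>B. tr (Y * Z) *c Y)" if Z: "inn N Z" for Z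
 proof -
  have "tr (Y * tlp N Z) = tr (Y * Z)" if "Y \<in> B" for Y
  proof -
   have Y: "Y \<in> su N" using that B by blast
   show ?thesis by (simp add: tlp_def cut_inn[OF Z] ring_distribs suD[OF Y])
  qed
  then have t: "tr (Y * skp N Z) + \<i> * tr (Y * hep N Z) = tr (Y * Z)" if "Y \<in> B" for Y
   using that by (simp add: skp_hep ring_distribs)
  have "tlp N Z = skp N Z + \<i> *c hep N Z" by (rule skp_hep)
  also have "\<dots> = - (\<Sum>Y\<in>B. tr (Y * skp N Z) *c Y) + \<i> *c (- (\<Sum>Y\<in>B. tr (Y * hep N Z) *c Y))"
   using exp_su[OF skp_su[OF N0, of Z]] exp_su[OF hep_su[OF N0, of Z]] by simp
  also have "\<dots> = - (\<Sum>Y\<in>B. (tr (Y * skp N Z) + \<i> * tr (Y * hep N Z)) *c Y)"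
   by (simp add: sc_sum_right sc_add_left sum.distrib)
  also have "\<dots> = - (\<Sum>Y\<in>B. tr (Y * Z) *c Y)" using t by simp
  finally show ?thesis .
 qed
 have D: "D (eu i j) = - (\<Sum>Y\<in>B. ent Y j i *c L Y)" if "i < N" "j < N" for i j
 proof -
  have "tr (Y * eu i j) = ent Y j i" for Y
   by (subst tr_S[of "{j}"]) (auto simp: ent_times_eu split: if_splits)
  then have "tlp N (eu i j) = - (\<Sum>Y\<in>B. ent Y j i *c Y)" using exp_tl[OF inn_eu[OF that]] by simp
  then have "D (eu i j) = - (\<Sum>Y\<in>B. ent Y j i *c D Y)" using D_tl[of "eu i j"] by (simp add: D_uminus D_sum D_sc)
  then show ?thesis using B(2) D_su by (simp add: subset_iff)
 qed
 have "D (eu i j) * D (eu j i) = (\<Sum>Y\<in>B. - (L Y * (ent Y j i *c D (eu j i))))" if "i < N" "j < N" for i j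
  by (subst D[OF that]) (simp add: sum_distrib_right sum_negf)
 then have "CAS = (\<Sum>i<N. \<Sum>j<N. \<Sum>Y\<in>B. - (L Y * (ent Y j i *c D (eu j i))))"
  unfolding CAS_def by (intro sum.cong refl) simp
 also have "\<dots> = (\<Sum>i<N. \<Sum>Y\<in>B. \<Sum>j<N. - (L Y * (ent Y j i *c D (eu j i))))"
  by (intro sum.cong refl sum.swap)
 also have "\<dots> = (\<Sum>Y\<in>B. \<Sum>i<N. \<Sum>j<N. - (L Y * (ent Y j i *c D (eu j i))))" by (rule sum.swap)
 also have "\<dots> = (\<Sum>Y\<in>B. - (L Y * L Y))"
 proof (rule sum.cong)
  fix Y assume "Y \<in> B"
  then have Y: "Y \<in> su N" using B(2) by blast
  have "(\<Sum>i<N. \<Sum>j<N. - (L Y * (ent Y j i *c D (eu j i)))) = (\<Sum>j<N. \<Sum>i<N. - (L Y * (ent Y j i *c D (eu j i))))"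
   by (rule sum.swap)
  also have "\<dots> = - (L Y * (\<Sum>j<N. \<Sum>i<N. ent Y j i *c D (eu j i)))"
   by (simp only: sum_negf sum_distrib_left)
  also have "(\<Sum>j<N. \<Sum>i<N. ent Y j i *c D (eu j i)) = L Y"
   using D_expand[OF suD(1)[OF Y]] D_su[OF Y] by simp
  finally show "(\<Sum>i<N. \<Sum>j<N. - (L Y * (ent Y j i *c D (eu j i)))) = - (L Y * L Y)" .
 qed simp
 also have "\<dots> = - (\<Sum>Y\<in>B. L Y * L Y)" by (rule sum_negf)
 finally show ?thesis .
qed

text \<open>Orthogonalisation of the projections to \<open>su N\<close> of the matrix units and of
  \<open>\<i>\<close> times the matrix units, which span \<open>su N\<close> over the reals.\<close>

lemma su_onb:
 assumes N: "N > 0"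
 obtains B where "finite B" "B \<subseteq> su N" "\<And>X Y. X \<in> B ==> Y \<in> B ==> inner X Y = (if X = Y then 1 else 0)"
  "\<And>X. X \<in> su N ==> \<exists>c :: fmat => real. X = (\<Sum>Y\<in>B. c Y *\<^sub>R Y)"
proof -
 define S where "S = (\<lambda>(i, j). skp N (eu i j)) ` ({..<N} \<times> {..<N}) \<union> (\<lambda>(i, j). skp N (\<i> *c eu i j)) ` ({..<N} \<times> {..<N})"
 have sub: "Real_Vector_Spaces.subspace (su N)"
  by (rule Real_Vector_Spaces.subspaceI) (auto intro: su_zero su_add su_scaleR)
 have "finite S" by (simp add: S_def)
 then obtain C where C: "finite C" "Real_Vector_Spaces.span C = Real_Vector_Spaces.span S" "pairwise (\<lambda>x y. inner x y = 0) C"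
  proof -
  assume t: "\<And>C. finite C ==> Real_Vector_Spaces.span C = Real_Vector_Spaces.span S ==> pairwise (\<lambda>x y. inner x y = 0) C ==> thesis"
  show thesis using basis_orthogonal[OF \<open>finite S\<close>]
   by (elim exE conjE) (rule t, auto simp: pairwise_def real_inner_class.orthogonal_def)
 qed
 have "S \<subseteq> su N" using skp_su[OF N] by (auto simp: S_def)
 then have "Real_Vector_Spaces.span C \<subseteq> su N" unfolding C(2) by (rule Real_Vector_Spaces.span_minimal[OF _ sub])
 then have Csu: "C \<subseteq> su N" using Real_Vector_Spaces.span_superset by blast
 define B where "B = (\<lambda>x. x /\<^sub>R norm x) ` (C - {0})"
 have BC: "inner (x /\<^sub>R norm x) (y /\<^sub>R norm y) = (if x = y then 1 else 0)" if "x \<in> C - {0}" "y \<in> C - {0}" for x y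
  using that C(3) by (auto simp: pairwise_def dot_square_norm power2_eq_square field_simps)
 have fB: "finite B" using C(1) by (simp add: B_def)
 have "B \<subseteq> su N" using Csu su_scaleR by (auto simp: B_def)
 moreover have "inner X Y = (if X = Y then 1 else 0)" if "X \<in> B" "Y \<in> B" for X Y
  using that BC unfolding B_def by (auto split: if_splits)
 moreover have "\<exists>c. X = (\<Sum>Y\<in>B. c Y *\<^sub>R Y)" if X: "X \<in> su N" for X
 proof -
  have "C \<subseteq> Real_Vector_Spaces.span B"
  proof
   fix x assume x: "x \<in> C"
   show "x \<in> Real_Vector_Spaces.span B"
   proof (cases "x = 0")
    case False
    then have "x /\<^sub>R norm x \<in> Real_Vector_Spaces.span B" using x by (intro Real_Vector_Spaces.span_base) (auto simp: B_def)
    then have "norm x *\<^sub>R (x /\<^sub>R norm x) \<in> Real_Vector_Spaces.span B" by (rule Real_Vector_Spaces.span_scale)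
    then show ?thesis using False by simp
   qed (simp add: Real_Vector_Spaces.span_zero)
  qed
  then have CB: "Real_Vector_Spaces.span S \<subseteq> Real_Vector_Spaces.span B"
   using C(2) Real_Vector_Spaces.span_minimal Real_Vector_Spaces.subspace_span by metis
  have "X = skp N X" using skp_of_su[OF X] by simp
  also have "\<dots> = skp N (\<Sum>i<N. \<Sum>j<N. ent X i j *c eu i j)" using fmat_expand[OF suD(1)[OF X]] by simp
  also have "\<dots> = (\<Sum>i<N. \<Sum>j<N. skp N (ent X i j *c eu i j))"
  proof -
   have z: "skp N 0 = 0" using skp_of_su[OF su_zero] .
   have "skp N (\<Sum>x\<in>A. f x) = (\<Sum>x\<in>A. skp N (f x))" for A :: "nat set" and f
    by (induction A rule: infinite_finite_induct) (auto simp: z skp_add)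
   then show ?thesis by simp
  qed
  also have "\<dots> \<in> Real_Vector_Spaces.span S"
  proof (intro Real_Vector_Spaces.span_sum)
   fix i j assume ij: "i \<in> {..<N}" "j \<in> {..<N}"
   have "ent X i j *c eu i j = of_real (Re (ent X i j)) *c eu i j + of_real (Im (ent X i j)) *c (\<i> *c eu i j)"
    by (rule fmat_eqI) (simp add: complex_eq_iff)
   then have "skp N (ent X i j *c eu i j) = Re (ent X i j) *\<^sub>R skp N (eu i j) + Im (ent X i j) *\<^sub>R skp N (\<i> *c eu i j)"
    by (simp only: skp_add skp_real)
   moreover have "skp N (eu i j) \<in> S" "skp N (\<i> *c eu i j) \<in> S" using ij by (auto simp: S_def)
   ultimately show "skp N (ent X i j *c eu i j) \<in> Real_Vector_Spaces.span S"
    by (simp add: Real_Vector_Spaces.span_add Real_Vector_Spaces.span_scale Real_Vector_Spaces.span_base)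
  qed
  finally have "X \<in> Real_Vector_Spaces.span B" using CB by blast
  then show ?thesis using Real_Vector_Spaces.span_finite[OF fB] by auto
 qed
 ultimately show ?thesis using that fB by blast
qed

lemma su_inner_tr: assumes "X \<in> carrier_mat N N" "Y \<in> carrier_mat N N" shows "su_inner X Y = - Re (tr (fm X * fm Y))"
 using assms by (simp add: su_inner_sum[OF assms] tr_n[OF inn_mult[OF inn_fm inn_fm]] ent_times_n[of N] inn_fm ent_fm)

text \<open>If there were no such basis, every scalar would satisfy the condition in
  \<open>casimir_eigenvalue\<close>, and the description would not be unique.\<close>

lemma onb_ex: assumes N: "N > 0" obtains B where "su_orthonormal_basis N B"
proof -
 obtain B where B: "finite B" "B \<subseteq> su N" "\<And>X Y. X \<in> B ==> Y \<in> B ==> inner X Y = (if X = Y then 1 else 0)"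
  "\<And>X. X \<in> su N ==> \<exists>c :: fmat => real. X = (\<Sum>Y\<in>B. c Y *\<^sub>R Y)" using su_onb[OF N] by blast
 have inj: "inj_on (mt N N) B" by (rule inj_onI) (metis B(2) su_mt(2) subsetD)
 have "su_inner (mt N N X) (mt N N Y) = (if mt N N X = mt N N Y then 1 else 0)" if "X \<in> B" "Y \<in> B" for X Y
 proof -
  have XY: "X \<in> su N" "Y \<in> su N" using that B by auto
  have "su_inner (mt N N X) (mt N N Y) = Re (tr (adj X * Y))"
   by (simp add: su_inner_tr[of _ N] su_mt(2) XY suD(2)[OF XY(1)])
  also have "\<dots> = inner X Y" by (simp add: inner_fmat_def)
  finally show ?thesis using B(3)[OF that] inj that by (auto simp: inj_on_eq_iff)
 qed
 moreover have "\<exists>c. \<forall>i<N. \<forall>j<N. X $$ (i, j) = (\<Sum>Y\<in>mt N N ` B. complex_of_real (c Y) * Y $$ (i, j))" if X: "X \<in> su_alg N" for X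
 proof -
  obtain c :: "fmat => real" where c: "fm X = (\<Sum>Y\<in>B. c Y *\<^sub>R Y)" using B(4)[OF su_alg_fm(2)[OF X]] by blast
  have "X $$ (i, j) = (\<Sum>Y\<in>mt N N ` B. complex_of_real (c (fm Y)) * Y $$ (i, j))" if "i < N" "j < N" for i j
  proof -
   have "X $$ (i, j) = ent (fm X) i j" using that su_alg_fm(1)[OF X] by (simp add: ent_fm)
   also have "\<dots> = (\<Sum>Y\<in>B. of_real (c Y) * ent Y i j)" by (simp add: c scaleR_fmat_def)
   also have "\<dots> = (\<Sum>Y\<in>mt N N ` B. complex_of_real (c (fm Y)) * Y $$ (i, j))"
    unfolding sum.reindex[OF inj] by (rule sum.cong) (use that B(2) su_mt(2) in auto)
   finally show ?thesis .
  qed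
  then show ?thesis by (intro exI[of _ "\<lambda>Y. c (fm Y)"]) blast
 qed
 ultimately have "su_orthonormal_basis N (mt N N ` B)"
  using B(1,2) su_mt(1) by (auto simp: su_orthonormal_basis_def)
 then show ?thesis using that by blast
qed

theorem casimir_casc:
 assumes s: "\<sigma> \<in> unitary_irreps N" and N: "N > 0" and v: "urep.hwv N (rid \<sigma>) (rfm N \<sigma>) v w"
 shows "casimir_eigenvalue N \<sigma> = casc N w"
proof -
 interpret irr N "rid \<sigma>" "rfm N \<sigma>" by (rule irrep_irr[OF s N])
 let ?d = "fst \<sigma>"
 have op: "casimir_op N B \<sigma> = of_real (casc N w) \<cdot>\<^sub>m 1\<^sub>m ?d" if B: "su_orthonormal_basis N B" for B
 proof -
  have Bs: "finite B" "B \<subseteq> su_alg N" using B by (auto simp: su_orthonormal_basis_def)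
  have inj: "inj_on fm B" by (rule inj_onI) (use Bs su_alg_fm(1) fm_inj in blast)
  have "CAS = - (\<Sum>Y\<in>fm ` B. L Y * L Y)"
  proof (rule CAS_basis)
   show "finite (fm ` B)" "fm ` B \<subseteq> su N" using Bs su_alg_fm(2) by auto
   show "Re (tr (X * Y)) = (if X = Y then - 1 else 0)" if XY: "X \<in> fm ` B" "Y \<in> fm ` B" for X Y
   proof -
    obtain X' Y' where X': "X = fm X'" "X' \<in> B" "Y = fm Y'" "Y' \<in> B" using XY by blast
    then have "su_inner X' Y' = (if X' = Y' then 1 else 0)" using B by (simp add: su_orthonormal_basis_def)
    moreover have "su_inner X' Y' = - Re (tr (X * Y))"
     unfolding X' by (rule su_inner_tr) (use X' Bs su_alg_fm(1) in auto)
    ultimately show ?thesis using X' inj by (auto simp: inj_on_eq_iff)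
   qed
   show "\<exists>c :: fmat => real. X = (\<Sum>Y\<in>fm ` B. of_real (c Y) *c Y)" if X: "X \<in> su N" for X
   proof -
    obtain c :: "complex mat => real" where c: "\<forall>i<N. \<forall>j<N. mt N N X $$ (i, j) = (\<Sum>Y\<in>B. of_real (c Y) * Y $$ (i, j))"
     using B su_mt(1)[OF X] unfolding su_orthonormal_basis_def by blast
    have "X = (\<Sum>Y\<in>B. of_real (c Y) *c fm Y)"
    proof (rule fmat_eqI)
     fix i j
     show "ent X i j = ent (\<Sum>Y\<in>B. of_real (c Y) *c fm Y) i j"
     proof (cases "i < N \<and> j < N")
      case True
      have "ent (fm Y) i j = Y $$ (i, j)" if "Y \<in> B" for Y
       using True that Bs(2) su_alg_fm(1)[of Y N] by (auto simp: ent_fm)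
      then show ?thesis using c True by simp
     next
      case False
      have "ent (fm Y) i j = 0" if "Y \<in> B" for Y
       using False that Bs(2) su_alg_fm(1)[of Y N] by (auto simp: ent_fm)
      moreover have "ent X i j = 0" using False suD(1)[OF X] by (auto simp: inn_def)
      ultimately show ?thesis by simp
     qed
    qed
    also have "\<dots> = (\<Sum>Y\<in>fm ` B. of_real (c (the_inv_into B fm Y)) *c Y)"
     unfolding sum.reindex[OF inj] by (simp add: the_inv_into_f_f[OF inj])
    finally show ?thesis by (rule exI[of _ "\<lambda>Y. c (the_inv_into B fm Y)"])
   qed
  qed
  then have "casimir_op N B \<sigma> = mt ?d ?d CAS" using casimir_op_L[OF s N Bs(2)] by simp
  also have "\<dots> = of_real (casc N w) \<cdot>\<^sub>m 1\<^sub>m ?d"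
   unfolding CAS_scalar[OF v] by (rule eq_matI) (auto simp: ent_un)
  finally show ?thesis .
 qed
 obtain B where B: "su_orthonormal_basis N B" using onb_ex[OF N] .
 show ?thesis unfolding casimir_eigenvalue_def
 proof (rule the_equality)
  fix c assume "\<forall>B. su_orthonormal_basis N B --> casimir_op N B \<sigma> = of_real c \<cdot>\<^sub>m 1\<^sub>m ?d"
  then have "complex_of_real c \<cdot>\<^sub>m 1\<^sub>m ?d = of_real (casc N w) \<cdot>\<^sub>m 1\<^sub>m ?d" using op[OF B] B by metis
  from arg_cong[OF this, of "\<lambda>M. M $$ (0, 0)"] show "c = casc N w" using irrepD(6)[OF s] by simp
 qed (use op in blast)
qed

section \<open>Conjugation and equivalence of representations\<close>

lemma oneparam_cj: assumes "oneparam e M f" shows "oneparam (cj e) (cj M) (\<lambda>t. cj (f t))"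
 using assms bounded_linear.has_vector_derivative[OF bounded_linear_cj, of f M]
 by (auto simp: oneparam_def cj_adj[symmetric])

lemma proj_cj: "proj P ==> proj (cj P)"
 by (auto simp: proj_def cj_adj[symmetric] cj_times[symmetric] simp del: cj_times)

lemma urep_cj: assumes "urep N e r" shows "urep N (cj e) (\<lambda>g. cj (r g))"
proof -
 interpret urep N e r by (rule assms)
 show ?thesis
 proof
  show "continuous_on (SU N) (\<lambda>g. cj (r g))"
   by (rule bounded_linear.continuous_on[OF bounded_linear_cj r_cont])
 qed (auto simp: N0 proj_cj pe r_mult r_one r_adj cj_adj)
qed

lemma irr_cj: assumes "irr N e r" shows "irr N (cj e) (\<lambda>g. cj (r g))"
proof -
 interpret irr N e r by (rule assms)
 interpret C: urep N "cj e" "\<lambda>g. cj (r g)" by (rule urep_cj) unfold_locales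
 show ?thesis
 proof
  show "cj e \<noteq> 0" using e_nz by (metis cj_cj cj_zero)
  fix P assume P: "proj P" "cj e * P = P" "\<And>g. g \<in> SU N ==> P * cj (r g) = cj (r g) * P"
  have "cj P * r g = r g * cj P" if "g \<in> SU N" for g using arg_cong[OF P(3)[OF that], of cj] by simp
  moreover have "e * cj P = cj P" using arg_cong[OF P(2), of cj] by simp
  ultimately have "cj P = 0 \<or> cj P = e" using irr[OF proj_cj[OF P(1)]] by blast
  then show "P = 0 \<or> P = cj e" by (metis cj_cj cj_zero)
 qed
qed

text \<open>The differential of the conjugate representation at \<open>X\<close> is minus the
  conjugate of \<open>D (adj X)\<close>; the signs cancel in each product, and the adjoints only
  exchange the two summation indices.\<close>

lemma CAS_cj: assumes "urep N e r" shows "urep.CAS N (cj e) (\<lambda>g. cj (r g)) = cj (urep.CAS N e r)"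
proof -
 interpret urep N e r by (rule assms)
 interpret C: urep N "cj e" "\<lambda>g. cj (r g)" by (rule urep_cj[OF assms])
 have L: "C.L X = cj (L X)" if "X \<in> su N" for X
  by (rule dL_eqI) (rule oneparam_cj[OF L_oneparam[OF that]])
 have "C.D X = cj (- D (adj X))" for X
  using skp_su[OF N0, of X] hep_su[OF N0, of X] L_uminus[OF skp_su[OF N0, of X]]
  by (simp add: Dop_def L skp_adj hep_adj)
 then have "C.CAS = (\<Sum>i<N. \<Sum>j<N. cj (D (eu j i)) * cj (D (eu i j)))" by (simp add: C.CAS_def)
 also have "\<dots> = (\<Sum>j<N. \<Sum>i<N. cj (D (eu j i)) * cj (D (eu i j)))" by (rule sum.swap)
 also have "\<dots> = cj CAS"
 proof -
  have "cj (sum f S) = (\<Sum>x\<in>S. cj (f x))" for f and S :: "nat set"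
   by (induction S rule: infinite_finite_induct) auto
  then show ?thesis by (simp add: CAS_def)
 qed
 finally show ?thesis .
qed

text \<open>Comparing the scalars by which \<open>CAS\<close> acts avoids computing the highest
  weight of the conjugate representation.\<close>

lemma casc_cj:
 assumes I: "irr N e r" and v: "urep.hwv N e r v w" and v': "urep.hwv N (cj e) (\<lambda>g. cj (r g)) v' w'"
 shows "casc N w = casc N w'"
proof -
 interpret irr N e r by (rule I)
 interpret C: irr N "cj e" "\<lambda>g. cj (r g)" by (rule irr_cj[OF I])
 have "C.CAS = cj CAS" by (rule CAS_cj) unfold_locales
 then have "complex_of_real (casc N w') *c cj e = of_real (casc N w) *c cj e"
  using C.CAS_scalar[OF v'] CAS_scalar[OF v] by simp
 then show ?thesis using C.e_nz by (simp add: sc_eq_iff del: cj_sc)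
qed

text \<open>The mean of the character is the trace of a projection, hence real.\<close>

lemma nG_cj: assumes "urep N e r" "fgrp N \<Gamma>" shows "nG \<Gamma> (\<lambda>g. cj (r g)) = nG \<Gamma> r"
proof -
 obtain A where A: "proj A" "tr A = nG \<Gamma> r" using urep.average[OF assms] by metis
 have "nG \<Gamma> (\<lambda>g. cj (r g)) = cnj (nG \<Gamma> r)" by (simp add: nG_def)
 also have "\<dots> = nG \<Gamma> r" using A by (metis tr_adj projD(1))
 finally show ?thesis .
qed

text \<open>A non-zero intertwiner of irreducible representations is already an equivalence, and
  being non-zero is easier to carry along than invertibility.\<close>

definition eqv :: "nat => mat_rep => mat_rep => fmat => bool" where
 "eqv N \<sigma> \<tau> T \<longleftrightarrow> T \<noteq> 0 \<and> T * rid \<sigma> = T \<and> rid \<tau> * T = T \<and> (\<forall>g\<in>SU N. T * rfm N \<sigma> g = rfm N \<tau> g * T)"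

text \<open>By \<open>intertwiner_iso\<close> a multiple of \<open>adj T\<close> inverts
  \<open>T\<close>, and comparing the traces of \<open>adj T * T\<close> and
  \<open>T * adj T\<close> shows that both sizes agree.\<close>

lemma rep_equiv_iff:
 assumes N: "N > 0"
 shows "(\<sigma>, \<tau>) \<in> rep_equiv N \<longleftrightarrow> \<sigma> \<in> unitary_irreps N \<and> \<tau> \<in> unitary_irreps N \<and> (\<exists>T. eqv N \<sigma> \<tau> T)"
proof (cases "\<sigma> \<in> unitary_irreps N \<and> \<tau> \<in> unitary_irreps N")
 case True
 then have s: "\<sigma> \<in> unitary_irreps N" and t: "\<tau> \<in> unitary_irreps N" by auto
 let ?c = "fst \<sigma>" and ?d = "fst \<tau>"
 have cs: "snd \<sigma> (mt N N g) \<in> carrier_mat ?c ?c" "snd \<tau> (mt N N g) \<in> carrier_mat ?d ?d" if "g \<in> SU N" for g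
  using irrepD(1)[OF s SU_mt[OF that]] irrepD(1)[OF t SU_mt[OF that]] by auto
 show ?thesis
 proof
  assume "(\<sigma>, \<tau>) \<in> rep_equiv N"
  then obtain T where T: "T \<in> carrier_mat ?d ?c" "\<And>k. k \<in> carrier (SU_group N) ==> T * snd \<sigma> k = snd \<tau> k * T" "invertible_mat T"
   by (auto simp: rep_equiv_def hom_K_def)
  have "fm T \<noteq> 0"
  proof
   assume "fm T = 0"
   then have "T = 0\<^sub>m ?d ?c" using mt_fm[OF T(1)] by (auto simp: mt_def)
   obtain B where B: "T * B = 1\<^sub>m ?d" "B * T = 1\<^sub>m (dim_row B)"
    using T(1,3) by (auto simp: invertible_mat_def inverts_mat_def)
   have "dim_row B = ?c" using arg_cong[OF B(2), of dim_col] T(1) by simp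
   moreover have "dim_col B = ?d" using arg_cong[OF B(1), of dim_col] by simp
   ultimately have "B \<in> carrier_mat ?c ?d" by (rule carrier_matI)
   then have "1\<^sub>m ?d = (0\<^sub>m ?d ?d :: complex mat)"
    using B(1) \<open>T = 0\<^sub>m ?d ?c\<close> by simp
   from arg_cong[OF this, of "\<lambda>M. M $$ (0, 0)"] show False using irrepD(6)[OF t] by simp
  qed
  moreover have "fm T * rfm N \<sigma> g = rfm N \<tau> g * fm T" if "g \<in> SU N" for g
   using T(2)[OF SU_mt[OF that]] fm_mult[OF T(1) cs(1)[OF that]] fm_mult[OF cs(2)[OF that] T(1)] by (simp add: rfm_def)
  ultimately have "eqv N \<sigma> \<tau> (fm T)" using fm_un[OF T(1)] by (simp add: eqv_def)
  then show "\<sigma> \<in> unitary_irreps N \<and> \<tau> \<in> unitary_irreps N \<and> (\<exists>T. eqv N \<sigma> \<tau> T)" using True by blast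
 next
  assume "\<sigma> \<in> unitary_irreps N \<and> \<tau> \<in> unitary_irreps N \<and> (\<exists>T. eqv N \<sigma> \<tau> T)"
  then obtain T where "eqv N \<sigma> \<tau> T" by blast
  then have T: "T \<noteq> 0" "T * rid \<sigma> = T" "rid \<tau> * T = T" "\<And>g. g \<in> SU N ==> T * rfm N \<sigma> g = rfm N \<tau> g * T"
   by (auto simp: eqv_def)
  obtain c where c: "c > 0" "adj T * T = of_real c *c rid \<sigma>" "T * adj T = of_real c *c rid \<tau>"
   using intertwiner_iso[OF irrep_irr[OF s N] irrep_irr[OF t N] T] by metis
  have "of_real c * complex_of_nat ?c = tr (adj T * T)" by (simp add: c tr_un)
  also have "\<dots> = of_real c * of_nat ?d" by (subst tr_comm) (simp add: c tr_un)
  finally have d: "?c = ?d" using c(1) by simp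
  define M where "M = mt ?d ?c T"
  have fM: "fm M = T" using T(2,3) by (simp add: M_def fm_mt)
  have Mc: "M \<in> carrier_mat ?d ?c" by (simp add: M_def)
  have aT: "adj T * rid \<tau> = adj T" using arg_cong[OF T(3), of adj] by simp
  define B where "B = mt ?c ?d ((1 / of_real c) *c adj T)"
  have "M * B = mt ?d ?d (T * ((1 / of_real c) *c adj T))" unfolding M_def B_def
   by (rule mt_mult[symmetric]) (use T(2) in blast)
  also have "\<dots> = 1\<^sub>m ?d" using c(1,3) by (simp add: mt_one)
  finally have MB: "M * B = 1\<^sub>m ?d" .
  have "B * M = mt ?c ?c (((1 / of_real c) *c adj T) * T)" unfolding M_def B_def
   by (rule mt_mult[symmetric]) (use T(3) in blast)
  also have "\<dots> = 1\<^sub>m ?c" using c(1,2) by (simp add: mt_one)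
  finally have BM: "B * M = 1\<^sub>m ?c" .
  have "invertible_mat M" using MB BM d by (auto simp: invertible_mat_def inverts_mat_def M_def B_def)
  moreover have "M * snd \<sigma> k = snd \<tau> k * M" if k: "k \<in> carrier (SU_group N)" for k
  proof -
   have g: "fm k \<in> SU N" "mt N N (fm k) = k" using SU_fm[OF k] by (simp_all add: mt_fm)
   have "fm (M * snd \<sigma> k) = fm (snd \<tau> k * M)"
    using T(4)[OF g(1)] fm_mult[OF Mc irrepD(1)[OF s k]] fm_mult[OF irrepD(1)[OF t k] Mc] by (simp add: rfm_def g(2) fM)
   then show ?thesis
    using fm_inj[OF mult_carrier_mat[OF Mc irrepD(1)[OF s k]] mult_carrier_mat[OF irrepD(1)[OF t k] Mc]] by simp
  qed
  ultimately show "(\<sigma>, \<tau>) \<in> rep_equiv N" using s t Mc by (auto simp: rep_equiv_def hom_K_def)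
 qed
qed (auto simp: rep_equiv_def)

lemma equiv_rep: assumes N: "N > 0" shows "equiv (unitary_irreps N) (rep_equiv N)"
proof (rule equivI)
 show "rep_equiv N \<subseteq> unitary_irreps N \<times> unitary_irreps N" by (auto simp: rep_equiv_def)
 show "refl_on (unitary_irreps N) (rep_equiv N)"
 proof (rule refl_onI)
  fix \<sigma> assume s: "\<sigma> \<in> unitary_irreps N"
  interpret irr N "rid \<sigma>" "rfm N \<sigma>" by (rule irrep_irr[OF s N])
  have "eqv N \<sigma> \<sigma> (rid \<sigma>)" using e_nz er by (simp add: eqv_def)
  then show "(\<sigma>, \<sigma>) \<in> rep_equiv N" using s rep_equiv_iff[OF N] by blast
 qed
 show "sym (rep_equiv N)"
 proof (rule symI)
  fix \<sigma> \<tau> assume "(\<sigma>, \<tau>) \<in> rep_equiv N"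
  then obtain T where s: "\<sigma> \<in> unitary_irreps N" "\<tau> \<in> unitary_irreps N" and T: "eqv N \<sigma> \<tau> T"
   using rep_equiv_iff[OF N] by blast
  interpret A: irr N "rid \<sigma>" "rfm N \<sigma>" by (rule irrep_irr[OF s(1) N])
  interpret B: irr N "rid \<tau>" "rfm N \<tau>" by (rule irrep_irr[OF s(2) N])
  have "adj T * rfm N \<tau> g = rfm N \<sigma> g * adj T" if g: "g \<in> SU N" for g
  proof -
   have "adj (T * rfm N \<sigma> (adj g)) = adj (rfm N \<tau> (adj g) * T)" using T SU_adj[OF g] by (simp add: eqv_def)
   then show ?thesis using A.r_adj[OF g] B.r_adj[OF g] by simp
  qed
  moreover have "adj T * rid \<tau> = adj T" "rid \<sigma> * adj T = adj T"
  proof -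
   have "T * rid \<sigma> = T" "rid \<tau> * T = T" using T by (auto simp: eqv_def)
   then have "adj (T * rid \<sigma>) = adj T" "adj (rid \<tau> * T) = adj T" by simp_all
   then show "adj T * rid \<tau> = adj T" "rid \<sigma> * adj T = adj T" by simp_all
  qed
  ultimately have "eqv N \<tau> \<sigma> (adj T)" using T by (simp add: eqv_def)
  then show "(\<tau>, \<sigma>) \<in> rep_equiv N" using s rep_equiv_iff[OF N] by blast
 qed
 show "trans (rep_equiv N)"
 proof (rule transI)
  fix \<sigma> \<tau> \<upsilon> assume "(\<sigma>, \<tau>) \<in> rep_equiv N" "(\<tau>, \<upsilon>) \<in> rep_equiv N"
  then obtain T U where s: "\<sigma> \<in> unitary_irreps N" "\<tau> \<in> unitary_irreps N" "\<upsilon> \<in> unitary_irreps N"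
   and T: "eqv N \<sigma> \<tau> T" and U: "eqv N \<tau> \<upsilon> U" using rep_equiv_iff[OF N] by blast
  have U': "U \<noteq> 0" "U * rid \<tau> = U" "rid \<upsilon> * U = U" "\<And>g. g \<in> SU N ==> U * rfm N \<tau> g = rfm N \<upsilon> g * U"
   using U by (auto simp: eqv_def)
  have T': "T \<noteq> 0" "T * rid \<sigma> = T" "rid \<tau> * T = T" "\<And>g. g \<in> SU N ==> T * rfm N \<sigma> g = rfm N \<tau> g * T"
   using T by (auto simp: eqv_def)
  obtain c where c: "c > 0" "adj U * U = of_real c *c rid \<tau>"
   using intertwiner_iso[OF irrep_irr[OF s(2) N] irrep_irr[OF s(3) N] U'] by metis
  have "adj U * (U * T) = of_real c *c T" using mac[OF c(2), of T] T'(3) by simp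
  then have "U * T \<noteq> 0" using c(1) T'(1) by auto
  moreover have "U * T * rfm N \<sigma> g = rfm N \<upsilon> g * (U * T)" if "g \<in> SU N" for g
   using T'(4)[OF that] U'(4)[OF that] by (metis mult.assoc)
  ultimately have "eqv N \<sigma> \<upsilon> (U * T)" using T'(2) U'(3) by (simp add: eqv_def mult.assoc mac[OF U'(3)])
  then show "(\<sigma>, \<upsilon>) \<in> rep_equiv N" using s rep_equiv_iff[OF N] by blast
 qed
qed

abbreviation hwt :: "nat => mat_rep => fmat => (nat => real) => bool" where
 "hwt N \<sigma> \<equiv> urep.hwv N (rid \<sigma>) (rfm N \<sigma>)"

lemma rep_of_in: assumes N: "N > 0" and p: "\<pi> \<in> unitary_dual N" shows "rep_of \<pi> \<in> \<pi>" "rep_of \<pi> \<in> unitary_irreps N"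
proof -
 obtain \<sigma> where s: "\<pi> = rep_equiv N `` {\<sigma>}" "\<sigma> \<in> unitary_irreps N"
  using p by (auto simp: unitary_dual_def quotient_def)
 have "\<sigma> \<in> \<pi>" using s equiv_class_self[OF equiv_rep[OF N]] by simp
 then show 1: "rep_of \<pi> \<in> \<pi>" unfolding rep_of_def by (rule someI)
 then show "rep_of \<pi> \<in> unitary_irreps N" using s by (auto simp: rep_equiv_def)
qed

lemma hwt_equiv:
 assumes N: "N > 0" and s: "\<sigma> \<in> unitary_irreps N" "\<tau> \<in> unitary_irreps N" and v: "hwt N \<sigma> v w" "hwt N \<tau> v' w"
 shows "(\<sigma>, \<tau>) \<in> rep_equiv N"
proof -
 obtain T where "T \<noteq> 0" "T * rid \<sigma> = T" "rid \<tau> * T = T" "\<And>g. g \<in> SU N ==> T * rfm N \<sigma> g = rfm N \<tau> g * T"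
  using hw_unique[OF irrep_irr[OF s(1) N] irrep_irr[OF s(2) N] v] by metis
 then have "eqv N \<sigma> \<tau> T" by (simp add: eqv_def)
 then show ?thesis using s rep_equiv_iff[OF N] by blast
qed

lemma dual_eqI:
 assumes N: "N > 0" and p: "\<pi> \<in> unitary_dual N" "\<pi>' \<in> unitary_dual N"
  and v: "hwt N (rep_of \<pi>) v w" "hwt N (rep_of \<pi>') v' w"
 shows "\<pi> = \<pi>'"
 using quotient_eqI[OF equiv_rep[OF N]] p rep_of_in[OF N p(1)] rep_of_in[OF N p(2)] hwt_equiv[OF N _ _ v]
 unfolding unitary_dual_def by blast

text \<open>The abstract representation is written in coordinates and then replaced by the chosen
  representative of its class; the intertwiners carry the highest weight vector along.\<close>

lemma dual_ex:
 assumes N: "N > 0" and I: "irr N e r" and v: "urep.hwv N e r v w"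
 obtains \<pi> v' where "\<pi> \<in> unitary_dual N" "hwt N (rep_of \<pi>) v' w"
proof -
 interpret irr N e r by (rule I)
 obtain m S where S: "isom m S" "S * adj S = e" using proj_isom[OF pe] .
 define \<sigma> where "\<sigma> = mrep m S r"
 have s: "\<sigma> \<in> unitary_irreps N" unfolding \<sigma>_def by (rule mrep_irrep[OF I S])
 have aS: "adj S * S = un {..<m}" using S(1) by (simp add: isom_def)
 have u: "un {..<m} * adj S = adj S" by (rule isom_un(2)[OF S(1)])
 have rs: "rid \<sigma> = un {..<m}" by (simp add: \<sigma>_def mrep_def)
 have "adj S * r g = rfm N \<sigma> g * adj S" if "g \<in> SU N" for g
  using mrep_rfm[OF S(1) that, of r] er(2)[OF that] by (simp add: \<sigma>_def mult.assoc S(2))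
 moreover have "adj S * e = adj S" unfolding S(2)[symmetric] by (simp add: assoc' aS u)
 moreover have "adj S \<noteq> 0" using S(2) e_nz by auto
 ultimately have hs: "hwt N \<sigma> (adj S * v) w"
  by (intro hwv_transport[OF I irrep_irr[OF s N] _ _ _ _ v]) (simp_all add: rs u)
 define \<pi> where "\<pi> = rep_equiv N `` {\<sigma>}"
 have p: "\<pi> \<in> unitary_dual N" using s by (auto simp: \<pi>_def unitary_dual_def quotient_def)
 have "(\<sigma>, rep_of \<pi>) \<in> rep_equiv N" using rep_of_in(1)[OF N p] by (simp add: \<pi>_def)
 then obtain T where T: "eqv N \<sigma> (rep_of \<pi>) T" using rep_equiv_iff[OF N] by blast
 have "hwt N (rep_of \<pi>) (T * (adj S * v)) w"
  by (rule hwv_transport[OF irrep_irr[OF s N] irrep_irr[OF rep_of_in(2)[OF N p] N] _ _ _ _ hs])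
   (use T in \<open>auto simp: eqv_def\<close>)
 then show ?thesis using that p by blast
qed

text \<open>The sum in \<open>mult_spec\<close> is meaningful only over a finite set. By dominance
  all terms of \<open>casc\<close> are non-negative, so the integers \<open>w i - w (N - 1)\<close>
  are bounded by the eigenvalue. As the coordinates sum to 0, these integers determine the weight,
  and the weight determines the class.\<close>

lemma finite_casimir:
 assumes N: "N > 0"
 shows "finite {\<pi>. \<pi> \<in> unitary_dual N \<and> casimir_eigenvalue N (rep_of \<pi>) = \<mu>}" (is "finite ?P")
proof -
 define M where "M = nat \<lfloor>\<mu>\<rfloor>"
 define F where "F = {k :: nat => nat. \<forall>i. (i \<in> {..<N} --> k i \<in> {..M}) \<and> (i \<notin> {..<N} --> k i = 0)}"
 have fF: "finite F" unfolding F_def by (rule finite_set_of_finite_funs) auto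
 have "\<exists>k\<in>F. \<exists>v. hwt N (rep_of \<pi>) v (\<lambda>i. real (k i) - (\<Sum>l<N. real (k l)) / real N)" if p: "\<pi> \<in> ?P" for \<pi>
 proof -
  let ?s = "rep_of \<pi>"
  have s: "?s \<in> unitary_irreps N" using rep_of_in(2)[OF N] p by blast
  interpret irr N "rid ?s" "rfm N ?s" by (rule irrep_irr[OF s N])
  obtain v w where v: "hwt N ?s v w" using hw_exists[OF e_nz] by blast
  have mu: "casc N w = \<mu>" using casimir_casc[OF s N v] p by simp
  define m where "m = N - 1"
  have m: "m < N" using N by (simp add: m_def)
  have ge: "w m \<le> w i" if "i < N" for i
   using hwv_dom[OF v, of i m] that m by (cases "i = m") (auto simp: m_def)
  have le: "w i - w m \<le> \<mu>" if i: "i < N" for i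
  proof -
   let ?f = "\<lambda>i j. if i = j then (w i)\<^sup>2 else if i < j then w i - w j else 0"
   have nn: "?f i j \<ge> 0" if "j < N" for i j using hwv_dom[OF v, of i j] that by auto
   have "w i - w m \<le> ?f i m" using i by (auto simp: m_def)
   also have "\<dots> \<le> (\<Sum>j<N. ?f i j)" by (rule member_le_sum) (use m nn in auto)
   also have "\<dots> \<le> (\<Sum>i<N. \<Sum>j<N. ?f i j)"
    by (rule member_le_sum[of i "{..<N}" "\<lambda>i. \<Sum>j<N. ?f i j"]) (use i nn in \<open>auto intro!: sum_nonneg\<close>)
   finally show ?thesis using mu by (simp add: casc_def)
  qed
  define k where "k i = (if i < N then nat \<lfloor>w i - w m\<rfloor> else 0)" for i
  have k: "w i - w m = real (k i)" if i: "i < N" for i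
   using hwv_int[OF v i m] ge[OF i] i by (auto simp: k_def elim!: Ints_cases)
  have "k \<in> F" unfolding F_def using le by (auto simp: k_def M_def intro!: nat_mono floor_mono)
  moreover have "hwt N ?s v (\<lambda>i. real (k i) - (\<Sum>l<N. real (k l)) / real N)"
  proof (rule hwv_cong[OF _ v])
   fix i assume i: "i < N"
   have "(\<Sum>l<N. real (k l)) = (\<Sum>l<N. w l - w m)" using k by simp
   also have "\<dots> = - real N * w m" using hwv_sum[OF v] by (simp add: sum_subtractf)
   finally show "w i = real (k i) - (\<Sum>l<N. real (k l)) / real N" using k[OF i] N by simp
  qed
  ultimately show ?thesis by blast
 qed
 then have "\<forall>\<pi>\<in>?P. \<exists>k. k \<in> F \<and> (\<exists>v. hwt N (rep_of \<pi>) v (\<lambda>i. real (k i) - (\<Sum>l<N. real (k l)) / real N))"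
  by blast
 from bchoice[OF this] obtain f where f: "\<And>\<pi>. \<pi> \<in> ?P ==>
   f \<pi> \<in> F \<and> (\<exists>v. hwt N (rep_of \<pi>) v (\<lambda>i. real (f \<pi> i) - (\<Sum>l<N. real (f \<pi> l)) / real N))"
  by blast
 have "inj_on f ?P"
 proof (rule inj_onI)
  fix \<pi> \<pi>' assume p: "\<pi> \<in> ?P" "\<pi>' \<in> ?P" "f \<pi> = f \<pi>'"
  obtain v where v: "hwt N (rep_of \<pi>) v (\<lambda>i. real (f \<pi> i) - (\<Sum>l<N. real (f \<pi> l)) / real N)" using f[OF p(1)] by blast
  obtain v' where v': "hwt N (rep_of \<pi>') v' (\<lambda>i. real (f \<pi> i) - (\<Sum>l<N. real (f \<pi> l)) / real N)"
   using f[OF p(2)] p(3) by auto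
  show "\<pi> = \<pi>'" by (rule dual_eqI[OF N _ _ v v']) (use p in auto)
 qed
 then show ?thesis by (rule inj_on_finite[OF _ _ fF]) (use f in blast)
qed

text \<open>Independent sets in the subspace are independent in the whole space and so have bounded
  size; a maximal one generates.\<close>

lemma subspace_fin_dim:
 assumes V: "vectorspace K V" "vectorspace.fin_dim K V" and W: "VectorSpace.subspace K W V"
 shows "vectorspace K (V\<lparr>carrier := W\<rparr>)" "vectorspace.fin_dim K (V\<lparr>carrier := W\<rparr>)"
proof -
 interpret V: vectorspace K V by (rule V)
 show vW: "vectorspace K (V\<lparr>carrier := W\<rparr>)" by (rule V.subspace_is_vs[OF W])
 interpret W: vectorspace K "V\<lparr>carrier := W\<rparr>" by (rule vW)
 have sm: "submodule K W V" using W by (simp add: VectorSpace.subspace_def)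
 have WV: "W \<subseteq> carrier V" by (rule submodule.subset[OF sm])
 have "finite S \<and> card S \<le> V.dim" if "S \<subseteq> carrier (V\<lparr>carrier := W\<rparr>) \<and> W.lin_indpt S" for S
 proof -
  have S: "S \<subseteq> W" "\<not> W.lin_dep S" using that by auto
  have "V.lin_indpt S" using V.span_li_not_depend(2)[OF S(1) sm] S(2) by simp
  then show ?thesis using V.li_le_dim[OF V(2), of S] S(1) WV by blast
 qed
 moreover have "W.lin_indpt {}" by (simp add: W.lin_dep_def)
 ultimately obtain A where A: "finite A" "maximal A (\<lambda>S. S \<subseteq> carrier (V\<lparr>carrier := W\<rparr>) \<and> W.lin_indpt S)"
  using maximal_exists[of "\<lambda>S. S \<subseteq> carrier (V\<lparr>carrier := W\<rparr>) \<and> W.lin_indpt S" V.dim "{}"] by auto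
 then show "W.fin_dim" using W.max_li_is_gen[OF A(2)] unfolding W.fin_dim_def maximal_def by blast
qed

lemma dim_Hom_K_0_iff:
 assumes c: "\<And>k. k \<in> K ==> snd \<tau> k \<in> carrier_mat (fst \<tau>) (fst \<tau>)" "\<And>k. k \<in> K ==> snd \<rho> k \<in> carrier_mat (fst \<rho>) (fst \<rho>)"
 shows "dim_Hom_K K \<tau> \<rho> = 0 \<longleftrightarrow> hom_K K \<tau> \<rho> = {0\<^sub>m (fst \<rho>) (fst \<tau>)}"
proof -
 let ?r = "fst \<rho>" and ?c = "fst \<tau>" and ?W = "hom_K K \<tau> \<rho>"
 let ?V = "module_mat TYPE(complex) (fst \<rho>) (fst \<tau>)"
 interpret V: vectorspace class_ring ?V by (rule matrix_vs)
 \<comment> \<open>Unpacks a vector row by row into a matrix, which shows that the space of all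
   matrices is finite dimensional.\<close>
 define T where "T v = mat ?r ?c (\<lambda>(i, j). v $ (i * ?c + j))" for v :: "complex vec"
 have idx: "i * ?c + j < ?r * ?c" if "i < ?r" "j < ?c" for i j
 proof -
  have "i * ?c + j < i * ?c + ?c" using that by simp
  also have "\<dots> = Suc i * ?c" by simp
  also have "\<dots> \<le> ?r * ?c" using that by (intro mult_le_mono1) simp
  finally show ?thesis .
 qed
 have fd: "vectorspace.fin_dim class_ring ?V"
 proof (rule linear_vec(1)[OF V.vectorspace_axioms, of "?r * ?c" T])
  show "carrier ?V \<subseteq> T ` carrier_vec (?r * ?c)"
  proof
   fix A assume "A \<in> carrier ?V"
   then have A: "A \<in> carrier_mat ?r ?c" by (simp add: module_mat_simps)
   have "A = T (vec (?r * ?c) (\<lambda>k. A $$ (k div ?c, k mod ?c)))"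
   proof (rule eq_matI)
    fix i j assume ij: "i < dim_row (T (vec (?r * ?c) (\<lambda>k. A $$ (k div ?c, k mod ?c))))"
     "j < dim_col (T (vec (?r * ?c) (\<lambda>k. A $$ (k div ?c, k mod ?c))))"
    then have "(i * ?c + j) div ?c = i" "(i * ?c + j) mod ?c = j" by (simp_all add: T_def)
    then show "A $$ (i, j) = T (vec (?r * ?c) (\<lambda>k. A $$ (k div ?c, k mod ?c))) $$ (i, j)"
     using ij idx[of i j] by (simp add: T_def)
   qed (use A in \<open>simp_all add: T_def\<close>)
   then show "A \<in> T ` carrier_vec (?r * ?c)" by (rule image_eqI) simp
  qed
 qed (auto simp: T_def module_mat_simps idx intro!: eq_matI)
 have "submodule class_ring ?W ?V"
 proof (rule submodule.intro)
  show "module class_ring ?V" by (rule V.module_axioms)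
  show "?W \<subseteq> carrier ?V" by (auto simp: hom_K_def module_mat_simps)
  show "\<zero>\<^bsub>?V\<^esub> \<in> ?W"
   by (simp add: hom_K_def module_mat_simps left_mult_zero_mat[OF c(1)] right_mult_zero_mat[OF c(2)])
  show "v \<oplus>\<^bsub>?V\<^esub> w \<in> ?W" if "v \<in> ?W" "w \<in> ?W" for v w
  proof -
   have vw: "v \<in> carrier_mat ?r ?c" "w \<in> carrier_mat ?r ?c" using that by (auto simp: hom_K_def)
   have "(v + w) * snd \<tau> k = snd \<rho> k * (v + w)" if k: "k \<in> K" for k
    unfolding add_mult_distrib_mat[OF vw c(1)[OF k]] mult_add_distrib_mat[OF c(2)[OF k] vw]
    using \<open>v \<in> ?W\<close> \<open>w \<in> ?W\<close> k by (simp add: hom_K_def)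
   then show ?thesis using vw by (simp add: hom_K_def module_mat_simps)
  qed
  show "a \<odot>\<^bsub>?V\<^esub> v \<in> ?W" if "v \<in> ?W" for a v
  proof -
   have v: "v \<in> carrier_mat ?r ?c" using that by (simp add: hom_K_def)
   have "(a \<cdot>\<^sub>m v) * snd \<tau> k = snd \<rho> k * (a \<cdot>\<^sub>m v)" if k: "k \<in> K" for k
    unfolding mult_smult_assoc_mat[OF v c(1)[OF k]] mult_smult_distrib[OF c(2)[OF k] v]
    using \<open>v \<in> ?W\<close> k by (simp add: hom_K_def)
   then show ?thesis using v by (simp add: hom_K_def module_mat_simps)
  qed
 qed
 then have sub: "VectorSpace.subspace class_ring ?W ?V" using V.vectorspace_axioms by (simp add: VectorSpace.subspace_def)
 interpret W: vectorspace class_ring "?V\<lparr>carrier := ?W\<rparr>" by (rule subspace_fin_dim(1)[OF V.vectorspace_axioms fd sub])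
 have fW: "W.fin_dim" by (rule subspace_fin_dim(2)[OF V.vectorspace_axioms fd sub])
 have z: "\<zero>\<^bsub>?V\<lparr>carrier := ?W\<rparr>\<^esub> = 0\<^sub>m ?r ?c" by (simp add: module_mat_simps)
 show ?thesis unfolding dim_Hom_K_def
 proof
  assume d: "W.dim = 0"
  obtain A where A: "finite A" "W.basis A" using W.finite_basis_exists[OF fW] by blast
  have "A = {}" using W.dim_basis[OF A] d A(1) by simp
  then have "W.span {} = ?W" using A(2) by (simp add: W.basis_def)
  then show "?W = {0\<^sub>m ?r ?c}" using W.span_empty z by simp
 next
  assume 0: "?W = {0\<^sub>m ?r ?c}"
  have "W.gen_set {}" using W.span_empty z 0 by simp
  then show "W.dim = 0" using W.gen_ge_dim[of "{}"] by simp
 qed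
qed

section \<open>Spherical representations\<close>

lemma K_fm: assumes "k \<in> S_U_U1 n" shows "fm k \<in> KK n" "k \<in> carrier (SU_group (Suc n))" "k \<in> carrier_mat (Suc n) (Suc n)"
proof -
 have k: "k \<in> carrier (SU_group (n + 1))" "\<And>i. i < n ==> k $$ (i, n) = 0 \<and> k $$ (n, i) = 0"
  using assms S_U_U1_iff by blast+
 show "k \<in> carrier (SU_group (Suc n))" using k(1) by simp
 then show c: "k \<in> carrier_mat (Suc n) (Suc n)" and "fm k \<in> KK n"
  using SU_fm[of k "Suc n"] k(2) by (auto simp: KK_def ent_fm)
qed

lemma K_mt: assumes "g \<in> KK n" shows "mt (Suc n) (Suc n) g \<in> S_U_U1 n"
 using assms SU_mt[of g "Suc n"] unfolding S_U_U1_iff by (simp add: KK_def)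

lemma KK_D:
 assumes "g \<in> KK n"
 shows "g \<in> SU (Suc n)" "inn (Suc n) g" "i < n ==> ent g i n = 0" "i < n ==> ent g n i = 0"
  "ent g n n * cnj (ent g n n) = 1"
proof -
 show g: "g \<in> SU (Suc n)" and z: "i < n ==> ent g i n = 0" "i < n ==> ent g n i = 0" for i
  using assms by (auto simp: KK_def)
 show i: "inn (Suc n) g" by (rule UU_D(1)[OF SU_UU[OF g]])
 have "1 = ent (g * adj g) n n" using UU_D(3)[OF SU_UU[OF g]] by (simp add: ent_un)
 also have "\<dots> = ent g n n * cnj (ent g n n)" using i z(2) by (subst ent_times_n[of "Suc n"]) auto
 finally show "ent g n n * cnj (ent g n n) = 1" by simp
qed

lemma KK_eu: "g \<in> KK n ==> eu a n * g = ent g n n *c eu a n" "g \<in> KK n ==> g * eu n a = ent g n n *c eu n a"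
proof -
 assume g: "g \<in> KK n"
 have z: "ent g n j = (if j = n then ent g n n else 0)" "ent g j n = (if j = n then ent g n n else 0)" for j
  using KK_D(2-4)[OF g] by (auto simp: inn_def not_less_eq_eq[symmetric] linorder_neq_iff Suc_le_eq)
 show "eu a n * g = ent g n n *c eu a n" by (rule fmat_eqI) (subst ent_eu_times, subst z(1), simp)
 show "g * eu n a = ent g n n *c eu n a" by (rule fmat_eqI) (subst ent_times_eu, subst z(2), simp)
qed

section \<open>The isotropy representation in coordinates\<close>

lemma filter_subseqs_0: "filter (\<lambda>I. length I = 0) (subseqs xs) = [[]]"
 by (induction xs) (auto simp: Let_def filter_map o_def)
lemma filter_subseqs_1: "filter (\<lambda>I. length I = 1) (subseqs xs) = map (\<lambda>x. [x]) xs"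
proof (induction xs)
 case (Cons x xs)
 then show ?case using filter_subseqs_0[of xs] by (simp add: Let_def filter_map o_def)
qed simp

lemma ext_index_0: "ext_index 0 m = [[]]" unfolding ext_index_def by (rule filter_subseqs_0)
lemma ext_index_1: "ext_index 1 m = map (\<lambda>x. [x]) [0..<m]" unfolding ext_index_def by (rule filter_subseqs_1)

lemma tau_0: "fst (tau n 0) = 1" "snd (tau n 0) k = 1\<^sub>m 1"
 by (auto simp: tau_def ext_index_0 ext_power_def intro!: eq_matI)

lemma tau_1: "fst (tau n 1) = 2 * n" "snd (tau n 1) k \<in> carrier_mat (2 * n) (2 * n)"
 using ext_index_1[of "2 * n"] by (simp_all add: tau_def ext_power_def)

lemma p_index_nth: "a < n ==> p_index n ! a = (a, n)" "a < n ==> p_index n ! (n + a) = (n, a)"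
 by (simp_all add: p_index_def nth_append)

text \<open>The contragredient transposes and evaluates \<open>Ad_p\<close> at the inverse, so the
  entry is that of \<open>adj k * eu s t * k\<close> at \<open>(x, y)\<close>.\<close>

lemma tau_1_index:
 assumes k: "k \<in> S_U_U1 n" and ab: "a < 2 * n" "b < 2 * n" and p: "p_index n ! a = (s, t)" "p_index n ! b = (x, y)"
 shows "snd (tau n 1) k $$ (a, b) = cnj (k $$ (s, x)) * k $$ (t, y)"
proof -
 have "(s, t) \<in> set (p_index n)" "(x, y) \<in> set (p_index n)"
  using nth_mem[of a "p_index n"] nth_mem[of b "p_index n"] ab p by (simp_all add: length_p_index)
 then have st: "s < Suc n" "t < Suc n" "x < Suc n" "y < Suc n" by (auto simp: set_p_index)
 note kc = K_fm(2,3)[OF k]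
 interpret G: group "SU_group (n + 1)" by (rule group_SU)
 let ?i = "inv\<^bsub>SU_group (n + 1)\<^esub> k"
 have i: "?i = mat_adjoint k" "inv\<^bsub>SU_group (n + 1)\<^esub> ?i = k"
  using SU_inv[of k "n + 1"] G.inv_inv[of k] kc(1) by simp_all
 note ac = mat_adjoint_carrier[OF kc(2)]
 have uc: "mat_unit (n + 1) (s, t) \<in> carrier_mat (Suc n) (Suc n)" by (simp add: mat_unit_def)
 have ue: "fm (mat_unit (n + 1) (s, t)) = eu s t" by (rule fmat_eqI) (use st in \<open>auto simp: ent_fm mat_unit_def\<close>)
 have "snd (tau n 1) k $$ (a, b) = Ad_p n ?i $$ (b, a)"
  using ext_index_1[of "2 * n"] ab by (simp add: tau_def ext_power_def det_single Ad_p_def)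
 also have "\<dots> = (mat_adjoint k * mat_unit (n + 1) (s, t) * k) $$ (x, y)"
  using ab p by (simp add: Ad_p_def i[simplified] i(2)[unfolded i(1), simplified])
 also have "\<dots> = ent (fm (mat_adjoint k * mat_unit (n + 1) (s, t) * k)) x y"
  using st kc(2) carrier_matD[OF ac] by (simp add: ent_fm)
 also have "\<dots> = ent (adj (fm k) * eu s t * fm k) x y"
  unfolding fm_mult[OF mult_carrier_mat[OF ac uc] kc(2)] fm_mult[OF ac uc] ue fm_adj[OF kc(2)] ..
 also have "\<dots> = cnj (ent (fm k) s x) * ent (fm k) t y"
  by (subst ent_times_S[of "{t}"]) (auto simp: ent_times_eu split: if_splits)
 finally show ?thesis using st kc(2) by (simp add: ent_fm)
qed

text \<open>The mixed blocks vanish, and the two diagonal blocks are complex conjugates of each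
  other. The second one is the standard representation twisted by the inverse of its last character,
  as in \<open>kequiv\<close>.\<close>

lemma tau_1_ent:
 assumes g: "g \<in> KK n"
 shows "ent (fm (snd (tau n 1) (mt (Suc n) (Suc n) g))) a b =
  (if a < n \<and> b < n then ent g n n * cnj (ent g a b)
  else if n \<le> a \<and> a < 2 * n \<and> n \<le> b \<and> b < 2 * n then cnj (ent g n n) * ent g (a - n) (b - n) else 0)"
  (is "ent (fm ?t) a b = _")
proof (cases "a < 2 * n \<and> b < 2 * n")
 case False
 then show ?thesis using carrier_matD[OF tau_1(2)[of n "mt (Suc n) (Suc n) g"]] by (auto simp: ent_fm)
next
 case True
 note k = K_mt[OF g] and gD = KK_D(3,4)[OF g]
 have e: "ent (fm ?t) a b = ?t $$ (a, b)" using True carrier_matD[OF tau_1(2)[of n "mt (Suc n) (Suc n) g"]] by (simp add: ent_fm)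
 have T: "?t $$ (a, b) = cnj (ent g s x) * ent g t y" if "p_index n ! a = (s, t)" "p_index n ! b = (x, y)"
  "s \<le> n" "x \<le> n" "t \<le> n" "y \<le> n" for s t x y
  using tau_1_index[OF k _ _ that(1,2)] True that by simp
 consider "a < n" "b < n" | i where "a = n + i" "i < n" "b < n" | j where "a < n" "b = n + j" "j < n"
  | i j where "a = n + i" "i < n" "b = n + j" "j < n"
  using True by (metis add_less_cancel_left le_Suc_ex mult_2 not_less)
 then show ?thesis
 proof cases
  case 1 then show ?thesis using T[of a n b n] e by (simp add: p_index_nth)
 next
  case 2 then show ?thesis using T[of n i b n] e gD by (simp add: p_index_nth)
 next
  case 3 then show ?thesis using T[of a n n j] e gD by (simp add: p_index_nth)
 next
  case 4 then show ?thesis using T[of n i n j] e by (simp add: p_index_nth)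
 qed
qed

lemma hom_K_ne:
 assumes s: "\<sigma> \<in> unitary_irreps (Suc n)" and t: "\<And>k. k \<in> S_U_U1 n ==> snd \<tau> k \<in> carrier_mat (fst \<tau>) (fst \<tau>)"
 shows "hom_K (S_U_U1 n) \<tau> \<sigma> \<noteq> {0\<^sub>m (fst \<sigma>) (fst \<tau>)} \<longleftrightarrow> (\<exists>F. F \<noteq> 0 \<and> rid \<sigma> * F = F \<and> F * rid \<tau> = F \<and>
  (\<forall>g\<in>KK n. F * fm (snd \<tau> (mt (Suc n) (Suc n) g)) = rfm (Suc n) \<sigma> g * F))"
proof
 have sc: "snd \<sigma> k \<in> carrier_mat (fst \<sigma>) (fst \<sigma>)" if "k \<in> S_U_U1 n" for k using irrepD(1)[OF s K_fm(2)[OF that]] .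
 {
  assume ne: "hom_K (S_U_U1 n) \<tau> \<sigma> \<noteq> {0\<^sub>m (fst \<sigma>) (fst \<tau>)}"
  have "0\<^sub>m (fst \<sigma>) (fst \<tau>) \<in> hom_K (S_U_U1 n) \<tau> \<sigma>"
   by (simp add: hom_K_def left_mult_zero_mat[OF t] right_mult_zero_mat[OF sc])
  with ne obtain T where T: "T \<in> hom_K (S_U_U1 n) \<tau> \<sigma>" "T \<noteq> 0\<^sub>m (fst \<sigma>) (fst \<tau>)" by blast
  have c: "T \<in> carrier_mat (fst \<sigma>) (fst \<tau>)" using T(1) by (simp add: hom_K_def)
  have "fm T \<noteq> 0" using T(2) c by (metis fm_inj fm_zero zero_carrier_mat)
  moreover have "fm T * fm (snd \<tau> (mt (Suc n) (Suc n) g)) = rfm (Suc n) \<sigma> g * fm T" if g: "g \<in> KK n" for g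
  proof -
   note k = K_mt[OF g]
   have "T * snd \<tau> (mt (Suc n) (Suc n) g) = snd \<sigma> (mt (Suc n) (Suc n) g) * T" using T(1) k by (simp add: hom_K_def)
   then show ?thesis using fm_mult[OF c t[OF k]] fm_mult[OF sc[OF k] c] by (simp add: rfm_def)
  qed
  ultimately show "\<exists>F. F \<noteq> 0 \<and> rid \<sigma> * F = F \<and> F * rid \<tau> = F \<and>
   (\<forall>g\<in>KK n. F * fm (snd \<tau> (mt (Suc n) (Suc n) g)) = rfm (Suc n) \<sigma> g * F)" using fm_un[OF c] by blast
 }
 assume "\<exists>F. F \<noteq> 0 \<and> rid \<sigma> * F = F \<and> F * rid \<tau> = F \<and>
   (\<forall>g\<in>KK n. F * fm (snd \<tau> (mt (Suc n) (Suc n) g)) = rfm (Suc n) \<sigma> g * F)"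
 then obtain F where F: "F \<noteq> 0" "rid \<sigma> * F = F" "F * rid \<tau> = F"
  "\<And>g. g \<in> KK n ==> F * fm (snd \<tau> (mt (Suc n) (Suc n) g)) = rfm (Suc n) \<sigma> g * F" by blast
 let ?T = "mt (fst \<sigma>) (fst \<tau>) F"
 have c: "?T \<in> carrier_mat (fst \<sigma>) (fst \<tau>)" by simp
 have fT: "fm ?T = F" by (simp add: fm_mt F)
 have "?T * snd \<tau> k = snd \<sigma> k * ?T" if k: "k \<in> S_U_U1 n" for k
 proof -
  have m: "mt (Suc n) (Suc n) (fm k) = k" by (rule mt_fm[OF K_fm(3)[OF k]])
  have "fm (?T * snd \<tau> k) = fm (snd \<sigma> k * ?T)"
   unfolding fm_mult[OF c t[OF k]] fm_mult[OF sc[OF k] c] fT using F(4)[OF K_fm(1)[OF k]] by (simp add: m rfm_def)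
  then show ?thesis using fm_inj[OF mult_carrier_mat[OF c t[OF k]] mult_carrier_mat[OF sc[OF k] c]] by blast
 qed
 then have "?T \<in> hom_K (S_U_U1 n) \<tau> \<sigma>" by (simp add: hom_K_def)
 moreover have "?T \<noteq> 0\<^sub>m (fst \<sigma>) (fst \<tau>)" using F(1) fT by (metis fm_zero)
 ultimately show "hom_K (S_U_U1 n) \<tau> \<sigma> \<noteq> {0\<^sub>m (fst \<sigma>) (fst \<tau>)}" by blast
qed

lemma (in kirr) kequiv_hw:
 assumes "kequiv n e r \<Xi>" "\<Xi> \<noteq> 0"
 shows "\<exists>v j. hwv v (wA n j) \<or> 1 \<le> j \<and> hwv v (wB n j)"
proof -
 obtain v w where v: "hwv v w" by (rule hw_exists[OF e_nz])
 show ?thesis using kequiv_type[OF assms v] typeA_wA[OF v] typeB_wB[OF v] by metis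
qed

lemma (in kirr) lastcol_hw:
 assumes "kequiv n e r \<Xi>" "\<Xi> \<noteq> 0" "\<Xi> * eu n n = \<Xi>"
 shows "\<exists>v j. hwv v (wA n j)"
proof -
 obtain v w where v: "hwv v w" by (rule hw_exists[OF e_nz])
 show ?thesis using lastcol_typeA[OF assms v] typeA_wA[OF v] by metis
qed

text \<open>The map \<open>X0\<close> of a model is projected to the summand with the given weight
  and carried over by the isomorphism from \<open>hw_unique\<close>.\<close>

lemma dec_transport:
 assumes n: "n \<ge> 2" and I: "irr (Suc n) e r" and v: "urep.hwv (Suc n) e r v w"
  and D: "dec n b k PS" and Q: "Q \<in> PS" "ov n b k Q v' w"
 shows "\<exists>T. T * X0 n (pat b k) \<noteq> 0 \<and> kequiv n e r (T * X0 n (pat b k))"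
proof -
 interpret D: dec n b k PS by (rule D)
 have Qv: "urep.hwv (Suc n) Q (\<lambda>g. Q * rho (pat b k) g) v' w" using Q(2) by (simp add: ov_def)
 obtain T where T: "T \<noteq> 0" "T * Q = T" "e * T = T" "\<And>g. g \<in> SU (Suc n) ==> T * (Q * rho (pat b k) g) = r g * T"
  using hw_unique[OF D.dirr[OF Q(1)] I Qv v] by metis
 obtain c where c: "c > 0" "adj T * T = of_real c *c Q" using intertwiner_iso[OF D.dirr[OF Q(1)] I T] by metis
 have "adj T * (T * X0 n (pat b k)) = of_real c *c (Q * X0 n (pat b k))" by (simp add: mac[OF c(2)])
 then have "T * X0 n (pat b k) \<noteq> 0" using c(1) D.QX(2)[OF Q(1)] by auto
 moreover have "T * rho (pat b k) g = r g * T" if "g \<in> SU (Suc n)" for g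
  using T(4)[OF that] by (simp add: assoc' T(2))
 then have "kequiv n e r (T * X0 n (pat b k))" by (rule D.kequiv_mult[OF T(3)])
 ultimately show ?thesis by blast
qed

lemma sph_A0:
 assumes n: "n \<ge> 2" and I: "irr (Suc n) e r" and v: "urep.hwv (Suc n) e r v (wA n j)"
 obtains \<Xi> where "kequiv n e r \<Xi>" "\<Xi> \<noteq> 0" "\<Xi> * eu n n = \<Xi>"
proof -
 obtain PS where "isdec n bQ j PS" using dec_ex by blast
 then have D: "dec n bQ j PS" using n by (simp add: dec_def good_def)
 obtain Q v' where Q: "Q \<in> PS" "ov n bQ j Q v' (wA n j)" using dexists_A[OF D] by blast
 obtain T where "T * X0 n (pat bQ j) \<noteq> 0" "kequiv n e r (T * X0 n (pat bQ j))"
  using dec_transport[OF n I v D Q] by blast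
 then show ?thesis using that dec.bQ_lastcol[OF D refl, of T] by blast
qed

text \<open>The last column of an equivariant map is equivariant by itself and would force type A if
  it were non-zero.\<close>

lemma sph_B:
 assumes n: "n \<ge> 2" and I: "irr (Suc n) e r" and v: "urep.hwv (Suc n) e r v (wB n j)" and j: "1 \<le> j"
 obtains \<Xi> where "kequiv n e r \<Xi>" "\<Xi> \<noteq> 0" "\<Xi> * eu n n = 0"
proof -
 interpret kirr n e r using I n by (simp add: kirr_def kirr_axioms_def)
 obtain PS where "isdec n bR j PS" using dec_ex by blast
 then have D: "dec n bR j PS" using n by (simp add: dec_def good_def)
 obtain Q v' where Q: "Q \<in> PS" "ov n bR j Q v' (wB n j)" using dexists_B[OF D j] by blast
 obtain T where T: "T * X0 n (pat bR j) \<noteq> 0" "kequiv n e r (T * X0 n (pat bR j))"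
  using dec_transport[OF n I v D Q] by blast
 define \<Xi> where "\<Xi> = T * X0 n (pat bR j)"
 have K: "kequiv n e r (\<Xi> * eu n n)" unfolding kequiv_def
 proof (intro conjI ballI)
  show "e * (\<Xi> * eu n n) = \<Xi> * eu n n" using T(2) by (simp add: \<Xi>_def kequiv_def assoc')
  show "\<Xi> * eu n n * un {..<Suc n} = \<Xi> * eu n n" by (simp add: mult.assoc eu_un')
  fix k assume k: "k \<in> KK n"
  have "r k * (\<Xi> * eu n n) = cnj (ent k n n) *c (\<Xi> * k) * eu n n"
   using T(2) k by (simp add: \<Xi>_def kequiv_def assoc')
  also have "\<dots> = cnj (ent k n n) *c (\<Xi> * eu n n * k)" by (simp add: mult.assoc KK_eu[OF k])
  finally show "r k * (\<Xi> * eu n n) = cnj (ent k n n) *c (\<Xi> * eu n n * k)" .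
 qed
 have "\<Xi> * eu n n = 0"
 proof (rule ccontr)
  assume "\<Xi> * eu n n \<noteq> 0"
  then have "typeA (wB n j)" by (rule lastcol_typeA[OF K _ _ v]) (simp add: mult.assoc eu_mult)
  then show False using n by (simp add: typeA_def wB_def)
 qed
 then show ?thesis using that[of \<Xi>] T by (simp add: \<Xi>_def)
qed

text \<open>The gradient of a \<open>K\<close>-fixed vector; if it vanished, so would the Casimir eigenvalue.\<close>

lemma sph_A1:
 assumes n: "n \<ge> 2" and I: "irr (Suc n) e r" and v: "urep.hwv (Suc n) e r v (wA n j)" and j: "1 \<le> j"
 obtains \<Xi> where "kequiv n e r \<Xi>" "\<Xi> \<noteq> 0" "\<Xi> * eu n n = 0"
proof -
 interpret kirr n e r using I n by (simp add: kirr_def kirr_axioms_def)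
 obtain Y where Y: "kequiv n e r Y" "Y \<noteq> 0" "Y * eu n n = Y" using sph_A0[OF n I v] by blast
 define u where "u = Y * eu n 0"
 have uY: "u * eu 0 n = Y" by (simp add: u_def mult.assoc eu_mult Y(3))
 have u0: "u \<noteq> 0" using uY Y(2) by auto
 have eu: "e * u = u" using Y(1) by (simp add: u_def kequiv_def assoc')
 have Ye: "Y * eu i l = 0" if "i < n" for i l
 proof -
  have "Y * eu i l = Y * (eu n n * eu i l)" using Y(3) by (simp add: assoc')
  also have "eu n n * eu i l = 0" using that by (simp add: eu_mult)
  finally show ?thesis by simp
 qed
 have k0: "D (eu i l) * u = 0" if "i < n \<and> l < n \<or> i = n \<and> l = n" for i l
 proof -
  have "D (eu i l) * Y = Y * eu i l - ent (eu i l) n n *c Y"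
  proof (rule kequiv_D[OF Y(1)])
   show "inn (Suc n) (eu i l)" by (rule inn_eu) (use that in linarith)+
   show "kblock n (eu i l)" unfolding kblock_def ent_eu using that by (metis less_irrefl)
  qed
  also have "\<dots> = 0" using that Ye Y(3) by auto
  finally show ?thesis by (simp add: u_def assoc')
 qed
 have rk: "r k * u = u" if k: "k \<in> KK n" for k
 proof -
  have "r k * u = cnj (ent k n n) *c (Y * k) * eu n 0" using Y(1) k by (simp add: u_def kequiv_def assoc')
  also have "\<dots> = u" by (simp add: mult.assoc KK_eu[OF k] u_def KK_D(5)[OF k] mult.commute)
  finally show ?thesis .
 qed
 \<comment> \<open>The derivatives of the fixed vector in the directions \<open>eu l n\<close>;
   under the isotropy group they transform like the first \<open>n\<close> columns required by
   \<open>kequiv\<close>.\<close>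
 define \<Xi> where "\<Xi> = (\<Sum>l<n. D (eu l n) * u * eu 0 l)"
 have K: "kequiv n e r \<Xi>" unfolding kequiv_def
 proof (intro conjI ballI)
  show "e * \<Xi> = \<Xi>" by (simp add: \<Xi>_def sum_distrib_left assoc' D_e)
  show "\<Xi> * un {..<Suc n} = \<Xi>" unfolding \<Xi>_def sum_distrib_right
   by (rule sum.cong) (auto simp: mult.assoc eu_un')
  fix k assume k: "k \<in> KK n"
  note kD = KK_D[OF k]
  have 1: "r k * (D (eu l n) * u) = (\<Sum>i<n. (cnj (ent k n n) * ent k i l) *c (D (eu i n) * u))" if l: "l < n" for l
  proof -
   have "r k * (D (eu l n) * u) = D (k * eu l n * adj k) * (r k * u)"
    using D_r_commute[OF kD(1) inn_eu[of l "Suc n" n]] l by (simp add: assoc')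
   also have "k * eu l n * adj k = (\<Sum>i<n. (cnj (ent k n n) * ent k i l) *c eu i n)"
   proof (rule fmat_eqI)
    fix a b
    have "ent (k * eu l n * adj k) a b = ent k a l * cnj (ent k b n)"
     by (subst ent_times_S[of "{n}"]) (auto simp: ent_times_eu split: if_splits)
    moreover have "ent (\<Sum>i<n. (cnj (ent k n n) * ent k i l) *c eu i n) a b
      = (\<Sum>i<n. if i = a then (if b = n then cnj (ent k n n) * ent k a l else 0) else 0)"
     unfolding ent_sum by (rule sum.cong) auto
    moreover have "ent k a l = 0" if "\<not> a < n" using that kD(2,4) l by (cases "a = n") (auto simp: inn_def)
    moreover have "ent k b n = 0" if "b \<noteq> n" using that kD(2,3) by (cases "b < n") (auto simp: inn_def)
    ultimately show "ent (k * eu l n * adj k) a b = ent (\<Sum>i<n. (cnj (ent k n n) * ent k i l) *c eu i n) a b"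
     by (auto simp: sum.delta)
   qed
   finally show ?thesis by (simp add: rk[OF k] D_sum D_sc sum_distrib_right)
  qed
  have e0: "eu 0 i * k = (\<Sum>l<n. ent k i l *c eu 0 l)" if i: "i < n" for i
  proof (rule fmat_eqI)
   fix a b
   have "ent (\<Sum>l<n. ent k i l *c eu 0 l) a b = (\<Sum>l<n. if l = b then (if a = 0 then ent k i b else 0) else 0)"
    unfolding ent_sum by (rule sum.cong) auto
   moreover have "ent k i b = 0" if "\<not> b < n" using that kD(2,3) i by (cases "b = n") (auto simp: inn_def)
   ultimately show "ent (eu 0 i * k) a b = ent (\<Sum>l<n. ent k i l *c eu 0 l) a b"
    by (auto simp: ent_eu_times sum.delta)
  qed
  have "r k * \<Xi> = (\<Sum>l<n. \<Sum>i<n. (cnj (ent k n n) * ent k i l) *c (D (eu i n) * u * eu 0 l))"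
   unfolding \<Xi>_def sum_distrib_left
  proof (rule sum.cong)
   fix l assume "l \<in> {..<n}"
   then have "r k * (D (eu l n) * u) * eu 0 l = (\<Sum>i<n. (cnj (ent k n n) * ent k i l) *c (D (eu i n) * u * eu 0 l))"
    by (simp add: 1 sum_distrib_right)
   then show "r k * (D (eu l n) * u * eu 0 l) = (\<Sum>i<n. (cnj (ent k n n) * ent k i l) *c (D (eu i n) * u * eu 0 l))"
    by (simp only: mult.assoc)
  qed simp
  also have "\<dots> = (\<Sum>i<n. \<Sum>l<n. (cnj (ent k n n) * ent k i l) *c (D (eu i n) * u * eu 0 l))" by (rule sum.swap)
  also have "\<dots> = cnj (ent k n n) *c (\<Xi> * k)" unfolding \<Xi>_def sum_distrib_right sc_sum_right
   by (rule sum.cong) (simp_all add: mult.assoc e0 sum_distrib_left sc_sum_right)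
  finally show "r k * \<Xi> = cnj (ent k n n) *c (\<Xi> * k)" .
 qed
 have "\<Xi> \<noteq> 0"
 proof
  assume X0: "\<Xi> = 0"
  have z: "D (eu l n) * u = 0" if l: "l < n" for l
  proof -
   have "0 = \<Xi> * eu l 0" using X0 by simp
   also have "\<dots> = (\<Sum>i<n. if i = l then D (eu l n) * u * eu 0 0 else 0)"
    unfolding \<Xi>_def sum_distrib_right by (rule sum.cong) (auto simp: mult.assoc eu_mult)
   also have "\<dots> = D (eu l n) * u" using l by (simp add: mult.assoc u_def eu_mult)
   finally show ?thesis by simp
  qed
  have "D (eu i l) * (D (eu l i) * u) = 0" if il: "i < Suc n" "l < Suc n" for i l
  proof -
   consider "i < n \<and> l < n \<or> i = n \<and> l = n" | "i = n" "l < n" | "i < n" "l = n" using il by linarith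
   then show ?thesis
   proof cases
    case 1 then show ?thesis using k0[of l i] by auto
   next
    case 2 then show ?thesis using z[of l] by simp
   next
    case 3
    \<comment> \<open>With \<open>D (eu i n) * u = 0\<close> only the commutator remains, a
      difference of diagonal units, and these kill \<open>u\<close>.\<close>
    have "D (eu i n) * (D (eu n i) * u) = D (eu n i) * (D (eu i n) * u) + D (eu i n * eu n i - eu n i * eu i n) * u"
     using 3 by (intro D_comm inn_eu) auto
    also have "\<dots> = 0" using 3 z[of i] k0[of i i] k0[of n n] by (simp add: eu_mult D_diff ring_distribs)
    finally show ?thesis using 3 by simp
   qed
  qed
  then have "CAS * u = 0" by (simp add: CAS_def sum_distrib_right mult.assoc sum.neutral del: sum.lessThan_Suc)
  then have "complex_of_real (casc (Suc n) (wA n j)) = 0" using CAS_scalar[OF v] eu u0 by simp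
  then have "casc (Suc n) (wA n j) = 0" by (simp only: of_real_eq_0_iff)
  moreover have "casc (Suc n) (wA n j) = 2 * real j * (real j + real n)" by (rule casc_wA[OF n1])
  moreover have "2 * real j * (real j + real n) > 0" using j by (intro mult_pos_pos) auto
  ultimately show False by linarith
 qed
 moreover have "\<Xi> * eu n n = 0" unfolding \<Xi>_def sum_distrib_right by (rule sum.neutral) (auto simp: mult.assoc eu_mult)
 ultimately show ?thesis using that K by blast
qed

text \<open>Neither the Casimir scalar nor the number of invariants tells a representation from its
  conjugate, so weights are recorded up to conjugation.\<close>

definition hasw :: "nat => mat_rep => (nat => real) => bool" where
 "hasw N \<sigma> w \<longleftrightarrow> (\<exists>v. hwt N \<sigma> v w) \<or> (\<exists>v. urep.hwv N (rid \<sigma>) (\<lambda>g. cj (rfm N \<sigma> g)) v w)"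

lemma irrep_cj: assumes "\<sigma> \<in> unitary_irreps N" "N > 0" shows "irr N (rid \<sigma>) (\<lambda>g. cj (rfm N \<sigma> g))"
 using irr_cj[OF irrep_irr[OF assms]] by simp

lemma hasw_props:
 assumes s: "\<sigma> \<in> unitary_irreps N" and N: "N > 0" and w: "hasw N \<sigma> w"
 shows "casimir_eigenvalue N \<sigma> = casc N w"
  "subgroup \<Gamma> (SU_group N) ==> finite \<Gamma> ==> of_nat (n_inv \<Gamma> \<sigma>) = nW N (fm ` \<Gamma>) w"
proof -
 interpret irr N "rid \<sigma>" "rfm N \<sigma>" by (rule irrep_irr[OF s N])
 obtain v0 w0 where v0: "hwv v0 w0" by (rule hw_exists[OF e_nz])
 have "casc N w0 = casc N w"
  using w casc_cj[OF irr_axioms v0] casc_unique[OF irr_axioms v0] by (auto simp: hasw_def)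
 then show "casimir_eigenvalue N \<sigma> = casc N w" using casimir_casc[OF s N v0] by simp
 assume G: "subgroup \<Gamma> (SU_group N)" "finite \<Gamma>"
 have g: "fgrp N (fm ` \<Gamma>)" by (rule fgrp_subgroup[OF G])
 then have sub: "fm ` \<Gamma> \<subseteq> SU N" by (simp add: fgrp_def)
 have "nG (fm ` \<Gamma>) (rfm N \<sigma>) = nW N (fm ` \<Gamma>) w"
  using w nW_eq[OF irr_axioms _ sub] nW_eq[OF irrep_cj[OF s N] _ sub] nG_cj[OF urep_axioms g]
  by (auto simp: hasw_def)
 then show "of_nat (n_inv \<Gamma> \<sigma>) = nW N (fm ` \<Gamma>) w" using n_inv_nG[OF s N G] by simp
qed

lemma sph_0:
 assumes n: "n \<ge> 2" and s: "\<sigma> \<in> unitary_irreps (Suc n)"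
 shows "hom_K (S_U_U1 n) (tau n 0) \<sigma> \<noteq> {0\<^sub>m (fst \<sigma>) (fst (tau n 0))} ==> \<exists>j. hasw (Suc n) \<sigma> (wA n j)"
  "hwt (Suc n) \<sigma> v (wA n j) ==> hom_K (S_U_U1 n) (tau n 0) \<sigma> \<noteq> {0\<^sub>m (fst \<sigma>) (fst (tau n 0))}"
proof -
 have I: "irr (Suc n) (rid \<sigma>) (rfm (Suc n) \<sigma>)" by (rule irrep_irr[OF s]) simp
 interpret kirr n "rid \<sigma>" "rfm (Suc n) \<sigma>" using I n by (simp add: kirr_def kirr_axioms_def)
 have tc: "snd (tau n 0) k \<in> carrier_mat (fst (tau n 0)) (fst (tau n 0))" for k by (simp only: tau_0 one_carrier_mat)
 have u1: "un {..<Suc 0} = eu 0 0" by (rule fmat_eqI) (auto simp: ent_un)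
 note iff = hom_K_ne[OF s tc, unfolded tau_0 fm_one One_nat_def u1]
 {
  assume "hom_K (S_U_U1 n) (tau n 0) \<sigma> \<noteq> {0\<^sub>m (fst \<sigma>) (fst (tau n 0))}"
  then obtain F where F: "F \<noteq> 0" "rid \<sigma> * F = F" "F * eu 0 0 = F" "\<And>g. g \<in> KK n ==> F * eu 0 0 = rfm (Suc n) \<sigma> g * F"
   using iff unfolding tau_0 One_nat_def by blast
  \<comment> \<open>The fixed vector sits in column 0; \<open>eu 0 n\<close> moves it to column
    \<open>n\<close>, where \<open>kequiv\<close> expects it.\<close>
  have "kequiv n (rid \<sigma>) (rfm (Suc n) \<sigma>) (F * eu 0 n)" unfolding kequiv_def
  proof (intro conjI ballI)
   show "rid \<sigma> * (F * eu 0 n) = F * eu 0 n" by (simp add: assoc' F(2))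
   show "F * eu 0 n * un {..<Suc n} = F * eu 0 n" by (simp add: mult.assoc eu_un')
   fix k assume k: "k \<in> KK n"
   have "rfm (Suc n) \<sigma> k * (F * eu 0 n) = F * eu 0 n" using F(3,4) k by (simp add: assoc')
   then show "rfm (Suc n) \<sigma> k * (F * eu 0 n) = cnj (ent k n n) *c (F * eu 0 n * k)"
    by (simp add: mult.assoc KK_eu[OF k] KK_D(5)[OF k] mult.commute[of "cnj _"])
  qed
  moreover have "F * eu 0 n \<noteq> 0"
  proof
   assume "F * eu 0 n = 0"
   then have "F * eu 0 n * eu n 0 = 0" by simp
   then show False using F(1,3) by (simp add: mult.assoc eu_mult)
  qed
  moreover have "F * eu 0 n * eu n n = F * eu 0 n" by (simp add: mult.assoc eu_mult)
  ultimately show "\<exists>j. hasw (Suc n) \<sigma> (wA n j)" using lastcol_hw unfolding hasw_def by blast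
 }
 assume "hwt (Suc n) \<sigma> v (wA n j)"
 then obtain Y where Y: "kequiv n (rid \<sigma>) (rfm (Suc n) \<sigma>) Y" "Y \<noteq> 0" "Y * eu n n = Y" using sph_A0[OF n I] by blast
 have "Y * eu n 0 * eu 0 0 = rfm (Suc n) \<sigma> g * (Y * eu n 0)" if g: "g \<in> KK n" for g
 proof -
  have "rfm (Suc n) \<sigma> g * (Y * eu n 0) = cnj (ent g n n) *c (Y * g) * eu n 0"
   using Y(1) g by (simp add: kequiv_def assoc')
  then show ?thesis by (simp add: mult.assoc KK_eu[OF g] KK_D(5)[OF g] mult.commute[of "cnj _"] eu_mult)
 qed
 moreover have "Y * eu n 0 \<noteq> 0"
 proof
  assume "Y * eu n 0 = 0"
  then have "Y * eu n 0 * eu 0 n = 0" by simp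
  then show False using Y(2,3) by (simp add: mult.assoc eu_mult)
 qed
 moreover have "rid \<sigma> * (Y * eu n 0) = Y * eu n 0" "Y * eu n 0 * eu 0 0 = Y * eu n 0"
  using Y(1) by (simp_all add: kequiv_def assoc') (simp add: mult.assoc eu_mult)
 ultimately show "hom_K (S_U_U1 n) (tau n 0) \<sigma> \<noteq> {0\<^sub>m (fst \<sigma>) (fst (tau n 0))}"
  using iff unfolding tau_0 One_nat_def by blast
qed

text \<open>The inclusion of the second half of the coordinates of \<open>tau n 1\<close>.\<close>

definition J2 :: "nat => fmat" where "J2 n = (\<Sum>l<n. eu (n + l) l)"

lemma ent_J2: "ent (J2 n) i j = (if j < n \<and> i = n + j then 1 else 0)"
proof -
 have "ent (J2 n) i j = (\<Sum>l<n. if l = j then (if i = n + j then 1 else 0) else 0)"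
  unfolding J2_def ent_sum by (rule sum.cong) auto
 then show ?thesis by (simp add: sum.delta)
qed
lemma times_J2: "ent (A * J2 n) i j = (if j < n then ent A i (n + j) else 0)"
 by (subst ent_times_S[of "{n + j}"]) (auto simp: ent_J2 split: if_splits)
lemma J2_times: "ent (J2 n * A) i j = (if n \<le> i \<and> i < 2 * n then ent A (i - n) j else 0)"
 by (subst ent_times_S[of "{i - n}"]) (auto simp: ent_J2 split: if_splits)
lemma adj_J2_times: "ent (adj (J2 n) * A) i j = (if i < n then ent A (n + i) j else 0)"
 by (subst ent_times_S[of "{n + i}"]) (auto simp: ent_J2 split: if_splits)
lemma times_adj_J2: "ent (A * adj (J2 n)) i j = (if n \<le> j \<and> j < 2 * n then ent A i (j - n) else 0)"
 by (subst ent_times_S[of "{j - n}"]) (auto simp: ent_J2 split: if_splits)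

text \<open>Restricted to the second half of the coordinates, an equivariant map for
  \<open>tau n 1\<close> is a \<open>kequiv\<close> map; restricted to the first half, its conjugate
  is one for the conjugate representation. In the converse direction index 0 is excluded, since the
  gradient of an invariant vector is zero.\<close>

lemma sph_1:
 assumes n: "n \<ge> 2" and s: "\<sigma> \<in> unitary_irreps (Suc n)"
 shows "hom_K (S_U_U1 n) (tau n 1) \<sigma> \<noteq> {0\<^sub>m (fst \<sigma>) (fst (tau n 1))} ==>
   \<exists>j. hasw (Suc n) \<sigma> (wA n j) \<or> 1 \<le> j \<and> hasw (Suc n) \<sigma> (wB n j)"
  "1 \<le> j ==> hwt (Suc n) \<sigma> v (wA n j) \<or> hwt (Suc n) \<sigma> v (wB n j) ==>
   hom_K (S_U_U1 n) (tau n 1) \<sigma> \<noteq> {0\<^sub>m (fst \<sigma>) (fst (tau n 1))}"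
proof -
 have I: "irr (Suc n) (rid \<sigma>) (rfm (Suc n) \<sigma>)" by (rule irrep_irr[OF s]) simp
 interpret kirr n "rid \<sigma>" "rfm (Suc n) \<sigma>" using I n by (simp add: kirr_def kirr_axioms_def)
 have "irr (Suc n) (rid \<sigma>) (\<lambda>g. cj (rfm (Suc n) \<sigma> g))" by (rule irrep_cj[OF s]) simp
 then interpret C: kirr n "rid \<sigma>" "\<lambda>g. cj (rfm (Suc n) \<sigma> g)" using n by (simp add: kirr_def kirr_axioms_def)
 have tc: "snd (tau n 1) k \<in> carrier_mat (fst (tau n 1)) (fst (tau n 1))" for k using tau_1(2) by (simp only: tau_1(1))
 note iff = hom_K_ne[OF s tc]
 let ?t = "\<lambda>g. fm (snd (tau n 1) (mt (Suc n) (Suc n) g))"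
 {
  assume "hom_K (S_U_U1 n) (tau n 1) \<sigma> \<noteq> {0\<^sub>m (fst \<sigma>) (fst (tau n 1))}"
  then obtain F where F: "F \<noteq> 0" "rid \<sigma> * F = F" "F * un {..<2 * n} = F" "\<And>g. g \<in> KK n ==> F * ?t g = rfm (Suc n) \<sigma> g * F"
   using iff unfolding tau_1(1) by blast
  have "un {..<2 * n} = un {..<n} + J2 n * adj (J2 n)"
   by (rule fmat_eqI) (auto simp: ent_un times_adj_J2 ent_J2)
  then have "F * un {..<n} \<noteq> 0 \<or> F * J2 n \<noteq> 0" using F(1,3) by (metis add.right_neutral distrib_left mult.assoc mult_zero_left)
  then show "\<exists>j. hasw (Suc n) \<sigma> (wA n j) \<or> 1 \<le> j \<and> hasw (Suc n) \<sigma> (wB n j)"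
  proof
   assume ne: "F * J2 n \<noteq> 0"
   have "kequiv n (rid \<sigma>) (rfm (Suc n) \<sigma>) (F * J2 n)" unfolding kequiv_def
   proof (intro conjI ballI)
    show "rid \<sigma> * (F * J2 n) = F * J2 n" by (simp add: assoc' F(2))
    have "J2 n * un {..<Suc n} = J2 n" by (rule fmat_eqI) (simp add: ent_times_un ent_J2)
    then show "F * J2 n * un {..<Suc n} = F * J2 n" by (simp add: mult.assoc)
    fix k assume k: "k \<in> KK n"
    have "?t k * J2 n = cnj (ent k n n) *c (J2 n * k)"
    proof (rule fmat_eqI)
     fix i j
     have "ent k (i - n) j = 0" if "n \<le> i" "i < 2 * n" "\<not> j < n"
      using KK_D(2)[OF k] KK_D(3)[OF k, of "i - n"] that by (cases "j = n") (auto simp: inn_def)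
     then show "ent (?t k * J2 n) i j = ent (cnj (ent k n n) *c (J2 n * k)) i j"
      by (auto simp: times_J2 J2_times tau_1_ent[OF k] simp del: One_nat_def)
    qed
    then have "F * ?t k * J2 n = cnj (ent k n n) *c (F * J2 n * k)" by (simp only: mult.assoc sc_times_right)
    then show "rfm (Suc n) \<sigma> k * (F * J2 n) = cnj (ent k n n) *c (F * J2 n * k)"
     unfolding F(4)[OF k] by (simp only: mult.assoc)
   qed
   from kequiv_hw[OF this ne] show ?thesis unfolding hasw_def by blast
  next
   assume ne: "F * un {..<n} \<noteq> 0"
   have "kequiv n (rid \<sigma>) (\<lambda>g. cj (rfm (Suc n) \<sigma> g)) (cj (F * un {..<n}))"
    unfolding kequiv_def
   proof (intro conjI ballI)
    show "rid \<sigma> * cj (F * un {..<n}) = cj (F * un {..<n})"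
     using arg_cong[OF F(2), of cj] by (simp add: assoc')
    show "cj (F * un {..<n}) * un {..<Suc n} = cj (F * un {..<n})"
     by (simp add: mult.assoc un_mult Int_absorb2 lessThan_subset_iff)
    fix k assume k: "k \<in> KK n"
    have "?t k * un {..<n} = ent k n n *c (un {..<n} * cj k)"
    proof (rule fmat_eqI)
     fix i j
     have "ent k i j = 0" if "i < n" "\<not> j < n"
      using KK_D(2)[OF k] KK_D(3)[OF k, of i] that by (cases "j = n") (auto simp: inn_def)
     then show "ent (?t k * un {..<n}) i j = ent (ent k n n *c (un {..<n} * cj k)) i j"
      by (auto simp: ent_times_un ent_un_times tau_1_ent[OF k] simp del: One_nat_def)
    qed
    then have "F * ?t k * un {..<n} = ent k n n *c (F * un {..<n} * cj k)" by (simp only: mult.assoc sc_times_right)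
    then have "rfm (Suc n) \<sigma> k * (F * un {..<n}) = ent k n n *c (F * un {..<n} * cj k)"
     unfolding F(4)[OF k] by (simp only: mult.assoc)
    from arg_cong[OF this, of cj]
    show "cj (rfm (Suc n) \<sigma> k) * cj (F * un {..<n}) = cnj (ent k n n) *c (cj (F * un {..<n}) * k)" by simp
   qed
   moreover have "cj (F * un {..<n}) \<noteq> 0" using ne by (metis cj_cj cj_zero)
   ultimately show ?thesis using C.kequiv_hw unfolding hasw_def by blast
  qed
 }
 assume "1 \<le> j" "hwt (Suc n) \<sigma> v (wA n j) \<or> hwt (Suc n) \<sigma> v (wB n j)"
 then obtain Y where Y: "kequiv n (rid \<sigma>) (rfm (Suc n) \<sigma>) Y" "Y \<noteq> 0" "Y * eu n n = 0"
  using sph_A1[OF n I, of v j] sph_B[OF n I, of v j] by metis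
 have "un {..<Suc n} = un {..<n} + eu n n" by (rule fmat_eqI) (auto simp: ent_un)
 then have Yn: "Y * un {..<n} = Y" using Y(1,3) by (auto simp: kequiv_def ring_distribs)
 let ?F = "Y * adj (J2 n)"
 have "adj (J2 n) * J2 n = un {..<n}" by (rule fmat_eqI) (auto simp: ent_un times_J2 ent_J2)
 then have "?F * J2 n = Y" by (simp add: mult.assoc Yn)
 then have "?F \<noteq> 0" using Y(2) by auto
 moreover have "rid \<sigma> * ?F = ?F" using Y(1) by (simp add: kequiv_def assoc')
 moreover have "?F * un {..<2 * n} = ?F"
 proof -
  have "adj (J2 n) * un {..<2 * n} = adj (J2 n)" by (rule fmat_eqI) (simp add: ent_times_un ent_J2)
  then show ?thesis by (simp add: mult.assoc)
 qed
 moreover have "?F * ?t g = rfm (Suc n) \<sigma> g * ?F" if g: "g \<in> KK n" for g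
 proof -
  have "adj (J2 n) * ?t g = cnj (ent g n n) *c (un {..<n} * g * adj (J2 n))"
   by (rule fmat_eqI) (auto simp: adj_J2_times times_adj_J2 ent_un_times tau_1_ent[OF g] simp del: One_nat_def)
  then have "?F * ?t g = cnj (ent g n n) *c (Y * un {..<n} * g * adj (J2 n))" by (simp add: mult.assoc)
  also have "\<dots> = rfm (Suc n) \<sigma> g * Y * adj (J2 n)" using Y(1) g by (simp add: Yn kequiv_def)
  finally show ?thesis by (simp add: mult.assoc)
 qed
 ultimately show "hom_K (S_U_U1 n) (tau n 1) \<sigma> \<noteq> {0\<^sub>m (fst \<sigma>) (fst (tau n 1))}"
  using iff unfolding tau_1(1) by blast
qed

text \<open>All classes contributing to this eigenvalue have the same number of invariants, which
  factors out of the sum. What remains is the sum \<open>M\<close> of the dimensions of the spaces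
  of equivariant maps; it does not depend on the group and is positive because \<open>\<pi>0\<close>
  contributes.\<close>

lemma mult_spec_nW:
 assumes N: "N = Suc n" and tc: "\<And>k. k \<in> S_U_U1 n ==> snd \<tau> k \<in> carrier_mat (fst \<tau>) (fst \<tau>)"
  and p0: "\<pi>0 \<in> unitary_dual N" "hwt N (rep_of \<pi>0) v w"
   "hom_K (S_U_U1 n) \<tau> (rep_of \<pi>0) \<noteq> {0\<^sub>m (fst (rep_of \<pi>0)) (fst \<tau>)}"
  and only: "\<And>\<sigma>. \<sigma> \<in> unitary_irreps N ==> hom_K (S_U_U1 n) \<tau> \<sigma> \<noteq> {0\<^sub>m (fst \<sigma>) (fst \<tau>)} ==>
   casimir_eigenvalue N \<sigma> = casc N w ==> hasw N \<sigma> w"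
 obtains M where "M > (0::nat)" "\<And>\<Gamma>. subgroup \<Gamma> (SU_group N) ==> finite \<Gamma> ==>
  of_nat (mult_spec N (S_U_U1 n) \<tau> \<Gamma> (casc N w)) = of_nat M * nW N (fm ` \<Gamma>) w"
proof -
 have N0: "N > 0" using N by simp
 define P where "P = {\<pi>. \<pi> \<in> unitary_dual N \<and> casimir_eigenvalue N (rep_of \<pi>) = casc N w}"
 have fP: "finite P" unfolding P_def by (rule finite_casimir[OF N0])
 have sc: "snd \<sigma> k \<in> carrier_mat (fst \<sigma>) (fst \<sigma>)" if "\<sigma> \<in> unitary_irreps N" "k \<in> S_U_U1 n" for \<sigma> k
  using irrepD(1)[OF that(1)] K_fm(2)[OF that(2)] N by simp
 define d where "d \<pi> = dim_Hom_K (S_U_U1 n) \<tau> (rep_of \<pi>)" for \<pi>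
 have d0: "d \<pi> = 0 \<longleftrightarrow> hom_K (S_U_U1 n) \<tau> (rep_of \<pi>) = {0\<^sub>m (fst (rep_of \<pi>)) (fst \<tau>)}" if "\<pi> \<in> unitary_dual N" for \<pi>
  unfolding d_def by (rule dim_Hom_K_0_iff[OF tc sc[OF rep_of_in(2)[OF N0 that]]])
 have "\<pi>0 \<in> P" using p0(1) casimir_casc[OF rep_of_in(2)[OF N0 p0(1)] N0 p0(2)] by (simp add: P_def)
 moreover have "d \<pi>0 > 0" using d0[OF p0(1)] p0(3) by simp
 ultimately have "(\<Sum>\<pi>\<in>P. d \<pi>) > 0" using fP by (meson sum_pos2 zero_le)
 moreover have "of_nat (mult_spec N (S_U_U1 n) \<tau> \<Gamma> (casc N w)) = of_nat (\<Sum>\<pi>\<in>P. d \<pi>) * nW N (fm ` \<Gamma>) w"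
  if G: "subgroup \<Gamma> (SU_group N)" "finite \<Gamma>" for \<Gamma>
 proof -
  have "of_nat (n_inv \<Gamma> (rep_of \<pi>) * d \<pi>) = of_nat (d \<pi>) * nW N (fm ` \<Gamma>) w" if p: "\<pi> \<in> P" for \<pi>
  proof (cases "d \<pi> = 0")
   case False
   have pd: "\<pi> \<in> unitary_dual N" using p by (simp add: P_def)
   have "hasw N (rep_of \<pi>) w" using only[OF rep_of_in(2)[OF N0 pd]] d0[OF pd] False p by (simp add: P_def)
   then show ?thesis using hasw_props(2)[OF rep_of_in(2)[OF N0 pd] N0 _ G] by simp
  qed simp
  then have "(\<Sum>\<pi>\<in>P. of_nat (n_inv \<Gamma> (rep_of \<pi>) * d \<pi>)) = (\<Sum>\<pi>\<in>P. of_nat (d \<pi>) * nW N (fm ` \<Gamma>) w)"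
   by (intro sum.cong refl)
  then show ?thesis by (simp add: mult_spec_def P_def d_def sum_distrib_right)
 qed
 ultimately show ?thesis using that by blast
qed

lemma cofinite_inj:
 assumes "finite {\<mu>::real. f \<mu> \<noteq> (g \<mu> :: nat)}" "inj (h :: nat => real)"
 obtains J where "\<And>j. j \<ge> J ==> f (h j) = g (h j)"
proof -
 have "finite (h -` {\<mu>. f \<mu> \<noteq> g \<mu>})" by (rule finite_vimageI[OF assms])
 then have "\<exists>J. \<forall>j\<in>h -` {\<mu>. f \<mu> \<noteq> g \<mu>}. j < J" by (simp only: finite_nat_set_iff_bounded)
 then obtain J where J: "\<forall>j\<in>h -` {\<mu>. f \<mu> \<noteq> g \<mu>}. j < J" ..
 have "f (h j) = g (h j)" if "j \<ge> J" for j using J that by (force simp: not_less[symmetric])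
 then show ?thesis by (rule that)
qed

theorem theorem6p7:
 fixes n p :: nat
 assumes "n \<ge> 2" and "p \<in> {0, 1}"
 shows "strong_rep_spectral_converse (n + 1) (S_U_U1 n) (tau n p)" unfolding strong_rep_spectral_converse_def
proof (intro allI impI ballI)
 let ?N = "n + 1" and ?K = "S_U_U1 n" and ?t = "tau n p"
 fix \<Gamma> \<Gamma>' \<pi>
 assume G: "subgroup \<Gamma> (SU_group ?N) \<and> finite \<Gamma> \<and> subgroup \<Gamma>' (SU_group ?N) \<and> finite \<Gamma>'"
  and fin: "finite {\<mu>. mult_spec ?N ?K ?t \<Gamma> \<mu> \<noteq> mult_spec ?N ?K ?t \<Gamma>' \<mu>}"
  and p: "\<pi> \<in> unitary_dual ?N" and ne: "hom_K ?K ?t (rep_of \<pi>) \<noteq> {0\<^sub>m (fst (rep_of \<pi>)) (fst ?t)}"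
 have n: "n \<ge> 2" "n \<ge> 1" using assms(1) by auto
 have N: "?N = Suc n" "Suc n > 0" by simp_all
 let ?W = "nW (Suc n)"
 have g: "fgrp (Suc n) (fm ` \<Gamma>)" "fgrp (Suc n) (fm ` \<Gamma>')" using G fgrp_subgroup by auto
 have s: "rep_of \<pi> \<in> unitary_irreps (Suc n)" using rep_of_in(2)[OF N(2)] p by simp
 have tc: "snd ?t k \<in> carrier_mat (fst ?t) (fst ?t)" for k
  using assms(2) tau_0 tau_1 by (auto simp: tau_0 simp del: One_nat_def)
 have sph: "\<exists>j. hasw (Suc n) \<sigma> (wA n j) \<or> p = 1 \<and> 1 \<le> j \<and> hasw (Suc n) \<sigma> (wB n j)"
  if "\<sigma> \<in> unitary_irreps (Suc n)" "hom_K ?K ?t \<sigma> \<noteq> {0\<^sub>m (fst \<sigma>) (fst ?t)}" for \<sigma>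
  using sph_0(1)[OF n(1) that(1)] sph_1(1)[OF n(1) that(1)] assms(2) that(2) by blast
 \<comment> \<open>If no other admissible weight shares the Casimir scalar of \<open>w\<close>,
   equal multiplicities there can be divided by \<open>M\<close> to give equal numbers of
   invariants.\<close>
 have key: "?W (fm ` \<Gamma>) w = ?W (fm ` \<Gamma>') w"
  if w: "\<exists>e r v. irr (Suc n) e r \<and> urep.hwv (Suc n) e r v w"
   and hom: "\<And>\<sigma> v. \<sigma> \<in> unitary_irreps (Suc n) ==> hwt (Suc n) \<sigma> v w ==> hom_K ?K ?t \<sigma> \<noteq> {0\<^sub>m (fst \<sigma>) (fst ?t)}"
   and un: "\<And>j. casc (Suc n) (wA n j) = casc (Suc n) w ==> wA n j = w"
    "\<And>j. p = 1 ==> 1 \<le> j ==> casc (Suc n) (wB n j) = casc (Suc n) w ==> wB n j = w"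
   and eq: "mult_spec (Suc n) ?K ?t \<Gamma> (casc (Suc n) w) = mult_spec (Suc n) ?K ?t \<Gamma>' (casc (Suc n) w)" for w
 proof -
  obtain e r v where I: "irr (Suc n) e r" "urep.hwv (Suc n) e r v w" using w by blast
  obtain \<pi>0 v0 where p0: "\<pi>0 \<in> unitary_dual (Suc n)" "hwt (Suc n) (rep_of \<pi>0) v0 w" using dual_ex[OF N(2) I] by blast
  have only: "hasw (Suc n) \<sigma> w" if "\<sigma> \<in> unitary_irreps (Suc n)" "hom_K ?K ?t \<sigma> \<noteq> {0\<^sub>m (fst \<sigma>) (fst ?t)}"
   "casimir_eigenvalue (Suc n) \<sigma> = casc (Suc n) w" for \<sigma>
   using sph[OF that(1,2)] un hasw_props(1)[OF that(1) N(2)] that(3) by metis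
  obtain M where M: "M > (0::nat)" "\<And>\<Gamma>. subgroup \<Gamma> (SU_group (Suc n)) ==> finite \<Gamma> ==>
    of_nat (mult_spec (Suc n) ?K ?t \<Gamma> (casc (Suc n) w)) = of_nat M * ?W (fm ` \<Gamma>) w"
   using mult_spec_nW[OF refl tc p0 hom[OF rep_of_in(2)[OF N(2) p0(1)] p0(2)] only] by blast
  have "of_nat M * ?W (fm ` \<Gamma>) w = of_nat M * ?W (fm ` \<Gamma>') w"
   using M(2)[of \<Gamma>] M(2)[of \<Gamma>'] eq G unfolding N(1) by metis
  then show ?thesis using M(1) by simp
 qed
 have exA: "\<exists>e r v. irr (Suc n) e r \<and> urep.hwv (Suc n) e r v (wA n j)" for j
 proof -
  obtain PS where "isdec n bQ j PS" using dec_ex by blast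
  then have D: "dec n bQ j PS" using n by (simp add: dec_def good_def)
  show ?thesis using dexists_A[OF D, of j] dec.dirr[OF D] unfolding ov_def by blast
 qed
 have exB: "\<exists>e r v. irr (Suc n) e r \<and> urep.hwv (Suc n) e r v (wB n j)" if "1 \<le> j" for j
 proof -
  obtain PS where "isdec n bR j PS" using dec_ex by blast
  then have D: "dec n bR j PS" using n by (simp add: dec_def good_def)
  show ?thesis using dexists_B[OF D that] dec.dirr[OF D] unfolding ov_def by blast
 qed
 have fin': "finite {\<mu>. mult_spec (Suc n) ?K ?t \<Gamma> \<mu> \<noteq> mult_spec (Suc n) ?K ?t \<Gamma>' \<mu>}" using fin by simp
 have iA: "inj (\<lambda>j. casc (Suc n) (wA n j))" by (rule injI) (rule casc_A_inj[OF n(2)])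
 have iB: "inj (\<lambda>j. casc (Suc n) (wB n j))" by (rule injI) (rule casc_B_inj[OF n(1)])
 obtain JA where JA: "\<And>j. j \<ge> JA ==> mult_spec (Suc n) ?K ?t \<Gamma> (casc (Suc n) (wA n j)) = mult_spec (Suc n) ?K ?t \<Gamma>' (casc (Suc n) (wA n j))"
  using cofinite_inj[OF fin' iA] by blast
 obtain JB where JB: "\<And>j. j \<ge> JB ==> mult_spec (Suc n) ?K ?t \<Gamma> (casc (Suc n) (wB n j)) = mult_spec (Suc n) ?K ?t \<Gamma>' (casc (Suc n) (wB n j))"
  using cofinite_inj[OF fin' iB] by blast
 \<comment> \<open>The bound 1 matters for \<open>p = 1\<close>, where the trivial representation
   does not contribute to the spectrum.\<close>
 have evA: "?W (fm ` \<Gamma>) (wA n j) = ?W (fm ` \<Gamma>') (wA n j)" if j: "j \<ge> max JA 1" for j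
 proof (rule key[OF exA])
  show "hom_K ?K ?t \<sigma> \<noteq> {0\<^sub>m (fst \<sigma>) (fst ?t)}" if "\<sigma> \<in> unitary_irreps (Suc n)" "hwt (Suc n) \<sigma> v (wA n j)" for \<sigma> v
   using sph_0(2)[OF n(1) that] sph_1(2)[OF n(1) that(1), of j v] that(2) assms(2) j by auto
  show "wA n i = wA n j" if "casc (Suc n) (wA n i) = casc (Suc n) (wA n j)" for i
   using casc_A_inj[OF n(2) that] by simp
  show "wB n i = wA n j" if "casc (Suc n) (wB n i) = casc (Suc n) (wA n j)" for i
   using casc_AB[OF n(1)] that by metis
 qed (use JA j in simp)
 \<comment> \<open>Holds for all \<open>j\<close>, also for \<open>j = 0\<close> when
   \<open>p = 1\<close>; the second family depends on this.\<close>
 have A: "?W (fm ` \<Gamma>) (wA n j) = ?W (fm ` \<Gamma>') (wA n j)" for j by (rule nW_A_all[OF n(1) g evA])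
 have evB: "?W (fm ` \<Gamma>) (wB n j) = ?W (fm ` \<Gamma>') (wB n j)" if p1: "p = 1" and j: "j \<ge> max JB 1" for j
 proof (rule key)
  show "\<exists>e r v. irr (Suc n) e r \<and> urep.hwv (Suc n) e r v (wB n j)" using exB j by simp
  show "hom_K ?K ?t \<sigma> \<noteq> {0\<^sub>m (fst \<sigma>) (fst ?t)}" if "\<sigma> \<in> unitary_irreps (Suc n)" "hwt (Suc n) \<sigma> v (wB n j)" for \<sigma> v
   using sph_1(2)[OF n(1) that(1), of j v] that(2) p1 j by auto
  show "wA n i = wB n j" if "casc (Suc n) (wA n i) = casc (Suc n) (wB n j)" for i
   using casc_AB[OF n(1)] that by metis
  show "wB n i = wB n j" if "casc (Suc n) (wB n i) = casc (Suc n) (wB n j)" for i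
   using casc_B_inj[OF n(1) that] by simp
 qed (use JB j in simp)
 have B: "?W (fm ` \<Gamma>) (wB n j) = ?W (fm ` \<Gamma>') (wB n j)" if "p = 1" "1 \<le> j" for j
  by (rule nW_B_all[OF n(1) g A evB[OF that(1)] that(2)])
 obtain w where w: "hasw (Suc n) (rep_of \<pi>) w" "?W (fm ` \<Gamma>) w = ?W (fm ` \<Gamma>') w"
  using sph[OF s ne] A B by blast
 have "complex_of_nat (n_inv \<Gamma> (rep_of \<pi>)) = of_nat (n_inv \<Gamma>' (rep_of \<pi>))"
  using hasw_props(2)[OF s N(2) w(1), of \<Gamma>] hasw_props(2)[OF s N(2) w(1), of \<Gamma>'] w(2) G by simp
 then show "n_inv \<Gamma> (rep_of \<pi>) = n_inv \<Gamma>' (rep_of \<pi>)" by simp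
qed

end
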